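(* Let $0<\beta_0<1/2$ and $k\in\mathbb{N}$. Suppose that $U:\mathbb{R}\to\mathbb{R}$ is infinitely differentiable and that $U$ and its derivatives of all orders are of moderate growth. Then there is a constant $K$ depending only on $\beta_0$, $k$ and $U$ such that for every $N\ge 1$, every $1\le i\le N$, every $0<\beta\le\beta_0$ and every $h\in\mathbb{R}$, $$E\left[\left\langle U(l_i)\right\rangle-\int_{\mathbb{R}} U(x)\,\nu_i(dx)\right]^{2k}\le\frac{K}{N^k},$$ where $l_i$ is the local field at site $i$ of the $N$-spin Sherrington-Kirkpatrick model at inverse temperature $\beta$ and external field $h$, and $\nu_i$ is the random Gaussian mixture defined in the context.
   Context: Sherrington-Kirkpatrick (SK) model: $\Sigma_N=\{-1,+1\}^N$; $\{g_{ij}\}_{1\le i<j\le N}$ are i.i.d. standard Gaussian random variables (the disorder), $g_{ij}=g_{ji}$. For $\beta>0$, $h\in\mathbb{R}$ the Hamiltonian is given by $-H_N(\sigma)=\frac{\beta}{\sqrt N}\sum_{i<j\le N}g_{ij}\sigma_i\sigma_j+h\sum_{i\le N}\sigma_i$ for $\sigma=(\sigma_1,\dots,\sigma_N)\in\Sigma_N$, and the Gibbs measure is $G_N(\{\sigma\})=\exp(-H_N(\sigma))/Z_N$ with $Z_N=\sum_{\sigma}\exp(-H_N(\sigma))$. For a function $f$ on $\Sigma_N$ (possibly also depending on the disorder, which is kept fixed), $\langle f\rangle=\sum_\sigma f(\sigma)G_N(\{\sigma\})$. $E$ denotes expectation over the disorder. $q$ is the unique solution of $q=E\tanh^2(\beta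 z\sqrt q+h)$, where $z$ is a standard Gaussian random variable. The local field at site $i$ is $l_i=\frac1{\sqrt N}\sum_{j\le N,\,j\ne i}g_{ij}\sigma_j$. Put $$\gamma_i=\frac1{\sqrt N}\sum_{j\le N,\,j\neq i}g_{ij}\langle\sigma_j\rangle-\beta(1-q)\langle\sigma_i\rangle,\qquad p_i=\frac{e^{\beta\gamma_i+h}}{e^{\beta\gamma_i+h}+e^{-\beta\gamma_i-h}},$$ and let $\nu_i$ be the random probability measure on $\mathbb{R}$ with density $$p_i\,\phi_{\gamma_i+\beta(1-q),\,1-q}+(1-p_i)\,\phi_{\gamma_i-\beta(1-q),\,1-q},$$ where $\phi_{\mu,\sigma^2}$ denotes the Gaussian density with mean $\mu$ and variance $\sigma^2$. A continuous function $U:\mathbb{R}^d\to\mathbb{R}$ is of moderate growth if $\lim_{\|x\|\to\infty}U(x)\exp(-a\|x\|^2)=0$ for every $a>0$. *)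

theory Defs
  imports "HOL-Probability.Probability"
begin

definition moderate_growth :: "('a::euclidean_space \<Rightarrow> real) \<Rightarrow> bool" where
  "moderate_growth U \<longleftrightarrow>
     continuous_on UNIV U \<and>
     (\<forall>a>0. ((\<lambda>x. U x * exp (- a * (norm x)\<^sup>2)) \<longlongrightarrow> 0) at_infinity)"

definition infinitely_differentiable :: "(real \<Rightarrow> real) \<Rightarrow> bool" where
  "infinitely_differentiable U \<longleftrightarrow> (\<forall>n x. (deriv ^^ n) U differentiable (at x))"

definition bonds :: "nat \<Rightarrow> (nat \<times> nat) set" where
  "bonds N = {(i, j). 1 \<le> i \<and> i < j \<and> j \<le> N}"

definition sk_disorder :: "'a measure \<Rightarrow> nat \<Rightarrow> (nat \<Rightarrow> nat \<Rightarrow> 'a \<Rightarrow> real) \<Rightarrow> bool" where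
  "sk_disorder M N g \<longleftrightarrow>
     prob_space M \<and>
     prob_space.indep_vars M (\<lambda>_. borel) (\<lambda>(i, j). g i j) (bonds N) \<and>
     (\<forall>(i, j)\<in>bonds N. distributed M lborel (g i j) std_normal_density) \<and>
     (\<forall>i\<in>{1..N}. \<forall>j\<in>{1..N}. \<forall>\<omega>\<in>space M. g i j \<omega> = g j i \<omega>)"

text \<open>
  Below, \<open>J i j\<close> is one realization of the couplings. Spins are indexed by \<open>1, \<dots>, N\<close>, and
  configurations are extensional functions, so that the configuration space is finite
  with \<open>2 ^ N\<close> elements.
\<close>

definition configs :: "nat \<Rightarrow> (nat \<Rightarrow> real) set" where
  "configs N = {1..N} \<rightarrow>\<^sub>E {-1, 1}"

definition hamiltonian ::
  "nat \<Rightarrow> real \<Rightarrow> real \<Rightarrow> (nat \<Rightarrow> nat \<Rightarrow> real) \<Rightarrow> (nat \<Rightarrow> real) \<Rightarrow> real" where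
  "hamiltonian N \<beta> h J \<sigma> =
     - (\<beta> / sqrt N * (\<Sum>(i, j)\<in>bonds N. J i j * \<sigma> i * \<sigma> j) + h * (\<Sum>i\<in>{1..N}. \<sigma> i))"

definition partition_function ::
  "nat \<Rightarrow> real \<Rightarrow> real \<Rightarrow> (nat \<Rightarrow> nat \<Rightarrow> real) \<Rightarrow> real" where
  "partition_function N \<beta> h J = (\<Sum>\<sigma>\<in>configs N. exp (- hamiltonian N \<beta> h J \<sigma>))"

definition gibbs_weight ::
  "nat \<Rightarrow> real \<Rightarrow> real \<Rightarrow> (nat \<Rightarrow> nat \<Rightarrow> real) \<Rightarrow> (nat \<Rightarrow> real) \<Rightarrow> real" where
  "gibbs_weight N \<beta> h J \<sigma> = exp (- hamiltonian N \<beta> h J \<sigma>) / partition_function N \<beta> h J"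

definition gibbs_average ::
  "nat \<Rightarrow> real \<Rightarrow> real \<Rightarrow> (nat \<Rightarrow> nat \<Rightarrow> real) \<Rightarrow> ((nat \<Rightarrow> real) \<Rightarrow> real) \<Rightarrow> real" where
  "gibbs_average N \<beta> h J f = (\<Sum>\<sigma>\<in>configs N. f \<sigma> * gibbs_weight N \<beta> h J \<sigma>)"

definition local_field ::
  "nat \<Rightarrow> (nat \<Rightarrow> nat \<Rightarrow> real) \<Rightarrow> nat \<Rightarrow> (nat \<Rightarrow> real) \<Rightarrow> real" where
  "local_field N J i \<sigma> = 1 / sqrt N * (\<Sum>j\<in>{1..N} - {i}. J i j * \<sigma> j)"

text \<open>
  The definite description denotes the actual solution only when existence and uniqueness
  hold, in particular for \<open>0 < \<beta> < 1/2\<close> and every \<open>h\<close>.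
\<close>

definition sk_q :: "real \<Rightarrow> real \<Rightarrow> real" where
  "sk_q \<beta> h = (THE q. 0 \<le> q \<and>
     q = (\<integral>z. (tanh (\<beta> * z * sqrt q + h))\<^sup>2 \<partial>density lborel std_normal_density))"

definition cavity_mean ::
  "nat \<Rightarrow> real \<Rightarrow> real \<Rightarrow> (nat \<Rightarrow> nat \<Rightarrow> real) \<Rightarrow> nat \<Rightarrow> real" where
  "cavity_mean N \<beta> h J i =
     1 / sqrt N * (\<Sum>j\<in>{1..N} - {i}. J i j * gibbs_average N \<beta> h J (\<lambda>\<sigma>. \<sigma> j))
       - \<beta> * (1 - sk_q \<beta> h) * gibbs_average N \<beta> h J (\<lambda>\<sigma>. \<sigma> i)"

definition mixture_weight ::
  "nat \<Rightarrow> real \<Rightarrow> real \<Rightarrow> (nat \<Rightarrow> nat \<Rightarrow> real) \<Rightarrow> nat \<Rightarrow> real" where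
  "mixture_weight N \<beta> h J i =
     (let \<gamma> = cavity_mean N \<beta> h J i
      in exp (\<beta> * \<gamma> + h) / (exp (\<beta> * \<gamma> + h) + exp (- \<beta> * \<gamma> - h)))"

text \<open>The second argument of \<^const>\<open>normal_density\<close> is the standard deviation.\<close>

definition mixture_measure ::
  "nat \<Rightarrow> real \<Rightarrow> real \<Rightarrow> (nat \<Rightarrow> nat \<Rightarrow> real) \<Rightarrow> nat \<Rightarrow> real measure" where
  "mixture_measure N \<beta> h J i =
     (let \<gamma> = cavity_mean N \<beta> h J i; p = mixture_weight N \<beta> h J i; q = sk_q \<beta> h
      in density lborel (\<lambda>x. ennreal
           (p * normal_density (\<gamma> + \<beta> * (1 - q)) (sqrt (1 - q)) x
            + (1 - p) * normal_density (\<gamma> - \<beta> * (1 - q)) (sqrt (1 - q)) x)))"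

definition mixture_error ::
  "nat \<Rightarrow> real \<Rightarrow> real \<Rightarrow> (nat \<Rightarrow> nat \<Rightarrow> real) \<Rightarrow> nat \<Rightarrow> (real \<Rightarrow> real) \<Rightarrow> real" where
  "mixture_error N \<beta> h J i U =
     gibbs_average N \<beta> h J (\<lambda>\<sigma>. U (local_field N J i \<sigma>))
       - (\<integral>x. U x \<partial>mixture_measure N \<beta> h J i)"

end

theory Submission imports Defs begin

text \<open>The proof is the cavity method. Remove site \<open>i\<close>: given the remaining spins, the weight of
\<open>\<sigma> i\<close> is proportional to \<open>exp (\<sigma> i * (\<beta> * l + h))\<close>, where the local field \<open>l\<close> is a function of
the remaining spins only. Hence every Gibbs average of a function of \<open>\<sigma> i\<close> and \<open>l\<close> is a ratio of two
averages over the system without \<open>i\<close>, of functions of \<open>l\<close> multiplied by \<open>exp (\<beta> * l)\<close> or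
\<open>exp (- \<beta> * l)\<close> (lemma \<open>gibbs_average_cavity\<close>). The couplings in \<open>l\<close> are independent of the reduced
system.

Given the reduced system, the fields of its replicas are jointly Gaussian with the overlaps as
covariances. If all overlaps were equal to \<open>q\<close>, the field of a replica would be its Gibbs mean plus
an independent Gaussian of variance \<open>1 - q\<close>. For \<open>\<beta> < 1/2\<close> the overlaps concentrate at \<open>q\<close> on the
scale \<open>1 / sqrt N\<close>. This is Latala's argument: an interpolation between the system and independent
spins, along which an exponential moment of \<open>N * (R - q)\<^sup>2\<close> with a decreasing exponent does not
increase (\<open>overlap_exponential_moment\<close>); at the independent end it is bounded by Hoeffding's
inequality.

To turn the closeness of the overlaps into a bound for the moment of order \<open>n = 2 * k\<close> of the error
\<open>\<langle>W l\<rangle> - E W (\<langle>l\<rangle> + sqrt (1 - q) * z)\<close>, write it with \<open>n\<close> replicas and rotate the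
field of each from its Gaussian limit to its true value. Gaussian integration by parts shows that a
derivative along the rotation of replica \<open>a\<close> brings a small factor, built from the errors of overlaps,
which either has mean zero in replica \<open>a\<close> or counts twice for it. A replica carrying fewer than two such factors
contributes nothing at the start of its rotation, so it can be differentiated once more; when all of
them carry two, there are at least \<open>n\<close> small factors (\<open>replica_avg_main\<close>, \<open>cavity_error_moment\<close>).
By the concentration of the overlaps this is of the order \<open>N\<close> to the power \<open>- k\<close>.

It remains to pass to the ratio. The Gaussian average of a function times \<open>exp (\<beta> * l)\<close> is the
average of the shifted function, shifted by \<open>\<beta> * (1 - q)\<close>; this produces the two centres and the
weights of the mixture, with \<open>\<gamma>\<close> replaced by the mean field \<open>y\<close> of the reduced system
(\<open>tilted_limit_eq_mixture_mean\<close>). The quantity \<open>\<gamma>\<close> of the full system recovers \<open>y\<close>: for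
\<open>U x = x\<close> the mixture has mean \<open>y + \<beta> * (1 - q) * (2 * p - 1)\<close>, and \<open>2 * p - 1\<close> is the limit of
\<open>\<langle>\<sigma> i\<rangle>\<close>, so that \<open>\<langle>l\<rangle> - \<beta> * (1 - q) * \<langle>\<sigma> i\<rangle>\<close> is \<open>y\<close> up to an error of the same order
(\<open>moment_order_cavity_gamma\<close>). All constants are uniform in \<open>h\<close> because the tilts are normalised by \<open>cosh h\<close>.\<close>

section \<open>Gaussian measures and integration by parts\<close>

abbreviation gauss1 :: "real measure" where
  "gauss1 \<equiv> density lborel (\<lambda>x. ennreal (std_normal_density x))"

definition gaussian :: "'i set \<Rightarrow> ('i \<Rightarrow> real) measure" where
  "gaussian I = Pi\<^sub>M I (\<lambda>_. gauss1)"

lemma sets_gaussian[measurable_cong]: "sets (gaussian I) = sets (Pi\<^sub>M I (\<lambda>_. borel))"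
  unfolding gaussian_def by (intro sets_PiM_cong) auto

lemma prob_space_gauss1: "prob_space gauss1"
  by (rule prob_space_normal_density) simp

lemma prob_space_gaussian: "prob_space (gaussian I)"
  unfolding gaussian_def by (intro prob_space_PiM prob_space_gauss1)

lemma product_sigma_finite_gauss1: "product_sigma_finite (\<lambda>_. gauss1)"
  by (intro product_sigma_finite.intro prob_space_imp_sigma_finite prob_space_gauss1)

text \<open>The Cameron-Martin formula in dimension one; it is the source of every exponential moment used below.\<close>
lemma nn_integral_gauss1_shift:
  fixes f :: "real \<Rightarrow> ennreal"
  assumes [measurable]: "f \<in> borel_measurable borel"
  shows "(\<integral>\<^sup>+x. ennreal (exp (c * x)) * f x \<partial>gauss1) = ennreal (exp (c\<^sup>2/2)) * (\<integral>\<^sup>+x. f (x + c) \<partial>gauss1)"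
proof -
  have e: "std_normal_density (x + c) * exp (c * (x+c)) = exp (c\<^sup>2/2) * std_normal_density x" for x
    unfolding std_normal_density_def
    by (simp add: exp_add[symmetric] power2_eq_square field_simps)
  have "(\<integral>\<^sup>+x. ennreal (exp (c * x)) * f x \<partial>gauss1)
      = (\<integral>\<^sup>+x. ennreal (std_normal_density x * exp (c * x)) * f x \<partial>lborel)"
    by (subst nn_integral_density) (auto simp: ennreal_mult' mult.assoc)
  also have "\<dots> = (\<integral>\<^sup>+x. ennreal (std_normal_density (x + c) * exp (c * (x+c))) * f (x+c) \<partial>lborel)"
    by (subst lborel_distr_plus[symmetric, of c], subst nn_integral_distr) (auto simp: add.commute)
  also have "\<dots> = (\<integral>\<^sup>+x. ennreal (exp (c\<^sup>2/2)) * (ennreal (std_normal_density x) * f (x+c)) \<partial>lborel)"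
    unfolding e by (simp add: ennreal_mult' mult.assoc)
  also have "\<dots> = ennreal (exp (c\<^sup>2/2)) * (\<integral>\<^sup>+x. f (x + c) \<partial>gauss1)"
    by (subst nn_integral_cmult, simp, subst nn_integral_density) auto
  finally show ?thesis .
qed

lemma nn_integral_gauss1_exp: "(\<integral>\<^sup>+x. ennreal (exp (c * x)) \<partial>gauss1) = ennreal (exp (c\<^sup>2/2))"
  using nn_integral_gauss1_shift[of "\<lambda>_. 1" c] prob_space.emeasure_space_1[OF prob_space_gauss1] by simp

lemma nn_integral_gauss1_exp_square:
  assumes "a < 1/2"
  shows "(\<integral>\<^sup>+x. ennreal (exp (a * x\<^sup>2)) \<partial>gauss1) = ennreal (1 / sqrt (1 - 2*a))"
proof -
  define s where "s = 1 / sqrt (1 - 2*a)"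
  have s: "s > 0" "s\<^sup>2 = 1 / (1 - 2*a)" using assms by (auto simp: s_def power_divide)
  have e: "std_normal_density x * exp (a * x\<^sup>2) = s * normal_density 0 s x" for x
    unfolding std_normal_density_def normal_density_def using s assms
    by (simp add: exp_add[symmetric] real_sqrt_mult real_sqrt_divide s_def power_divide)
       (simp add: field_simps)
  have "(\<integral>\<^sup>+x. ennreal (exp (a * x\<^sup>2)) \<partial>gauss1)
      = (\<integral>\<^sup>+x. ennreal (std_normal_density x * exp (a * x\<^sup>2)) \<partial>lborel)"
    by (subst nn_integral_density) (auto simp: ennreal_mult')
  also have "\<dots> = ennreal s * (\<integral>\<^sup>+x. ennreal (normal_density 0 s x) \<partial>lborel)"
    unfolding e using s by (subst nn_integral_cmult[symmetric]) (auto simp: ennreal_mult')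
  also have "(\<integral>\<^sup>+x. ennreal (normal_density 0 s x) \<partial>lborel) = 1"
    using prob_space.emeasure_space_1[OF prob_space_normal_density[OF s(1), of 0]]
    by (simp add: emeasure_density)
  finally show ?thesis by (simp add: s_def)
qed

lemma integrable_gauss1_exp_square: "a < 1/2 \<Longrightarrow> integrable gauss1 (\<lambda>x. exp (a * x\<^sup>2))"
  by (rule integrableI_nonneg) (auto simp: nn_integral_gauss1_exp_square)

lemma integrable_gauss1_exp: "integrable gauss1 (\<lambda>x. exp (a * x))"
  by (rule integrableI_nonneg) (auto simp: nn_integral_gauss1_exp)

text \<open>A linear factor costs \<open>1/16\<close> in the exponent. Integrands bounded by \<open>exp (3 * x\<^sup>2 / 16)\<close> therefore remain
below \<open>exp (x\<^sup>2 / 4)\<close> after multiplication by \<open>x\<close>, and the latter is integrable because \<open>1/4 < 1/2\<close>.\<close>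
lemma exp_ge_abs_sixteenth: "\<bar>t\<bar> \<le> 4 * exp (t\<^sup>2/16)" for t :: real
proof -
  have "\<bar>t\<bar>/4 \<le> 1 + (\<bar>t\<bar>/4)\<^sup>2"
    using zero_le_power2[of "\<bar>t\<bar>/4 - 1"] zero_le_power2[of "\<bar>t\<bar>/4"] by (simp add: power2_eq_square algebra_simps)
  also have "\<dots> \<le> exp ((\<bar>t\<bar>/4)\<^sup>2)" by (rule exp_ge_add_one_self)
  finally show ?thesis by (simp add: power_divide)
qed

lemma abs_mult_exp_bound:
  fixes f :: "real \<Rightarrow> real"
  assumes "\<bar>f x\<bar> \<le> C * exp (3 * x\<^sup>2 / 16)"
  shows "\<bar>x * f x\<bar> \<le> 4 * C * exp (x\<^sup>2/4)"
proof -
  have "\<bar>x * f x\<bar> \<le> (4 * exp (x\<^sup>2/16)) * (C * exp (3 * x\<^sup>2 / 16))"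
    unfolding abs_mult using assms exp_ge_abs_sixteenth[of x] by (intro mult_mono) auto
  also have "\<dots> = 4 * C * exp (x\<^sup>2/4)" by (simp add: exp_add[symmetric])
  finally show ?thesis .
qed

lemma integrable_gauss1_bound:
  fixes f :: "real \<Rightarrow> real"
  assumes [measurable]: "f \<in> borel_measurable borel"
  assumes "\<And>x. \<bar>f x\<bar> \<le> C * exp (x\<^sup>2/4)"
  shows "integrable gauss1 f"
proof (rule Bochner_Integration.integrable_bound)
  show "integrable gauss1 (\<lambda>x. C * exp (1/4 * x\<^sup>2))"
    by (intro integrable_mult_right integrable_gauss1_exp_square) simp
  show "AE x in gauss1. norm (f x) \<le> norm (C * exp (1/4 * x\<^sup>2))"
    using assms(2) by (intro AE_I2) (auto intro: order_trans[OF _ abs_ge_self])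
qed auto

text \<open>Stein's identity. The product of the density with \<open>f\<close> vanishes at infinity, so the integral of its
derivative is zero.\<close>
lemma gauss1_integration_by_parts:
  fixes f f' :: "real \<Rightarrow> real"
  assumes f: "\<And>x. (f has_real_derivative f' x) (at x)" and f': "continuous_on UNIV f'"
    and bf: "\<And>x. \<bar>f x\<bar> \<le> C * exp (3*x\<^sup>2/16)" and bf': "\<And>x. \<bar>f' x\<bar> \<le> C * exp (3*x\<^sup>2/16)"
  shows "(\<integral>x. x * f x \<partial>gauss1) = (\<integral>x. f' x \<partial>gauss1)"
proof -
  have cf: "continuous_on UNIV f"
    using f by (intro DERIV_continuous_on) (auto intro: has_field_derivative_at_within)
  have [measurable]: "f \<in> borel_measurable borel" "f' \<in> borel_measurable borel"
    using cf f' by (auto intro: borel_measurable_continuous_onI)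
  have C0: "C \<ge> 0" using bf[of 0] by simp
  have mono: "C * exp (3*x\<^sup>2/16) \<le> C * exp (x\<^sup>2/4)" for x
    using C0 by (intro mult_left_mono) auto
  have i1: "integrable gauss1 (\<lambda>x. x * f x)"
    by (intro integrable_gauss1_bound[where C="4*C"] abs_mult_exp_bound bf) measurable
  have i2: "integrable gauss1 f'"
    using order_trans[OF bf' mono] by (intro integrable_gauss1_bound[where C=C]) auto
  define \<phi> where "\<phi> = std_normal_density"
  define k where "k = (\<lambda>x. \<phi> x * (f' x - x * f x))"
  have d\<phi>: "(\<phi> has_real_derivative - x * \<phi> x) (at x)" for x
  proof -
    have e: "\<phi> = (\<lambda>x. inverse (sqrt (2 * pi)) * exp (- x\<^sup>2 / 2))"
      unfolding \<phi>_def std_normal_density_def by (simp add: inverse_eq_divide)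
    show ?thesis unfolding e by (auto intro!: derivative_eq_intros simp: power2_eq_square)
  qed
  have d: "((\<lambda>x. \<phi> x * f x) has_real_derivative k x) (at x)" for x
    unfolding k_def using f[of x] d\<phi>[of x] by (auto intro!: derivative_eq_intros simp: algebra_simps)
  have c\<phi>: "continuous_on UNIV \<phi>"
    using d\<phi> by (intro DERIV_continuous_on) (auto intro: has_field_derivative_at_within)
  have ck: "continuous_on UNIV k" unfolding k_def using f' cf c\<phi>
    by (intro continuous_intros) auto
  have ik: "integrable lborel k"
  proof -
    have "integrable gauss1 (\<lambda>x. f' x - x * f x)" using i1 i2 by simp
    then show ?thesis unfolding k_def \<phi>_def
      by (subst (asm) integrable_density) auto
  qed
  have lim: "((\<lambda>x. \<phi> x * f x) \<longlongrightarrow> 0) F" if "filterlim (\<lambda>x::real. x) at_infinity F" for F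
  proof (rule tendsto_0_le[where K=C])
    show "\<forall>\<^sub>F x in F. norm (\<phi> x * f x) \<le> norm (exp (- (5/16) * x\<^sup>2)) * C"
    proof (intro always_eventually allI)
      fix x
      have "\<bar>\<phi> x * f x\<bar> \<le> exp (- x\<^sup>2/2) * (C * exp (3*x\<^sup>2/16))"
        unfolding abs_mult \<phi>_def std_normal_density_def
      proof (intro mult_mono bf)
        have "1 \<le> sqrt (2 * pi)" using pi_ge_two by (simp add: real_le_rsqrt)
        then have "1 / sqrt (2 * pi) \<le> 1" by simp
        then show "\<bar>1 / sqrt (2 * pi)\<bar> * \<bar>exp (- x\<^sup>2 / 2)\<bar> \<le> exp (- x\<^sup>2 / 2)"
          using mult_right_mono[of "1 / sqrt (2 * pi)" 1 "exp (- x\<^sup>2 / 2)"] by (simp add: abs_mult)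
      qed auto
      also have "\<dots> = exp (- (5/16) * x\<^sup>2) * C" by (simp add: exp_add[symmetric])
      finally show "norm (\<phi> x * f x) \<le> norm (exp (- (5/16) * x\<^sup>2)) * C" by simp
    qed
    have "filterlim (\<lambda>x. (norm x)\<^sup>2) at_top F"
      by (intro filterlim_pow_at_top filterlim_at_infinity_imp_norm_at_top that) auto
    then have "filterlim (\<lambda>x. - (5/16) * x\<^sup>2) at_bot F"
      by (intro filterlim_tendsto_neg_mult_at_bot[where c="-5/16"]) auto
    then show "((\<lambda>x. exp (- (5/16) * x\<^sup>2)) \<longlongrightarrow> 0) F"
      by (rule filterlim_compose[OF exp_at_bot])
  qed
  have "(LBINT x=-\<infinity>..\<infinity>. k x) = 0 - 0"
  proof (rule interval_integral_FTC_integrable[where F="\<lambda>x. \<phi> x * f x"])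
    show "((\<lambda>x. \<phi> x * f x) has_vector_derivative k x) (at x)" for x
      using d[of x] by (simp add: has_real_derivative_iff_has_vector_derivative)
    show "isCont k x" for x using ck by (simp add: continuous_on_eq_continuous_at)
    show "set_integrable lborel (einterval (-\<infinity>) \<infinity>) k" using ik by (simp add: set_integrable_def)
    show "(((\<lambda>x. \<phi> x * f x) \<circ> real_of_ereal) \<longlongrightarrow> 0) (at_right (-\<infinity>))"
      using lim[OF filterlim_at_bot_imp_at_infinity[OF filterlim_ident]] by (simp add: ereal_tendsto_simps)
    show "(((\<lambda>x. \<phi> x * f x) \<circ> real_of_ereal) \<longlongrightarrow> 0) (at_left \<infinity>)"
      using lim[OF filterlim_at_top_imp_at_infinity[OF filterlim_ident]] by (simp add: ereal_tendsto_simps)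
  qed auto
  then have "(\<integral>x. k x \<partial>lborel) = 0" by (simp add: interval_lebesgue_integral_def set_lebesgue_integral_def)
  also have "(\<integral>x. k x \<partial>lborel) = (\<integral>x. f' x - x * f x \<partial>gauss1)"
    unfolding k_def \<phi>_def by (subst integral_density) auto
  also have "\<dots> = (\<integral>x. f' x \<partial>gauss1) - (\<integral>x. x * f x \<partial>gauss1)" using i1 i2 by simp
  finally show ?thesis by simp
qed

lemma gaussian_exp_sum_squares:
  assumes "finite I" "a < 1/2"
  shows "integrable (gaussian I) (\<lambda>x. exp (a * (\<Sum>i\<in>I. (x i)\<^sup>2)))"
proof -
  interpret product_sigma_finite "\<lambda>_. gauss1" by (rule product_sigma_finite_gauss1)
  have "integrable (gaussian I) (\<lambda>x. \<Prod>i\<in>I. exp (a * (x i)\<^sup>2))"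
    unfolding gaussian_def using assms
    by (intro product_integrable_prod integrable_gauss1_exp_square)
  then show ?thesis using assms by (simp add: exp_sum[symmetric] sum_distrib_left)
qed

lemma gaussian_integrable_bound:
  fixes F :: "('i \<Rightarrow> real) \<Rightarrow> real"
  assumes "finite I" and [measurable]: "F \<in> borel_measurable (gaussian I)"
    and b: "\<And>x. x \<in> space (gaussian I) \<Longrightarrow> \<bar>F x\<bar> \<le> C * exp ((\<Sum>i\<in>I. (x i)\<^sup>2) / 4)"
  shows "integrable (gaussian I) F"
proof (rule Bochner_Integration.integrable_bound)
  show "integrable (gaussian I) (\<lambda>x. C * exp (1/4 * (\<Sum>i\<in>I. (x i)\<^sup>2)))"
    using assms(1) by (intro integrable_mult_right gaussian_exp_sum_squares) auto
  show "AE x in gaussian I. norm (F x) \<le> norm (C * exp (1/4 * (\<Sum>i\<in>I. (x i)\<^sup>2)))"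
    using b by (intro AE_I2) (auto intro: order_trans[OF _ abs_ge_self])
qed fact

lemma gaussian_component_bound:
  fixes F :: "('i \<Rightarrow> real) \<Rightarrow> real"
  assumes "finite I" "e \<in> I" and b: "\<bar>F x\<bar> \<le> C * exp ((\<Sum>i\<in>I. (x i)\<^sup>2) * 3 / 16)"
  shows "\<bar>x e * F x\<bar> \<le> 4 * C * exp ((\<Sum>i\<in>I. (x i)\<^sup>2) / 4)"
proof -
  have "(x e)\<^sup>2 \<le> (\<Sum>i\<in>I. (x i)\<^sup>2)" using assms by (intro member_le_sum) auto
  then have "\<bar>x e\<bar> \<le> 4 * exp ((\<Sum>i\<in>I. (x i)\<^sup>2)/16)"
    by (intro order_trans[OF exp_ge_abs_sixteenth]) auto
  then have "\<bar>x e * F x\<bar> \<le> (4 * exp ((\<Sum>i\<in>I. (x i)\<^sup>2)/16)) * (C * exp ((\<Sum>i\<in>I. (x i)\<^sup>2) * 3 / 16))"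
    unfolding abs_mult using b by (intro mult_mono) auto
  also have "\<dots> = 4 * C * exp ((\<Sum>i\<in>I. (x i)\<^sup>2) / 4)"
    by (simp add: exp_add[symmetric])
  finally show ?thesis .
qed

text \<open>Fubini in the coordinate \<open>e\<close> reduces the identity to dimension one. The bounds are required of all
functions on the index type, which saves conditions on the domain when a coordinate is updated.\<close>
lemma gaussian_integration_by_parts:
  fixes F F' :: "('i \<Rightarrow> real) \<Rightarrow> real"
  assumes I: "finite I" "e \<in> I"
    and F: "\<And>x t. ((\<lambda>t. F (x(e := t))) has_real_derivative F' (x(e := t))) (at t)"
    and F': "\<And>x. continuous_on UNIV (\<lambda>t. F' (x(e := t)))"
    and m[measurable]: "F \<in> borel_measurable (gaussian I)" "F' \<in> borel_measurable (gaussian I)"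
    and b: "\<And>x. \<bar>F x\<bar> \<le> C * exp ((\<Sum>i\<in>I. (x i)\<^sup>2) * 3 / 16)"
    and b': "\<And>x. \<bar>F' x\<bar> \<le> C * exp ((\<Sum>i\<in>I. (x i)\<^sup>2) * 3 / 16)"
  shows "(\<integral>x. x e * F x \<partial>gaussian I) = (\<integral>x. F' x \<partial>gaussian I)"
proof -
  interpret product_sigma_finite "\<lambda>_. gauss1" by (rule product_sigma_finite_gauss1)
  define J where "J = I - {e}"
  have J: "finite J" "e \<notin> J" "I = insert e J" using I by (auto simp: J_def)
  have C0: "C \<ge> 0" using order_trans[OF abs_ge_zero b[of "\<lambda>_. 0"]] by simp
  have [measurable]: "(\<lambda>x. x e) \<in> borel_measurable (gaussian I)"
    using I(2) by measurable
  have i1: "integrable (gaussian I) (\<lambda>x. x e * F x)"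
    by (rule gaussian_integrable_bound[OF I(1), where C="4*C"], measurable, rule gaussian_component_bound[OF I b])
  have i2: "integrable (gaussian I) F'"
  proof (rule gaussian_integrable_bound[OF I(1) m(2), where C=C])
    fix x :: "'i \<Rightarrow> real"
    have "0 \<le> (\<Sum>i\<in>I. (x i)\<^sup>2)" by (intro sum_nonneg) auto
    then have "C * exp ((\<Sum>i\<in>I. (x i)\<^sup>2) * 3 / 16) \<le> C * exp ((\<Sum>i\<in>I. (x i)\<^sup>2) / 4)"
      using C0 by (intro mult_left_mono) auto
    with b'[of x] show "\<bar>F' x\<bar> \<le> C * exp ((\<Sum>i\<in>I. (x i)\<^sup>2) / 4)" by linarith
  qed
  have sq: "(\<Sum>i\<in>I. ((x(e := t)) i)\<^sup>2) = t\<^sup>2 + (\<Sum>i\<in>J. (x i)\<^sup>2)" for x :: "'i \<Rightarrow> real" and t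
  proof -
    have "(\<Sum>i\<in>J. ((x(e := t)) i)\<^sup>2) = (\<Sum>i\<in>J. (x i)\<^sup>2)" using J by (intro sum.cong) auto
    then show ?thesis unfolding J(3) using J(1,2) by simp
  qed
  have "(\<integral>x. x e * F x \<partial>gaussian I) = (\<integral>x. (\<integral>t. t * F (x(e := t)) \<partial>gauss1) \<partial>gaussian J)"
    using i1 unfolding gaussian_def J(3) by (subst product_integral_insert[OF J(1,2)]) auto
  also have "\<dots> = (\<integral>x. (\<integral>t. F' (x(e := t)) \<partial>gauss1) \<partial>gaussian J)"
  proof (rule Bochner_Integration.integral_cong[OF refl])
    fix x :: "'i \<Rightarrow> real"
    have b1: "\<bar>F (x(e := t))\<bar> \<le> (C * exp ((\<Sum>i\<in>J. (x i)\<^sup>2) * 3 / 16)) * exp (3 * t\<^sup>2 / 16)" for t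
      using b[of "x(e := t)"] unfolding sq by (simp add: exp_add[symmetric] field_simps)
    have b2: "\<bar>F' (x(e := t))\<bar> \<le> (C * exp ((\<Sum>i\<in>J. (x i)\<^sup>2) * 3 / 16)) * exp (3 * t\<^sup>2 / 16)" for t
      using b'[of "x(e := t)"] unfolding sq by (simp add: exp_add[symmetric] field_simps)
    show "(\<integral>t. t * F (x(e := t)) \<partial>gauss1) = (\<integral>t. F' (x(e := t)) \<partial>gauss1)"
      by (rule gauss1_integration_by_parts[OF F F' b1 b2])
  qed
  also have "\<dots> = (\<integral>x. F' x \<partial>gaussian I)"
    using i2 unfolding gaussian_def J(3) by (subst product_integral_insert[OF J(1,2)]) auto
  finally show ?thesis .
qed

text \<open>The mean value theorem bounds the difference quotients by \<open>B\<close>, and dominated convergence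
applies along every sequence.\<close>
lemma has_real_derivative_integral:
  fixes F F' :: "real \<Rightarrow> 'x \<Rightarrow> real"
  assumes F: "\<And>s x. x \<in> space M \<Longrightarrow> ((\<lambda>s. F s x) has_real_derivative F' s x) (at s)"
    and iF: "\<And>s. integrable M (F s)" and mF': "\<And>s. F' s \<in> borel_measurable M"
    and iB: "integrable M B" and b: "\<And>s x. x \<in> space M \<Longrightarrow> \<bar>F' s x\<bar> \<le> B x"
  shows "((\<lambda>s. \<integral>x. F s x \<partial>M) has_real_derivative (\<integral>x. F' s x \<partial>M)) (at s)"
  unfolding DERIV_def tendsto_at_iff_sequentially comp_def
proof (intro allI impI)
  fix X :: "nat \<Rightarrow> real" assume X: "\<forall>i. X i \<in> UNIV - {0}" "X \<longlonglongrightarrow> 0"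
  have "(\<lambda>n. \<integral>x. (F (s + X n) x - F s x) / X n \<partial>M) \<longlonglongrightarrow> (\<integral>x. F' s x \<partial>M)"
  proof (rule integral_dominated_convergence[OF _ _ iB])
    show "(\<lambda>x. (F (s + X n) x - F s x) / X n) \<in> borel_measurable M" for n
      using iF by (intro borel_measurable_integrable) auto
    show "AE x in M. (\<lambda>n. (F (s + X n) x - F s x) / X n) \<longlonglongrightarrow> F' s x"
    proof (intro AE_I2)
      fix x assume "x \<in> space M"
      from F[OF this, of s] X show "(\<lambda>n. (F (s + X n) x - F s x) / X n) \<longlonglongrightarrow> F' s x"
        unfolding DERIV_def tendsto_at_iff_sequentially comp_def by auto
    qed
    show "AE x in M. norm ((F (s + X n) x - F s x) / X n) \<le> B x" for n
    proof (intro AE_I2)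
      fix x assume x: "x \<in> space M"
      have "norm (F (s + X n) x - F s x) \<le> B x * norm ((s + X n) - s)"
        by (rule field_differentiable_bound[where S=UNIV and f'="\<lambda>s. F' s x"])
           (use F[OF x] b[OF x] in auto)
      then show "norm ((F (s + X n) x - F s x) / X n) \<le> B x"
        using X(1) by (auto simp: field_simps)
    qed
  qed (rule mF')
  also have "(\<lambda>n. \<integral>x. (F (s + X n) x - F s x) / X n \<partial>M) = (\<lambda>n. ((\<integral>x. F (s + X n) x \<partial>M) - (\<integral>x. F s x \<partial>M)) / X n)"
    using iF by simp
  finally show "(\<lambda>n. ((\<integral>x. F (s + X n) x \<partial>M) - (\<integral>x. F s x \<partial>M)) / X n) \<longlonglongrightarrow> (\<integral>x. F' s x \<partial>M)" .
qed

lemma nn_integral_gaussian_exp_linear: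
  assumes "finite I"
  shows "(\<integral>\<^sup>+x. ennreal (exp (c * (\<Sum>i\<in>I. x i * v i))) \<partial>gaussian I) = ennreal (exp (c\<^sup>2 * (\<Sum>i\<in>I. (v i)\<^sup>2) / 2))"
proof -
  interpret product_sigma_finite "\<lambda>_. gauss1" by (rule product_sigma_finite_gauss1)
  have "(\<integral>\<^sup>+x. ennreal (exp (c * (\<Sum>i\<in>I. x i * v i))) \<partial>gaussian I)
    = (\<integral>\<^sup>+x. (\<Prod>i\<in>I. ennreal (exp ((c * v i) * x i))) \<partial>gaussian I)"
    using assms by (simp add: prod_ennreal exp_sum[symmetric] sum_distrib_left mult_ac)
  also have "\<dots> = (\<Prod>i\<in>I. \<integral>\<^sup>+x. ennreal (exp ((c * v i) * x)) \<partial>gauss1)"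
    unfolding gaussian_def using assms by (intro product_nn_integral_prod) auto
  also have "\<dots> = ennreal (exp (c\<^sup>2 * (\<Sum>i\<in>I. (v i)\<^sup>2) / 2))"
    unfolding nn_integral_gauss1_exp using assms
    by (simp add: prod_ennreal exp_sum[symmetric] sum_distrib_left sum_divide_distrib power_mult_distrib)
  finally show ?thesis .
qed

text \<open>Linearise the square with an auxiliary Gaussian \<open>z\<close>, integrate \<open>x\<close> first, and use
\<open>1 / sqrt (1 - 2 * (1/4)) \<le> 2\<close>.\<close>
lemma nn_integral_gaussian_exp_linear_square:
  assumes I: "finite I" and a: "0 \<le> a" "a * (\<Sum>i\<in>I. (v i)\<^sup>2) \<le> 1/4"
  shows "(\<integral>\<^sup>+x. ennreal (exp (a * (\<Sum>i\<in>I. x i * v i)\<^sup>2)) \<partial>gaussian I) \<le> ennreal 2"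
proof -
  interpret product_sigma_finite "\<lambda>_. gauss1" by (rule product_sigma_finite_gauss1)
  interpret pair_sigma_finite gauss1 "gaussian I"
    by (intro pair_sigma_finite.intro prob_space_imp_sigma_finite prob_space_gauss1 prob_space_gaussian)
  define c where "c = sqrt (2 * a)"
  have c: "c\<^sup>2 = 2 * a" using a by (simp add: c_def)
  have [measurable]: "(\<lambda>x. \<Sum>i\<in>I. x i * v i) \<in> borel_measurable (gaussian I)" by measurable
  have "(\<integral>\<^sup>+x. ennreal (exp (a * (\<Sum>i\<in>I. x i * v i)\<^sup>2)) \<partial>gaussian I)
    = (\<integral>\<^sup>+x. (\<integral>\<^sup>+z. ennreal (exp ((c * (\<Sum>i\<in>I. x i * v i)) * z)) \<partial>gauss1) \<partial>gaussian I)"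
    unfolding nn_integral_gauss1_exp by (simp add: power_mult_distrib c)
  also have "\<dots> = (\<integral>\<^sup>+z. (\<integral>\<^sup>+x. ennreal (exp ((c * (\<Sum>i\<in>I. x i * v i)) * z)) \<partial>gaussian I) \<partial>gauss1)"
    by (intro Fubini') measurable
  also have "\<dots> = (\<integral>\<^sup>+z. ennreal (exp ((a * (\<Sum>i\<in>I. (v i)\<^sup>2)) * z\<^sup>2)) \<partial>gauss1)"
  proof (intro nn_integral_cong)
    fix z :: real
    show "(\<integral>\<^sup>+x. ennreal (exp ((c * (\<Sum>i\<in>I. x i * v i)) * z)) \<partial>gaussian I) = ennreal (exp ((a * (\<Sum>i\<in>I. (v i)\<^sup>2)) * z\<^sup>2))"
      using nn_integral_gaussian_exp_linear[OF I, of "c * z" v] by (simp add: power_mult_distrib c mult_ac)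
  qed
  also have "\<dots> \<le> (\<integral>\<^sup>+z. ennreal (exp (1/4 * z\<^sup>2)) \<partial>gauss1)"
    using mult_right_mono[OF a(2) zero_le_power2] by (intro nn_integral_mono ennreal_leI) simp
  also have "\<dots> = ennreal (1 / sqrt (1 - 2 * (1/4)))" by (rule nn_integral_gauss1_exp_square) simp
  also have "\<dots> \<le> ennreal 2"
    by (intro ennreal_leI) (simp add: real_sqrt_divide real_le_lsqrt)
  finally show ?thesis .
qed

section \<open>Replicas of a cavity system and their interpolation\<close>

definition noise :: "nat \<Rightarrow> (nat \<times> nat) set" where "noise n = Pair 0 ` {..<n}"

text \<open>The order of the derivative of \<open>W\<close> is recorded for each replica; a differentiation in the field of replica
\<open>a\<close> raises one entry.\<close>
definition bump :: "nat \<Rightarrow> (nat \<Rightarrow> nat) \<Rightarrow> nat \<Rightarrow> nat" where "bump a m = m(a := Suc (m a))"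

text \<open>An abstract cavity system: \<open>S\<close> is the set of configurations of the reduced system with weights
\<open>\<mu>\<close>, and configuration \<open>s\<close> sees the Gaussian field with coefficients \<open>x s\<close>. The functions
\<open>W m\<close> are the successive derivatives of \<open>W 0\<close>. Their bound depends on the number \<open>n\<close> of replicas so that a
product of \<open>n\<close> of them, evaluated at fields with coefficients of squared norm at most \<open>11\<close>
(\<open>norm_v\<close>), stays below \<open>exp (sqn G / 16)\<close>.
The Gaussian index \<open>(0, a)\<close> is the private noise of replica \<open>a\<close>, which is why the couplings in
\<open>J\<close> avoid the first coordinate \<open>0\<close>.\<close>
locale cavity =
  fixes n :: nat and J :: "(nat \<times> nat) set" and S :: "'s set" and \<mu> :: "'s \<Rightarrow> real"
    and x :: "'s \<Rightarrow> nat \<times> nat \<Rightarrow> real" and q :: real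
    and W :: "nat \<Rightarrow> real \<Rightarrow> real" and B :: "nat \<Rightarrow> real"
  assumes n: "1 \<le> n"
    and finJ: "finite J" and J0: "\<And>a. (0, a) \<notin> J"
    and finS: "finite S" and \<mu>0: "\<And>s. s \<in> S \<Longrightarrow> 0 \<le> \<mu> s" and \<mu>1: "(\<Sum>s\<in>S. \<mu> s) = 1"
    and x1: "\<And>s. s \<in> S \<Longrightarrow> (\<Sum>i\<in>J. (x s i)\<^sup>2) \<le> 1"
    and q0: "0 \<le> q" and q1: "q \<le> 1"
    and dW: "\<And>m y. (W m has_real_derivative W (Suc m) y) (at y)"
    and bW: "\<And>m y. \<bar>W m y\<bar> \<le> B m * exp (y\<^sup>2 / (320 * real n))"
begin

definition bary :: "nat \<times> nat \<Rightarrow> real" where "bary i = (\<Sum>s\<in>S. \<mu> s * x s i)"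
definition dev :: "'s \<Rightarrow> nat \<times> nat \<Rightarrow> real" where "dev s i = x s i - bary i"
definition T :: "'s \<Rightarrow> 's \<Rightarrow> real" where "T s t = (\<Sum>i\<in>J. dev s i * dev t i)"
definition \<beta> :: "'s \<Rightarrow> real" where "\<beta> s = (\<Sum>i\<in>J. dev s i * bary i)"
definition \<alpha> :: "'s \<Rightarrow> real" where "\<alpha> s = T s s - (1 - q)"
definition I :: "(nat \<times> nat) set" where "I = J \<union> noise n"

text \<open>The coefficients of the field of replica \<open>a\<close> at angle \<open>\<theta>\<close>, for the configuration \<open>s\<close>. At
\<open>pi / 2\<close> it is the field of \<open>s\<close>; at \<open>0\<close> it is the mean field plus the private noise, and does not depend
on \<open>s\<close>. The rotation keeps the variance constant when \<open>\<alpha>\<close> and \<open>\<beta>\<close> vanish.\<close>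
definition v :: "'s \<Rightarrow> nat \<Rightarrow> real \<Rightarrow> nat \<times> nat \<Rightarrow> real" where
  "v s a \<theta> i = (if i \<in> J then bary i + sin \<theta> * dev s i else if i = (0, a) then cos \<theta> * sqrt (1 - q) else 0)"
definition v' :: "'s \<Rightarrow> nat \<Rightarrow> real \<Rightarrow> nat \<times> nat \<Rightarrow> real" where
  "v' s a \<theta> i = (if i \<in> J then cos \<theta> * dev s i else if i = (0, a) then - sin \<theta> * sqrt (1 - q) else 0)"
definition dot :: "(nat \<times> nat \<Rightarrow> real) \<Rightarrow> (nat \<times> nat \<Rightarrow> real) \<Rightarrow> real" where
  "dot G u = (\<Sum>i\<in>I. G i * u i)"
definition sqn :: "(nat \<times> nat \<Rightarrow> real) \<Rightarrow> real" where "sqn G = (\<Sum>i\<in>I. (G i)\<^sup>2)"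

text \<open>Replicas in \<open>Z\<close> are centred at their limit, so that their factor vanishes at angle \<open>0\<close>.\<close>
definition X :: "nat set \<Rightarrow> (nat \<Rightarrow> nat) \<Rightarrow> (nat \<Rightarrow> real) \<Rightarrow> (nat \<Rightarrow> 's) \<Rightarrow> nat \<Rightarrow> (nat \<times> nat \<Rightarrow> real) \<Rightarrow> real" where
  "X Z m \<theta> r a G = W (m a) (dot G (v (r a) a (\<theta> a))) - (if a \<in> Z then W (m a) (dot G (v (r a) a 0)) else 0)"

definition \<Phi> :: "nat set \<Rightarrow> (nat \<Rightarrow> nat) \<Rightarrow> (nat \<Rightarrow> real) \<Rightarrow> (nat \<Rightarrow> 's) \<Rightarrow> real" where
  "\<Phi> Z m \<theta> r = (\<integral>G. (\<Prod>a<n. X Z m \<theta> r a G) \<partial>gaussian I)"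

text \<open>By how much the covariance of two interpolated fields depends on the angles. A second index \<open>n\<close> stands for the barycentre.\<close>
definition small_param :: "(nat \<Rightarrow> 's) \<Rightarrow> nat \<times> nat \<Rightarrow> real" where
  "small_param r p = (case p of (a, b) \<Rightarrow> if b = n then \<beta> (r a) else if a = b then \<alpha> (r a) else T (r a) (r b))"

lemma finI: "finite I" using finJ by (auto simp: I_def noise_def)

lemma sum_I:
  "(\<Sum>i\<in>I. f i) = (\<Sum>i\<in>J. f i) + (\<Sum>a<n. f (0, a))" for f :: "nat \<times> nat \<Rightarrow> real"
proof -
  have "J \<inter> noise n = {}" using J0 by (auto simp: noise_def)
  moreover have "sum f (noise n) = (\<Sum>a<n. f (0, a))"
    unfolding noise_def by (subst sum.reindex) (auto simp: inj_on_def)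
  ultimately show ?thesis using finJ
    by (simp add: I_def sum.union_disjoint noise_def)
qed

text \<open>The covariance of a velocity with a position is what integration by parts produces. For equal replicas the
noise contributes \<open>- sin \<theta> * cos \<theta> * (1 - q)\<close>, which turns \<open>T s s\<close> into \<open>\<alpha> s\<close>.\<close>
lemma dot_v'_v_same:
  assumes "a < n"
  shows "dot (v' s a \<theta>) (v s a \<theta>) = cos \<theta> * (\<beta> s + sin \<theta> * \<alpha> s)"
proof -
  have "(\<Sum>i\<in>J. v' s a \<theta> i * v s a \<theta> i) = cos \<theta> * (\<beta> s + sin \<theta> * T s s)"
    by (simp add: v'_def v_def \<beta>_def T_def sum_distrib_left sum.distrib[symmetric] algebra_simps cong: sum.cong)
  moreover have "(\<Sum>c<n. v' s a \<theta> (0, c) * v s a \<theta> (0, c)) = - sin \<theta> * cos \<theta> * (1 - q)"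
  proof -
    have "(\<Sum>c<n. v' s a \<theta> (0, c) * v s a \<theta> (0, c)) = (\<Sum>c<n. if c = a then - sin \<theta> * cos \<theta> * (sqrt (1 - q))\<^sup>2 else 0)"
      using J0 by (intro sum.cong) (auto simp: v'_def v_def power2_eq_square)
    also have "\<dots> = - sin \<theta> * cos \<theta> * (1 - q)" using assms q1 by simp
    finally show ?thesis .
  qed
  ultimately show ?thesis unfolding dot_def sum_I by (simp add: \<alpha>_def algebra_simps)
qed

lemma dot_v'_v_other:
  assumes "a \<noteq> b"
  shows "dot (v' s a \<theta>) (v t b \<phi>) = cos \<theta> * (\<beta> s + sin \<phi> * T s t)"
proof -
  have "(\<Sum>i\<in>J. v' s a \<theta> i * v t b \<phi> i) = cos \<theta> * (\<beta> s + sin \<phi> * T s t)"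
    by (simp add: v'_def v_def \<beta>_def T_def sum_distrib_left sum.distrib[symmetric] algebra_simps cong: sum.cong)
  moreover have "(\<Sum>c<n. v' s a \<theta> (0, c) * v t b \<phi> (0, c)) = 0"
    using J0 assms by (intro sum.neutral) (auto simp: v'_def v_def)
  ultimately show ?thesis unfolding dot_def sum_I by simp
qed

lemma norm_bary: "(\<Sum>i\<in>J. (bary i)\<^sup>2) \<le> 1"
proof -
  have "(\<Sum>i\<in>J. (bary i)\<^sup>2) \<le> (\<Sum>i\<in>J. \<Sum>s\<in>S. \<mu> s * (x s i)\<^sup>2)"
  proof (rule sum_mono)
    fix i
    have "(\<Sum>s\<in>S. \<mu> s *\<^sub>R x s i)\<^sup>2 \<le> (\<Sum>s\<in>S. \<mu> s * (x s i)\<^sup>2)"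
      using finS \<mu>0 \<mu>1 by (intro convex_on_sum[OF _ _ convex_power2]) auto
    then show "(bary i)\<^sup>2 \<le> (\<Sum>s\<in>S. \<mu> s * (x s i)\<^sup>2)" by (simp add: bary_def)
  qed
  also have "\<dots> = (\<Sum>s\<in>S. \<mu> s * (\<Sum>i\<in>J. (x s i)\<^sup>2))"
    by (subst sum.swap) (simp add: sum_distrib_left)
  also have "\<dots> \<le> (\<Sum>s\<in>S. \<mu> s * 1)" using \<mu>0 x1 by (intro sum_mono mult_left_mono) auto
  finally show ?thesis using \<mu>1 by simp
qed

lemma norm_dev: assumes "s \<in> S" shows "(\<Sum>i\<in>J. (dev s i)\<^sup>2) \<le> 4"
proof -
  have "(\<Sum>i\<in>J. (dev s i)\<^sup>2) \<le> (\<Sum>i\<in>J. 2 * (x s i)\<^sup>2 + 2 * (bary i)\<^sup>2)"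
  proof (rule sum_mono)
    fix i show "(dev s i)\<^sup>2 \<le> 2 * (x s i)\<^sup>2 + 2 * (bary i)\<^sup>2"
      using zero_le_power2[of "x s i + bary i"] by (simp add: dev_def power2_eq_square algebra_simps)
  qed
  also have "\<dots> \<le> 4" using x1[OF assms] norm_bary by (simp add: sum.distrib sum_distrib_left[symmetric])
  finally show ?thesis .
qed

lemma norm_v: assumes "s \<in> S" "a < n" shows "(\<Sum>i\<in>I. (v s a \<theta> i)\<^sup>2) \<le> 11"
proof -
  have "(\<Sum>i\<in>J. (v s a \<theta> i)\<^sup>2) \<le> (\<Sum>i\<in>J. 2 * (bary i)\<^sup>2 + 2 * (dev s i)\<^sup>2)"
  proof (rule sum_mono)
    fix i assume "i \<in> J"
    have "(bary i + sin \<theta> * dev s i)\<^sup>2 \<le> 2 * (bary i)\<^sup>2 + 2 * (sin \<theta> * dev s i)\<^sup>2"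
      using zero_le_power2[of "bary i - sin \<theta> * dev s i"] by (simp add: power2_eq_square algebra_simps)
    also have "(sin \<theta> * dev s i)\<^sup>2 \<le> 1 * (dev s i)\<^sup>2"
      unfolding power_mult_distrib by (intro mult_right_mono) (auto simp: abs_square_le_1)
    finally show "(v s a \<theta> i)\<^sup>2 \<le> 2 * (bary i)\<^sup>2 + 2 * (dev s i)\<^sup>2" using \<open>i \<in> J\<close> by (simp add: v_def)
  qed
  also have "\<dots> \<le> 10" using norm_dev[OF assms(1)] norm_bary by (simp add: sum.distrib sum_distrib_left[symmetric])
  finally have 1: "(\<Sum>i\<in>J. (v s a \<theta> i)\<^sup>2) \<le> 10" .
  have "(\<Sum>c<n. (v s a \<theta> (0, c))\<^sup>2) = (\<Sum>c<n. if c = a then (cos \<theta>)\<^sup>2 * (1 - q) else 0)"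
    using J0 q1 by (intro sum.cong) (auto simp: v_def power_mult_distrib)
  also have "\<dots> = (cos \<theta>)\<^sup>2 * (1 - q)" using assms(2) by simp
  also have "\<dots> \<le> 1 * 1" using q0 q1 by (intro mult_mono) (auto simp: abs_square_le_1)
  finally show ?thesis unfolding sum_I using 1 by simp
qed

lemma sqn_nonneg: "0 \<le> sqn G" unfolding sqn_def by (intro sum_nonneg) auto

lemma dot_square_le: "(dot G u)\<^sup>2 \<le> sqn G * (\<Sum>i\<in>I. (u i)\<^sup>2)"
  unfolding dot_def sqn_def by (rule Cauchy_Schwarz_ineq_sum)

lemma B_nonneg: "0 \<le> B m" using order_trans[OF abs_ge_zero bW[of m 0]] by simp

lemma W_bound:
  assumes "(\<Sum>i\<in>I. (u i)\<^sup>2) \<le> 11"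
  shows "\<bar>W m (dot G u)\<bar> \<le> B m * exp (sqn G / 16 / real n)"
proof -
  have "(dot G u)\<^sup>2 / (320 * real n) \<le> sqn G * 11 / (320 * real n)"
    using n order_trans[OF dot_square_le mult_left_mono[OF assms sqn_nonneg]] by (intro divide_right_mono) auto
  also have "\<dots> \<le> sqn G * 20 / (320 * real n)" using sqn_nonneg
    by (intro divide_right_mono mult_left_mono) auto
  also have "\<dots> = sqn G / 16 / real n" by simp
  finally have "B m * exp ((dot G u)\<^sup>2 / (320 * real n)) \<le> B m * exp (sqn G / 16 / real n)"
    using B_nonneg by (intro mult_left_mono) auto
  with bW[of m "dot G u"] show ?thesis by linarith
qed

lemma X_bound:
  assumes "r a \<in> S" "a < n"
  shows "\<bar>X Z m \<theta> r a G\<bar> \<le> 2 * B (m a) * exp (sqn G / 16 / real n)"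
  using W_bound[OF norm_v[OF assms, of "\<theta> a"], of "m a" G] W_bound[OF norm_v[OF assms, of 0], of "m a" G]
  unfolding X_def by (auto split: if_splits)

lemma prod_X_bound:
  assumes r: "\<And>a. a < n \<Longrightarrow> r a \<in> S" and A: "A \<subseteq> {..<n}"
  shows "\<bar>\<Prod>a\<in>A. X Z m \<theta> r a G\<bar> \<le> (\<Prod>a\<in>A. 2 * B (m a)) * exp (sqn G / 16)"
proof -
  have finA: "finite A" using A finite_subset by auto
  have "\<bar>\<Prod>a\<in>A. X Z m \<theta> r a G\<bar> \<le> (\<Prod>a\<in>A. 2 * B (m a) * exp (sqn G / 16 / real n))"
    unfolding abs_prod using A r by (intro prod_mono conjI X_bound) auto
  also have "\<dots> = (\<Prod>a\<in>A. 2 * B (m a)) * exp (real (card A) * (sqn G / 16 / real n))"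
    by (simp only: prod.distrib prod_constant exp_of_nat_mult)
  also have "\<dots> \<le> (\<Prod>a\<in>A. 2 * B (m a)) * exp (sqn G / 16)"
  proof (intro mult_left_mono prod_nonneg)
    have "card A \<le> n" using A by (metis card_lessThan card_mono finite_lessThan)
    then have "real (card A) * (sqn G / 16 / real n) \<le> real n * (sqn G / 16 / real n)"
      using sqn_nonneg by (intro mult_right_mono) auto
    then show "exp (real (card A) * (sqn G / 16 / real n)) \<le> exp (sqn G / 16)" using n by simp
  qed (use B_nonneg in auto)
  finally show ?thesis .
qed

lemma W_measurable[measurable]: "W m \<in> borel_measurable borel"
  using dW by (intro borel_measurable_continuous_onI DERIV_continuous_on) (auto intro: has_field_derivative_at_within)

lemma dot_measurable[measurable]: "(\<lambda>G. dot G u) \<in> borel_measurable (gaussian I)"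
  unfolding dot_def by measurable

lemma X_measurable[measurable]: "X Z m \<theta> r a \<in> borel_measurable (gaussian I)"
  unfolding X_def by measurable

lemma dot_upd_deriv:
  assumes "e \<in> I"
  shows "((\<lambda>t. dot (G(e := t)) u) has_real_derivative u e) (at t)"
proof -
  have "dot (G(e := t)) u = t * u e + (\<Sum>i\<in>I - {e}. G i * u i)" for t
    unfolding dot_def using finI assms by (subst sum.remove[of _ e]) auto
  then show ?thesis by (auto intro!: derivative_eq_intros)
qed

text \<open>Partial derivative of a factor in the Gaussian coordinate \<open>e\<close>.\<close>
definition dX :: "nat set \<Rightarrow> (nat \<Rightarrow> nat) \<Rightarrow> (nat \<Rightarrow> real) \<Rightarrow> (nat \<Rightarrow> 's) \<Rightarrow> nat \<Rightarrow> nat \<times> nat \<Rightarrow> (nat \<times> nat \<Rightarrow> real) \<Rightarrow> real" where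
  "dX Z m \<theta> r a e G = W (Suc (m a)) (dot G (v (r a) a (\<theta> a))) * v (r a) a (\<theta> a) e
     - (if a \<in> Z then W (Suc (m a)) (dot G (v (r a) a 0)) * v (r a) a 0 e else 0)"

lemma dX_measurable[measurable]: "dX Z m \<theta> r a e \<in> borel_measurable (gaussian I)"
  unfolding dX_def by measurable

lemma X_upd_deriv:
  assumes "e \<in> I"
  shows "((\<lambda>t. X Z m \<theta> r a (G(e := t))) has_real_derivative dX Z m \<theta> r a e (G(e := t))) (at t)"
proof -
  note d = DERIV_chain2[OF dW dot_upd_deriv[OF assms]]
  show ?thesis unfolding X_def dX_def by (auto intro!: derivative_eq_intros d)
qed

lemma dX_upd_continuous:
  assumes "e \<in> I" shows "continuous_on UNIV (\<lambda>t. dX Z m \<theta> r a e (G(e := t)))"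
proof -
  have c: "isCont (\<lambda>t. W k (dot (G(e := t)) u)) t" for k u t
    using DERIV_chain2[OF dW dot_upd_deriv[OF assms]] DERIV_isCont by blast
  show ?thesis unfolding dX_def
    by (cases "a \<in> Z") (auto intro!: continuous_intros continuous_at_imp_continuous_on c)
qed

lemma v_le: assumes "s \<in> S" "a < n" "i \<in> I" shows "\<bar>v s a \<theta> i\<bar> \<le> 4"
proof -
  have "(v s a \<theta> i)\<^sup>2 \<le> (\<Sum>i\<in>I. (v s a \<theta> i)\<^sup>2)" using finI assms by (intro member_le_sum) auto
  also have "\<dots> \<le> 4\<^sup>2" using norm_v[OF assms(1,2), of \<theta>] by simp
  finally show ?thesis using power2_le_iff_abs_le[of "4::real"] by simp
qed

lemma v'_le: assumes "s \<in> S" "i \<in> I" shows "\<bar>v' s a \<theta> i\<bar> \<le> 3"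
proof (cases "i \<in> J")
  case True
  have "(dev s i)\<^sup>2 \<le> (\<Sum>i\<in>J. (dev s i)\<^sup>2)" using finJ True by (intro member_le_sum) auto
  also have "\<dots> \<le> 2\<^sup>2" using norm_dev[OF assms(1)] by simp
  finally have "\<bar>dev s i\<bar> \<le> 2" using power2_le_iff_abs_le[of "2::real"] by simp
  then have "\<bar>cos \<theta>\<bar> * \<bar>dev s i\<bar> \<le> 1 * 2" by (intro mult_mono) auto
  then show ?thesis using True by (simp add: v'_def abs_mult)
next
  case False
  have "\<bar>sin \<theta>\<bar> * \<bar>sqrt (1 - q)\<bar> \<le> 1 * 1" using q0 q1 by (intro mult_mono) auto
  then show ?thesis using False by (auto simp: v'_def abs_mult)
qed

lemma dX_bound:
  assumes "r a \<in> S" "a < n" "e \<in> I"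
  shows "\<bar>dX Z m \<theta> r a e G\<bar> \<le> 8 * B (Suc (m a)) * exp (sqn G / 16 / real n)"
proof -
  have *: "\<bar>W (Suc (m a)) (dot G (v (r a) a t)) * v (r a) a t e\<bar> \<le> B (Suc (m a)) * exp (sqn G / 16 / real n) * 4" for t
    unfolding abs_mult using assms B_nonneg by (intro mult_mono W_bound norm_v v_le) auto
  show ?thesis using *[of "\<theta> a"] *[of 0] unfolding dX_def by (auto split: if_splits)
qed

lemma prod_expectation_by_parts:
  assumes r: "\<And>a. a < n \<Longrightarrow> r a \<in> S" and e: "e \<in> I"
  shows "(\<integral>G. G e * (\<Prod>a<n. X Z m \<theta> r a G) \<partial>gaussian I)
     = (\<integral>G. (\<Sum>b<n. dX Z m \<theta> r b e G * (\<Prod>c\<in>{..<n} - {b}. X Z m \<theta> r c G)) \<partial>gaussian I)"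
proof -
  define C where "C = (\<Prod>a<n. 2 * B (m a)) + (\<Sum>b<n. 8 * B (Suc (m b)) * (\<Prod>c\<in>{..<n} - {b}. 2 * B (m c)))"
  have C1: "0 \<le> (\<Prod>a<n. 2 * B (m a))" using B_nonneg by (intro prod_nonneg) auto
  have C2: "0 \<le> (\<Sum>b<n. 8 * B (Suc (m b)) * (\<Prod>c\<in>{..<n} - {b}. 2 * B (m c)))"
    using B_nonneg by (intro sum_nonneg mult_nonneg_nonneg prod_nonneg) auto
  show ?thesis
  proof (rule gaussian_integration_by_parts[OF finI e, where C=C])
    fix G :: "nat \<times> nat \<Rightarrow> real" and t
    show "((\<lambda>t. \<Prod>a<n. X Z m \<theta> r a (G(e := t))) has_real_derivative
       (\<Sum>b<n. dX Z m \<theta> r b e (G(e := t)) * (\<Prod>c\<in>{..<n} - {b}. X Z m \<theta> r c (G(e := t))))) (at t)"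
      using X_upd_deriv[OF e] by (intro has_field_derivative_prod) auto
    have cX: "continuous_on UNIV (\<lambda>t. X Z m \<theta> r a (G(e := t)))" for a
      using X_upd_deriv[OF e, THEN DERIV_isCont] by (intro continuous_at_imp_continuous_on) auto
    show "continuous_on UNIV (\<lambda>t. \<Sum>b<n. dX Z m \<theta> r b e (G(e := t)) * (\<Prod>c\<in>{..<n} - {b}. X Z m \<theta> r c (G(e := t))))"
      by (intro continuous_intros dX_upd_continuous[OF e] cX)
    have s: "exp (sqn G / 16) \<le> exp ((\<Sum>i\<in>I. (G i)\<^sup>2) * 3 / 16)" using sqn_nonneg[of G] by (simp add: sqn_def)
    have s2: "exp (sqn G / 16 / real n) * exp (sqn G / 16) \<le> exp ((\<Sum>i\<in>I. (G i)\<^sup>2) * 3 / 16)"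
    proof -
      have "sqn G / 16 / real n \<le> sqn G / 16 / 1"
        using n sqn_nonneg[of G] by (intro divide_left_mono) auto
      then show ?thesis using sqn_nonneg[of G] unfolding exp_add[symmetric] by (simp add: sqn_def)
    qed
    have "\<bar>\<Prod>a<n. X Z m \<theta> r a G\<bar> \<le> (\<Prod>a<n. 2 * B (m a)) * exp (sqn G / 16)"
      by (rule prod_X_bound[OF r]) auto
    also have "\<dots> \<le> C * exp ((\<Sum>i\<in>I. (G i)\<^sup>2) * 3 / 16)"
      using C1 C2 s by (intro mult_mono) (auto simp: C_def)
    finally show "\<bar>\<Prod>a<n. X Z m \<theta> r a G\<bar> \<le> C * exp ((\<Sum>i\<in>I. (G i)\<^sup>2) * 3 / 16)" .
    have "\<bar>\<Sum>b<n. dX Z m \<theta> r b e G * (\<Prod>c\<in>{..<n} - {b}. X Z m \<theta> r c G)\<bar>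
       \<le> (\<Sum>b<n. \<bar>dX Z m \<theta> r b e G\<bar> * \<bar>\<Prod>c\<in>{..<n} - {b}. X Z m \<theta> r c G\<bar>)"
      by (rule order_trans[OF sum_abs]) (simp add: abs_mult)
    also have "\<dots> \<le> (\<Sum>b<n. (8 * B (Suc (m b)) * exp (sqn G / 16 / real n)) * ((\<Prod>c\<in>{..<n} - {b}. 2 * B (m c)) * exp (sqn G / 16)))"
      using e B_nonneg r by (intro sum_mono mult_mono dX_bound prod_X_bound) auto
    also have "\<dots> = (\<Sum>b<n. 8 * B (Suc (m b)) * (\<Prod>c\<in>{..<n} - {b}. 2 * B (m c))) * (exp (sqn G / 16 / real n) * exp (sqn G / 16))"
      unfolding sum_distrib_right by (intro sum.cong refl) (simp only: mult_ac)
    also have "\<dots> \<le> C * exp ((\<Sum>i\<in>I. (G i)\<^sup>2) * 3 / 16)"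
      using C1 C2 s2 by (intro mult_mono) (auto simp: C_def)
    finally show "\<bar>\<Sum>b<n. dX Z m \<theta> r b e G * (\<Prod>c\<in>{..<n} - {b}. X Z m \<theta> r c G)\<bar> \<le> C * exp ((\<Sum>i\<in>I. (G i)\<^sup>2) * 3 / 16)" .
  qed measurable
qed

lemma prod_X_integrable:
  assumes r: "\<And>a. a < n \<Longrightarrow> r a \<in> S"
  shows "integrable (gaussian I) (\<lambda>G. \<Prod>a<n. X Z m \<theta> r a G)"
proof (rule gaussian_integrable_bound[OF finI, where C="\<Prod>a<n. 2 * B (m a)"])
  fix G
  have "\<bar>\<Prod>a<n. X Z m \<theta> r a G\<bar> \<le> (\<Prod>a<n. 2 * B (m a)) * exp (sqn G / 16)"
    by (rule prod_X_bound[OF r]) auto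
  also have "\<dots> \<le> (\<Prod>a<n. 2 * B (m a)) * exp ((\<Sum>i\<in>I. (G i)\<^sup>2) / 4)"
    using sqn_nonneg[of G] B_nonneg by (intro mult_left_mono prod_nonneg) (auto simp: sqn_def)
  finally show "\<bar>\<Prod>a<n. X Z m \<theta> r a G\<bar> \<le> (\<Prod>a<n. 2 * B (m a)) * exp ((\<Sum>i\<in>I. (G i)\<^sup>2) / 4)" .
qed measurable

text \<open>Contracting the partial derivatives with the velocity of replica \<open>a\<close>.\<close>
lemma contract_dX:
  assumes "a < n" "a \<notin> Z" "b < n"
  shows "(\<Sum>e\<in>I. v' (r a) a (\<theta> a) e * dX Z m \<theta> r b e G)
    = cos (\<theta> a) * (\<beta> (r a) * X Z (bump b m) \<theta> r b G + sin (\<theta> b) * small_param r (a, b) * X (Z - {b}) (bump b m) \<theta> r b G)"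
proof -
  have e: "(\<Sum>e\<in>I. v' (r a) a (\<theta> a) e * dX Z m \<theta> r b e G)
    = W (Suc (m b)) (dot G (v (r b) b (\<theta> b))) * dot (v' (r a) a (\<theta> a)) (v (r b) b (\<theta> b))
     - (if b \<in> Z then W (Suc (m b)) (dot G (v (r b) b 0)) * dot (v' (r a) a (\<theta> a)) (v (r b) b 0) else 0)"
    unfolding dX_def dot_def[of "v' (r a) a (\<theta> a)"] by (simp add: sum_distrib_left sum_subtractf algebra_simps)
  show ?thesis
  proof (cases "b = a")
    case True
    then show ?thesis unfolding e using assms
      by (simp add: X_def bump_def small_param_def dot_v'_v_same algebra_simps)
  next
    case False
    then have "a \<noteq> b" by simp
    then show ?thesis unfolding e dot_v'_v_other[OF \<open>a \<noteq> b\<close>] using assms False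
      by (simp add: X_def bump_def small_param_def algebra_simps)
  qed
qed

lemma v_deriv: "((\<lambda>s. v t a s i) has_real_derivative v' t a s i) (at s)"
  unfolding v_def v'_def by (auto intro!: derivative_eq_intros)

lemma dot_v_deriv: "((\<lambda>s. dot G (v t a s)) has_real_derivative dot G (v' t a s)) (at s)"
  unfolding dot_def by (intro DERIV_sum DERIV_cmult v_deriv)

text \<open>Differentiating in the angle of replica \<open>a\<close> brings down \<open>dot G (v' (r a) a s)\<close>; each coordinate of
\<open>G\<close> is then removed by integration by parts, and \<open>contract_dX\<close> collects the coordinates into
small parameters. In the term with \<open>small_param r (a, b)\<close> the centring of replica \<open>b\<close> disappears, because the
covariance with the limit field of \<open>b\<close> has no such part.\<close>
lemma \<Phi>_deriv:
  assumes r: "\<And>a. a < n \<Longrightarrow> r a \<in> S" and a: "a < n" "a \<notin> Z"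
  shows "((\<lambda>s. \<Phi> Z m (\<theta>(a := s)) r) has_real_derivative
     (cos s * (\<Sum>b<n. \<beta> (r a) * \<Phi> Z (bump b (bump a m)) (\<theta>(a := s)) r
        + sin ((\<theta>(a := s)) b) * small_param r (a, b) * \<Phi> (Z - {b}) (bump b (bump a m)) (\<theta>(a := s)) r))) (at s)"
proof -
  define \<theta>' where "\<theta>' = \<theta>(a := s)"
  define m1 where "m1 = bump a m"
  define C where "C = (\<Prod>a<n. 2 * B (m1 a))"
  have C0: "C \<ge> 0" using B_nonneg by (auto simp: C_def intro!: prod_nonneg)
  have upd: "(\<Prod>c<n. X Z m1 (\<theta>(a := s)) r c G) = W (Suc (m a)) (dot G (v (r a) a s)) * (\<Prod>c\<in>{..<n} - {a}. X Z m \<theta> r c G)" for G s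
  proof -
    have "(\<Prod>c\<in>{..<n} - {a}. X Z m1 (\<theta>(a := s)) r c G) = (\<Prod>c\<in>{..<n} - {a}. X Z m \<theta> r c G)"
      by (intro prod.cong) (auto simp: X_def m1_def bump_def)
    moreover have "X Z m1 (\<theta>(a := s)) r a G = W (Suc (m a)) (dot G (v (r a) a s))"
      using a by (simp add: X_def m1_def bump_def)
    ultimately show ?thesis using a by (subst prod.remove[of _ a]) auto
  qed
  have bnd: "\<bar>G e * (\<Prod>c<n. X Z m1 (\<theta>(a := s)) r c G)\<bar> \<le> 4 * C * exp (sqn G / 4)" if "e \<in> I" for e G s
  proof -
    have "\<bar>\<Prod>c<n. X Z m1 (\<theta>(a := s)) r c G\<bar> \<le> C * exp (sqn G / 16)"
      unfolding C_def by (rule prod_X_bound[OF r]) auto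
    also have "\<dots> \<le> C * exp ((\<Sum>i\<in>I. (G i)\<^sup>2) * 3 / 16)" using C0 sqn_nonneg[of G]
      by (intro mult_left_mono) (auto simp: sqn_def)
    finally show ?thesis unfolding sqn_def by (rule gaussian_component_bound[OF finI that])
  qed
  have "((\<lambda>s. \<Phi> Z m (\<theta>(a := s)) r) has_real_derivative
     (\<integral>G. dot G (v' (r a) a s) * (\<Prod>c<n. X Z m1 (\<theta>(a := s)) r c G) \<partial>gaussian I)) (at s)"
    unfolding \<Phi>_def
  proof (rule has_real_derivative_integral)
    fix s :: real and G
    have e: "(\<Prod>c<n. X Z m (\<theta>(a := s)) r c G) = W (m a) (dot G (v (r a) a s)) * (\<Prod>c\<in>{..<n} - {a}. X Z m \<theta> r c G)" for s
      using a by (subst prod.remove[of _ a]) (auto simp: X_def intro!: prod.cong)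
    show "((\<lambda>s. \<Prod>c<n. X Z m (\<theta>(a := s)) r c G) has_real_derivative dot G (v' (r a) a s) * (\<Prod>c<n. X Z m1 (\<theta>(a := s)) r c G)) (at s)"
      unfolding e upd by (auto intro!: derivative_eq_intros DERIV_chain2[OF dW dot_v_deriv])
    show "integrable (gaussian I) (\<lambda>G. \<Prod>c<n. X Z m (\<theta>(a := s)) r c G)" by (rule prod_X_integrable[OF r])
    show "(\<lambda>G. dot G (v' (r a) a s) * (\<Prod>c<n. X Z m1 (\<theta>(a := s)) r c G)) \<in> borel_measurable (gaussian I)"
      by measurable
    show "integrable (gaussian I) (\<lambda>G. real (card I) * 12 * C * exp (1/4 * (\<Sum>i\<in>I. (G i)\<^sup>2)))"
      by (intro integrable_mult_right gaussian_exp_sum_squares finI) auto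
    show "\<bar>dot G (v' (r a) a s) * (\<Prod>c<n. X Z m1 (\<theta>(a := s)) r c G)\<bar> \<le> real (card I) * 12 * C * exp (1/4 * (\<Sum>i\<in>I. (G i)\<^sup>2))"
    proof -
      have "\<bar>dot G (v' (r a) a s) * (\<Prod>c<n. X Z m1 (\<theta>(a := s)) r c G)\<bar>
        \<le> (\<Sum>e\<in>I. \<bar>v' (r a) a s e\<bar> * \<bar>G e * (\<Prod>c<n. X Z m1 (\<theta>(a := s)) r c G)\<bar>)"
        unfolding dot_def sum_distrib_right by (rule order_trans[OF sum_abs]) (simp add: abs_mult mult_ac)
      also have "\<dots> \<le> (\<Sum>e\<in>I. 3 * (4 * C * exp (sqn G / 4)))"
        using C0 r a by (intro sum_mono mult_mono v'_le bnd) auto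
      finally show ?thesis by (simp add: sqn_def)
    qed
  qed
  note D = this[folded \<theta>'_def]
  have "(\<integral>G. dot G (v' (r a) a s) * (\<Prod>c<n. X Z m1 \<theta>' r c G) \<partial>gaussian I)
    = (\<Sum>e\<in>I. v' (r a) a s e * (\<integral>G. G e * (\<Prod>c<n. X Z m1 \<theta>' r c G) \<partial>gaussian I))"
  proof -
    have i: "integrable (gaussian I) (\<lambda>G. G e * (\<Prod>c<n. X Z m1 \<theta>' r c G))" if "e \<in> I" for e
    proof (rule gaussian_integrable_bound[OF finI])
      have [measurable]: "(\<lambda>G. G e) \<in> borel_measurable (gaussian I)" using that by measurable
      show "(\<lambda>G. G e * (\<Prod>c<n. X Z m1 \<theta>' r c G)) \<in> borel_measurable (gaussian I)" by measurable
      show "\<bar>G e * (\<Prod>c<n. X Z m1 \<theta>' r c G)\<bar> \<le> 4 * C * exp ((\<Sum>i\<in>I. (G i)\<^sup>2) / 4)" for G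
        using bnd[OF that] by (simp add: \<theta>'_def sqn_def)
    qed
    have "(\<integral>G. dot G (v' (r a) a s) * (\<Prod>c<n. X Z m1 \<theta>' r c G) \<partial>gaussian I)
      = (\<integral>G. (\<Sum>e\<in>I. v' (r a) a s e * (G e * (\<Prod>c<n. X Z m1 \<theta>' r c G))) \<partial>gaussian I)"
      unfolding dot_def sum_distrib_right by (simp add: mult_ac)
    also have "\<dots> = (\<Sum>e\<in>I. v' (r a) a s e * (\<integral>G. G e * (\<Prod>c<n. X Z m1 \<theta>' r c G) \<partial>gaussian I))"
      using i by simp
    finally show ?thesis .
  qed
  also have "\<dots> = (\<Sum>e\<in>I. v' (r a) a s e * (\<integral>G. (\<Sum>b<n. dX Z m1 \<theta>' r b e G * (\<Prod>c\<in>{..<n} - {b}. X Z m1 \<theta>' r c G)) \<partial>gaussian I))"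
    by (intro sum.cong refl arg_cong2[where f="(*)"] prod_expectation_by_parts r)
  also have "\<dots> = (\<integral>G. (\<Sum>e\<in>I. v' (r a) a s e * (\<Sum>b<n. dX Z m1 \<theta>' r b e G * (\<Prod>c\<in>{..<n} - {b}. X Z m1 \<theta>' r c G))) \<partial>gaussian I)"
  proof -
    have i: "integrable (gaussian I) (\<lambda>G. dX Z m1 \<theta>' r b e G * (\<Prod>c\<in>{..<n} - {b}. X Z m1 \<theta>' r c G))" if "e \<in> I" "b < n" for e b
    proof (rule gaussian_integrable_bound[OF finI])
      fix G
      have D: "0 \<le> 8 * B (Suc (m1 b)) * (\<Prod>c\<in>{..<n} - {b}. 2 * B (m1 c))"
        using B_nonneg by (intro mult_nonneg_nonneg prod_nonneg) auto
      have "\<bar>dX Z m1 \<theta>' r b e G * (\<Prod>c\<in>{..<n} - {b}. X Z m1 \<theta>' r c G)\<bar> \<le> (8 * B (Suc (m1 b)) * exp (sqn G / 16 / real n)) * ((\<Prod>c\<in>{..<n} - {b}. 2 * B (m1 c)) * exp (sqn G / 16))"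
        unfolding abs_mult using that B_nonneg r by (intro mult_mono dX_bound prod_X_bound) auto
      also have "\<dots> = (8 * B (Suc (m1 b)) * (\<Prod>c\<in>{..<n} - {b}. 2 * B (m1 c))) * exp (sqn G / 16 / real n + sqn G / 16)"
        unfolding exp_add by (simp only: mult_ac)
      also have "\<dots> \<le> (8 * B (Suc (m1 b)) * (\<Prod>c\<in>{..<n} - {b}. 2 * B (m1 c))) * exp ((\<Sum>i\<in>I. (G i)\<^sup>2) / 4)"
      proof (rule mult_left_mono[OF _ D])
        have "sqn G / 16 / real n \<le> sqn G / 16 / 1"
          using n sqn_nonneg[of G] by (intro divide_left_mono) auto
        then show "exp (sqn G / 16 / real n + sqn G / 16) \<le> exp ((\<Sum>i\<in>I. (G i)\<^sup>2) / 4)"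
          using sqn_nonneg[of G] by (simp add: sqn_def)
      qed
      finally show "\<bar>dX Z m1 \<theta>' r b e G * (\<Prod>c\<in>{..<n} - {b}. X Z m1 \<theta>' r c G)\<bar> \<le> (8 * B (Suc (m1 b)) * (\<Prod>c\<in>{..<n} - {b}. 2 * B (m1 c))) * exp ((\<Sum>i\<in>I. (G i)\<^sup>2) / 4)" .
    qed measurable
    have i2: "integrable (gaussian I) (\<lambda>G. \<Sum>b<n. dX Z m1 \<theta>' r b e G * (\<Prod>c\<in>{..<n} - {b}. X Z m1 \<theta>' r c G))" if "e \<in> I" for e
      using that by (intro Bochner_Integration.integrable_sum i) auto
    show ?thesis using i2
      by (subst Bochner_Integration.integral_sum) (auto intro!: integrable_mult_right)
  qed
  also have "\<dots> = (\<integral>G. (\<Sum>b<n. cos s * (\<beta> (r a) * (\<Prod>c<n. X Z (bump b m1) \<theta>' r c G) + sin (\<theta>' b) * small_param r (a, b) * (\<Prod>c<n. X (Z - {b}) (bump b m1) \<theta>' r c G))) \<partial>gaussian I)"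
  proof (rule Bochner_Integration.integral_cong[OF refl])
    fix G
    have "(\<Sum>e\<in>I. v' (r a) a s e * (\<Sum>b<n. dX Z m1 \<theta>' r b e G * (\<Prod>c\<in>{..<n} - {b}. X Z m1 \<theta>' r c G)))
      = (\<Sum>b<n. (\<Sum>e\<in>I. v' (r a) a (\<theta>' a) e * dX Z m1 \<theta>' r b e G) * (\<Prod>c\<in>{..<n} - {b}. X Z m1 \<theta>' r c G))"
      unfolding sum_distrib_left sum_distrib_right by (subst sum.swap) (simp add: \<theta>'_def mult_ac)
    also have "\<dots> = (\<Sum>b<n. cos s * (\<beta> (r a) * (\<Prod>c<n. X Z (bump b m1) \<theta>' r c G) + sin (\<theta>' b) * small_param r (a, b) * (\<Prod>c<n. X (Z - {b}) (bump b m1) \<theta>' r c G)))"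
    proof (rule sum.cong[OF refl])
      fix b assume b: "b \<in> {..<n}"
      have o: "(\<Prod>c\<in>{..<n} - {b}. X Z (bump b m1) \<theta>' r c G) = (\<Prod>c\<in>{..<n} - {b}. X Z m1 \<theta>' r c G)"
        "(\<Prod>c\<in>{..<n} - {b}. X (Z - {b}) (bump b m1) \<theta>' r c G) = (\<Prod>c\<in>{..<n} - {b}. X Z m1 \<theta>' r c G)"
        by (intro prod.cong; auto simp: X_def bump_def)+
      have 1: "(\<Prod>c<n. X Z (bump b m1) \<theta>' r c G) = X Z (bump b m1) \<theta>' r b G * (\<Prod>c\<in>{..<n} - {b}. X Z m1 \<theta>' r c G)"
        using b by (simp add: prod.remove[of "{..<n}" b] o)
      have 2: "(\<Prod>c<n. X (Z - {b}) (bump b m1) \<theta>' r c G) = X (Z - {b}) (bump b m1) \<theta>' r b G * (\<Prod>c\<in>{..<n} - {b}. X Z m1 \<theta>' r c G)"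
        using b by (simp add: prod.remove[of "{..<n}" b] o)
      have 3: "cos (\<theta>' a) = cos s" by (simp add: \<theta>'_def)
      show "(\<Sum>e\<in>I. v' (r a) a (\<theta>' a) e * dX Z m1 \<theta>' r b e G) * (\<Prod>c\<in>{..<n} - {b}. X Z m1 \<theta>' r c G)
        = cos s * (\<beta> (r a) * (\<Prod>c<n. X Z (bump b m1) \<theta>' r c G) + sin (\<theta>' b) * small_param r (a, b) * (\<Prod>c<n. X (Z - {b}) (bump b m1) \<theta>' r c G))"
        using b unfolding 1 2 by (subst contract_dX[OF a]) (auto simp: 3 algebra_simps)
    qed
    finally show "(\<Sum>e\<in>I. v' (r a) a s e * (\<Sum>b<n. dX Z m1 \<theta>' r b e G * (\<Prod>c\<in>{..<n} - {b}. X Z m1 \<theta>' r c G)))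
      = (\<Sum>b<n. cos s * (\<beta> (r a) * (\<Prod>c<n. X Z (bump b m1) \<theta>' r c G) + sin (\<theta>' b) * small_param r (a, b) * (\<Prod>c<n. X (Z - {b}) (bump b m1) \<theta>' r c G)))" .
  qed
  also have "\<dots> = cos s * (\<Sum>b<n. \<beta> (r a) * \<Phi> Z (bump b m1) \<theta>' r + sin (\<theta>' b) * small_param r (a, b) * \<Phi> (Z - {b}) (bump b m1) \<theta>' r)"
    unfolding \<Phi>_def using prod_X_integrable[OF r] by (simp add: sum_distrib_left)
  finally have E: "(\<integral>G. dot G (v' (r a) a s) * (\<Prod>c<n. X Z m1 \<theta>' r c G) \<partial>gaussian I)
    = cos s * (\<Sum>b<n. \<beta> (r a) * \<Phi> Z (bump b m1) \<theta>' r + sin (\<theta>' b) * small_param r (a, b) * \<Phi> (Z - {b}) (bump b m1) \<theta>' r)" .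
  show ?thesis using D unfolding E unfolding \<theta>'_def m1_def .
qed

end

section \<open>Raising every replica to multiplicity two\<close>

text \<open>Separates one coordinate of a dependent product; used for a replica here and for the removed spin below.\<close>
lemma sum_PiE_insert:
  fixes f :: "('i \<Rightarrow> 'b) \<Rightarrow> 'c::comm_monoid_add"
  assumes "i \<notin> A"
  shows "(\<Sum>r\<in>PiE (insert i A) S. f r) = (\<Sum>s\<in>S i. \<Sum>r\<in>PiE A S. f (r(i := s)))"
proof -
  have "(\<Sum>r\<in>PiE (insert i A) S. f r) = (\<Sum>(s, r)\<in>S i \<times> PiE A S. f (r(i := s)))"
    unfolding PiE_insert_eq by (subst sum.reindex[OF inj_combinator[OF assms]]) (auto simp: case_prod_unfold)
  then show ?thesis by (simp add: sum.cartesian_product)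
qed

text \<open>The constant of \<open>replica_avg_main\<close>, by recursion on the number of differentiations that may still be needed. It depends
on \<open>n\<close> and the bounds \<open>B\<close> only, which is what the uniformity in all other parameters rests on.\<close>
primrec raise_const :: "nat \<Rightarrow> (nat \<Rightarrow> real) \<Rightarrow> nat \<Rightarrow> (nat \<times> nat) list \<Rightarrow> (nat \<Rightarrow> nat) \<Rightarrow> real" where
  "raise_const n B 0 = (\<lambda>L m. 5 ^ length L * real n * (2 * real n * (\<Prod>a<n. \<bar>B (m a)\<bar>)))"
| "raise_const n B (Suc d) = (\<lambda>L m. 5 ^ length L * real n * (2 * real n * (\<Prod>a<n. \<bar>B (m a)\<bar>))
     + (\<Sum>a<n. \<Sum>b<n. 2 * (raise_const n B d ((a, n) # L) (bump b (bump a m)) + raise_const n B d ((a, b) # L) (bump b (bump a m)))))"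

definition multiplicity :: "(nat \<times> nat) list \<Rightarrow> nat \<Rightarrow> nat" where
  "multiplicity L a = count_list (map fst L) a + count_list (map snd L) a"

lemma raise_const_nonneg: "0 \<le> raise_const n B d L m"
  by (induction d arbitrary: L m) (auto intro!: add_nonneg_nonneg sum_nonneg mult_nonneg_nonneg prod_nonneg)

context cavity begin

definition replica_avg :: "((nat \<Rightarrow> 's) \<Rightarrow> real) \<Rightarrow> real" where
  "replica_avg f = (\<Sum>r\<in>PiE {..<n} (\<lambda>_. S). (\<Prod>a<n. \<mu> (r a)) * f r)"

lemma replica_avg_cong: "(\<And>r. (\<And>a. a < n \<Longrightarrow> r a \<in> S) \<Longrightarrow> f r = g r) \<Longrightarrow> replica_avg f = replica_avg g"
  unfolding replica_avg_def by (intro sum.cong) (auto simp: PiE_iff)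

lemma replica_avg_add: "replica_avg (\<lambda>r. f r + g r) = replica_avg f + replica_avg g"
  unfolding replica_avg_def by (simp add: distrib_left sum.distrib)

lemma replica_avg_diff: "replica_avg (\<lambda>r. f r - g r) = replica_avg f - replica_avg g"
  unfolding replica_avg_def by (simp add: right_diff_distrib sum_subtractf)

lemma replica_avg_cmult: "replica_avg (\<lambda>r. c * f r) = c * replica_avg f"
  unfolding replica_avg_def by (simp add: sum_distrib_left mult_ac)

lemma replica_avg_sum: "replica_avg (\<lambda>r. \<Sum>b\<in>A. f b r) = (\<Sum>b\<in>A. replica_avg (f b))"
  unfolding replica_avg_def sum_distrib_left by (rule sum.swap)

lemma replica_avg_mono: "(\<And>r. (\<And>a. a < n \<Longrightarrow> r a \<in> S) \<Longrightarrow> f r \<le> g r) \<Longrightarrow> replica_avg f \<le> replica_avg g"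
  unfolding replica_avg_def using \<mu>0 by (intro sum_mono mult_left_mono prod_nonneg) (auto simp: PiE_iff)

lemma replica_avg_abs: "\<bar>replica_avg f\<bar> \<le> replica_avg (\<lambda>r. \<bar>f r\<bar>)"
  unfolding replica_avg_def using \<mu>0
  by (intro order_trans[OF sum_abs] sum_mono) (auto simp: abs_mult abs_prod PiE_iff)

lemma replica_avg_const: "replica_avg (\<lambda>_. c) = c"
proof -
  have "(\<Sum>r\<in>PiE {..<n} (\<lambda>_. S). \<Prod>a<n. \<mu> (r a)) = (\<Prod>a<n. \<Sum>s\<in>S. \<mu> s)"
    using finS by (intro prod_sum_PiE[symmetric]) auto
  then show ?thesis unfolding replica_avg_def sum_distrib_right[symmetric] by (simp add: \<mu>1)
qed

text \<open>Fresh sampling of one replica does not change the average, since the replicas are independent.\<close>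
lemma replica_avg_resample:
  assumes a: "a < n"
  shows "replica_avg f = replica_avg (\<lambda>r. \<Sum>s\<in>S. \<mu> s * f (r(a := s)))"
proof -
  define A where "A = {..<n} - {a}"
  have A: "{..<n} = insert a A" "a \<notin> A" "finite A" using a by (auto simp: A_def)
  have "replica_avg g = (\<Sum>s\<in>S. \<Sum>r\<in>PiE A (\<lambda>_. S). \<mu> s * (\<Prod>c\<in>A. \<mu> (r c)) * g (r(a := s)))" for g
  proof -
    have "(\<Prod>c\<in>A. \<mu> ((r(a := s)) c)) = (\<Prod>c\<in>A. \<mu> (r c))" for r s
      using A by (intro prod.cong) auto
    then show ?thesis unfolding replica_avg_def A(1) sum_PiE_insert[OF A(2)] using A by simp
  qed
  note e = this
  have "replica_avg (\<lambda>r. \<Sum>s\<in>S. \<mu> s * f (r(a := s)))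
    = (\<Sum>s\<in>S. \<mu> s * (\<Sum>r\<in>PiE A (\<lambda>_. S). (\<Prod>c\<in>A. \<mu> (r c)) * (\<Sum>s\<in>S. \<mu> s * f (r(a := s)))))"
    unfolding e[of "\<lambda>r. \<Sum>s\<in>S. \<mu> s * f (r(a := s))"] by (simp add: sum_distrib_left mult_ac)
  also have "\<dots> = (\<Sum>r\<in>PiE A (\<lambda>_. S). (\<Prod>c\<in>A. \<mu> (r c)) * (\<Sum>s\<in>S. \<mu> s * f (r(a := s))))"
    by (simp add: sum_distrib_right[symmetric] \<mu>1)
  also have "\<dots> = replica_avg f" unfolding e[of f] sum_distrib_left by (subst sum.swap) (simp add: mult_ac)
  finally show ?thesis by simp
qed

lemma replica_avg_one: "a < n \<Longrightarrow> replica_avg (\<lambda>r. f (r a)) = (\<Sum>s\<in>S. \<mu> s * f s)"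
  by (subst replica_avg_resample[of a]) (auto simp: replica_avg_const)

lemma replica_avg_two: "a < n \<Longrightarrow> b < n \<Longrightarrow> a \<noteq> b \<Longrightarrow> replica_avg (\<lambda>r. f (r a) (r b)) = (\<Sum>s\<in>S. \<mu> s * (\<Sum>t\<in>S. \<mu> t * f s t))"
  by (subst replica_avg_resample[of b]) (auto intro: replica_avg_one)

text \<open>A list of pairs stands for a monomial in the small parameters. The second entry \<open>n\<close> denotes the barycentre
instead of a replica, and the multiplicity of a replica counts its occurrences in either entry.\<close>
definition M :: "(nat \<times> nat) list \<Rightarrow> (nat \<Rightarrow> 's) \<Rightarrow> real" where "M L r = prod_list (map (small_param r) L)"
definition well_indexed :: "(nat \<times> nat) list \<Rightarrow> bool" where "well_indexed L \<longleftrightarrow> (\<forall>(a, b)\<in>set L. a < n \<and> b \<le> n)"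
definition untouched :: "(nat \<times> nat) list \<Rightarrow> nat set" where "untouched L = {a. a < n \<and> multiplicity L a = 0}"

text \<open>The number of small factors still missing before every replica has multiplicity two; it decreases
at each differentiation.\<close>
definition deficiency :: "(nat \<times> nat) list \<Rightarrow> nat" where "deficiency L = (\<Sum>a<n. 2 - multiplicity L a)"

lemma M_Cons: "M (p # L) r = small_param r p * M L r" by (simp add: M_def)

lemma sum_mu_dev: "(\<Sum>s\<in>S. \<mu> s * dev s i) = 0"
  unfolding dev_def by (simp add: right_diff_distrib sum_subtractf sum_distrib_right[symmetric] \<mu>1 bary_def)

lemma sum_mu_dot_dev: "(\<Sum>s\<in>S. \<mu> s * (\<Sum>i\<in>J. dev s i * c i)) = 0"
proof -
  have "(\<Sum>s\<in>S. \<mu> s * (\<Sum>i\<in>J. dev s i * c i)) = (\<Sum>i\<in>J. (\<Sum>s\<in>S. \<mu> s * dev s i) * c i)"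
    unfolding sum_distrib_left sum_distrib_right by (subst sum.swap) (simp add: mult_ac)
  then show ?thesis by (simp add: sum_mu_dev)
qed

lemma multiplicity_Cons: "multiplicity (p # L) a = (if fst p = a then 1 else 0) + (if snd p = a then 1 else 0) + multiplicity L a"
  by (simp add: multiplicity_def)
lemma multiplicity_Nil: "multiplicity [] a = 0" by (simp add: multiplicity_def)

lemma M_indep: "multiplicity L a = 0 \<Longrightarrow> M L (r(a := s)) = M L r"
proof (induction L)
  case (Cons p L)
  then show ?case by (cases p) (auto simp: M_Cons small_param_def multiplicity_Cons split: if_splits)
qed (simp add: M_def)

lemma multiplicity_eq_1_split:
  "multiplicity L a = 1 \<Longrightarrow> \<exists>L1 p L2. L = L1 @ p # L2 \<and> multiplicity L1 a = 0 \<and> multiplicity L2 a = 0 \<and> multiplicity [p] a = 1"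
proof (induction L)
  case (Cons p L)
  show ?case
  proof (cases "multiplicity [p] a = 0")
    case True
    then have "multiplicity L a = 1" using Cons.prems by (simp add: multiplicity_Cons multiplicity_Nil split: if_splits)
    with Cons.IH obtain L1 p' L2 where "L = L1 @ p' # L2" "multiplicity L1 a = 0" "multiplicity L2 a = 0" "multiplicity [p'] a = 1" by blast
    then have "p # L = (p # L1) @ p' # L2 \<and> multiplicity (p # L1) a = 0 \<and> multiplicity L2 a = 0 \<and> multiplicity [p'] a = 1"
      using True by (auto simp: multiplicity_Cons multiplicity_Nil split: if_splits)
    then show ?thesis by blast
  next
    case False
    then have "p # L = [] @ p # L \<and> multiplicity [] a = 0 \<and> multiplicity L a = 0 \<and> multiplicity [p] a = 1"
      using Cons.prems by (auto simp: multiplicity_Cons multiplicity_Nil split: if_splits)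
    then show ?thesis by blast
  qed
qed (simp add: multiplicity_Nil)

text \<open>Each small parameter other than \<open>\<alpha>\<close> is linear in the deviation \<open>dev (r a)\<close> from the barycentre, which has
mean zero. The diagonal \<open>\<alpha>\<close> is excluded since it counts twice.\<close>
lemma small_param_average:
  assumes "a < n" "fst p < n" "snd p \<le> n" "multiplicity [p] a = 1"
  shows "(\<Sum>s\<in>S. \<mu> s * small_param (r(a := s)) p) = 0"
proof -
  obtain b c where p: "p = (b, c)" by (cases p)
  consider "b = a" "c = n" | "b = a" "c \<noteq> n" "c \<noteq> a" | "b \<noteq> a" "c = a"
    using assms unfolding p by (auto simp: multiplicity_Cons multiplicity_Nil split: if_splits)
  then show ?thesis
  proof cases
    case 1 then show ?thesis using assms(1) by (simp add: p small_param_def \<beta>_def sum_mu_dot_dev)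
  next
    case 2 then show ?thesis by (simp add: p small_param_def T_def sum_mu_dot_dev)
  next
    case 3
    have "T t s = (\<Sum>i\<in>J. dev s i * dev t i)" for s t by (simp add: T_def mult.commute)
    then show ?thesis using 3 assms(1) by (simp add: p small_param_def sum_mu_dot_dev)
  qed
qed

lemma v_0: "v s a 0 = v t a 0" by (auto simp: v_def fun_eq_iff)

lemma \<Phi>_indep: "\<Phi> Z m (\<theta>(a := 0)) (r(a := s)) = \<Phi> Z m (\<theta>(a := 0)) r"
proof -
  have "X Z m (\<theta>(a := 0)) (r(a := s)) c G = X Z m (\<theta>(a := 0)) r c G" for c G
    using v_0[of s a "r a"] by (simp add: X_def)
  then show ?thesis by (simp add: \<Phi>_def)
qed

text \<open>At angle \<open>0\<close> the replica \<open>a\<close> enters only through its single small parameter.\<close>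
lemma replica_avg_single_vanishes:
  assumes "a < n" "multiplicity L a = 1" "well_indexed L"
  shows "replica_avg (\<lambda>r. M L r * \<Phi> Z m (\<theta>(a := 0)) r) = 0"
proof -
  obtain L1 p L2 where L: "L = L1 @ p # L2" "multiplicity L1 a = 0" "multiplicity L2 a = 0" "multiplicity [p] a = 1"
    using multiplicity_eq_1_split[OF assms(2)] by blast
  have p: "fst p < n" "snd p \<le> n" using assms(3) by (auto simp: well_indexed_def L)
  have M: "M L r = small_param r p * (M L1 r * M L2 r)" for r unfolding L by (simp add: M_def)
  have "(\<Sum>s\<in>S. \<mu> s * (M L (r(a := s)) * \<Phi> Z m (\<theta>(a := 0)) (r(a := s)))) = 0" for r
  proof -
    have "(\<Sum>s\<in>S. \<mu> s * (M L (r(a := s)) * \<Phi> Z m (\<theta>(a := 0)) (r(a := s))))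
      = (\<Sum>s\<in>S. \<mu> s * small_param (r(a := s)) p) * (M L1 r * M L2 r * \<Phi> Z m (\<theta>(a := 0)) r)"
      unfolding M M_indep[OF L(2)] M_indep[OF L(3)] \<Phi>_indep sum_distrib_right by (simp only: mult_ac)
    then show ?thesis using small_param_average[OF assms(1) p L(4)] by simp
  qed
  then show ?thesis by (subst replica_avg_resample[OF assms(1)]) (simp add: replica_avg_const)
qed

lemma T_le: assumes "s \<in> S" "t \<in> S" shows "\<bar>T s t\<bar> \<le> 4"
proof -
  have "(T s t)\<^sup>2 \<le> (\<Sum>i\<in>J. (dev s i)\<^sup>2) * (\<Sum>i\<in>J. (dev t i)\<^sup>2)"
    unfolding T_def by (rule Cauchy_Schwarz_ineq_sum)
  also have "\<dots> \<le> 4 * 4" using norm_dev assms by (intro mult_mono sum_nonneg) auto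
  finally show ?thesis using power2_le_iff_abs_le[of "4::real"] by simp
qed

lemma \<beta>_le: assumes "s \<in> S" shows "\<bar>\<beta> s\<bar> \<le> 4"
proof -
  have "(\<beta> s)\<^sup>2 \<le> (\<Sum>i\<in>J. (dev s i)\<^sup>2) * (\<Sum>i\<in>J. (bary i)\<^sup>2)"
    unfolding \<beta>_def by (rule Cauchy_Schwarz_ineq_sum)
  also have "\<dots> \<le> 4 * 4" using norm_dev[OF assms] norm_bary by (intro mult_mono sum_nonneg) auto
  finally show ?thesis using power2_le_iff_abs_le[of "4::real"] by simp
qed

lemma small_param_le:
  assumes "\<And>a. a < n \<Longrightarrow> r a \<in> S" "fst p < n" "snd p \<le> n"
  shows "\<bar>small_param r p\<bar> \<le> 5"
  using \<beta>_le[of "r (fst p)"] T_le[of "r (fst p)" "r (fst p)"] T_le[of "r (fst p)" "r (snd p)"] assms q0 q1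
  by (auto simp: small_param_def \<alpha>_def split: prod.splits)

text \<open>Bounding every field by the largest one dominates the product by a sum of exponentials of squares. The resulting bound does not depend on the number of Gaussian coordinates.\<close>
lemma prod_W_expectation:
  assumes r: "\<And>a. a < n \<Longrightarrow> r a \<in> S"
  shows "\<bar>\<Phi> {} m \<theta> r\<bar> \<le> 2 * real n * (\<Prod>a<n. \<bar>B (m a)\<bar>)"
proof -
  define y where "y = (\<lambda>a G. dot G (v (r a) a (\<theta> a)))"
  define P where "P = (\<Prod>a<n. \<bar>B (m a)\<bar>)"
  have P0: "0 \<le> P" unfolding P_def by (intro prod_nonneg) auto
  have [measurable]: "y a \<in> borel_measurable (gaussian I)" for a unfolding y_def by measurable
  have pt: "\<bar>\<Prod>a<n. X {} m \<theta> r a G\<bar> \<le> P * (\<Sum>a<n. exp (1/320 * (y a G)\<^sup>2))" for G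
  proof -
    define Y where "Y = Max ((\<lambda>a. (y a G)\<^sup>2) ` {..<n})"
    have Y: "(y a G)\<^sup>2 \<le> Y" if "a < n" for a unfolding Y_def using that by (intro Max_ge) auto
    have "Y \<in> (\<lambda>a. (y a G)\<^sup>2) ` {..<n}" unfolding Y_def using n by (intro Max_in) (auto simp: lessThan_empty_iff)
    then obtain c where c: "c < n" "Y = (y c G)\<^sup>2" by auto
    have "\<bar>\<Prod>a<n. X {} m \<theta> r a G\<bar> \<le> (\<Prod>a<n. B (m a) * exp (Y / (320 * real n)))"
      unfolding abs_prod
    proof (intro prod_mono conjI)
      fix a assume a: "a \<in> {..<n}"
      have "\<bar>X {} m \<theta> r a G\<bar> \<le> B (m a) * exp ((y a G)\<^sup>2 / (320 * real n))"
        using bW by (simp add: X_def y_def)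
      also have "\<dots> \<le> B (m a) * exp (Y / (320 * real n))"
        using B_nonneg Y[of a] a n by (intro mult_left_mono) (auto intro!: divide_right_mono)
      finally show "\<bar>X {} m \<theta> r a G\<bar> \<le> B (m a) * exp (Y / (320 * real n))" .
    qed auto
    also have "\<dots> = P * exp (real n * (Y / (320 * real n)))"
      unfolding P_def using B_nonneg by (simp add: prod.distrib exp_of_nat_mult[symmetric])
    also have "\<dots> = P * exp (1/320 * (y c G)\<^sup>2)" using n c by simp
    also have "\<dots> \<le> P * (\<Sum>a<n. exp (1/320 * (y a G)\<^sup>2))"
      using c P0 by (intro mult_left_mono member_le_sum) auto
    finally show ?thesis .
  qed
  have ex: "(\<integral>\<^sup>+G. ennreal (exp (1/320 * (y a G)\<^sup>2)) \<partial>gaussian I) \<le> ennreal 2" if "a < n" for a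
    unfolding y_def dot_def
    using norm_v[OF r[OF that] that, of "\<theta> a"] by (intro nn_integral_gaussian_exp_linear_square finI) auto
  have "ennreal \<bar>\<Phi> {} m \<theta> r\<bar> \<le> (\<integral>\<^sup>+G. ennreal (norm (\<Prod>a<n. X {} m \<theta> r a G)) \<partial>gaussian I)"
    unfolding \<Phi>_def using integral_norm_bound_ennreal[OF prod_X_integrable[OF r]] by simp
  also have "\<dots> \<le> (\<integral>\<^sup>+G. ennreal P * (\<Sum>a<n. ennreal (exp (1/320 * (y a G)\<^sup>2))) \<partial>gaussian I)"
    using pt P0 by (intro nn_integral_mono) (simp add: ennreal_mult'[symmetric] sum_ennreal ennreal_leI)
  also have "\<dots> = ennreal P * (\<Sum>a<n. \<integral>\<^sup>+G. ennreal (exp (1/320 * (y a G)\<^sup>2)) \<partial>gaussian I)"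
    by (subst nn_integral_cmult) (auto simp: nn_integral_sum simp del: sum_ennreal)
  also have "\<dots> \<le> ennreal P * (\<Sum>a<n. ennreal 2)"
    using ex by (intro mult_left_mono sum_mono) auto
  also have "\<dots> = ennreal (2 * real n * P)" using P0
    by (simp add: ennreal_mult ennreal_of_nat_eq_real_of_nat mult_ac)
  finally show ?thesis using P0 by (subst (asm) ennreal_le_iff) (auto simp: P_def)
qed

text \<open>The first \<open>n\<close> factors give \<open>\<tau>\<close>, as a product is at most the sum of the powers of its factors;
the others are bounded by \<open>5\<close>.\<close>
lemma replica_avg_monomial:
  assumes \<tau>: "\<And>a b. a < n \<Longrightarrow> b \<le> n \<Longrightarrow> replica_avg (\<lambda>r. \<bar>small_param r (a, b)\<bar> ^ n) \<le> \<tau>"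
    and "well_indexed L" "n \<le> length L"
  shows "replica_avg (\<lambda>r. \<bar>M L r\<bar>) \<le> 5 ^ length L * real n * \<tau>"
proof -
  define F where "F = (\<lambda>r. \<Sum>i<n. \<bar>small_param r (L ! i)\<bar> ^ n)"
  have F: "\<bar>M L r\<bar> \<le> 5 ^ length L * F r" if r: "\<And>a. a < n \<Longrightarrow> r a \<in> S" for r
  proof -
    define t where "t = (\<lambda>i. \<bar>small_param r (L ! i)\<bar>)"
    have t0: "0 \<le> t i" for i by (simp add: t_def)
    have t5: "t i \<le> 5" if "i < length L" for i
      unfolding t_def using assms(2) nth_mem[OF that] by (intro small_param_le r) (auto simp: well_indexed_def)
    have "\<bar>M L r\<bar> = (\<Prod>i<length L. t i)"
      unfolding M_def t_def abs_prod[symmetric] by (simp add: prod.list_conv_set_nth atLeast0LessThan)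
    also have "\<dots> = (\<Prod>i<n. t i) * (\<Prod>i\<in>{n..<length L}. t i)"
      using assms(3) by (subst prod.union_disjoint[symmetric]) (auto intro!: prod.cong)
    also have "\<dots> \<le> (\<Sum>i<n. t i ^ n) * 5 ^ length L"
    proof (intro mult_mono prod_nonneg sum_nonneg)
      define Y where "Y = Max (t ` {..<n})"
      have Y: "t a \<le> Y" if "a < n" for a unfolding Y_def using that by (intro Max_ge) auto
      have "Y \<in> t ` {..<n}" unfolding Y_def using n by (intro Max_in) (auto simp: lessThan_empty_iff)
      then obtain c where c: "c < n" "Y = t c" by auto
      have "(\<Prod>i<n. t i) \<le> (\<Prod>i<n. Y)" using Y t0 by (intro prod_mono) auto
      also have "\<dots> = t c ^ n" using c by simp
      also have "\<dots> \<le> (\<Sum>i<n. t i ^ n)" using c t0 by (intro member_le_sum) auto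
      finally show "(\<Prod>i<n. t i) \<le> (\<Sum>i<n. t i ^ n)" .
      have "(\<Prod>i\<in>{n..<length L}. t i) \<le> (\<Prod>i\<in>{n..<length L}. 5)" using t0 t5 by (intro prod_mono) auto
      also have "\<dots> \<le> 5 ^ length L" by (simp add: power_increasing)
      finally show "(\<Prod>i\<in>{n..<length L}. t i) \<le> 5 ^ length L" .
    qed (use t0 in auto)
    finally show ?thesis by (simp add: F_def t_def mult.commute)
  qed
  have "replica_avg (\<lambda>r. \<bar>M L r\<bar>) \<le> replica_avg (\<lambda>r. 5 ^ length L * F r)" by (intro replica_avg_mono F)
  also have "\<dots> = 5 ^ length L * (\<Sum>i<n. replica_avg (\<lambda>r. \<bar>small_param r (L ! i)\<bar> ^ n))"
    unfolding replica_avg_cmult F_def replica_avg_sum ..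
  also have "\<dots> \<le> 5 ^ length L * (\<Sum>i<n. \<tau>)"
  proof (intro mult_left_mono sum_mono)
    fix i assume "i \<in> {..<n}"
    then have "L ! i \<in> set L" using assms(3) by (intro nth_mem) auto
    then show "replica_avg (\<lambda>r. \<bar>small_param r (L ! i)\<bar> ^ n) \<le> \<tau>" using assms(2) \<tau>[of "fst (L ! i)" "snd (L ! i)"]
      by (auto simp: well_indexed_def)
  qed auto
  finally show ?thesis by simp
qed

lemma replica_avg_deriv:
  assumes a: "a < n" "a \<notin> Z"
  shows "((\<lambda>s. replica_avg (\<lambda>r. M L r * \<Phi> Z m (\<theta>(a := s)) r)) has_real_derivative
    (cos s * (\<Sum>b<n. replica_avg (\<lambda>r. M ((a, n) # L) r * \<Phi> Z (bump b (bump a m)) (\<theta>(a := s)) r)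
       + sin ((\<theta>(a := s)) b) * replica_avg (\<lambda>r. M ((a, b) # L) r * \<Phi> (Z - {b}) (bump b (bump a m)) (\<theta>(a := s)) r)))) (at s)"
proof -
  define D where "D = (\<lambda>r. cos s * (\<Sum>b<n. \<beta> (r a) * \<Phi> Z (bump b (bump a m)) (\<theta>(a := s)) r
        + sin ((\<theta>(a := s)) b) * small_param r (a, b) * \<Phi> (Z - {b}) (bump b (bump a m)) (\<theta>(a := s)) r))"
  have "((\<lambda>s. replica_avg (\<lambda>r. M L r * \<Phi> Z m (\<theta>(a := s)) r)) has_real_derivative replica_avg (\<lambda>r. M L r * D r)) (at s)"
    unfolding replica_avg_def D_def
    by (intro DERIV_sum DERIV_cmult \<Phi>_deriv a) (auto simp: PiE_iff)
  also have "replica_avg (\<lambda>r. M L r * D r) = cos s * (\<Sum>b<n. replica_avg (\<lambda>r. M ((a, n) # L) r * \<Phi> Z (bump b (bump a m)) (\<theta>(a := s)) r)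
       + sin ((\<theta>(a := s)) b) * replica_avg (\<lambda>r. M ((a, b) # L) r * \<Phi> (Z - {b}) (bump b (bump a m)) (\<theta>(a := s)) r))"
    unfolding replica_avg_cmult[symmetric] replica_avg_add[symmetric] replica_avg_sum[symmetric]
    by (intro arg_cong[where f=replica_avg]) (simp add: fun_eq_iff D_def M_Cons small_param_def sum_distrib_left algebra_simps)
  finally show ?thesis .
qed

text \<open>Together with multiplicity two for every replica this forces at least \<open>n\<close> factors.\<close>
lemma sum_multiplicity: "well_indexed L \<Longrightarrow> (\<Sum>a<n. multiplicity L a) \<le> 2 * length L"
proof (induction L)
  case (Cons p L)
  then have "(\<Sum>a<n. multiplicity L a) \<le> 2 * length L" by (simp add: well_indexed_def)
  moreover have "(\<Sum>a<n. (if fst p = a then 1 else 0) :: nat) \<le> 1" "(\<Sum>a<n. (if snd p = a then 1 else 0) :: nat) \<le> 1" by auto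
  ultimately show ?case by (simp add: multiplicity_Cons sum.distrib)
qed (simp add: multiplicity_Nil)

lemma deficiency_Cons:
  assumes "a < n" "multiplicity L a < 2" "fst p = a"
  shows "deficiency (p # L) < deficiency L"
  unfolding deficiency_def
proof (rule sum_strict_mono_ex1)
  have le: "multiplicity L c \<le> multiplicity (p # L) c" for c by (simp add: multiplicity_Cons)
  show "\<forall>c\<in>{..<n}. 2 - multiplicity (p # L) c \<le> 2 - multiplicity L c" using diff_le_mono2[OF le] by blast
  have "multiplicity L a < multiplicity (p # L) a" using assms(3) by (simp add: multiplicity_Cons)
  then have "2 - multiplicity (p # L) a < 2 - multiplicity L a" using assms(2) by simp
  with assms(1) show "\<exists>c\<in>{..<n}. 2 - multiplicity (p # L) c < 2 - multiplicity L c" by blast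
qed simp

text \<open>Induction on the deficiency. A replica \<open>a\<close> with multiplicity below two is moved back to angle \<open>0\<close>,
where the average vanishes: by the centring if the multiplicity is zero, and by
\<open>replica_avg_single_vanishes\<close> if it is one. The average is thus at most its derivative times the length
of the path, and every term of the derivative has a larger monomial.\<close>
lemma replica_avg_main:
  assumes \<tau>: "\<And>a b. a < n \<Longrightarrow> b \<le> n \<Longrightarrow> replica_avg (\<lambda>r. \<bar>small_param r (a, b)\<bar> ^ n) \<le> \<tau>"
  shows "deficiency L \<le> d \<Longrightarrow> well_indexed L \<Longrightarrow> (\<And>a. a < n \<Longrightarrow> 0 \<le> \<theta> a \<and> \<theta> a \<le> 2)
    \<Longrightarrow> \<bar>replica_avg (\<lambda>r. M L r * \<Phi> (untouched L) m \<theta> r)\<bar> \<le> raise_const n B d L m * \<tau>"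
proof (induction d arbitrary: L m \<theta>)
  have \<tau>0: "0 \<le> \<tau>"
  proof -
    have "replica_avg (\<lambda>r. 0) \<le> replica_avg (\<lambda>r. \<bar>small_param r (0, 0)\<bar> ^ n)" by (intro replica_avg_mono) auto
    also have "\<dots> \<le> \<tau>" using n by (intro \<tau>) auto
    finally show ?thesis by (simp add: replica_avg_const)
  qed
  have base: "\<bar>replica_avg (\<lambda>r. M L r * \<Phi> (untouched L) m \<theta> r)\<bar> \<le> 5 ^ length L * real n * (2 * real n * (\<Prod>a<n. \<bar>B (m a)\<bar>)) * \<tau>"
    if "deficiency L = 0" "well_indexed L" for L m \<theta>
  proof -
    have c: "2 \<le> multiplicity L a" if "a < n" for a using \<open>deficiency L = 0\<close> that by (auto simp: deficiency_def)
    then have Z: "untouched L = {}" by (fastforce simp: untouched_def)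
    have "(\<Sum>a<n. 2) \<le> (\<Sum>a<n. multiplicity L a)" using c by (intro sum_mono) auto
    also have "\<dots> \<le> 2 * length L" by (rule sum_multiplicity[OF that(2)])
    finally have len: "n \<le> length L" by simp
    define K where "K = 2 * real n * (\<Prod>a<n. \<bar>B (m a)\<bar>)"
    have K0: "K \<ge> 0" unfolding K_def by (intro mult_nonneg_nonneg prod_nonneg) auto
    have "\<bar>replica_avg (\<lambda>r. M L r * \<Phi> (untouched L) m \<theta> r)\<bar> \<le> replica_avg (\<lambda>r. \<bar>M L r * \<Phi> (untouched L) m \<theta> r\<bar>)" by (rule replica_avg_abs)
    also have "\<dots> \<le> replica_avg (\<lambda>r. K * \<bar>M L r\<bar>)"
    proof (rule replica_avg_mono)
      fix r assume r: "\<And>a. a < n \<Longrightarrow> r a \<in> S"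
      show "\<bar>M L r * \<Phi> (untouched L) m \<theta> r\<bar> \<le> K * \<bar>M L r\<bar>"
        using mult_left_mono[OF prod_W_expectation[where r=r and m=m and \<theta>=\<theta>, OF r], of "\<bar>M L r\<bar>"]
        unfolding Z K_def[symmetric] by (simp add: abs_mult mult.commute)
    qed
    also have "\<dots> \<le> K * (5 ^ length L * real n * \<tau>)"
      unfolding replica_avg_cmult using K0 replica_avg_monomial[OF \<tau> that(2) len] by (intro mult_left_mono)
    finally show ?thesis by (simp add: K_def mult_ac)
  qed
  {
    case 0
    then show ?case using base by simp
  next
    case (Suc d)
    have c2: "0 \<le> (\<Sum>a<n. \<Sum>b<n. 2 * (raise_const n B d ((a, n) # L) (bump b (bump a m)) + raise_const n B d ((a, b) # L) (bump b (bump a m))))"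
      by (intro sum_nonneg mult_nonneg_nonneg add_nonneg_nonneg raise_const_nonneg) auto
    have c1: "0 \<le> 5 ^ length L * real n * (2 * real n * (\<Prod>a<n. \<bar>B (m a)\<bar>))"
      by (intro mult_nonneg_nonneg prod_nonneg) auto
    show ?case
    proof (cases "deficiency L = 0")
      case True
      have "5 ^ length L * real n * (2 * real n * (\<Prod>a<n. \<bar>B (m a)\<bar>)) * \<tau> \<le> raise_const n B (Suc d) L m * \<tau>"
        using c2 \<tau>0 by (intro mult_right_mono) auto
      then show ?thesis by (rule order_trans[OF base[OF True Suc.prems(2)]])
    next
      case False
      have "\<exists>a<n. multiplicity L a < 2"
      proof (rule ccontr)
        assume "\<not> (\<exists>a<n. multiplicity L a < 2)"
        then have "2 - multiplicity L a = 0" if "a < n" for a using that by (meson not_less diff_is_0_eq)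
        then have "deficiency L = 0" by (simp add: deficiency_def)
        with False show False by simp
      qed
      then obtain a where a: "a < n" "multiplicity L a < 2" by blast
      \<comment> \<open>Removing \<open>a\<close> from the centred replicas leaves the function to be differentiated; its value at angle \<open>0\<close> is subtracted below.\<close>
      define Z where "Z = untouched L - {a}"
      have aZ: "a \<notin> Z" by (simp add: Z_def)
      define \<psi> where "\<psi> = (\<lambda>s. replica_avg (\<lambda>r. M L r * \<Phi> Z m (\<theta>(a := s)) r))"
      define \<psi>' where "\<psi>' = (\<lambda>s. cos s * (\<Sum>b<n. replica_avg (\<lambda>r. M ((a, n) # L) r * \<Phi> Z (bump b (bump a m)) (\<theta>(a := s)) r)
       + sin ((\<theta>(a := s)) b) * replica_avg (\<lambda>r. M ((a, b) # L) r * \<Phi> (Z - {b}) (bump b (bump a m)) (\<theta>(a := s)) r)))"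
      define K where "K = (\<Sum>b<n. raise_const n B d ((a, n) # L) (bump b (bump a m)) + raise_const n B d ((a, b) # L) (bump b (bump a m))) * \<tau>"
      have K0: "K \<ge> 0" unfolding K_def using \<tau>0 by (intro mult_nonneg_nonneg sum_nonneg add_nonneg_nonneg raise_const_nonneg) auto
      have d: "(\<psi> has_real_derivative \<psi>' s) (at s)" for s
        unfolding \<psi>_def \<psi>'_def by (rule replica_avg_deriv[OF a(1) aZ])
      have Z1: "Z = untouched ((a, n) # L)" using a by (auto simp: Z_def untouched_def multiplicity_Cons)
      have Z2: "Z - {b} = untouched ((a, b) # L)" if "b < n" for b using a that by (auto simp: Z_def untouched_def multiplicity_Cons)
      have vl: "well_indexed ((a, b) # L)" if "b \<le> n" for b using Suc.prems(2) a that by (auto simp: well_indexed_def)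
      have df: "deficiency ((a, b) # L) \<le> d" for b using deficiency_Cons[OF a, of "(a, b)"] Suc.prems(1) by simp
      have b': "\<bar>\<psi>' s\<bar> \<le> K" if s: "0 \<le> s" "s \<le> 2" for s
      proof -
        have th: "0 \<le> (\<theta>(a := s)) c \<and> (\<theta>(a := s)) c \<le> 2" if "c < n" for c using s Suc.prems(3)[OF that] by auto
        have "\<bar>\<psi>' s\<bar> \<le> 1 * (\<Sum>b<n. raise_const n B d ((a, n) # L) (bump b (bump a m)) * \<tau> + 1 * (raise_const n B d ((a, b) # L) (bump b (bump a m)) * \<tau>))"
          unfolding \<psi>'_def abs_mult
        proof (intro mult_mono order_trans[OF sum_abs] sum_mono order_trans[OF abs_triangle_ineq] add_mono)
          fix b assume b: "b \<in> {..<n}"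
          show "\<bar>replica_avg (\<lambda>r. M ((a, n) # L) r * \<Phi> Z (bump b (bump a m)) (\<theta>(a := s)) r)\<bar> \<le> raise_const n B d ((a, n) # L) (bump b (bump a m)) * \<tau>"
            unfolding Z1 by (rule Suc.IH[OF df vl th]) auto
          show "\<bar>sin ((\<theta>(a := s)) b) * replica_avg (\<lambda>r. M ((a, b) # L) r * \<Phi> (Z - {b}) (bump b (bump a m)) (\<theta>(a := s)) r)\<bar>
             \<le> 1 * (raise_const n B d ((a, b) # L) (bump b (bump a m)) * \<tau>)"
            unfolding abs_mult using b Z2 by (intro mult_mono) (auto intro!: Suc.IH[OF df vl th])
        qed auto
        also have "\<dots> = K" by (simp add: K_def sum_distrib_right distrib_right)
        finally show ?thesis .
      qed
      have th: "0 \<le> \<theta> a" "\<theta> a \<le> 2" using Suc.prems(3)[OF a(1)] by auto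
      have "\<bar>\<psi> (\<theta> a) - \<psi> 0\<bar> \<le> K * \<bar>\<theta> a - 0\<bar>"
      proof -
        have "norm (\<psi> (\<theta> a) - \<psi> 0) \<le> K * norm (\<theta> a - 0)"
          by (rule field_differentiable_bound[where S="{0..2}" and f'=\<psi>'])
             (use th b' d in \<open>auto intro: has_field_derivative_at_within\<close>)
        then show ?thesis by simp
      qed
      also have "\<dots> \<le> K * 2" using th K0 by (intro mult_left_mono) auto
      finally have diff: "\<bar>\<psi> (\<theta> a) - \<psi> 0\<bar> \<le> K * 2" .
      have eq: "replica_avg (\<lambda>r. M L r * \<Phi> (untouched L) m \<theta> r) = \<psi> (\<theta> a) - \<psi> 0"
      proof (cases "multiplicity L a = 1")
        case True
        then have "untouched L = Z" by (auto simp: Z_def untouched_def)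
        moreover have "\<psi> 0 = 0" unfolding \<psi>_def by (rule replica_avg_single_vanishes[OF a(1) True Suc.prems(2)])
        ultimately show ?thesis by (simp add: \<psi>_def)
      next
        case False
        then have aL: "a \<in> untouched L" using a by (auto simp: untouched_def)
        have eqr: "M L r * \<Phi> (untouched L) m \<theta> r = M L r * \<Phi> Z m (\<theta>(a := \<theta> a)) r - M L r * \<Phi> Z m (\<theta>(a := 0)) r"
          if r: "\<And>a. a < n \<Longrightarrow> r a \<in> S" for r
        proof -
          have "(\<Prod>c<n. X (untouched L) m \<theta> r c G) = (\<Prod>c<n. X Z m \<theta> r c G) - (\<Prod>c<n. X Z m (\<theta>(a := 0)) r c G)" for G
          proof -
            have o: "(\<Prod>c\<in>{..<n} - {a}. X (untouched L) m \<theta> r c G) = (\<Prod>c\<in>{..<n} - {a}. X Z m \<theta> r c G)"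
              "(\<Prod>c\<in>{..<n} - {a}. X Z m (\<theta>(a := 0)) r c G) = (\<Prod>c\<in>{..<n} - {a}. X Z m \<theta> r c G)"
              by (intro prod.cong; auto simp: X_def Z_def)+
            have "X (untouched L) m \<theta> r a G = X Z m \<theta> r a G - X Z m (\<theta>(a := 0)) r a G"
              using aL aZ by (simp add: X_def)
            then show ?thesis using a(1) o
              by (simp add: prod.remove[of "{..<n}" a] left_diff_distrib)
          qed
          then have "\<Phi> (untouched L) m \<theta> r = \<Phi> Z m \<theta> r - \<Phi> Z m (\<theta>(a := 0)) r"
            unfolding \<Phi>_def using prod_X_integrable[OF r] by simp
          then show ?thesis by (simp add: right_diff_distrib)
        qed
        show ?thesis unfolding \<psi>_def replica_avg_diff[symmetric] by (rule replica_avg_cong[OF eqr])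
      qed
      have "K * 2 = (\<Sum>b<n. 2 * (raise_const n B d ((a, n) # L) (bump b (bump a m)) + raise_const n B d ((a, b) # L) (bump b (bump a m)))) * \<tau>"
        unfolding K_def sum_distrib_left[symmetric] by (simp only: mult_ac)
      also have "\<dots> \<le> (\<Sum>a<n. \<Sum>b<n. 2 * (raise_const n B d ((a, n) # L) (bump b (bump a m)) + raise_const n B d ((a, b) # L) (bump b (bump a m)))) * \<tau>"
      proof (intro mult_right_mono \<tau>0)
        define k where "k = (\<lambda>a. \<Sum>b<n. 2 * (raise_const n B d ((a, n) # L) (bump b (bump a m)) + raise_const n B d ((a, b) # L) (bump b (bump a m))))"
        have "k a \<le> sum k {..<n}" using a(1)
          by (intro member_le_sum) (auto simp: k_def intro!: sum_nonneg mult_nonneg_nonneg add_nonneg_nonneg raise_const_nonneg)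
        then show "(\<Sum>b<n. 2 * (raise_const n B d ((a, n) # L) (bump b (bump a m)) + raise_const n B d ((a, b) # L) (bump b (bump a m))))
          \<le> (\<Sum>a<n. \<Sum>b<n. 2 * (raise_const n B d ((a, n) # L) (bump b (bump a m)) + raise_const n B d ((a, b) # L) (bump b (bump a m))))"
          by (simp add: k_def)
      qed
      also have "\<dots> \<le> raise_const n B (Suc d) L m * \<tau>" using c1 \<tau>0 by (intro mult_right_mono) auto
      finally show ?thesis using diff unfolding eq by linarith
    qed
  }
qed

end

section \<open>Moments of the cavity error\<close>

context cavity begin

text \<open>The distance between the average of \<open>W 0\<close> at the field and its Gaussian limit, for a realization \<open>g\<close> of the
couplings at the cavity.\<close>
definition cavity_error :: "(nat \<times> nat \<Rightarrow> real) \<Rightarrow> real" where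
  "cavity_error g = (\<Sum>s\<in>S. \<mu> s * W 0 (\<Sum>i\<in>J. g i * x s i))
     - (\<integral>z. W 0 ((\<Sum>i\<in>J. g i * bary i) + sqrt (1 - q) * z) \<partial>gauss1)"

lemma dot_v_end: "dot G (v s a (pi/2)) = (\<Sum>i\<in>J. G i * x s i)"
proof -
  have "v s a (pi/2) = (\<lambda>i. if i \<in> J then x s i else 0)"
    by (simp add: v_def dev_def fun_eq_iff cos_pi_half sin_pi_half)
  then show ?thesis unfolding dot_def sum_I using J0 by simp
qed

lemma dot_v_start: "a < n \<Longrightarrow> dot G (v s a 0) = (\<Sum>i\<in>J. G i * bary i) + sqrt (1 - q) * G (0, a)"
proof -
  assume a: "a < n"
  have "(\<Sum>c<n. G (0, c) * v s a 0 (0, c)) = (\<Sum>c<n. if c = a then sqrt (1 - q) * G (0, a) else 0)"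
    using J0 by (intro sum.cong) (auto simp: v_def)
  then show ?thesis unfolding dot_def sum_I using a by (simp add: v_def)
qed

lemma square_shift_bound: "\<bar>W 0 (y + sqrt (1 - q) * z)\<bar> \<le> B 0 * exp (y\<^sup>2 / (160 * real n)) * exp (1/160 * z\<^sup>2)"
proof -
  have "(y + sqrt (1 - q) * z)\<^sup>2 \<le> 2 * y\<^sup>2 + 2 * (sqrt (1 - q) * z)\<^sup>2"
    using zero_le_power2[of "y - sqrt (1 - q) * z"] by (simp add: power2_eq_square algebra_simps)
  also have "\<dots> \<le> 2 * y\<^sup>2 + 2 * z\<^sup>2"
    using q0 q1 by (simp add: power_mult_distrib mult_left_le_one_le)
  finally have "(y + sqrt (1 - q) * z)\<^sup>2 / (320 * real n) \<le> (2 * y\<^sup>2 + 2 * z\<^sup>2) / (320 * real n)"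
    using n by (intro divide_right_mono) auto
  also have "\<dots> = y\<^sup>2 / (160 * real n) + 1/160 * z\<^sup>2 / real n" using n by (simp add: field_simps)
  also have "\<dots> \<le> y\<^sup>2 / (160 * real n) + 1/160 * z\<^sup>2"
    using n by (intro add_left_mono) (simp add: divide_le_eq mult_le_cancel_left1 mult_right_le_one_le)
  finally have "B 0 * exp ((y + sqrt (1 - q) * z)\<^sup>2 / (320 * real n)) \<le> B 0 * exp (y\<^sup>2 / (160 * real n) + 1/160 * z\<^sup>2)"
    using B_nonneg by (intro mult_left_mono) auto
  then show ?thesis using bW[of 0 "y + sqrt (1 - q) * z"] by (simp add: exp_add mult.assoc)
qed

lemma integrable_limit: "integrable gauss1 (\<lambda>z. W 0 (y + sqrt (1 - q) * z))"
proof (rule integrable_gauss1_bound)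
  fix z
  have "B 0 * exp (y\<^sup>2 / (160 * real n)) * exp (1/160 * z\<^sup>2) \<le> B 0 * exp (y\<^sup>2 / (160 * real n)) * exp (z\<^sup>2/4)"
    using B_nonneg by (intro mult_left_mono) auto
  then show "\<bar>W 0 (y + sqrt (1 - q) * z)\<bar> \<le> B 0 * exp (y\<^sup>2 / (160 * real n)) * exp (z\<^sup>2/4)"
    using square_shift_bound[of y z] by linarith
qed measurable

lemma cavity_error_measurable[measurable]: "cavity_error \<in> borel_measurable (gaussian J)"
proof -
  interpret sigma_finite_measure gauss1 by (rule prob_space_imp_sigma_finite[OF prob_space_gauss1])
  show ?thesis unfolding cavity_error_def by measurable
qed

text \<open>A power of an average is an average over independent replicas; the limits are written with the private noise of
each replica.\<close>
lemma cavity_error_moment_eq: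
  "(\<integral>g. cavity_error g ^ n \<partial>gaussian J) = replica_avg (\<lambda>r. \<Phi> {..<n} (\<lambda>_. 0) (\<lambda>_. pi/2) r)"
proof -
  interpret product_sigma_finite "\<lambda>_. gauss1" by (rule product_sigma_finite_gauss1)
  define A where "A = (\<lambda>s G. W 0 (\<Sum>i\<in>J. G i * x s i))"
  define y where "y = (\<lambda>G. \<Sum>i\<in>J. G i * bary i)"
  define N where "N = (\<lambda>G z. W 0 (y G + sqrt (1 - q) * z))"
  define P where "P = (\<lambda>G. \<Prod>a<n. (\<Sum>s\<in>S. \<mu> s * A s G) - N G (G (0, a)))"
  have X: "X {..<n} (\<lambda>_. 0) (\<lambda>_. pi/2) r a G = A (r a) G - N G (G (0, a))" if "a < n" for r a G
    unfolding X_def using that by (simp only: dot_v_end dot_v_start[OF that]) (simp add: A_def N_def y_def)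
  have PX: "P G = (\<Sum>r\<in>PiE {..<n} (\<lambda>_. S). (\<Prod>a<n. \<mu> (r a)) * (\<Prod>a<n. X {..<n} (\<lambda>_. 0) (\<lambda>_. pi/2) r a G))" for G
  proof -
    have "P G = (\<Prod>a<n. \<Sum>s\<in>S. \<mu> s * (A s G - N G (G (0, a))))"
      unfolding P_def by (simp add: right_diff_distrib sum_subtractf sum_distrib_right[symmetric] \<mu>1)
    also have "\<dots> = (\<Sum>r\<in>PiE {..<n} (\<lambda>_. S). \<Prod>a<n. \<mu> (r a) * (A (r a) G - N G (G (0, a))))"
      using finS by (intro prod_sum_PiE) auto
    also have "\<dots> = (\<Sum>r\<in>PiE {..<n} (\<lambda>_. S). (\<Prod>a<n. \<mu> (r a)) * (\<Prod>a<n. X {..<n} (\<lambda>_. 0) (\<lambda>_. pi/2) r a G))"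
      unfolding prod.distrib by (intro sum.cong refl arg_cong2[where f="(*)"] prod.cong) (simp add: X)
    finally show ?thesis .
  qed
  have intP: "integrable (gaussian I) P" unfolding PX
    by (intro Bochner_Integration.integrable_sum integrable_mult_right prod_X_integrable) (auto simp: PiE_iff)
  have "replica_avg (\<lambda>r. \<Phi> {..<n} (\<lambda>_. 0) (\<lambda>_. pi/2) r) = (\<integral>G. P G \<partial>gaussian I)"
    unfolding PX replica_avg_def \<Phi>_def
    by (subst Bochner_Integration.integral_sum) (auto intro!: integrable_mult_right prod_X_integrable simp: PiE_iff)
  also have "\<dots> = (\<integral>g. (\<integral>z. P (merge J (noise n) (g, z)) \<partial>gaussian (noise n)) \<partial>gaussian J)"
    using intP unfolding gaussian_def I_def
    by (intro product_integral_fold finJ) (use J0 in \<open>auto simp: noise_def\<close>)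
  also have "\<dots> = (\<integral>g. cavity_error g ^ n \<partial>gaussian J)"
  proof (rule Bochner_Integration.integral_cong[OF refl])
    fix g :: "nat \<times> nat \<Rightarrow> real"
    define D where "D = (\<Sum>s\<in>S. \<mu> s * A s g)"
    have m: "merge J (noise n) (g, z) i = g i" if "i \<in> J" for z :: "nat \<times> nat \<Rightarrow> real" and i using that by (simp add: merge_def)
    have m': "merge J (noise n) (g, z) (0, a) = z (0, a)" if "a < n" for z :: "nat \<times> nat \<Rightarrow> real" and a
      using that J0 by (simp add: merge_def noise_def)
    have "P (merge J (noise n) (g, z)) = (\<Prod>i\<in>noise n. D - N g (z i))" for z
    proof -
      have "P (merge J (noise n) (g, z)) = (\<Prod>a<n. D - N g (z (0, a)))"
        unfolding P_def D_def by (intro prod.cong) (simp_all add: A_def N_def y_def m m' cong: sum.cong)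
      also have "\<dots> = (\<Prod>i\<in>noise n. D - N g (z i))"
        unfolding noise_def by (subst prod.reindex) (auto simp: inj_on_def)
      finally show ?thesis .
    qed
    then have "(\<integral>z. P (merge J (noise n) (g, z)) \<partial>gaussian (noise n)) = (\<integral>z. (\<Prod>i\<in>noise n. D - N g (z i)) \<partial>gaussian (noise n))"
      by simp
    also have "\<dots> = (\<Prod>i\<in>noise n. \<integral>z. D - N g z \<partial>gauss1)"
      unfolding gaussian_def N_def
      by (intro product_integral_prod Bochner_Integration.integrable_diff integrable_limit)
         (auto simp: noise_def intro!: finite_measure.integrable_const prob_space.finite_measure prob_space_gauss1)
    also have "(\<integral>z. D - N g z \<partial>gauss1) = cavity_error g"
      unfolding N_def cavity_error_def
      using prob_space.prob_space[OF prob_space_gauss1] integrable_limit[of "y g"]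
      by (subst Bochner_Integration.integral_diff)
         (auto simp: D_def A_def y_def intro!: finite_measure.integrable_const prob_space.finite_measure prob_space_gauss1)
    also have "(\<Prod>i\<in>noise n. cavity_error g) = cavity_error g ^ n"
      by (simp add: noise_def card_image inj_on_def)
    finally show "(\<integral>z. P (merge J (noise n) (g, z)) \<partial>gaussian (noise n)) = cavity_error g ^ n" .
  qed
  finally show ?thesis by simp
qed

text \<open>Both terms grow more slowly than the Gaussian density decays; the bound is by Cauchy--Schwarz.\<close>
lemma cavity_error_pow_integrable: "integrable (gaussian J) (\<lambda>g. cavity_error g ^ n)"
proof (rule gaussian_integrable_bound[OF finJ])
  fix g :: "nat \<times> nat \<Rightarrow> real"
  define R where "R = (\<Sum>i\<in>J. (g i)\<^sup>2)"
  have R0: "0 \<le> R" unfolding R_def by (intro sum_nonneg) auto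
  have cs: "(\<Sum>i\<in>J. g i * u i)\<^sup>2 \<le> R" if "(\<Sum>i\<in>J. (u i)\<^sup>2) \<le> 1" for u
  proof -
    have "(\<Sum>i\<in>J. g i * u i)\<^sup>2 \<le> R * (\<Sum>i\<in>J. (u i)\<^sup>2)" unfolding R_def by (rule Cauchy_Schwarz_ineq_sum)
    also have "\<dots> \<le> R * 1" using that R0 by (intro mult_left_mono) auto
    finally show ?thesis by simp
  qed
  define E where "E = exp (R / (160 * real n))"
  have 1: "\<bar>\<Sum>s\<in>S. \<mu> s * W 0 (\<Sum>i\<in>J. g i * x s i)\<bar> \<le> B 0 * E"
  proof -
    have "\<bar>\<Sum>s\<in>S. \<mu> s * W 0 (\<Sum>i\<in>J. g i * x s i)\<bar> \<le> (\<Sum>s\<in>S. \<mu> s * (B 0 * E))"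
    proof (intro order_trans[OF sum_abs] sum_mono)
      fix s assume s: "s \<in> S"
      have "\<bar>W 0 (\<Sum>i\<in>J. g i * x s i)\<bar> \<le> B 0 * exp ((\<Sum>i\<in>J. g i * x s i)\<^sup>2 / (320 * real n))" by (rule bW)
      also have "\<dots> \<le> B 0 * E" unfolding E_def
        using cs[OF x1[OF s]] R0 B_nonneg n by (intro mult_left_mono) (auto intro!: frac_le)
      finally show "\<bar>\<mu> s * W 0 (\<Sum>i\<in>J. g i * x s i)\<bar> \<le> \<mu> s * (B 0 * E)"
        using \<mu>0[OF s] by (simp add: abs_mult mult_left_mono)
    qed
    then show ?thesis by (simp add: sum_distrib_right[symmetric] \<mu>1)
  qed
  have 2: "\<bar>\<integral>z. W 0 ((\<Sum>i\<in>J. g i * bary i) + sqrt (1 - q) * z) \<partial>gauss1\<bar> \<le> B 0 * E * (\<integral>z. exp (1/160 * z\<^sup>2) \<partial>gauss1)"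
  proof -
    have "\<bar>\<integral>z. W 0 ((\<Sum>i\<in>J. g i * bary i) + sqrt (1 - q) * z) \<partial>gauss1\<bar> \<le> (\<integral>z. B 0 * E * exp (1/160 * z\<^sup>2) \<partial>gauss1)"
    proof (rule order_trans[OF integral_abs_bound integral_mono])
      show "integrable gauss1 (\<lambda>z. \<bar>W 0 ((\<Sum>i\<in>J. g i * bary i) + sqrt (1 - q) * z)\<bar>)"
        by (intro integrable_abs integrable_limit)
      show "integrable gauss1 (\<lambda>z. B 0 * E * exp (1/160 * z\<^sup>2))"
        by (intro integrable_mult_right integrable_gauss1_exp_square) simp
      fix z
      have "B 0 * exp ((\<Sum>i\<in>J. g i * bary i)\<^sup>2 / (160 * real n)) * exp (1/160 * z\<^sup>2) \<le> B 0 * E * exp (1/160 * z\<^sup>2)"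
        unfolding E_def using cs[OF norm_bary] R0 B_nonneg n by (intro mult_right_mono mult_left_mono) (auto intro!: frac_le)
      then show "\<bar>W 0 ((\<Sum>i\<in>J. g i * bary i) + sqrt (1 - q) * z)\<bar> \<le> B 0 * E * exp (1/160 * z\<^sup>2)"
        using square_shift_bound order_trans by blast
    qed
    then show ?thesis by simp
  qed
  define c where "c = B 0 + B 0 * (\<integral>z. exp (1/160 * z\<^sup>2) \<partial>gauss1)"
  have c0: "0 \<le> c" unfolding c_def using B_nonneg by (intro add_nonneg_nonneg mult_nonneg_nonneg integral_nonneg) auto
  have "\<bar>cavity_error g\<bar> \<le> c * E" unfolding cavity_error_def c_def using 1 2 by (simp add: algebra_simps)
  then have "\<bar>cavity_error g ^ n\<bar> \<le> (c * E) ^ n" unfolding power_abs by (intro power_mono) auto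
  also have "\<dots> = c ^ n * exp (R / 160)"
    unfolding power_mult_distrib E_def exp_of_nat_mult[symmetric] using n by simp
  also have "\<dots> \<le> c ^ n * exp ((\<Sum>i\<in>J. (g i)\<^sup>2) / 4)" using R0 c0 by (intro mult_left_mono) (auto simp: R_def)
  finally show "\<bar>cavity_error g ^ n\<bar> \<le> (B 0 + B 0 * (\<integral>z. exp (1/160 * z\<^sup>2) \<partial>gauss1)) ^ n * exp ((\<Sum>i\<in>J. (g i)\<^sup>2) / 4)"
    by (simp add: c_def)
qed measurable

theorem cavity_error_moment:
  assumes "(\<Sum>s\<in>S. \<mu> s * \<bar>\<alpha> s\<bar> ^ n) \<le> \<tau>" "(\<Sum>s\<in>S. \<mu> s * \<bar>\<beta> s\<bar> ^ n) \<le> \<tau>"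
    "(\<Sum>s\<in>S. \<mu> s * (\<Sum>t\<in>S. \<mu> t * \<bar>T s t\<bar> ^ n)) \<le> \<tau>"
  shows "(\<integral>g. cavity_error g ^ n \<partial>gaussian J) \<le> raise_const n B (2 * n) [] (\<lambda>_. 0) * \<tau>"
proof -
  have \<tau>: "replica_avg (\<lambda>r. \<bar>small_param r (a, b)\<bar> ^ n) \<le> \<tau>" if "a < n" "b \<le> n" for a b
  proof -
    show ?thesis
    proof (cases "b = n")
      case True
      then have "small_param r (a, b) = \<beta> (r a)" for r by (simp add: small_param_def)
      then show ?thesis using assms(2) replica_avg_one[OF that(1), of "\<lambda>s. \<bar>\<beta> s\<bar> ^ n"] by simp
    next
      case bn: False
      with that have b: "b < n" by simp
      show ?thesis
      proof (cases "a = b")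
        case True
        with bn have "small_param r (a, b) = \<alpha> (r a)" for r by (simp add: small_param_def)
        then show ?thesis using assms(1) replica_avg_one[OF that(1), of "\<lambda>s. \<bar>\<alpha> s\<bar> ^ n"] by simp
      next
        case False
        with bn have "small_param r (a, b) = T (r a) (r b)" for r by (simp add: small_param_def)
        then show ?thesis using assms(3) replica_avg_two[OF that(1) b False, of "\<lambda>s t. \<bar>T s t\<bar> ^ n"] by simp
      qed
    qed
  qed
  have "deficiency [] \<le> 2 * n" by (simp add: deficiency_def multiplicity_Nil)
  then have "\<bar>replica_avg (\<lambda>r. M [] r * \<Phi> (untouched []) (\<lambda>_. 0) (\<lambda>_. pi/2) r)\<bar> \<le> raise_const n B (2 * n) [] (\<lambda>_. 0) * \<tau>"
    using pi_half_le_two pi_ge_zero by (intro replica_avg_main[OF \<tau>]) (auto simp: well_indexed_def)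
  moreover have "untouched [] = {..<n}" by (auto simp: untouched_def multiplicity_Nil)
  ultimately show ?thesis unfolding cavity_error_moment_eq by (simp add: M_def)
qed

end

section \<open>Gaussian interpolation of Gibbs averages\<close>

text \<open>A Gibbs measure on a finite set \<open>A\<close> with Gaussian energies \<open>x e * S e \<alpha>\<close>, whose amplitudes
\<open>c \<theta> e\<close> move with a parameter \<open>\<theta>\<close>, and an observable \<open>f \<theta>\<close> that moves as well.\<close>
locale gibbs_path =
  fixes A :: "'s set" and E :: "'i set" and S :: "'i \<Rightarrow> 's \<Rightarrow> real" and h :: "'s \<Rightarrow> real"
    and c c' :: "real \<Rightarrow> 'i \<Rightarrow> real" and f f' :: "real \<Rightarrow> 's \<Rightarrow> real" and Ks Kc Kf :: real
  assumes finA: "finite A" and neA: "A \<noteq> {}" and finE: "finite E"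
    and S: "\<And>e \<alpha>. e \<in> E \<Longrightarrow> \<alpha> \<in> A \<Longrightarrow> \<bar>S e \<alpha>\<bar> \<le> Ks"
    and dc: "\<And>e \<theta>. ((\<lambda>\<theta>. c \<theta> e) has_real_derivative c' \<theta> e) (at \<theta>)"
    and bc: "\<And>e \<theta>. \<bar>c \<theta> e\<bar> \<le> Kc" and bc': "\<And>e \<theta>. \<bar>c' \<theta> e\<bar> \<le> Kc"
    and df: "\<And>\<alpha> \<theta>. ((\<lambda>\<theta>. f \<theta> \<alpha>) has_real_derivative f' \<theta> \<alpha>) (at \<theta>)"
    and bf: "\<And>\<alpha> \<theta>. \<alpha> \<in> A \<Longrightarrow> \<bar>f \<theta> \<alpha>\<bar> \<le> Kf" and bf': "\<And>\<alpha> \<theta>. \<alpha> \<in> A \<Longrightarrow> \<bar>f' \<theta> \<alpha>\<bar> \<le> Kf"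
begin

definition energy :: "real \<Rightarrow> ('i \<Rightarrow> real) \<Rightarrow> 's \<Rightarrow> real" where
  "energy \<theta> x \<alpha> = (\<Sum>e\<in>E. c \<theta> e * x e * S e \<alpha>) + h \<alpha>"
definition Z :: "real \<Rightarrow> ('i \<Rightarrow> real) \<Rightarrow> real" where "Z \<theta> x = (\<Sum>\<alpha>\<in>A. exp (energy \<theta> x \<alpha>))"
definition av :: "real \<Rightarrow> ('i \<Rightarrow> real) \<Rightarrow> ('s \<Rightarrow> real) \<Rightarrow> real" where
  "av \<theta> x \<phi> = (\<Sum>\<alpha>\<in>A. \<phi> \<alpha> * exp (energy \<theta> x \<alpha>)) / Z \<theta> x"

lemma Z_pos: "0 < Z \<theta> x" unfolding Z_def using finA neA by (intro sum_pos) auto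

lemma av_cmult: "av \<theta> x (\<lambda>\<alpha>. k * \<phi> \<alpha>) = k * av \<theta> x \<phi>"
  by (simp add: av_def sum_distrib_left mult_ac)
lemma av_const: "av \<theta> x (\<lambda>_. k) = k"
  using Z_pos[of \<theta> x] by (simp add: av_def Z_def sum_distrib_left[symmetric])

lemma av_mono: "(\<And>\<alpha>. \<alpha> \<in> A \<Longrightarrow> \<phi> \<alpha> \<le> \<psi> \<alpha>) \<Longrightarrow> av \<theta> x \<phi> \<le> av \<theta> x \<psi>"
  unfolding av_def using Z_pos[of \<theta> x] by (intro divide_right_mono sum_mono mult_right_mono) auto

lemma av_abs_le: assumes "\<And>\<alpha>. \<alpha> \<in> A \<Longrightarrow> \<bar>\<phi> \<alpha>\<bar> \<le> K" shows "\<bar>av \<theta> x \<phi>\<bar> \<le> K"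
proof -
  have "av \<theta> x \<phi> \<le> K" using av_mono[of \<phi> "\<lambda>_. K" \<theta> x] assms by (fastforce simp: av_const)
  moreover have "- K \<le> av \<theta> x \<phi>" using av_mono[of "\<lambda>_. - K" \<phi> \<theta> x] assms by (fastforce simp: av_const)
  ultimately show ?thesis by simp
qed

lemma av_measurable[measurable]: "(\<lambda>x. av \<theta> x \<phi>) \<in> borel_measurable (gaussian E)"
  unfolding av_def Z_def energy_def by measurable

lemma Ks0: "E = {} \<or> 0 \<le> Ks" using S neA by (metis abs_ge_zero all_not_in_conv order_trans)
lemma Kc0: "0 \<le> Kc" using bc[of undefined undefined] by (rule order_trans[OF abs_ge_zero])
lemma Kf0: "0 \<le> Kf" using neA bf by (metis abs_ge_zero all_not_in_conv order_trans)

definition cov :: "real \<Rightarrow> ('i \<Rightarrow> real) \<Rightarrow> ('s \<Rightarrow> real) \<Rightarrow> ('s \<Rightarrow> real) \<Rightarrow> real" where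
  "cov \<theta> x \<phi> \<psi> = av \<theta> x (\<lambda>\<alpha>. \<phi> \<alpha> * \<psi> \<alpha>) - av \<theta> x \<phi> * av \<theta> x \<psi>"

lemma av_general_deriv:
  assumes energy: "\<And>\<alpha>. \<alpha> \<in> A \<Longrightarrow> ((\<lambda>t. g t \<alpha>) has_real_derivative g' \<alpha>) (at t)"
    and \<phi>: "\<And>\<alpha>. \<alpha> \<in> A \<Longrightarrow> ((\<lambda>t. \<phi> t \<alpha>) has_real_derivative \<phi>' \<alpha>) (at t)"
    and gt: "\<And>\<alpha>. \<alpha> \<in> A \<Longrightarrow> g t \<alpha> = energy \<theta> x \<alpha>"
  shows "((\<lambda>t. (\<Sum>\<alpha>\<in>A. \<phi> t \<alpha> * exp (g t \<alpha>)) / (\<Sum>\<alpha>\<in>A. exp (g t \<alpha>))) has_real_derivative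
    (av \<theta> x \<phi>' + cov \<theta> x (\<phi> t) g')) (at t)"
proof -
  have Zg: "(\<Sum>\<alpha>\<in>A. exp (g t \<alpha>)) = Z \<theta> x" unfolding Z_def by (intro sum.cong) (auto simp: gt)
  have D: "((\<lambda>t. (\<Sum>\<alpha>\<in>A. \<phi> t \<alpha> * exp (g t \<alpha>)) / (\<Sum>\<alpha>\<in>A. exp (g t \<alpha>))) has_real_derivative
    ((\<Sum>\<alpha>\<in>A. \<phi>' \<alpha> * exp (g t \<alpha>) + exp (g t \<alpha>) * g' \<alpha> * \<phi> t \<alpha>) * (\<Sum>\<alpha>\<in>A. exp (g t \<alpha>))
     - (\<Sum>\<alpha>\<in>A. \<phi> t \<alpha> * exp (g t \<alpha>)) * (\<Sum>\<alpha>\<in>A. exp (g t \<alpha>) * g' \<alpha>))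
     / ((\<Sum>\<alpha>\<in>A. exp (g t \<alpha>)) * (\<Sum>\<alpha>\<in>A. exp (g t \<alpha>)))) (at t)"
    using Z_pos[of \<theta> x] unfolding Zg[symmetric]
    by (intro DERIV_divide DERIV_sum DERIV_mult DERIV_fun_exp assms) auto
  have E1: "(\<Sum>\<alpha>\<in>A. \<phi>' \<alpha> * exp (g t \<alpha>) + exp (g t \<alpha>) * g' \<alpha> * \<phi> t \<alpha>) = (av \<theta> x \<phi>' + av \<theta> x (\<lambda>\<alpha>. \<phi> t \<alpha> * g' \<alpha>)) * Z \<theta> x"
    using Z_pos[of \<theta> x] unfolding av_def by (simp add: gt sum.distrib distrib_right mult_ac cong: sum.cong) (simp add: field_simps)
  have E2: "(\<Sum>\<alpha>\<in>A. \<phi> t \<alpha> * exp (g t \<alpha>)) = av \<theta> x (\<phi> t) * Z \<theta> x" "(\<Sum>\<alpha>\<in>A. exp (g t \<alpha>) * g' \<alpha>) = av \<theta> x g' * Z \<theta> x"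
    using Z_pos[of \<theta> x] unfolding av_def by (simp_all add: gt mult_ac cong: sum.cong)
  have "((p + r) * z * z - u * z * (w * z)) / (z * z) = p + (r - u * w)" if "0 < z" for p r u w z :: real
    using that by (simp add: field_simps)
  then show ?thesis using D Z_pos[of \<theta> x] unfolding Zg E1 E2 cov_def by simp
qed

lemma energy_upd_deriv: "e \<in> E \<Longrightarrow> ((\<lambda>t. energy \<theta> (x(e := t)) \<alpha>) has_real_derivative c \<theta> e * S e \<alpha>) (at t)"
proof -
  assume e: "e \<in> E"
  have "energy \<theta> (x(e := t)) \<alpha> = c \<theta> e * S e \<alpha> * t + ((\<Sum>i\<in>E - {e}. c \<theta> i * x i * S i \<alpha>) + h \<alpha>)" for t
    unfolding energy_def using finE e by (subst sum.remove[of _ e]) auto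
  then show ?thesis by (auto intro!: derivative_eq_intros)
qed

lemma av_upd_deriv:
  assumes "e \<in> E"
  shows "((\<lambda>t. av \<theta> (x(e := t)) \<phi>) has_real_derivative c \<theta> e * cov \<theta> (x(e := t)) \<phi> (S e)) (at t)"
proof -
  have "((\<lambda>t. av \<theta> (x(e := t)) \<phi>) has_real_derivative
     (av \<theta> (x(e := t)) (\<lambda>_. 0) + cov \<theta> (x(e := t)) \<phi> (\<lambda>\<alpha>. c \<theta> e * S e \<alpha>))) (at t)"
    unfolding av_def[of _ "x(e := _)" \<phi>] Z_def
    by (rule av_general_deriv) (auto intro: energy_upd_deriv[OF assms])
  moreover have "cov \<theta> y \<phi> (\<lambda>\<alpha>. c \<theta> e * S e \<alpha>) = c \<theta> e * cov \<theta> y \<phi> (S e)" for y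
    unfolding cov_def by (simp add: av_cmult mult.left_commute[of "\<phi> _"] right_diff_distrib)
  ultimately show ?thesis by (simp add: av_const)
qed

lemma av_path_deriv:
  "((\<lambda>\<theta>. av \<theta> x (f \<theta>)) has_real_derivative
     (av \<theta> x (f' \<theta>) + (\<Sum>e\<in>E. c' \<theta> e * (x e * cov \<theta> x (f \<theta>) (S e))))) (at \<theta>)"
proof -
  have "((\<lambda>\<theta>. av \<theta> x (f \<theta>)) has_real_derivative
     (av \<theta> x (f' \<theta>) + cov \<theta> x (f \<theta>) (\<lambda>\<alpha>. \<Sum>e\<in>E. c' \<theta> e * x e * S e \<alpha>))) (at \<theta>)"
    unfolding av_def[of _ x "f _"] Z_def
  proof (rule av_general_deriv)
    fix \<alpha>
    have "((\<lambda>\<theta>. (\<Sum>e\<in>E. (x e * S e \<alpha>) * c \<theta> e) + h \<alpha>) has_real_derivative ((\<Sum>e\<in>E. (x e * S e \<alpha>) * c' \<theta> e) + 0)) (at \<theta>)"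
      by (intro DERIV_add DERIV_sum DERIV_cmult dc DERIV_const)
    then show "((\<lambda>\<theta>. energy \<theta> x \<alpha>) has_real_derivative (\<Sum>e\<in>E. c' \<theta> e * x e * S e \<alpha>)) (at \<theta>)"
      by (simp add: energy_def mult_ac)
  qed (auto intro: df)
  moreover have "cov \<theta> x (f \<theta>) (\<lambda>\<alpha>. \<Sum>e\<in>E. c' \<theta> e * x e * S e \<alpha>) = (\<Sum>e\<in>E. c' \<theta> e * (x e * cov \<theta> x (f \<theta>) (S e)))"
  proof -
    have av_sum: "av \<theta> x (\<lambda>\<alpha>. \<Sum>e\<in>E. k e * \<phi> e \<alpha>) = (\<Sum>e\<in>E. k e * av \<theta> x (\<phi> e))" for k \<phi>
      unfolding av_def sum_distrib_left sum_distrib_right sum_divide_distrib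
      by (subst sum.swap) (simp add: mult_ac)
    have "av \<theta> x (\<lambda>\<alpha>. f \<theta> \<alpha> * (\<Sum>e\<in>E. c' \<theta> e * x e * S e \<alpha>)) = (\<Sum>e\<in>E. c' \<theta> e * x e * av \<theta> x (\<lambda>\<alpha>. f \<theta> \<alpha> * S e \<alpha>))"
      by (subst av_sum[symmetric]) (simp add: sum_distrib_left mult_ac)
    then show ?thesis unfolding cov_def av_sum
      by (simp add: sum_distrib_left sum_subtractf algebra_simps)
  qed
  ultimately show ?thesis by simp
qed

text \<open>The bracket produced by integrating by parts the coupling of index \<open>e\<close>.\<close>
definition bracket :: "real \<Rightarrow> ('i \<Rightarrow> real) \<Rightarrow> 'i \<Rightarrow> real" where
  "bracket \<theta> x e = av \<theta> x (\<lambda>\<alpha>. f \<theta> \<alpha> * (S e \<alpha>)\<^sup>2) - av \<theta> x (f \<theta>) * av \<theta> x (\<lambda>\<alpha>. (S e \<alpha>)\<^sup>2)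
     - 2 * av \<theta> x (\<lambda>\<alpha>. f \<theta> \<alpha> * S e \<alpha>) * av \<theta> x (S e) + 2 * av \<theta> x (f \<theta>) * (av \<theta> x (S e))\<^sup>2"

lemma av_continuous:
  assumes "e \<in> E" shows "continuous_on UNIV (\<lambda>t. av \<theta> (x(e := t)) \<phi>)"
  by (intro continuous_at_imp_continuous_on ballI DERIV_isCont[OF av_upd_deriv[OF assms]])

lemma fS_le: assumes "e \<in> E" "\<alpha> \<in> A" shows "\<bar>f \<theta> \<alpha> * S e \<alpha>\<bar> \<le> Kf * Ks"
  unfolding abs_mult using assms Kf0 by (intro mult_mono bf S) auto

lemma cov_le: assumes "e \<in> E" shows "\<bar>cov \<theta> x (f \<theta>) (S e)\<bar> \<le> 2 * (Kf * Ks)"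
proof -
  have "\<bar>av \<theta> x (\<lambda>\<alpha>. f \<theta> \<alpha> * S e \<alpha>)\<bar> \<le> Kf * Ks" using assms by (intro av_abs_le fS_le)
  moreover have "\<bar>av \<theta> x (f \<theta>) * av \<theta> x (S e)\<bar> \<le> Kf * Ks"
    unfolding abs_mult using assms Kf0 by (intro mult_mono av_abs_le bf S) auto
  ultimately show ?thesis unfolding cov_def by linarith
qed

lemma bracket_le: assumes "e \<in> E" shows "\<bar>bracket \<theta> x e\<bar> \<le> 6 * (Kf * Ks\<^sup>2)"
proof -
  have K: "0 \<le> Ks" using Ks0 assms by auto
  have s2: "\<bar>(S e \<alpha>)\<^sup>2\<bar> \<le> Ks\<^sup>2" if "\<alpha> \<in> A" for \<alpha> using power_mono[OF S[OF assms that], of 2] by simp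
  have 1: "\<bar>av \<theta> x (\<lambda>\<alpha>. f \<theta> \<alpha> * (S e \<alpha>)\<^sup>2)\<bar> \<le> Kf * Ks\<^sup>2"
    using s2 bf Kf0 by (intro av_abs_le) (auto simp: abs_mult intro!: mult_mono)
  have 2: "\<bar>av \<theta> x (f \<theta>) * av \<theta> x (\<lambda>\<alpha>. (S e \<alpha>)\<^sup>2)\<bar> \<le> Kf * Ks\<^sup>2"
    unfolding abs_mult using Kf0 by (intro mult_mono av_abs_le bf s2) auto
  have 3: "\<bar>av \<theta> x (\<lambda>\<alpha>. f \<theta> \<alpha> * S e \<alpha>) * av \<theta> x (S e)\<bar> \<le> (Kf * Ks) * Ks"
    unfolding abs_mult[of "av \<theta> x (\<lambda>\<alpha>. f \<theta> \<alpha> * S e \<alpha>)"] using Kf0 K assms by (intro mult_mono av_abs_le fS_le S) auto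
  have 4: "\<bar>av \<theta> x (f \<theta>) * (av \<theta> x (S e))\<^sup>2\<bar> \<le> Kf * Ks\<^sup>2"
    unfolding abs_mult power2_eq_square using Kf0 K assms by (intro mult_mono av_abs_le bf S) auto
  show ?thesis using 1 2 3 4 unfolding bracket_def by (simp add: power2_eq_square abs_le_iff mult_ac)
qed

lemma cov_by_parts:
  assumes e: "e \<in> E"
  shows "(\<integral>x. x e * cov \<theta> x (f \<theta>) (S e) \<partial>gaussian E) = (\<integral>x. c \<theta> e * bracket \<theta> x e \<partial>gaussian E)"
proof (rule gaussian_integration_by_parts[OF finE e, where C="2 * (Kf * Ks) + Kc * (6 * (Kf * Ks\<^sup>2))"])
  have K: "0 \<le> Ks" using Ks0 e by auto
  have p: "0 \<le> 2 * (Kf * Ks)" "0 \<le> Kc * (6 * (Kf * Ks\<^sup>2))" using K Kf0 Kc0 by auto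
  fix x :: "'i \<Rightarrow> real" and t
  have "((\<lambda>t. cov \<theta> (x(e := t)) (f \<theta>) (S e)) has_real_derivative
     (c \<theta> e * cov \<theta> (x(e := t)) (\<lambda>\<alpha>. f \<theta> \<alpha> * S e \<alpha>) (S e)
      - (c \<theta> e * cov \<theta> (x(e := t)) (f \<theta>) (S e) * av \<theta> (x(e := t)) (S e)
         + c \<theta> e * cov \<theta> (x(e := t)) (S e) (S e) * av \<theta> (x(e := t)) (f \<theta>)))) (at t)"
    unfolding cov_def[of _ "x(e := _)" "f \<theta>" "S e"]
    unfolding cov_def[of _ "x(e := t)" "f \<theta>" "S e", symmetric]
    by (intro DERIV_diff DERIV_mult av_upd_deriv e)
  moreover have "c \<theta> e * cov \<theta> (x(e := t)) (\<lambda>\<alpha>. f \<theta> \<alpha> * S e \<alpha>) (S e)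
      - (c \<theta> e * cov \<theta> (x(e := t)) (f \<theta>) (S e) * av \<theta> (x(e := t)) (S e)
         + c \<theta> e * cov \<theta> (x(e := t)) (S e) (S e) * av \<theta> (x(e := t)) (f \<theta>)) = c \<theta> e * bracket \<theta> (x(e := t)) e"
    unfolding cov_def bracket_def by (simp add: power2_eq_square algebra_simps)
  ultimately show "((\<lambda>t. cov \<theta> (x(e := t)) (f \<theta>) (S e)) has_real_derivative c \<theta> e * bracket \<theta> (x(e := t)) e) (at t)" by simp
  show "continuous_on UNIV (\<lambda>t. c \<theta> e * bracket \<theta> (x(e := t)) e)"
    unfolding bracket_def by (intro continuous_intros av_continuous e)
  have "0 \<le> (\<Sum>i\<in>E. (x i)\<^sup>2) * 3 / 16" by (intro divide_nonneg_nonneg mult_nonneg_nonneg sum_nonneg) auto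
  then have ex: "1 \<le> exp ((\<Sum>i\<in>E. (x i)\<^sup>2) * 3 / 16)" by simp
  have up: "a \<le> (2 * (Kf * Ks) + Kc * (6 * (Kf * Ks\<^sup>2))) * exp ((\<Sum>i\<in>E. (x i)\<^sup>2) * 3 / 16)"
    if "a \<le> 2 * (Kf * Ks) + Kc * (6 * (Kf * Ks\<^sup>2))" for a
    using order_trans[OF that] mult_left_mono[OF ex add_nonneg_nonneg[OF p]] by simp
  show "\<bar>cov \<theta> x (f \<theta>) (S e)\<bar> \<le> (2 * (Kf * Ks) + Kc * (6 * (Kf * Ks\<^sup>2))) * exp ((\<Sum>i\<in>E. (x i)\<^sup>2) * 3 / 16)"
    by (rule up[OF add_increasing2[OF p(2) cov_le[OF e]]])
  have "\<bar>c \<theta> e * bracket \<theta> x e\<bar> \<le> Kc * (6 * (Kf * Ks\<^sup>2))"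
    unfolding abs_mult using Kc0 by (intro mult_mono bc bracket_le e) auto
  from up[OF add_increasing[OF p(1) this]]
  show "\<bar>c \<theta> e * bracket \<theta> x e\<bar> \<le> (2 * (Kf * Ks) + Kc * (6 * (Kf * Ks\<^sup>2))) * exp ((\<Sum>i\<in>E. (x i)\<^sup>2) * 3 / 16)" .
next
  show "(\<lambda>x. cov \<theta> x (f \<theta>) (S e)) \<in> borel_measurable (gaussian E)" unfolding cov_def by measurable
  show "(\<lambda>x. c \<theta> e * bracket \<theta> x e) \<in> borel_measurable (gaussian E)" unfolding bracket_def by measurable
qed

lemma integrable_bounded:
  fixes g :: "('i \<Rightarrow> real) \<Rightarrow> real"
  assumes [measurable]: "g \<in> borel_measurable (gaussian E)" and "\<And>x. \<bar>g x\<bar> \<le> K"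
  shows "integrable (gaussian E) g"
proof -
  interpret prob_space "gaussian E" by (rule prob_space_gaussian)
  show ?thesis using assms(2) by (intro integrable_const_bound[where B=K]) auto
qed

lemma integrable_abs_component: "e \<in> E \<Longrightarrow> integrable (gaussian E) (\<lambda>x. \<bar>x e\<bar>)"
proof -
  assume e: "e \<in> E"
  have [measurable]: "(\<lambda>x. x e) \<in> borel_measurable (gaussian E)" using e by measurable
  show ?thesis
  proof (rule gaussian_integrable_bound[OF finE, where C="4 * 1"])
    fix x :: "'i \<Rightarrow> real"
    have "0 \<le> (\<Sum>i\<in>E. (x i)\<^sup>2) * 3 / 16" by (intro divide_nonneg_nonneg mult_nonneg_nonneg sum_nonneg) auto
    then show "\<bar>\<bar>x e\<bar>\<bar> \<le> 4 * 1 * exp ((\<Sum>i\<in>E. (x i)\<^sup>2) / 4)"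
      using gaussian_component_bound[OF finE e, of "\<lambda>_. 1" x 1] by simp
  qed measurable
qed

text \<open>The derivative of the energy produces \<open>x e\<close> times a covariance; integration by parts in \<open>x e\<close>
replaces it by \<open>c \<theta> e\<close> times the third order bracket.\<close>
theorem expectation_deriv:
  "((\<lambda>\<theta>. \<integral>x. av \<theta> x (f \<theta>) \<partial>gaussian E) has_real_derivative
     (\<integral>x. av \<theta> x (f' \<theta>) + (\<Sum>e\<in>E. c' \<theta> e * c \<theta> e * bracket \<theta> x e) \<partial>gaussian E)) (at \<theta>)"
proof -
  have m[measurable]: "(\<lambda>x. cov \<theta> x (f \<theta>) (S e)) \<in> borel_measurable (gaussian E)"
    "(\<lambda>x. bracket \<theta> x e) \<in> borel_measurable (gaussian E)" for \<theta> e unfolding cov_def bracket_def by measurable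
  have mx[measurable]: "(\<lambda>x. x e) \<in> borel_measurable (gaussian E)" if "e \<in> E" for e using that by measurable
  have bnd: "\<bar>x e * cov \<theta> x (f \<theta>) (S e)\<bar> \<le> \<bar>x e\<bar> * (2 * (Kf * Ks))" if "e \<in> E" for x e \<theta>
    unfolding abs_mult using cov_le[OF that, of \<theta> x] by (intro mult_left_mono) auto
  have ix: "integrable (gaussian E) (\<lambda>x. x e * cov \<theta> x (f \<theta>) (S e))" if e: "e \<in> E" for e \<theta>
  proof (rule Bochner_Integration.integrable_bound)
    show "integrable (gaussian E) (\<lambda>x. \<bar>x e\<bar> * (2 * (Kf * Ks)))" by (intro integrable_mult_left integrable_abs_component e)
    show "(\<lambda>x. x e * cov \<theta> x (f \<theta>) (S e)) \<in> borel_measurable (gaussian E)" using e by measurable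
    show "AE x in gaussian E. norm (x e * cov \<theta> x (f \<theta>) (S e)) \<le> norm (\<bar>x e\<bar> * (2 * (Kf * Ks)))"
      using order_trans[OF bnd[OF e] abs_ge_self] by (intro AE_I2) simp
  qed
  have ib: "integrable (gaussian E) (\<lambda>x. bracket \<theta> x e)" if "e \<in> E" for e \<theta>
    using bracket_le[OF that] by (intro integrable_bounded) auto
  have ia: "integrable (gaussian E) (\<lambda>x. av \<theta> x (f' \<theta>))" for \<theta>
    by (intro integrable_bounded[where K=Kf] av_abs_le bf') auto
  have "((\<lambda>\<theta>. \<integral>x. av \<theta> x (f \<theta>) \<partial>gaussian E) has_real_derivative
     (\<integral>x. av \<theta> x (f' \<theta>) + (\<Sum>e\<in>E. c' \<theta> e * (x e * cov \<theta> x (f \<theta>) (S e))) \<partial>gaussian E)) (at \<theta>)"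
  proof (rule has_real_derivative_integral[where B="\<lambda>x. Kf + (\<Sum>e\<in>E. Kc * (\<bar>x e\<bar> * (2 * (Kf * Ks))))"])
    show "((\<lambda>\<theta>. av \<theta> x (f \<theta>)) has_real_derivative
     (av \<theta> x (f' \<theta>) + (\<Sum>e\<in>E. c' \<theta> e * (x e * cov \<theta> x (f \<theta>) (S e))))) (at \<theta>)" for \<theta> x by (rule av_path_deriv)
    show "integrable (gaussian E) (\<lambda>x. av \<theta> x (f \<theta>))" for \<theta> by (intro integrable_bounded[where K=Kf] av_abs_le bf) auto
    show "(\<lambda>x. av \<theta> x (f' \<theta>) + (\<Sum>e\<in>E. c' \<theta> e * (x e * cov \<theta> x (f \<theta>) (S e)))) \<in> borel_measurable (gaussian E)" for \<theta>
      by measurable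
    show "integrable (gaussian E) (\<lambda>x. Kf + (\<Sum>e\<in>E. Kc * (\<bar>x e\<bar> * (2 * (Kf * Ks)))))"
      by (intro Bochner_Integration.integrable_add Bochner_Integration.integrable_sum integrable_mult_right integrable_mult_left integrable_abs_component
        finite_measure.integrable_const prob_space.finite_measure prob_space_gaussian)
    fix \<theta> :: real and x :: "'i \<Rightarrow> real"
    show "\<bar>av \<theta> x (f' \<theta>) + (\<Sum>e\<in>E. c' \<theta> e * (x e * cov \<theta> x (f \<theta>) (S e)))\<bar> \<le> Kf + (\<Sum>e\<in>E. Kc * (\<bar>x e\<bar> * (2 * (Kf * Ks))))"
    proof (intro order_trans[OF abs_triangle_ineq] add_mono order_trans[OF sum_abs] sum_mono)
      show "\<bar>av \<theta> x (f' \<theta>)\<bar> \<le> Kf" by (intro av_abs_le bf')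
      fix e assume "e \<in> E"
      then show "\<bar>c' \<theta> e * (x e * cov \<theta> x (f \<theta>) (S e))\<bar> \<le> Kc * (\<bar>x e\<bar> * (2 * (Kf * Ks)))"
        unfolding abs_mult[of "c' \<theta> e"] using Kc0 by (intro mult_mono bc' bnd) auto
    qed
  qed
  also have "(\<integral>x. av \<theta> x (f' \<theta>) + (\<Sum>e\<in>E. c' \<theta> e * (x e * cov \<theta> x (f \<theta>) (S e))) \<partial>gaussian E)
    = (\<integral>x. av \<theta> x (f' \<theta>) \<partial>gaussian E) + (\<Sum>e\<in>E. c' \<theta> e * (\<integral>x. x e * cov \<theta> x (f \<theta>) (S e) \<partial>gaussian E))"
    using ia ix by (simp add: Bochner_Integration.integral_add Bochner_Integration.integral_sum)
  also have "\<dots> = (\<integral>x. av \<theta> x (f' \<theta>) \<partial>gaussian E) + (\<Sum>e\<in>E. c' \<theta> e * (\<integral>x. c \<theta> e * bracket \<theta> x e \<partial>gaussian E))"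
    by (intro arg_cong2[where f="(+)"] refl sum.cong) (simp add: cov_by_parts)
  also have "\<dots> = (\<integral>x. av \<theta> x (f' \<theta>) + (\<Sum>e\<in>E. c' \<theta> e * c \<theta> e * bracket \<theta> x e) \<partial>gaussian E)"
    using ia ib by (simp add: Bochner_Integration.integral_add Bochner_Integration.integral_sum mult_ac)
  finally show ?thesis .
qed

end

section \<open>The fixed point equation for the overlap\<close>

lemma tanh_sq_le_1: "(tanh x)\<^sup>2 \<le> 1" for x :: real
  using tanh_real_lt_1[of x] tanh_real_gt_neg1[of x] by (simp add: abs_square_le_1 abs_le_iff)

lemma tanh_sq_measurable[measurable]: "(\<lambda>z::real. (tanh (b * z * r + h))\<^sup>2) \<in> borel_measurable borel"
  by (intro borel_measurable_continuous_onI continuous_intros) auto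

lemma tanh_sq_integrable: "integrable gauss1 (\<lambda>z. (tanh (b * z * r + h))\<^sup>2)"
proof -
  interpret prob_space gauss1 by (rule prob_space_gauss1)
  show ?thesis using tanh_sq_le_1 by (intro integrable_const_bound[where B=1]) auto
qed

lemma quadratic_bound: "0 \<le> T \<Longrightarrow> T \<le> 1 \<Longrightarrow> \<bar>2 * (1 - T) * (1 - 3 * T)\<bar> \<le> 4" for T :: real
proof -
  assume T: "0 \<le> T" "T \<le> 1"
  have "\<bar>1 - T\<bar> * \<bar>1 - 3 * T\<bar> \<le> 1 * 2" using T by (intro mult_mono) (auto simp: abs_le_iff)
  then have "\<bar>(1 - T) * (1 - 3 * T)\<bar> \<le> 2" by (simp add: abs_mult)
  then show ?thesis unfolding mult.assoc abs_mult[of 2] by simp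
qed

lemma gauss1_integrable_abs: "integrable gauss1 (\<lambda>z. \<bar>z\<bar>)"
proof (rule integrable_gauss1_bound[where C=4])
  fix z :: real
  have "\<bar>z\<bar> \<le> 4 * exp (z\<^sup>2/16)" by (rule exp_ge_abs_sixteenth)
  also have "\<dots> \<le> 4 * exp (z\<^sup>2/4)" by simp
  finally show "\<bar>\<bar>z\<bar>\<bar> \<le> 4 * exp (z\<^sup>2/4)" by simp
qed measurable

text \<open>Integration by parts turns the factor \<open>z\<close> into a second derivative of \<open>tanh\<^sup>2\<close> and extracts a factor
\<open>r\<close>. This is what makes the map Lipschitz in \<open>r\<^sup>2 = q\<close> rather than in \<open>r\<close>.\<close>
lemma expectation_tanh_sq_deriv:
  fixes b h r :: real
  shows "((\<lambda>r. \<integral>z. (tanh (b * z * r + h))\<^sup>2 \<partial>gauss1) has_real_derivative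
    b\<^sup>2 * r * (\<integral>z. 2 * (1 - (tanh (b * z * r + h))\<^sup>2) * (1 - 3 * (tanh (b * z * r + h))\<^sup>2) \<partial>gauss1)) (at r)"
proof -
  define t where "t = (\<lambda>r z. tanh (b * z * r + h))"
  have t1: "(t r z)\<^sup>2 \<le> 1" for r z unfolding t_def by (rule tanh_sq_le_1)
  have ta: "\<bar>t r z\<bar> \<le> 1" for r z using t1[of r z] by (simp add: abs_square_le_1)
  have dr: "((\<lambda>r. t r z) has_real_derivative b * z * (1 - (t r z)\<^sup>2)) (at r)" for r z
    unfolding t_def by (auto intro!: derivative_eq_intros)
  have dz: "(t r has_real_derivative b * r * (1 - (t r z)\<^sup>2)) (at z)" for r z
    unfolding t_def by (auto intro!: derivative_eq_intros)
  have ct: "continuous_on UNIV (t r)" for r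
    by (intro continuous_at_imp_continuous_on ballI DERIV_isCont[OF dz])
  have [measurable]: "t r \<in> borel_measurable borel" for r
    using ct by (rule borel_measurable_continuous_onI)
  have "((\<lambda>r. \<integral>z. (t r z)\<^sup>2 \<partial>gauss1) has_real_derivative (\<integral>z. b * (z * (2 * t r z * (1 - (t r z)\<^sup>2))) \<partial>gauss1)) (at r)"
  proof (rule has_real_derivative_integral[where B="\<lambda>z. \<bar>b\<bar> * (\<bar>z\<bar> * 2)"])
    show "((\<lambda>r. (t r z)\<^sup>2) has_real_derivative b * (z * (2 * t r z * (1 - (t r z)\<^sup>2)))) (at r)" for r z
      by (auto intro!: derivative_eq_intros dr simp: power2_eq_square algebra_simps)
    show "integrable gauss1 (\<lambda>z. (t r z)\<^sup>2)" for r unfolding t_def by (rule tanh_sq_integrable)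
    show "integrable gauss1 (\<lambda>z. \<bar>b\<bar> * (\<bar>z\<bar> * 2))" by (intro integrable_mult_right integrable_mult_left gauss1_integrable_abs)
    fix r z
    have "\<bar>t r z\<bar> * \<bar>1 - (t r z)\<^sup>2\<bar> \<le> 1 * 1" using ta t1[of r z] by (intro mult_mono) auto
    then have "\<bar>2 * t r z * (1 - (t r z)\<^sup>2)\<bar> \<le> 2" by (simp add: abs_mult)
    then show "\<bar>b * (z * (2 * t r z * (1 - (t r z)\<^sup>2)))\<bar> \<le> \<bar>b\<bar> * (\<bar>z\<bar> * 2)"
      unfolding abs_mult[of b] abs_mult[of z] by (intro mult_left_mono) auto
  qed measurable
  moreover have "(\<integral>z. z * (2 * t r z * (1 - (t r z)\<^sup>2)) \<partial>gauss1) = (\<integral>z. b * r * (2 * (1 - (t r z)\<^sup>2) * (1 - 3 * (t r z)\<^sup>2)) \<partial>gauss1)"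
  proof (rule gauss1_integration_by_parts[where C="2 + \<bar>b * r\<bar> * 4"])
    fix z
    show "((\<lambda>z. 2 * t r z * (1 - (t r z)\<^sup>2)) has_real_derivative b * r * (2 * (1 - (t r z)\<^sup>2) * (1 - 3 * (t r z)\<^sup>2))) (at z)"
      by (auto intro!: derivative_eq_intros dz simp: power2_eq_square algebra_simps)
    have ex: "1 \<le> exp (3 * z\<^sup>2 / 16)" by simp
    have up: "a \<le> (2 + \<bar>b * r\<bar> * 4) * exp (3 * z\<^sup>2 / 16)" if "a \<le> 2 + \<bar>b * r\<bar> * 4" for a
      using order_trans[OF that] mult_left_mono[OF ex, of "2 + \<bar>b * r\<bar> * 4"] by simp
    have "\<bar>t r z\<bar> * \<bar>1 - (t r z)\<^sup>2\<bar> \<le> 1 * 1" using ta t1[of r z] by (intro mult_mono) auto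
    then have "\<bar>2 * t r z * (1 - (t r z)\<^sup>2)\<bar> \<le> 2" by (simp add: abs_mult)
    then show "\<bar>2 * t r z * (1 - (t r z)\<^sup>2)\<bar> \<le> (2 + \<bar>b * r\<bar> * 4) * exp (3 * z\<^sup>2 / 16)"
      by (intro up) simp
    have "\<bar>2 * (1 - (t r z)\<^sup>2) * (1 - 3 * (t r z)\<^sup>2)\<bar> \<le> 4" by (rule quadratic_bound) (auto intro: t1)
    then have "\<bar>b * r * (2 * (1 - (t r z)\<^sup>2) * (1 - 3 * (t r z)\<^sup>2))\<bar> \<le> \<bar>b * r\<bar> * 4"
      unfolding abs_mult[of "b * r"] by (intro mult_left_mono) auto
    then show "\<bar>b * r * (2 * (1 - (t r z)\<^sup>2) * (1 - 3 * (t r z)\<^sup>2))\<bar> \<le> (2 + \<bar>b * r\<bar> * 4) * exp (3 * z\<^sup>2 / 16)"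
      by (intro up) simp
  qed (intro continuous_intros ct)
  ultimately show ?thesis
    unfolding integral_mult_right_zero[of _ b] integral_mult_right_zero[of _ "b * r"]
    by (simp add: t_def power2_eq_square mult.assoc)
qed

lemma second_derivative_bound:
  "\<bar>\<integral>z. 2 * (1 - (tanh (b * z * r + h))\<^sup>2) * (1 - 3 * (tanh (b * z * r + h))\<^sup>2) \<partial>gauss1\<bar> \<le> 4"
proof -
  interpret prob_space gauss1 by (rule prob_space_gauss1)
  have b: "\<bar>2 * (1 - (tanh (b * z * r + h))\<^sup>2) * (1 - 3 * (tanh (b * z * r + h))\<^sup>2)\<bar> \<le> 4" for z
    by (rule quadratic_bound) (auto intro: tanh_sq_le_1)
  have i: "integrable gauss1 (\<lambda>z. 2 * (1 - (tanh (b * z * r + h))\<^sup>2) * (1 - 3 * (tanh (b * z * r + h))\<^sup>2))"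
    using b by (intro integrable_const_bound[where B=4]) auto
  have "\<bar>\<integral>z. 2 * (1 - (tanh (b * z * r + h))\<^sup>2) * (1 - 3 * (tanh (b * z * r + h))\<^sup>2) \<partial>gauss1\<bar>
     \<le> (\<integral>z. 4 \<partial>gauss1)"
    using b i by (intro order_trans[OF integral_abs_bound integral_mono] integrable_abs) auto
  then show ?thesis using prob_space by simp
qed

text \<open>Bounded by comparing the derivative with that of \<open>2 * b\<^sup>2 * r\<^sup>2\<close>. In terms of \<open>q = r\<^sup>2\<close> the
Lipschitz constant is \<open>2 * b\<^sup>2\<close>, below \<open>1/2\<close> for \<open>b < 1/2\<close>.\<close>
lemma expectation_tanh_sq_contraction:
  fixes b h r s :: real
  assumes "0 \<le> r" "r \<le> s"
  shows "\<bar>(\<integral>z. (tanh (b * z * s + h))\<^sup>2 \<partial>gauss1) - (\<integral>z. (tanh (b * z * r + h))\<^sup>2 \<partial>gauss1)\<bar> \<le> 2 * b\<^sup>2 * (s\<^sup>2 - r\<^sup>2)"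
proof -
  define \<psi> where "\<psi> = (\<lambda>r. \<integral>z. (tanh (b * z * r + h))\<^sup>2 \<partial>gauss1)"
  define D where "D = (\<lambda>r. \<integral>z. 2 * (1 - (tanh (b * z * r + h))\<^sup>2) * (1 - 3 * (tanh (b * z * r + h))\<^sup>2) \<partial>gauss1)"
  have d: "(\<psi> has_real_derivative b\<^sup>2 * u * D u) (at u)" for u
    unfolding \<psi>_def D_def by (rule expectation_tanh_sq_deriv)
  have D: "\<bar>D u\<bar> \<le> 4" for u unfolding D_def by (rule second_derivative_bound)
  have "\<psi> s - 2 * b\<^sup>2 * s\<^sup>2 \<le> \<psi> r - 2 * b\<^sup>2 * r\<^sup>2"
  proof (rule DERIV_nonpos_imp_nonincreasing[OF assms(2), where f="\<lambda>u. \<psi> u - 2 * b\<^sup>2 * u\<^sup>2"])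
    fix u assume "r \<le> u" "u \<le> s"
    then have "b\<^sup>2 * u * (D u - 4) \<le> 0" using D[of u] assms by (intro mult_nonneg_nonpos) auto
    moreover have "((\<lambda>u. \<psi> u - 2 * b\<^sup>2 * u\<^sup>2) has_real_derivative b\<^sup>2 * u * (D u - 4)) (at u)"
      by (auto intro!: derivative_eq_intros d simp: algebra_simps)
    ultimately show "\<exists>y. ((\<lambda>u. \<psi> u - 2 * b\<^sup>2 * u\<^sup>2) has_real_derivative y) (at u) \<and> y \<le> 0" by blast
  qed
  moreover have "\<psi> r + 2 * b\<^sup>2 * r\<^sup>2 \<le> \<psi> s + 2 * b\<^sup>2 * s\<^sup>2"
  proof (rule DERIV_nonneg_imp_nondecreasing[OF assms(2), where f="\<lambda>u. \<psi> u + 2 * b\<^sup>2 * u\<^sup>2"])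
    fix u assume "r \<le> u" "u \<le> s"
    then have "0 \<le> b\<^sup>2 * u * (D u + 4)" using D[of u] assms by (intro mult_nonneg_nonneg) auto
    moreover have "((\<lambda>u. \<psi> u + 2 * b\<^sup>2 * u\<^sup>2) has_real_derivative b\<^sup>2 * u * (D u + 4)) (at u)"
      by (auto intro!: derivative_eq_intros d simp: algebra_simps)
    ultimately show "\<exists>y. ((\<lambda>u. \<psi> u + 2 * b\<^sup>2 * u\<^sup>2) has_real_derivative y) (at u) \<and> y \<ge> 0" by blast
  qed
  ultimately show ?thesis unfolding \<psi>_def by (simp add: abs_le_iff algebra_simps)
qed

lemma expectation_tanh_sq_range:
  "0 \<le> (\<integral>z. (tanh (b * z * r + h))\<^sup>2 \<partial>gauss1)" "(\<integral>z. (tanh (b * z * r + h))\<^sup>2 \<partial>gauss1) < 1"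
proof -
  interpret prob_space gauss1 by (rule prob_space_gauss1)
  show "0 \<le> (\<integral>z. (tanh (b * z * r + h))\<^sup>2 \<partial>gauss1)" by (intro integral_nonneg_AE AE_I2) auto
  show "(\<integral>z. (tanh (b * z * r + h))\<^sup>2 \<partial>gauss1) < 1"
  proof (rule expectation_less[OF tanh_sq_integrable])
    have "(tanh y)\<^sup>2 < 1" for y :: real
      using tanh_real_lt_1[of y] tanh_real_gt_neg1[of y] by (simp add: abs_square_less_1 abs_less_iff)
    then show "AE z in gauss1. (tanh (b * z * r + h))\<^sup>2 < 1" by simp
  qed
qed

text \<open>Existence by the intermediate value theorem on \<open>[0, 1]\<close>, uniqueness by contraction; only then does the definite
description denote a solution.\<close>
lemma sk_q_properties:
  assumes "0 < \<beta>" "\<beta> < 1/2"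
  shows "0 \<le> sk_q \<beta> h" "sk_q \<beta> h < 1"
    "sk_q \<beta> h = (\<integral>z. (tanh (\<beta> * z * sqrt (sk_q \<beta> h) + h))\<^sup>2 \<partial>gauss1)"
proof -
  define \<psi> where "\<psi> = (\<lambda>r. \<integral>z. (tanh (\<beta> * z * r + h))\<^sup>2 \<partial>gauss1)"
  define P where "P = (\<lambda>q. 0 \<le> q \<and> q = \<psi> (sqrt q))"
  have b: "2 * \<beta>\<^sup>2 < 1/2"
  proof -
    have "\<beta> * \<beta> < 1/2 * (1/2)" using assms by (intro mult_strict_mono) auto
    then show ?thesis by (simp add: power2_eq_square)
  qed
  have "\<exists>r\<ge>0. r \<le> 1 \<and> r\<^sup>2 - \<psi> r = 0"
  proof (rule IVT')
    show "(0::real)\<^sup>2 - \<psi> 0 \<le> 0" using expectation_tanh_sq_range(1)[of \<beta> 0 h] by (simp add: \<psi>_def)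
    show "0 \<le> (1::real)\<^sup>2 - \<psi> 1" using expectation_tanh_sq_range(2)[of \<beta> 1 h] by (simp add: \<psi>_def)
    have "isCont \<psi> r" for r unfolding \<psi>_def by (rule DERIV_isCont[OF expectation_tanh_sq_deriv])
    then show "continuous_on {0..1} (\<lambda>r. r\<^sup>2 - \<psi> r)"
      by (intro continuous_intros continuous_at_imp_continuous_on) auto
  qed auto
  then obtain r where r: "0 \<le> r" "r\<^sup>2 = \<psi> r" by auto
  then have "sqrt (r\<^sup>2) = r" using real_sqrt_abs[of r] by linarith
  then have ex: "P (r\<^sup>2)" unfolding P_def using r(2) by (metis zero_le_power2)
  have le: "u = v" if "P u" "P v" "u \<le> v" for u v
  proof -
    have "\<bar>\<psi> (sqrt v) - \<psi> (sqrt u)\<bar> \<le> 2 * \<beta>\<^sup>2 * ((sqrt v)\<^sup>2 - (sqrt u)\<^sup>2)"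
      unfolding \<psi>_def using that by (intro expectation_tanh_sq_contraction) (auto simp: P_def)
    then have "v - u \<le> 2 * \<beta>\<^sup>2 * (v - u)" using that by (auto simp: P_def)
    also have "\<dots> \<le> 1/2 * (v - u)" using b that by (intro mult_right_mono) auto
    finally show "u = v" using that by simp
  qed
  have "P (sk_q \<beta> h)"
  proof -
    have "sk_q \<beta> h = (THE q. P q)" by (simp add: sk_q_def P_def \<psi>_def)
    moreover have "P (THE q. P q)"
      by (rule theI[of P, OF ex]) (metis le linear ex)
    ultimately show ?thesis by simp
  qed
  then show "0 \<le> sk_q \<beta> h" and e: "sk_q \<beta> h = (\<integral>z. (tanh (\<beta> * z * sqrt (sk_q \<beta> h) + h))\<^sup>2 \<partial>gauss1)"
    by (auto simp: P_def \<psi>_def)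
  show "sk_q \<beta> h < 1" by (subst e) (rule expectation_tanh_sq_range(2))
qed

section \<open>Spins, overlaps and replica inequalities\<close>

text \<open>Hoeffding's lemma for a spin with mean \<open>q\<close>, since \<open>cosh t + q * sinh t\<close> is its moment generating function.\<close>
lemma Hoeffding_spin:
  fixes t q :: real
  assumes "0 \<le> q" "q \<le> 1"
  shows "cosh t + q * sinh t \<le> exp (t * q + t\<^sup>2/2)"
proof -
  have main: "p * exp u + (1 - p) * exp (- u) \<le> exp (u * (2 * p - 1) + u\<^sup>2/2)"
    if "0 \<le> p" "p \<le> 1" "0 \<le> u" for p u :: real
  proof -
    define L where "L = (\<lambda>h. - h * p + ln (1 - p + p * exp h))"
    have pos: "0 < 1 - p + p * exp (2 * u)"
    proof -
      have "1 \<le> exp (2 * u)" using that by simp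
      then have "p * 1 \<le> p * exp (2 * u)" using that by (intro mult_left_mono) auto
      then show ?thesis by simp
    qed
    have "L (2 * u) \<le> (2 * u)\<^sup>2 / 8"
      unfolding L_def using that Hoeffdings_lemma_aux[of "2 * u" p] by (simp add: algebra_simps)
    then have "ln (1 - p + p * exp (2 * u)) \<le> 2 * u * p + u\<^sup>2/2" by (simp add: L_def power_mult_distrib)
    then have "1 - p + p * exp (2 * u) \<le> exp (2 * u * p + u\<^sup>2/2)" using pos by (metis exp_le_cancel_iff exp_ln)
    then have "exp (- u) * (1 - p + p * exp (2 * u)) \<le> exp (- u) * exp (2 * u * p + u\<^sup>2/2)" by simp
    moreover have "exp (- u) * (1 - p + p * exp (2 * u)) = p * exp u + (1 - p) * exp (- u)"
      by (simp add: algebra_simps exp_add[symmetric])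
    ultimately show ?thesis by (simp add: exp_add[symmetric] algebra_simps)
  qed
  define p where "p = (1 + q)/2"
  have p: "q = 2 * p - 1" "0 \<le> p" "p \<le> 1" using assms by (auto simp: p_def field_simps)
  have e: "cosh t + q * sinh t = p * exp t + (1 - p) * exp (- t)"
    unfolding p(1) by (simp add: cosh_field_def sinh_field_def field_simps)
  show ?thesis
  proof (cases "0 \<le> t")
    case True
    then show ?thesis using main[of p t] p unfolding e by simp
  next
    case False
    have "- t * (2 * (1 - p) - 1) + (- t)\<^sup>2/2 = t * q + t\<^sup>2/2" unfolding p(1) by (simp add: algebra_simps)
    then show ?thesis using main[of "1 - p" "- t"] p(2,3) False unfolding e by (simp add: add.commute)
  qed
qed

definition spins :: "nat set \<Rightarrow> (nat \<Rightarrow> real) set" where "spins V = PiE V (\<lambda>_. {-1, 1})"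
definition pairs :: "nat set \<Rightarrow> (nat \<times> nat) set" where "pairs V = {(i, j). i \<in> V \<and> j \<in> V \<and> i < j}"

text \<open>Index \<open>0\<close> is not a site, so \<open>(0, j)\<close> is free to denote the external Gaussian field at \<open>j\<close>.\<close>
definition fields :: "nat set \<Rightarrow> (nat \<times> nat) set" where "fields V = Pair 0 ` V"

text \<open>The normalisation is the number of sites of the full system, also on the reduced one.\<close>
definition overlap :: "nat \<Rightarrow> nat set \<Rightarrow> (nat \<Rightarrow> real) \<Rightarrow> (nat \<Rightarrow> real) \<Rightarrow> real" where
  "overlap N V \<sigma> \<tau> = (\<Sum>j\<in>V. \<sigma> j * \<tau> j) / real N"

text \<open>The energy feature multiplying the Gaussian of index \<open>e\<close>.\<close>
definition feat :: "nat \<times> nat \<Rightarrow> (nat \<Rightarrow> real) \<Rightarrow> real" where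
  "feat e \<sigma> = (if fst e = 0 then \<sigma> (snd e) else \<sigma> (fst e) * \<sigma> (snd e))"

lemma spins_finite: "finite V \<Longrightarrow> finite (spins V)" unfolding spins_def by (intro finite_PiE) auto
lemma spins_nonempty: "spins V \<noteq> {}" unfolding spins_def by (auto simp: PiE_eq_empty_iff)
lemma spins_sq: "\<sigma> \<in> spins V \<Longrightarrow> j \<in> V \<Longrightarrow> \<sigma> j * \<sigma> j = 1"
  unfolding spins_def using PiE_mem[of \<sigma> V "\<lambda>_. {-1, 1}" j] by auto
lemma spins_abs: "\<sigma> \<in> spins V \<Longrightarrow> j \<in> V \<Longrightarrow> \<bar>\<sigma> j\<bar> = 1"
  unfolding spins_def using PiE_mem[of \<sigma> V "\<lambda>_. {-1, 1}" j] by auto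

lemma pairs_finite: "finite V \<Longrightarrow> finite (pairs V)"
  by (rule finite_subset[of _ "V \<times> V"]) (auto simp: pairs_def)

lemma sum_pairs:
  fixes u :: "nat \<Rightarrow> real"
  assumes "finite V"
  shows "(\<Sum>(i, j)\<in>pairs V. u i * u j) = ((\<Sum>i\<in>V. u i)\<^sup>2 - (\<Sum>i\<in>V. (u i)\<^sup>2)) / 2"
proof -
  define P where "P = (\<Sum>(i, j)\<in>pairs V. u i * u j)"
  have fin: "finite (pairs V)" by (rule pairs_finite[OF assms])
  have "(\<Sum>i\<in>V. u i)\<^sup>2 = (\<Sum>(i, j)\<in>V \<times> V. u i * u j)"
    by (simp add: power2_eq_square sum_product sum.cartesian_product)
  also have "V \<times> V = (pairs V \<union> prod.swap ` pairs V) \<union> (\<lambda>i. (i, i)) ` V"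
    by (auto simp: pairs_def image_iff prod.swap_def)
  also have "(\<Sum>(i, j)\<in>\<dots>. u i * u j) = (\<Sum>(i, j)\<in>pairs V. u i * u j) + (\<Sum>(i, j)\<in>prod.swap ` pairs V. u i * u j) + (\<Sum>(i, j)\<in>(\<lambda>i. (i, i)) ` V. u i * u j)"
    using assms fin by (subst sum.union_disjoint, auto simp: pairs_def prod.swap_def)+
  also have "(\<Sum>(i, j)\<in>prod.swap ` pairs V. u i * u j) = P"
    unfolding P_def by (subst sum.reindex) (auto simp: inj_on_def case_prod_unfold mult.commute)
  also have "(\<Sum>(i, j)\<in>(\<lambda>i. (i, i)) ` V. u i * u j) = (\<Sum>i\<in>V. (u i)\<^sup>2)"
    by (subst sum.reindex) (auto simp: inj_on_def power2_eq_square)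
  finally show ?thesis by (simp add: P_def)
qed

text \<open>Two increasing functions of the same variable are positively correlated.\<close>
lemma Chebyshev_exp:
  fixes w \<rho> :: "'a \<Rightarrow> real" and \<Lambda> :: real
  assumes "finite A" "\<And>a. a \<in> A \<Longrightarrow> 0 \<le> w a" "(\<Sum>a\<in>A. w a) = 1" "0 \<le> \<Lambda>"
  shows "(\<Sum>a\<in>A. w a * exp (\<Lambda> * \<rho> a)) * (\<Sum>a\<in>A. w a * \<rho> a) \<le> (\<Sum>a\<in>A. w a * (exp (\<Lambda> * \<rho> a) * \<rho> a))"
proof -
  define F where "F = (\<lambda>a. exp (\<Lambda> * \<rho> a))"
  have "0 \<le> (\<Sum>a\<in>A. \<Sum>b\<in>A. w a * w b * ((F a - F b) * (\<rho> a - \<rho> b)))"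
  proof (intro sum_nonneg)
    fix a b assume ab: "a \<in> A" "b \<in> A"
    have "0 \<le> (F a - F b) * (\<rho> a - \<rho> b)"
    proof (cases "\<rho> a \<le> \<rho> b")
      case True
      then have "F a \<le> F b" using assms(4) by (simp add: F_def mult_left_mono)
      with True show ?thesis by (intro mult_nonpos_nonpos) auto
    next
      case False
      then have "F b \<le> F a" using assms(4) by (simp add: F_def mult_left_mono)
      with False show ?thesis by (intro mult_nonneg_nonneg) auto
    qed
    then show "0 \<le> w a * w b * ((F a - F b) * (\<rho> a - \<rho> b))"
      using assms(2)[OF ab(1)] assms(2)[OF ab(2)] by simp
  qed
  also have "\<dots> = 2 * (\<Sum>a\<in>A. w a * (F a * \<rho> a)) - 2 * ((\<Sum>a\<in>A. w a * F a) * (\<Sum>a\<in>A. w a * \<rho> a))"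
  proof -
    have e: "w a * w b * ((F a - F b) * (\<rho> a - \<rho> b)) = w a * (F a * \<rho> a) * w b + w a * (w b * (F b * \<rho> b))
       - (w a * F a) * (w b * \<rho> b) - (w a * \<rho> a) * (w b * F b)" for a b by (simp add: algebra_simps)
    show ?thesis unfolding e sum_subtractf sum.distrib sum_distrib_left[symmetric] sum_distrib_right[symmetric] assms(3)
      by (simp add: mult.commute)
  qed
  finally show ?thesis by (simp add: F_def)
qed

text \<open>Integration by parts in a two-replica system turns into overlaps between up to four replicas.\<close>
lemma replica_bracket:
  fixes w :: "'c \<Rightarrow> real" and s :: "'e \<Rightarrow> 'c \<Rightarrow> real" and f :: "'c \<Rightarrow> 'c \<Rightarrow> real"
  assumes fin: "finite C" and w1: "(\<Sum>\<sigma>\<in>C. w \<sigma>) = 1"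
    and s: "\<And>\<sigma>. \<sigma> \<in> C \<Longrightarrow> s e \<sigma> * s e \<sigma> = 1"
    and f: "\<And>\<sigma> \<tau>. f \<sigma> \<tau> = f \<tau> \<sigma>"
  defines "av2 \<equiv> \<lambda>\<phi>. \<Sum>\<sigma>\<in>C. \<Sum>\<tau>\<in>C. w \<sigma> * w \<tau> * \<phi> \<sigma> \<tau>"
  shows "av2 (\<lambda>\<sigma> \<tau>. f \<sigma> \<tau> * (s e \<sigma> + s e \<tau>)\<^sup>2) - av2 f * av2 (\<lambda>\<sigma> \<tau>. (s e \<sigma> + s e \<tau>)\<^sup>2)
      - 2 * av2 (\<lambda>\<sigma> \<tau>. f \<sigma> \<tau> * (s e \<sigma> + s e \<tau>)) * av2 (\<lambda>\<sigma> \<tau>. s e \<sigma> + s e \<tau>) + 2 * av2 f * (av2 (\<lambda>\<sigma> \<tau>. s e \<sigma> + s e \<tau>))\<^sup>2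
    = 2 * av2 (\<lambda>\<sigma> \<tau>. f \<sigma> \<tau> * (s e \<sigma> * s e \<tau>)) - 8 * (\<Sum>\<sigma>\<in>C. \<Sum>\<tau>\<in>C. \<Sum>\<rho>\<in>C. w \<sigma> * w \<tau> * w \<rho> * (f \<sigma> \<tau> * (s e \<sigma> * s e \<rho>)))
      + 6 * av2 f * av2 (\<lambda>\<sigma> \<tau>. s e \<sigma> * s e \<tau>)"
proof -
  define m where "m = (\<Sum>\<sigma>\<in>C. w \<sigma> * s e \<sigma>)"
  define F1 where "F1 = av2 (\<lambda>\<sigma> \<tau>. f \<sigma> \<tau> * (s e \<sigma> * s e \<tau>))"
  define G1 where "G1 = av2 (\<lambda>\<sigma> \<tau>. f \<sigma> \<tau> * s e \<sigma>)"
  have sq: "(s e \<sigma> + s e \<tau>)\<^sup>2 = 2 + 2 * (s e \<sigma> * s e \<tau>)" if "\<sigma> \<in> C" "\<tau> \<in> C" for \<sigma> \<tau>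
    using s[OF that(1)] s[OF that(2)] by (simp add: power2_eq_square algebra_simps)
  have 1: "av2 (\<lambda>\<sigma> \<tau>. f \<sigma> \<tau> * (s e \<sigma> + s e \<tau>)\<^sup>2) = 2 * av2 f + 2 * F1"
    unfolding av2_def F1_def sum_distrib_left sum.distrib[symmetric]
    by (intro sum.cong refl) (simp add: sq algebra_simps)
  have ss: "av2 (\<lambda>\<sigma> \<tau>. s e \<sigma> * s e \<tau>) = m * m"
    unfolding av2_def m_def sum_product by (simp add: mult_ac)
  have one: "av2 (\<lambda>\<sigma> \<tau>. k) = k" for k
    unfolding av2_def by (simp add: sum_distrib_left[symmetric] sum_distrib_right[symmetric] w1)
  have 2: "av2 (\<lambda>\<sigma> \<tau>. (s e \<sigma> + s e \<tau>)\<^sup>2) = 2 + 2 * (m * m)"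
  proof -
    have "av2 (\<lambda>\<sigma> \<tau>. (s e \<sigma> + s e \<tau>)\<^sup>2) = av2 (\<lambda>\<sigma> \<tau>. 2) + 2 * av2 (\<lambda>\<sigma> \<tau>. s e \<sigma> * s e \<tau>)"
      unfolding av2_def sum_distrib_left sum.distrib[symmetric]
      by (intro sum.cong refl) (simp add: sq algebra_simps)
    then show ?thesis by (simp add: one ss)
  qed
  have 3: "av2 (\<lambda>\<sigma> \<tau>. s e \<sigma> + s e \<tau>) = 2 * m"
  proof -
    have "av2 (\<lambda>\<sigma> \<tau>. s e \<sigma> + s e \<tau>) = (\<Sum>\<sigma>\<in>C. w \<sigma> * s e \<sigma>) * (\<Sum>\<tau>\<in>C. w \<tau>) + (\<Sum>\<sigma>\<in>C. w \<sigma>) * (\<Sum>\<tau>\<in>C. w \<tau> * s e \<tau>)"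
      unfolding av2_def sum_product sum.distrib[symmetric] by (intro sum.cong refl) (simp add: algebra_simps)
    then show ?thesis by (simp add: w1 m_def)
  qed
  have 4: "av2 (\<lambda>\<sigma> \<tau>. f \<sigma> \<tau> * (s e \<sigma> + s e \<tau>)) = 2 * G1"
  proof -
    have "av2 (\<lambda>\<sigma> \<tau>. f \<sigma> \<tau> * s e \<tau>) = G1"
      unfolding av2_def G1_def by (subst sum.swap) (simp add: f mult_ac)
    moreover have "av2 (\<lambda>\<sigma> \<tau>. f \<sigma> \<tau> * (s e \<sigma> + s e \<tau>)) = G1 + av2 (\<lambda>\<sigma> \<tau>. f \<sigma> \<tau> * s e \<tau>)"
      unfolding av2_def G1_def sum.distrib[symmetric] by (intro sum.cong refl) (simp add: algebra_simps)
    ultimately show ?thesis by simp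
  qed
  have 5: "(\<Sum>\<sigma>\<in>C. \<Sum>\<tau>\<in>C. \<Sum>\<rho>\<in>C. w \<sigma> * w \<tau> * w \<rho> * (f \<sigma> \<tau> * (s e \<sigma> * s e \<rho>))) = G1 * m"
  proof -
    have "(\<Sum>\<rho>\<in>C. w \<sigma> * w \<tau> * w \<rho> * (f \<sigma> \<tau> * (s e \<sigma> * s e \<rho>))) = w \<sigma> * w \<tau> * (f \<sigma> \<tau> * s e \<sigma>) * m" for \<sigma> \<tau>
      unfolding m_def by (simp add: sum_distrib_left mult_ac)
    then show ?thesis unfolding G1_def av2_def sum_distrib_right by simp
  qed
  show ?thesis unfolding 1 2 3 4 5 ss F1_def[symmetric] by (simp add: power2_eq_square algebra_simps)
qed

text \<open>The couplings add up to overlaps, so the sum over \<open>e\<close> of the brackets is a combination of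
\<open>\<langle>f * \<rho>\<rangle>\<close>, of the same with a third replica, and of \<open>\<langle>f\<rangle> * \<langle>\<rho>\<rangle>\<close>. The constant \<open>b\<close> cancels,
the middle term has the good sign and is dropped, and \<open>Chebyshev_exp\<close> absorbs the last one into the first:
\<open>2 + 6 = 8\<close>.\<close>
lemma replica_bracket_sum_le:
  fixes w :: "'c \<Rightarrow> real" and s :: "'e \<Rightarrow> 'c \<Rightarrow> real" and \<rho> :: "'c \<Rightarrow> 'c \<Rightarrow> real"
  assumes fin: "finite C" and w0: "\<And>\<sigma>. \<sigma> \<in> C \<Longrightarrow> 0 \<le> w \<sigma>" and w1: "(\<Sum>\<sigma>\<in>C. w \<sigma>) = 1"
    and s: "\<And>e \<sigma>. e \<in> E \<Longrightarrow> \<sigma> \<in> C \<Longrightarrow> s e \<sigma> * s e \<sigma> = 1"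
    and \<rho>: "\<And>\<sigma> \<tau>. \<rho> \<sigma> \<tau> = \<rho> \<tau> \<sigma>" "\<And>\<sigma> \<tau>. 0 \<le> \<rho> \<sigma> \<tau>"
    and k: "\<And>\<sigma> \<tau>. \<sigma> \<in> C \<Longrightarrow> \<tau> \<in> C \<Longrightarrow> (\<Sum>e\<in>E. k e * (s e \<sigma> * s e \<tau>)) = a * (\<rho> \<sigma> \<tau> + b)"
    and a: "0 \<le> a" and \<Lambda>: "0 \<le> \<Lambda>"
  defines "av2 \<equiv> \<lambda>\<phi>. \<Sum>\<sigma>\<in>C. \<Sum>\<tau>\<in>C. w \<sigma> * w \<tau> * \<phi> \<sigma> \<tau>"
  defines "f \<equiv> \<lambda>\<sigma> \<tau>. exp (\<Lambda> * \<rho> \<sigma> \<tau>)"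
  shows "(\<Sum>e\<in>E. k e * (av2 (\<lambda>\<sigma> \<tau>. f \<sigma> \<tau> * (s e \<sigma> + s e \<tau>)\<^sup>2) - av2 f * av2 (\<lambda>\<sigma> \<tau>. (s e \<sigma> + s e \<tau>)\<^sup>2)
      - 2 * av2 (\<lambda>\<sigma> \<tau>. f \<sigma> \<tau> * (s e \<sigma> + s e \<tau>)) * av2 (\<lambda>\<sigma> \<tau>. s e \<sigma> + s e \<tau>) + 2 * av2 f * (av2 (\<lambda>\<sigma> \<tau>. s e \<sigma> + s e \<tau>))\<^sup>2))
    \<le> 8 * a * av2 (\<lambda>\<sigma> \<tau>. f \<sigma> \<tau> * \<rho> \<sigma> \<tau>)"
proof -
  have fsym: "f \<sigma> \<tau> = f \<tau> \<sigma>" for \<sigma> \<tau> by (simp add: f_def \<rho>(1))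
  define av3 where "av3 = (\<lambda>\<phi>. \<Sum>\<sigma>\<in>C. \<Sum>\<tau>\<in>C. \<Sum>\<rho>\<in>C. w \<sigma> * w \<tau> * w \<rho> * \<phi> \<sigma> \<tau> \<rho> :: real)"
  have kav2: "(\<Sum>e\<in>E. k e * av2 (\<lambda>\<sigma> \<tau>. g \<sigma> \<tau> * (s e \<sigma> * s e \<tau>))) = a * av2 (\<lambda>\<sigma> \<tau>. g \<sigma> \<tau> * \<rho> \<sigma> \<tau>) + a * b * av2 g" for g
  proof -
    have "(\<Sum>e\<in>E. k e * av2 (\<lambda>\<sigma> \<tau>. g \<sigma> \<tau> * (s e \<sigma> * s e \<tau>))) = (\<Sum>\<sigma>\<in>C. \<Sum>\<tau>\<in>C. w \<sigma> * w \<tau> * g \<sigma> \<tau> * (\<Sum>e\<in>E. k e * (s e \<sigma> * s e \<tau>)))"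
      unfolding av2_def sum_distrib_left by (subst sum.swap, subst (2) sum.swap) (simp add: mult_ac)
    also have "\<dots> = (\<Sum>\<sigma>\<in>C. \<Sum>\<tau>\<in>C. w \<sigma> * w \<tau> * g \<sigma> \<tau> * (a * (\<rho> \<sigma> \<tau> + b)))"
      by (intro sum.cong refl) (simp add: k)
    also have "\<dots> = a * av2 (\<lambda>\<sigma> \<tau>. g \<sigma> \<tau> * \<rho> \<sigma> \<tau>) + a * b * av2 g"
      unfolding av2_def sum_distrib_left sum.distrib[symmetric] by (intro sum.cong refl) (simp add: algebra_simps)
    finally show ?thesis .
  qed
  have kav3: "(\<Sum>e\<in>E. k e * av3 (\<lambda>\<sigma> \<tau> \<rho>. f \<sigma> \<tau> * (s e \<sigma> * s e \<rho>))) = a * av3 (\<lambda>\<sigma> \<tau> \<rho>'. f \<sigma> \<tau> * \<rho> \<sigma> \<rho>') + a * b * av2 f"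
  proof -
    have "(\<Sum>e\<in>E. k e * av3 (\<lambda>\<sigma> \<tau> \<rho>. f \<sigma> \<tau> * (s e \<sigma> * s e \<rho>))) = (\<Sum>\<sigma>\<in>C. \<Sum>e\<in>E. \<Sum>\<tau>\<in>C. \<Sum>\<rho>\<in>C. w \<sigma> * w \<tau> * w \<rho> * f \<sigma> \<tau> * (k e * (s e \<sigma> * s e \<rho>)))"
      unfolding av3_def sum_distrib_left by (subst sum.swap) (simp add: mult_ac)
    also have "\<dots> = (\<Sum>\<sigma>\<in>C. \<Sum>\<tau>\<in>C. \<Sum>e\<in>E. \<Sum>\<rho>\<in>C. w \<sigma> * w \<tau> * w \<rho> * f \<sigma> \<tau> * (k e * (s e \<sigma> * s e \<rho>)))"
      by (intro sum.cong refl sum.swap)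
    also have "\<dots> = (\<Sum>\<sigma>\<in>C. \<Sum>\<tau>\<in>C. \<Sum>\<rho>\<in>C. \<Sum>e\<in>E. w \<sigma> * w \<tau> * w \<rho> * f \<sigma> \<tau> * (k e * (s e \<sigma> * s e \<rho>)))"
      by (intro sum.cong refl sum.swap)
    also have "\<dots> = (\<Sum>\<sigma>\<in>C. \<Sum>\<tau>\<in>C. \<Sum>\<rho>'\<in>C. w \<sigma> * w \<tau> * w \<rho>' * f \<sigma> \<tau> * (a * (\<rho> \<sigma> \<rho>' + b)))"
      unfolding sum_distrib_left[symmetric] by (intro sum.cong refl) (simp add: k)
    also have "\<dots> = a * av3 (\<lambda>\<sigma> \<tau> \<rho>'. f \<sigma> \<tau> * \<rho> \<sigma> \<rho>') + a * b * av3 (\<lambda>\<sigma> \<tau> \<rho>'. f \<sigma> \<tau>)"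
      unfolding av3_def sum_distrib_left sum.distrib[symmetric] by (intro sum.cong refl) (simp add: algebra_simps)
    also have "av3 (\<lambda>\<sigma> \<tau> \<rho>'. f \<sigma> \<tau>) = av2 f"
    proof -
      have "(\<Sum>\<rho>'\<in>C. w \<sigma> * w \<tau> * w \<rho>' * f \<sigma> \<tau>) = w \<sigma> * w \<tau> * f \<sigma> \<tau>" for \<sigma> \<tau>
        using w1 by (simp add: sum_distrib_left[symmetric] sum_distrib_right[symmetric])
      then show ?thesis unfolding av3_def av2_def by simp
    qed
    finally show ?thesis .
  qed
  have one: "av2 (\<lambda>\<sigma> \<tau>. 1) = 1"
    unfolding av2_def by (simp add: sum_distrib_left[symmetric] sum_distrib_right[symmetric] w1)
  have "(\<Sum>e\<in>E. k e * (av2 (\<lambda>\<sigma> \<tau>. f \<sigma> \<tau> * (s e \<sigma> + s e \<tau>)\<^sup>2) - av2 f * av2 (\<lambda>\<sigma> \<tau>. (s e \<sigma> + s e \<tau>)\<^sup>2)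
      - 2 * av2 (\<lambda>\<sigma> \<tau>. f \<sigma> \<tau> * (s e \<sigma> + s e \<tau>)) * av2 (\<lambda>\<sigma> \<tau>. s e \<sigma> + s e \<tau>) + 2 * av2 f * (av2 (\<lambda>\<sigma> \<tau>. s e \<sigma> + s e \<tau>))\<^sup>2))
    = (\<Sum>e\<in>E. k e * (2 * av2 (\<lambda>\<sigma> \<tau>. f \<sigma> \<tau> * (s e \<sigma> * s e \<tau>)) - 8 * av3 (\<lambda>\<sigma> \<tau> \<rho>. f \<sigma> \<tau> * (s e \<sigma> * s e \<rho>))
      + 6 * av2 f * av2 (\<lambda>\<sigma> \<tau>. 1 * (s e \<sigma> * s e \<tau>))))"
    unfolding av2_def av3_def mult_1
    by (intro sum.cong refl arg_cong2[where f="(*)"] replica_bracket fin w1 s fsym)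
  also have "\<dots> = 2 * (\<Sum>e\<in>E. k e * av2 (\<lambda>\<sigma> \<tau>. f \<sigma> \<tau> * (s e \<sigma> * s e \<tau>))) - 8 * (\<Sum>e\<in>E. k e * av3 (\<lambda>\<sigma> \<tau> \<rho>. f \<sigma> \<tau> * (s e \<sigma> * s e \<rho>)))
      + 6 * av2 f * (\<Sum>e\<in>E. k e * av2 (\<lambda>\<sigma> \<tau>. 1 * (s e \<sigma> * s e \<tau>)))"
    by (simp add: sum_distrib_left sum_subtractf sum.distrib algebra_simps)
  also have "\<dots> = a * (2 * av2 (\<lambda>\<sigma> \<tau>. f \<sigma> \<tau> * \<rho> \<sigma> \<tau>) - 8 * av3 (\<lambda>\<sigma> \<tau> \<rho>'. f \<sigma> \<tau> * \<rho> \<sigma> \<rho>') + 6 * (av2 f * av2 \<rho>))"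
    unfolding kav2 kav3 one by (simp add: algebra_simps)
  also have "\<dots> \<le> a * (8 * av2 (\<lambda>\<sigma> \<tau>. f \<sigma> \<tau> * \<rho> \<sigma> \<tau>))"
  proof (rule mult_left_mono[OF _ a])
    have "0 \<le> av3 (\<lambda>\<sigma> \<tau> \<rho>'. f \<sigma> \<tau> * \<rho> \<sigma> \<rho>')"
      unfolding av3_def using w0 \<rho>(2) by (intro sum_nonneg mult_nonneg_nonneg) (auto simp: f_def)
    moreover have "av2 f * av2 \<rho> \<le> av2 (\<lambda>\<sigma> \<tau>. f \<sigma> \<tau> * \<rho> \<sigma> \<tau>)"
    proof -
      have e: "av2 g = (\<Sum>p\<in>C \<times> C. (w (fst p) * w (snd p)) * g (fst p) (snd p))" for g
        unfolding av2_def by (simp add: sum.cartesian_product case_prod_unfold)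
      show ?thesis unfolding e f_def
      proof (rule Chebyshev_exp[OF _ _ _ \<Lambda>])
        show "(\<Sum>p\<in>C \<times> C. w (fst p) * w (snd p)) = 1" using e[of "\<lambda>_ _. 1"] one by simp
      qed (use fin w0 in auto)
    qed
    ultimately show "2 * av2 (\<lambda>\<sigma> \<tau>. f \<sigma> \<tau> * \<rho> \<sigma> \<tau>) - 8 * av3 (\<lambda>\<sigma> \<tau> \<rho>'. f \<sigma> \<tau> * \<rho> \<sigma> \<rho>') + 6 * (av2 f * av2 \<rho>) \<le> 8 * av2 (\<lambda>\<sigma> \<tau>. f \<sigma> \<tau> * \<rho> \<sigma> \<tau>)"
      by linarith
  qed
  finally show ?thesis by simp
qed

section \<open>Exponential concentration of the overlap\<close>

lemma integral_gauss1_exp: "(\<integral>z. exp (c * z) \<partial>gauss1) = exp (c\<^sup>2/2)"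
  by (subst integral_eq_nn_integral) (auto simp: nn_integral_gauss1_exp)

lemma integral_gauss1_exp_square: "a < 1/2 \<Longrightarrow> (\<integral>z. exp (a * z\<^sup>2) \<partial>gauss1) = 1 / sqrt (1 - 2*a)"
  by (subst integral_eq_nn_integral) (auto simp: nn_integral_gauss1_exp_square)

lemma fields_finite: "finite V \<Longrightarrow> finite (fields V)" by (simp add: fields_def)

definition cav_energy :: "nat \<Rightarrow> real \<Rightarrow> real \<Rightarrow> nat set \<Rightarrow> (nat \<times> nat \<Rightarrow> real) \<Rightarrow> (nat \<Rightarrow> real) \<Rightarrow> real" where
  "cav_energy N \<beta> h V x \<sigma> = \<beta> / sqrt (real N) * (\<Sum>(i, j)\<in>pairs V. x (i, j) * \<sigma> i * \<sigma> j) + h * (\<Sum>i\<in>V. \<sigma> i)"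

definition cav_weight :: "nat \<Rightarrow> real \<Rightarrow> real \<Rightarrow> nat set \<Rightarrow> (nat \<times> nat \<Rightarrow> real) \<Rightarrow> (nat \<Rightarrow> real) \<Rightarrow> real" where
  "cav_weight N \<beta> h V x \<sigma> = exp (cav_energy N \<beta> h V x \<sigma>) / (\<Sum>\<tau>\<in>spins V. exp (cav_energy N \<beta> h V x \<tau>))"

text \<open>The path from independent spins with random fields \<open>\<beta> * sqrt q * z + h\<close> (angle \<open>0\<close>) to the
system with couplings (angle \<open>pi / 2\<close>). The set \<open>V\<close> may miss one site of the \<open>N\<close> that enter the normalisation.\<close>
locale latala =
  fixes N :: nat and V :: "nat set" and \<beta> q h \<kappa> :: real
  assumes finV: "finite V" and V0: "0 \<notin> V" and N1: "1 \<le> N" and VN: "card V \<le> N" and NV: "N \<le> card V + 1"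
    and \<beta>: "0 < \<beta>" and q0: "0 \<le> q" and q1: "q \<le> 1"
    and qfix: "q = (\<integral>z. (tanh (\<beta> * z * sqrt q + h))\<^sup>2 \<partial>gauss1)"
    and \<kappa>2: "2 * \<beta>\<^sup>2 \<le> \<kappa>"
begin

abbreviation "C \<equiv> spins V"
definition E :: "(nat \<times> nat) set" where "E = pairs V \<union> fields V"
definition cc where "cc \<theta> e = (if fst e = (0::nat) then \<beta> * sqrt q * cos \<theta> else \<beta> / sqrt (real N) * sin \<theta>)" for \<theta> and e :: "nat \<times> nat"
definition cc' where "cc' \<theta> e = (if fst e = (0::nat) then - \<beta> * sqrt q * sin \<theta> else \<beta> / sqrt (real N) * cos \<theta>)" for \<theta> and e :: "nat \<times> nat"

text \<open>The exponent decreases by exactly what the interpolation may gain: \<open>2 * \<beta>\<^sup>2\<close> over the whole path.\<close>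
definition lam where "lam \<theta> = \<kappa> - 2 * \<beta>\<^sup>2 * (sin \<theta>)\<^sup>2" for \<theta> :: real
definition \<rho> where "\<rho> \<sigma> \<tau> = (overlap N V \<sigma> \<tau> - q)\<^sup>2"
definition ff where "ff \<theta> p = exp (lam \<theta> * (real N * \<rho> (fst p) (snd p)))" for \<theta> p
definition ff' where "ff' \<theta> p = - 4 * \<beta>\<^sup>2 * sin \<theta> * cos \<theta> * (real N * \<rho> (fst p) (snd p)) * ff \<theta> p" for \<theta> p
definition Sg where "Sg e p = feat e (fst p) + feat e (snd p)" for e p
definition hh where "hh p = h * (\<Sum>i\<in>V. fst p i) + h * (\<Sum>i\<in>V. snd p i)" for p :: "(nat \<Rightarrow> real) \<times> (nat \<Rightarrow> real)"

lemma finC: "finite C" by (rule spins_finite[OF finV])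
lemma finE: "finite E" using finV by (simp add: E_def pairs_finite fields_finite)

lemma pairs_fst: "e \<in> pairs V \<Longrightarrow> fst e \<noteq> 0"
proof -
  assume "e \<in> pairs V"
  then have "fst e \<in> V" by (auto simp: pairs_def)
  with V0 show ?thesis by metis
qed

lemma feat_sq: "e \<in> E \<Longrightarrow> \<sigma> \<in> C \<Longrightarrow> feat e \<sigma> * feat e \<sigma> = 1"
proof -
  assume e: "e \<in> E" and s: "\<sigma> \<in> C"
  have 1: "fst e \<in> V \<or> fst e = 0" and 2: "snd e \<in> V" using e by (auto simp: E_def pairs_def fields_def)
  show ?thesis using 1 2 spins_sq[OF s, of "fst e"] spins_sq[OF s, of "snd e"]
    by (auto simp: feat_def mult.assoc mult.left_commute[of "\<sigma> (snd e)"])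
qed

lemma feat_abs: "e \<in> E \<Longrightarrow> \<sigma> \<in> C \<Longrightarrow> \<bar>feat e \<sigma>\<bar> \<le> 1"
  using feat_sq[of e \<sigma>] by (metis abs_square_le_1 order_refl power2_eq_square)

lemma overlap_sym: "overlap N V \<sigma> \<tau> = overlap N V \<tau> \<sigma>" by (simp add: overlap_def mult.commute)

lemma overlap_le: assumes "\<sigma> \<in> C" "\<tau> \<in> C" shows "\<bar>overlap N V \<sigma> \<tau>\<bar> \<le> 1"
proof -
  have "\<bar>\<Sum>j\<in>V. \<sigma> j * \<tau> j\<bar> \<le> (\<Sum>j\<in>V. 1)"
    using assms spins_abs by (intro order_trans[OF sum_abs] sum_mono) (auto simp: abs_mult)
  also have "\<dots> \<le> real N" using VN by simp
  finally show ?thesis using N1 by (simp add: overlap_def)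
qed

lemma \<rho>_nonneg: "0 \<le> \<rho> \<sigma> \<tau>" by (simp add: \<rho>_def)
lemma \<rho>_le: assumes "\<sigma> \<in> C" "\<tau> \<in> C" shows "\<rho> \<sigma> \<tau> \<le> 4"
proof -
  have "\<bar>overlap N V \<sigma> \<tau> - q\<bar> \<le> 2" using overlap_le[OF assms] q0 q1 by linarith
  then have "(overlap N V \<sigma> \<tau> - q)\<^sup>2 \<le> 2\<^sup>2" using power2_le_iff_abs_le[of "2::real"] by simp
  then show ?thesis by (simp add: \<rho>_def)
qed

lemma lam_bounds: "0 \<le> lam \<theta>" "lam \<theta> \<le> \<kappa>"
proof -
  have "2 * \<beta>\<^sup>2 * (sin \<theta>)\<^sup>2 \<le> 2 * \<beta>\<^sup>2 * 1" by (intro mult_left_mono) (auto simp: abs_square_le_1)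
  then show "0 \<le> lam \<theta>" using \<kappa>2 by (simp add: lam_def)
  show "lam \<theta> \<le> \<kappa>" by (simp add: lam_def)
qed

lemma ff_le: assumes "p \<in> C \<times> C" shows "\<bar>ff \<theta> p\<bar> \<le> exp (\<kappa> * (real N * 4))"
proof -
  have "\<rho> (fst p) (snd p) \<le> 4" using assms by (intro \<rho>_le) auto
  then have "lam \<theta> * (real N * \<rho> (fst p) (snd p)) \<le> \<kappa> * (real N * 4)"
    using lam_bounds[of \<theta>] \<rho>_nonneg by (intro mult_mono) auto
  then show ?thesis by (simp add: ff_def)
qed

sublocale gibbs_path "C \<times> C" E Sg hh cc cc' ff ff' 2 "\<beta> * sqrt q + \<beta>" "(1 + 4 * \<beta>\<^sup>2 * (real N * 4)) * exp (\<kappa> * (real N * 4))"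
proof
  show "finite (C \<times> C)" using finC by simp
  show "C \<times> C \<noteq> {}" using spins_nonempty by auto
  show "finite E" by (rule finE)
  show "\<bar>Sg e p\<bar> \<le> 2" if "e \<in> E" "p \<in> C \<times> C" for e p
    using feat_abs[OF that(1), of "fst p"] feat_abs[OF that(1), of "snd p"] that(2) by (auto simp: Sg_def)
  show "((\<lambda>\<theta>. cc \<theta> e) has_real_derivative cc' \<theta> e) (at \<theta>)" for e \<theta>
    unfolding cc_def cc'_def using DERIV_cmult[OF DERIV_sin, of "\<beta> / sqrt (real N)"]
    by (cases "fst e = 0") (auto intro!: derivative_eq_intros)
  have sN: "\<beta> / sqrt (real N) \<le> \<beta>" using N1 \<beta> by (simp add: divide_le_eq)
  have b: "\<bar>\<beta> * sqrt q * c\<bar> \<le> \<beta> * sqrt q + \<beta>" "\<bar>\<beta> / sqrt (real N) * c\<bar> \<le> \<beta> * sqrt q + \<beta>" if "\<bar>c\<bar> \<le> 1" for c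
  proof -
    have "\<bar>\<beta> * sqrt q * c\<bar> \<le> (\<beta> * sqrt q) * 1" unfolding abs_mult[of "\<beta> * sqrt q"] using that \<beta> q0 by (intro mult_mono) auto
    then show "\<bar>\<beta> * sqrt q * c\<bar> \<le> \<beta> * sqrt q + \<beta>" using \<beta> by simp
    have "\<bar>\<beta> / sqrt (real N) * c\<bar> \<le> \<beta> * 1" unfolding abs_mult[of "\<beta> / sqrt (real N)"] using that \<beta> sN by (intro mult_mono) auto
    then show "\<bar>\<beta> / sqrt (real N) * c\<bar> \<le> \<beta> * sqrt q + \<beta>" using \<beta> q0 by (simp add: add_increasing)
  qed
  show "\<bar>cc \<theta> e\<bar> \<le> \<beta> * sqrt q + \<beta>" for \<theta> e unfolding cc_def using b[of "cos \<theta>"] b[of "sin \<theta>"] by auto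
  show "\<bar>cc' \<theta> e\<bar> \<le> \<beta> * sqrt q + \<beta>" for \<theta> e unfolding cc'_def using b[of "cos \<theta>"] b[of "sin \<theta>"] by auto
  show "((\<lambda>\<theta>. ff \<theta> p) has_real_derivative ff' \<theta> p) (at \<theta>)" for p \<theta>
    unfolding ff'_def ff_def lam_def by (auto intro!: derivative_eq_intros simp: mult_ac)
  show "\<bar>ff \<theta> p\<bar> \<le> (1 + 4 * \<beta>\<^sup>2 * (real N * 4)) * exp (\<kappa> * (real N * 4))" if "p \<in> C \<times> C" for p \<theta>
  proof -
    have "1 * exp (\<kappa> * (real N * 4)) \<le> (1 + 4 * \<beta>\<^sup>2 * (real N * 4)) * exp (\<kappa> * (real N * 4))"
      by (intro mult_right_mono) auto
    then show ?thesis using ff_le[OF that, of \<theta>] by linarith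
  qed
  show "\<bar>ff' \<theta> p\<bar> \<le> (1 + 4 * \<beta>\<^sup>2 * (real N * 4)) * exp (\<kappa> * (real N * 4))" if p: "p \<in> C \<times> C" for p \<theta>
  proof -
    have sc: "\<bar>sin \<theta> * cos \<theta>\<bar> \<le> 1 * 1" unfolding abs_mult by (intro mult_mono) auto
    have r: "\<rho> (fst p) (snd p) \<le> 4" using p by (intro \<rho>_le) auto
    have "\<bar>ff' \<theta> p\<bar> = (4 * \<beta>\<^sup>2 * \<bar>sin \<theta> * cos \<theta>\<bar>) * (real N * \<rho> (fst p) (snd p)) * \<bar>ff \<theta> p\<bar>"
      using \<rho>_nonneg by (simp add: ff'_def abs_mult)
    also have "\<dots> \<le> (4 * \<beta>\<^sup>2 * 1) * (real N * 4) * exp (\<kappa> * (real N * 4))"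
      using sc r \<rho>_nonneg by (intro mult_mono ff_le p) auto
    also have "\<dots> \<le> (1 + 4 * \<beta>\<^sup>2 * (real N * 4)) * exp (\<kappa> * (real N * 4))"
      by (intro mult_right_mono) auto
    finally show ?thesis .
  qed
qed

definition en1 where "en1 \<theta> x \<sigma> = (\<Sum>e\<in>E. cc \<theta> e * x e * feat e \<sigma>) + h * (\<Sum>i\<in>V. \<sigma> i)" for \<theta> x \<sigma>
definition w1 where "w1 \<theta> x \<sigma> = exp (en1 \<theta> x \<sigma>) / (\<Sum>\<tau>\<in>C. exp (en1 \<theta> x \<tau>))" for \<theta> x \<sigma>

lemma energy_split: "energy \<theta> x p = en1 \<theta> x (fst p) + en1 \<theta> x (snd p)"
  by (simp add: energy_def en1_def Sg_def hh_def sum.distrib algebra_simps)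

lemma Z1_pos: "0 < (\<Sum>\<tau>\<in>C. exp (en1 \<theta> x \<tau>))" using finC spins_nonempty by (intro sum_pos) auto

lemma Z_split: "Z \<theta> x = (\<Sum>\<tau>\<in>C. exp (en1 \<theta> x \<tau>)) * (\<Sum>\<tau>\<in>C. exp (en1 \<theta> x \<tau>))"
  unfolding Z_def energy_split exp_add sum_product by (simp add: sum.cartesian_product case_prod_unfold)

lemma av_split: "av \<theta> x \<phi> = (\<Sum>\<sigma>\<in>C. \<Sum>\<tau>\<in>C. w1 \<theta> x \<sigma> * w1 \<theta> x \<tau> * \<phi> (\<sigma>, \<tau>))"
  unfolding av_def Z_split energy_split exp_add w1_def
  by (simp add: sum.cartesian_product case_prod_unfold sum_divide_distrib mult_ac)

lemma w1_nonneg: "0 \<le> w1 \<theta> x \<sigma>" using Z1_pos[of \<theta> x] by (simp add: w1_def)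
lemma w1_sum: "(\<Sum>\<sigma>\<in>C. w1 \<theta> x \<sigma>) = 1"
  using Z1_pos[of \<theta> x] by (simp add: w1_def sum_divide_distrib[symmetric])

text \<open>The coupling part gives \<open>R\<^sup>2 / 2\<close> and the field part \<open>- q * R\<close>; the opposite motion of the two amplitudes
makes them complete a square.\<close>
lemma coupling_overlap:
  assumes "\<sigma> \<in> C" "\<tau> \<in> C"
  shows "(\<Sum>e\<in>E. cc' \<theta> e * cc \<theta> e * (feat e \<sigma> * feat e \<tau>))
    = (sin \<theta> * cos \<theta> * \<beta>\<^sup>2 * real N / 2) * (\<rho> \<sigma> \<tau> + (- q\<^sup>2 - real (card V) / (real N)\<^sup>2))"
proof -
  define R where "R = (\<Sum>j\<in>V. \<sigma> j * \<tau> j)"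
  have disj: "pairs V \<inter> fields V = {}" using V0 by (auto simp: pairs_def fields_def)
  have sN: "sqrt (real N) * sqrt (real N) = real N" by simp
  have qq: "sqrt q * sqrt q = q" using q0 by simp
  have "(\<Sum>e\<in>pairs V. cc' \<theta> e * cc \<theta> e * (feat e \<sigma> * feat e \<tau>))
    = (\<Sum>(i, j)\<in>pairs V. (\<beta>\<^sup>2 / real N * sin \<theta> * cos \<theta>) * ((\<sigma> i * \<tau> i) * (\<sigma> j * \<tau> j)))"
  proof (rule sum.cong[OF refl])
    fix e assume "e \<in> pairs V"
    then have "fst e \<noteq> 0" by (rule pairs_fst)
    moreover have "(\<beta> / sqrt (real N) * cos \<theta>) * (\<beta> / sqrt (real N) * sin \<theta>) = \<beta>\<^sup>2 / real N * sin \<theta> * cos \<theta>"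
      using sN by (simp add: power2_eq_square)
    ultimately have cceq: "cc' \<theta> e * cc \<theta> e = \<beta>\<^sup>2 / real N * sin \<theta> * cos \<theta>"
      by (simp only: cc_def cc'_def if_False)
    show "cc' \<theta> e * cc \<theta> e * (feat e \<sigma> * feat e \<tau>) = (case e of (i, j) \<Rightarrow> (\<beta>\<^sup>2 / real N * sin \<theta> * cos \<theta>) * ((\<sigma> i * \<tau> i) * (\<sigma> j * \<tau> j)))"
      unfolding cceq using \<open>fst e \<noteq> 0\<close> by (simp add: feat_def case_prod_unfold mult_ac)
  qed
  also have "\<dots> = (\<beta>\<^sup>2 / real N * sin \<theta> * cos \<theta>) * ((R\<^sup>2 - real (card V)) / 2)"
  proof -
    have "(\<Sum>i\<in>V. (\<sigma> i * \<tau> i)\<^sup>2) = (\<Sum>i\<in>V. 1)"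
      using spins_sq[OF assms(1)] spins_sq[OF assms(2)]
      by (intro sum.cong) (auto simp: power2_eq_square mult_ac mult.assoc[symmetric])
    then have S: "(\<Sum>(i, j)\<in>pairs V. (\<sigma> i * \<tau> i) * (\<sigma> j * \<tau> j)) = (R\<^sup>2 - real (card V)) / 2"
      using sum_pairs[OF finV, of "\<lambda>i. \<sigma> i * \<tau> i"] by (simp add: R_def)
    show ?thesis unfolding S[symmetric] case_prod_unfold sum_distrib_left ..
  qed
  finally have 1: "(\<Sum>e\<in>pairs V. cc' \<theta> e * cc \<theta> e * (feat e \<sigma> * feat e \<tau>)) = (\<beta>\<^sup>2 / real N * sin \<theta> * cos \<theta>) * ((R\<^sup>2 - real (card V)) / 2)" .
  have "(\<Sum>e\<in>fields V. cc' \<theta> e * cc \<theta> e * (feat e \<sigma> * feat e \<tau>)) = (\<Sum>j\<in>V. - (\<beta>\<^sup>2 * q * sin \<theta> * cos \<theta>) * (\<sigma> j * \<tau> j))"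
  proof -
    have "(- \<beta> * sqrt q * sin \<theta>) * (\<beta> * sqrt q * cos \<theta>) = - (\<beta>\<^sup>2 * (sqrt q * sqrt q) * sin \<theta> * cos \<theta>)"
      by (simp only: power2_eq_square mult_minus_left mult_minus_right mult_ac)
    then have "cc' \<theta> (0, j) * cc \<theta> (0, j) = - (\<beta>\<^sup>2 * q * sin \<theta> * cos \<theta>)" for j
      by (simp only: cc_def cc'_def fst_conv simp_thms if_True qq)
    then show ?thesis unfolding fields_def
      by (subst sum.reindex) (auto simp: inj_on_def feat_def)
  qed
  also have "\<dots> = - (\<beta>\<^sup>2 * q * sin \<theta> * cos \<theta>) * R" by (simp only: R_def sum_distrib_left)
  finally have 2: "(\<Sum>e\<in>fields V. cc' \<theta> e * cc \<theta> e * (feat e \<sigma> * feat e \<tau>)) = - (\<beta>\<^sup>2 * q * sin \<theta> * cos \<theta>) * R" .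
  have 3: "\<rho> \<sigma> \<tau> = (R / real N - q)\<^sup>2" by (simp add: \<rho>_def overlap_def R_def)
  have 4: "(\<beta>\<^sup>2 / real N * sin \<theta> * cos \<theta>) * ((R\<^sup>2 - real (card V)) / 2) + - (\<beta>\<^sup>2 * q * sin \<theta> * cos \<theta>) * R
    = (sin \<theta> * cos \<theta> * \<beta>\<^sup>2 * real N / 2) * ((R / real N - q)\<^sup>2 + (- q\<^sup>2 - real (card V) / (real N)\<^sup>2))"
    using N1 by (simp add: power2_eq_square field_simps)
  show ?thesis unfolding E_def 3 4[symmetric] 1[symmetric] 2[symmetric]
    by (rule sum.union_disjoint[OF pairs_finite[OF finV] fields_finite[OF finV] disj])
qed

text \<open>By \<open>replica_bracket_sum_le\<close> the Gaussian part of the derivative is at most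
\<open>4 * \<beta>\<^sup>2 * sin \<theta> * cos \<theta> * N\<close> times the average of \<open>ff \<theta> * \<rho>\<close>, which is minus the average
of \<open>ff' \<theta>\<close>.\<close>
lemma path_decreasing:
  assumes "0 \<le> \<theta>" "\<theta> \<le> pi/2"
  shows "av \<theta> x (ff' \<theta>) + (\<Sum>e\<in>E. cc' \<theta> e * cc \<theta> e * bracket \<theta> x e) \<le> 0"
proof -
  define a where "a = sin \<theta> * cos \<theta> * \<beta>\<^sup>2 * real N / 2"
  have a0: "0 \<le> a" unfolding a_def using assms sin_ge_zero[of \<theta>] cos_ge_zero[of \<theta>] pi_ge_zero
    by (intro divide_nonneg_nonneg mult_nonneg_nonneg) auto
  define w where "w = w1 \<theta> x"
  define \<Lambda> where "\<Lambda> = lam \<theta> * real N"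
  have ffe: "ff \<theta> (\<sigma>, \<tau>) = exp (\<Lambda> * \<rho> \<sigma> \<tau>)" for \<sigma> \<tau> by (simp add: ff_def \<Lambda>_def mult_ac)
  have "(\<Sum>e\<in>E. cc' \<theta> e * cc \<theta> e * bracket \<theta> x e) \<le> 8 * a * (\<Sum>\<sigma>\<in>C. \<Sum>\<tau>\<in>C. w \<sigma> * w \<tau> * (exp (\<Lambda> * \<rho> \<sigma> \<tau>) * \<rho> \<sigma> \<tau>))"
    unfolding bracket_def av_split w_def[symmetric] ffe Sg_def fst_conv snd_conv
  proof (rule replica_bracket_sum_le[OF finC])
    show "0 \<le> w \<sigma>" for \<sigma> by (simp add: w_def w1_nonneg)
    show "(\<Sum>\<sigma>\<in>C. w \<sigma>) = 1" by (simp add: w_def w1_sum)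
    show "feat e \<sigma> * feat e \<sigma> = 1" if "e \<in> E" "\<sigma> \<in> C" for e \<sigma> using that by (rule feat_sq)
    show "\<rho> \<sigma> \<tau> = \<rho> \<tau> \<sigma>" for \<sigma> \<tau> by (simp add: \<rho>_def overlap_sym[of \<sigma>])
    show "0 \<le> \<rho> \<sigma> \<tau>" for \<sigma> \<tau> by (rule \<rho>_nonneg)
    show "(\<Sum>e\<in>E. cc' \<theta> e * cc \<theta> e * (feat e \<sigma> * feat e \<tau>)) = a * (\<rho> \<sigma> \<tau> + (- q\<^sup>2 - real (card V) / (real N)\<^sup>2))"
      if "\<sigma> \<in> C" "\<tau> \<in> C" for \<sigma> \<tau> unfolding a_def by (rule coupling_overlap[OF that])
    show "0 \<le> a" by (rule a0)
    show "0 \<le> \<Lambda>" using lam_bounds by (simp add: \<Lambda>_def)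
  qed
  moreover have "av \<theta> x (ff' \<theta>) = - (8 * a * (\<Sum>\<sigma>\<in>C. \<Sum>\<tau>\<in>C. w \<sigma> * w \<tau> * (exp (\<Lambda> * \<rho> \<sigma> \<tau>) * \<rho> \<sigma> \<tau>)))"
    unfolding av_split w_def[symmetric] ff'_def ffe fst_conv snd_conv sum_distrib_left sum_negf[symmetric]
    by (intro sum.cong refl) (simp add: a_def mult_ac)
  ultimately show ?thesis by linarith
qed

lemma path_monotone: "(\<integral>x. av (pi/2) x (ff (pi/2)) \<partial>gaussian E) \<le> (\<integral>x. av 0 x (ff 0) \<partial>gaussian E)"
proof (rule DERIV_nonpos_imp_nonincreasing[where f="\<lambda>\<theta>. \<integral>x. av \<theta> x (ff \<theta>) \<partial>gaussian E"])
  fix \<theta> :: real assume \<theta>: "0 \<le> \<theta>" "\<theta> \<le> pi/2"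
  have "0 \<le> (\<integral>x. - (av \<theta> x (ff' \<theta>) + (\<Sum>e\<in>E. cc' \<theta> e * cc \<theta> e * bracket \<theta> x e)) \<partial>gaussian E)"
    using path_decreasing[OF \<theta>] by (intro integral_nonneg_AE AE_I2) (simp only: neg_0_le_iff_le)
  then have "(\<integral>x. av \<theta> x (ff' \<theta>) + (\<Sum>e\<in>E. cc' \<theta> e * cc \<theta> e * bracket \<theta> x e) \<partial>gaussian E) \<le> 0"
    by (simp only: integral_minus)
  with expectation_deriv[of \<theta>] show "\<exists>y. ((\<lambda>\<theta>. \<integral>x. av \<theta> x (ff \<theta>) \<partial>gaussian E) has_real_derivative y) (at \<theta>) \<and> y \<le> 0" by blast
qed simp

text \<open>At the start of the path the spins are independent given the fields.\<close>
lemma start_mgf: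
  "av 0 x (\<lambda>p. exp (t * (\<Sum>j\<in>V. fst p j * snd p j))) = (\<Prod>j\<in>V. cosh t + (tanh (\<beta> * x (0, j) * sqrt q + h))\<^sup>2 * sinh t)"
proof -
  define y where "y = (\<lambda>j. \<beta> * x (0, j) * sqrt q + h)"
  have en0: "en1 0 x \<sigma> = (\<Sum>j\<in>V. y j * \<sigma> j)" for \<sigma>
  proof -
    have disj: "pairs V \<inter> fields V = {}" using V0 by (auto simp: pairs_def fields_def)
    have "(\<Sum>e\<in>pairs V. cc 0 e * x e * feat e \<sigma>) = 0"
      using V0 by (intro sum.neutral) (auto simp: cc_def pairs_def)
    moreover have "(\<Sum>e\<in>fields V. cc 0 e * x e * feat e \<sigma>) = (\<Sum>j\<in>V. \<beta> * sqrt q * x (0, j) * \<sigma> j)"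
      unfolding fields_def by (subst sum.reindex) (auto simp: inj_on_def cc_def feat_def)
    ultimately show ?thesis using pairs_finite[OF finV] fields_finite[OF finV] disj
      by (simp add: en1_def E_def sum.union_disjoint y_def sum_distrib_left sum.distrib[symmetric] algebra_simps)
  qed
  have key: "(\<Sum>p\<in>C \<times> C. exp (s * (\<Sum>j\<in>V. fst p j * snd p j)) * exp (energy 0 x p))
     = (\<Prod>j\<in>V. \<Sum>a\<in>{-1,1}. \<Sum>b\<in>{-1,1}. exp (y j * a + y j * b + s * (a * b)))" for s
  proof -
    have "(\<Prod>j\<in>V. \<Sum>a\<in>{-1,1}. \<Sum>b\<in>{-1,1}. exp (y j * a + y j * b + s * (a * b)))
      = (\<Sum>\<sigma>\<in>C. \<Prod>j\<in>V. \<Sum>b\<in>{-1,1}. exp (y j * \<sigma> j + y j * b + s * (\<sigma> j * b)))"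
      unfolding spins_def using finV by (intro prod_sum_PiE) auto
    also have "\<dots> = (\<Sum>\<sigma>\<in>C. \<Sum>\<tau>\<in>C. \<Prod>j\<in>V. exp (y j * \<sigma> j + y j * \<tau> j + s * (\<sigma> j * \<tau> j)))"
      unfolding spins_def using finV by (intro sum.cong refl prod_sum_PiE) auto
    also have "\<dots> = (\<Sum>\<sigma>\<in>C. \<Sum>\<tau>\<in>C. exp (s * (\<Sum>j\<in>V. \<sigma> j * \<tau> j)) * exp (energy 0 x (\<sigma>, \<tau>)))"
      unfolding energy_split en0 using finV
      by (simp add: exp_sum[symmetric] exp_add[symmetric] sum.distrib sum_distrib_left add_ac)
    finally show ?thesis by (simp add: sum.cartesian_product case_prod_unfold)
  qed
  have one: "(\<Sum>a\<in>{-1,1::real}. \<Sum>b\<in>{-1,1}. exp (y j * a + y j * b + t * (a * b)))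
    / (\<Sum>a\<in>{-1,1::real}. \<Sum>b\<in>{-1,1}. exp (y j * a + y j * b + 0 * (a * b))) = cosh t + (tanh (y j))\<^sup>2 * sinh t" for j
  proof -
    define u where "u = exp (y j)"
    define c where "c = cosh t" define d where "d = sinh t"
    have u: "u > 0" by (simp add: u_def)
    have t: "exp t = c + d" "exp (- t) = c - d"
      by (simp_all add: c_def d_def cosh_plus_sinh cosh_minus_sinh)
    have y: "exp (y j) = u" "exp (- y j) = 1 / u" by (simp_all add: u_def exp_minus inverse_eq_divide)
    have e: "exp (y j * a + y j * b + r * (a * b)) = exp (a * y j) * exp (b * y j) * exp (a * b * r)" for a b r :: real
      by (simp add: exp_add[symmetric] mult_ac)
    have half: "(a/2) / (b/2) = a / b" for a b :: real by simp
    have sc: "sinh (y j) = (u - 1/u) / 2" "cosh (y j) = (u + 1/u) / 2"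
      by (auto simp: cosh_field_def sinh_field_def u_def exp_minus inverse_eq_divide)
    have th: "tanh (y j) = (u - 1/u) / (u + 1/u)" unfolding tanh_def sc half ..
    have num: "(\<Sum>a\<in>{-1,1::real}. \<Sum>b\<in>{-1,1}. exp (y j * a + y j * b + t * (a * b))) = c * (u + 1/u)\<^sup>2 + d * (u - 1/u)\<^sup>2"
      unfolding e using u by (simp add: t y power2_eq_square field_simps)
    have den: "(\<Sum>a\<in>{-1,1::real}. \<Sum>b\<in>{-1,1}. exp (y j * a + y j * b + 0 * (a * b))) = (u + 1/u)\<^sup>2"
      unfolding e using u by (simp add: y power2_eq_square field_simps)
    have "u + 1/u > 0" using u by (intro add_pos_pos) auto
    moreover have "(c * A\<^sup>2 + d * D\<^sup>2) / A\<^sup>2 = c + (D / A)\<^sup>2 * d" if "A > 0" for A D :: real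
      using that by (simp add: field_simps power_divide)
    ultimately show ?thesis unfolding num den th c_def[symmetric] d_def[symmetric] by blast
  qed
  have "av 0 x (\<lambda>p. exp (t * (\<Sum>j\<in>V. fst p j * snd p j))) = (\<Prod>j\<in>V. \<Sum>a\<in>{-1,1}. \<Sum>b\<in>{-1,1}. exp (y j * a + y j * b + t * (a * b)))
    / (\<Prod>j\<in>V. \<Sum>a\<in>{-1,1}. \<Sum>b\<in>{-1,1}. exp (y j * a + y j * b + 0 * (a * b)))"
    unfolding av_def key using key[of 0] by (simp add: Z_def)
  also have "\<dots> = (\<Prod>j\<in>V. cosh t + (tanh (y j))\<^sup>2 * sinh t)"
    unfolding prod_dividef[symmetric] one ..
  finally show ?thesis by (simp add: y_def)
qed

text \<open>The sites decouple, and each contributes the mean of \<open>tanh\<^sup>2\<close>. This is the only place where the fixed point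
equation for \<open>q\<close> enters.\<close>
lemma start_expectation: "(\<integral>x. av 0 x (\<lambda>p. exp (t * (\<Sum>j\<in>V. fst p j * snd p j))) \<partial>gaussian E) = (cosh t + q * sinh t) ^ card V"
proof -
  interpret product_sigma_finite "\<lambda>_. gauss1" by (rule product_sigma_finite_gauss1)
  interpret G: prob_space gauss1 by (rule prob_space_gauss1)
  define g where "g = (\<lambda>(e :: nat \<times> nat) z. if fst e = 0 then cosh t + (tanh (\<beta> * z * sqrt q + h))\<^sup>2 * sinh t else 1)"
  have disj: "pairs V \<inter> fields V = {}" using V0 by (auto simp: pairs_def fields_def)
  have P: "(\<Prod>e\<in>E. k e) = (\<Prod>j\<in>V. k (0, j))" if "\<And>e. e \<in> pairs V \<Longrightarrow> k e = 1" for k :: "nat \<times> nat \<Rightarrow> real"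
  proof -
    have "(\<Prod>e\<in>pairs V. k e) = 1" using that by (intro prod.neutral) auto
    moreover have "(\<Prod>e\<in>fields V. k e) = (\<Prod>j\<in>V. k (0, j))"
      unfolding fields_def by (subst prod.reindex) (auto simp: inj_on_def)
    ultimately show ?thesis using pairs_finite[OF finV] fields_finite[OF finV] disj
      by (simp add: E_def prod.union_disjoint)
  qed
  have pn: "fst e \<noteq> 0" if "e \<in> pairs V" for e using that by (rule pairs_fst)
  have ig: "integrable gauss1 (g e)" for e
    unfolding g_def by (cases "fst e = 0") (auto intro!: Bochner_Integration.integrable_add integrable_mult_left tanh_sq_integrable)
  have "(\<integral>x. av 0 x (\<lambda>p. exp (t * (\<Sum>j\<in>V. fst p j * snd p j))) \<partial>gaussian E) = (\<integral>x. (\<Prod>e\<in>E. g e (x e)) \<partial>gaussian E)"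
    unfolding start_mgf by (subst P) (simp_all add: g_def pn)
  also have "\<dots> = (\<Prod>e\<in>E. \<integral>z. g e z \<partial>gauss1)"
    unfolding gaussian_def by (intro product_integral_prod finE ig)
  also have "\<dots> = (\<Prod>j\<in>V. \<integral>z. g (0, j) z \<partial>gauss1)"
    using G.prob_space by (intro P) (simp add: g_def pn)
  also have "\<dots> = (\<Prod>j\<in>V. cosh t + q * sinh t)"
  proof (rule prod.cong[OF refl])
    fix j
    have "(\<integral>z. g (0, j) z \<partial>gauss1) = (\<integral>z. cosh t + (tanh (\<beta> * z * sqrt q + h))\<^sup>2 * sinh t \<partial>gauss1)"
      by (simp add: g_def)
    also have "\<dots> = cosh t + (\<integral>z. (tanh (\<beta> * z * sqrt q + h))\<^sup>2 \<partial>gauss1) * sinh t"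
      using G.prob_space tanh_sq_integrable by (subst Bochner_Integration.integral_add) auto
    finally show "(\<integral>z. g (0, j) z \<partial>gauss1) = cosh t + q * sinh t" using qfix by simp
  qed
  finally show ?thesis by simp
qed

text \<open>Linearise the square in \<open>ff 0\<close> with a Gaussian \<open>z\<close>, so that \<open>start_expectation\<close> and
\<open>Hoeffding_spin\<close> apply. The parameter \<open>\<epsilon>\<close> pays for the possible difference between \<open>card V\<close> and \<open>N\<close>.\<close>
lemma start_bound:
  assumes \<epsilon>: "0 < \<epsilon>" "\<kappa> * (1 + \<epsilon>) < 1/2"
  shows "(\<integral>x. av 0 x (ff 0) \<partial>gaussian E) \<le> exp (1 / (2 * \<epsilon>)) / sqrt (1 - 2 * (\<kappa> * (1 + \<epsilon>)))"
proof -
  define P where "P = (\<lambda>p. \<integral>x. exp (energy 0 x p) / Z 0 x \<partial>gaussian E)"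
  have kappa0: "0 \<le> \<kappa>" using \<kappa>2 by (meson order_trans zero_le_power2 mult_nonneg_nonneg zero_le_numeral)
  have int1: "integrable (gaussian E) (\<lambda>x. exp (energy 0 x p) / Z 0 x)" if "p \<in> C \<times> C" for p
  proof (rule integrable_bounded[where K=1])
    show "(\<lambda>x. exp (energy 0 x p) / Z 0 x) \<in> borel_measurable (gaussian E)"
      unfolding Z_def energy_def by measurable
    fix x
    have "exp (energy 0 x p) \<le> Z 0 x" unfolding Z_def using that finC by (intro member_le_sum) auto
    then show "\<bar>exp (energy 0 x p) / Z 0 x\<bar> \<le> 1" using Z_pos[of 0 x] by (simp add: divide_le_eq)
  qed
  have EF: "(\<integral>x. av 0 x \<phi> \<partial>gaussian E) = (\<Sum>p\<in>C \<times> C. P p * \<phi> p)" for \<phi>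
  proof -
    have "(\<integral>x. av 0 x \<phi> \<partial>gaussian E) = (\<integral>x. (\<Sum>p\<in>C \<times> C. (exp (energy 0 x p) / Z 0 x) * \<phi> p) \<partial>gaussian E)"
      unfolding av_def by (simp add: sum_divide_distrib mult_ac)
    also have "\<dots> = (\<Sum>p\<in>C \<times> C. P p * \<phi> p)"
      unfolding P_def using int1
      by (subst Bochner_Integration.integral_sum) (intro integrable_mult_left, assumption, simp only: integral_mult_left_zero)
    finally show ?thesis .
  qed
  \<comment> \<open>With this \<open>s\<close>, \<open>exp (\<kappa> * N * \<rho>)\<close> is the Gaussian average of \<open>exp (s * (D - N * q) * z)\<close>.\<close>
  define s where "s = sqrt (2 * \<kappa> / real N)"
  have s2: "s\<^sup>2 = 2 * \<kappa> / real N" using kappa0 by (simp add: s_def)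
  define D where "D = (\<lambda>p :: (nat \<Rightarrow> real) \<times> (nat \<Rightarrow> real). (\<Sum>j\<in>V. fst p j * snd p j))"
  have ffz: "ff 0 p = (\<integral>z. exp ((s * (D p - real N * q)) * z) \<partial>gauss1)" for p
  proof -
    have "\<rho> (fst p) (snd p) = (D p / real N - q)\<^sup>2" by (simp add: \<rho>_def overlap_def D_def)
    also have "\<dots> = (D p - real N * q)\<^sup>2 / (real N)\<^sup>2" using N1 by (simp add: power2_eq_square field_simps)
    finally have r: "\<rho> (fst p) (snd p) = (D p - real N * q)\<^sup>2 / (real N)\<^sup>2" .
    have "\<kappa> * (real N * ((D p - real N * q)\<^sup>2 / (real N)\<^sup>2)) = (s * (D p - real N * q))\<^sup>2 / 2"
      unfolding power_mult_distrib s2 using N1 by (simp add: power2_eq_square)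
    then show ?thesis unfolding integral_gauss1_exp ff_def r by (simp add: lam_def)
  qed
  have "(\<integral>x. av 0 x (ff 0) \<partial>gaussian E) = (\<integral>z. (\<Sum>p\<in>C \<times> C. P p * exp ((s * (D p - real N * q)) * z)) \<partial>gauss1)"
    unfolding EF ffz by (subst Bochner_Integration.integral_sum) (auto intro!: integrable_mult_right integrable_gauss1_exp)
  also have "\<dots> \<le> (\<integral>z. exp (1 / (2 * \<epsilon>)) * exp ((\<kappa> * (1 + \<epsilon>)) * z\<^sup>2) \<partial>gauss1)"
  proof (rule integral_mono)
    show "integrable gauss1 (\<lambda>z. \<Sum>p\<in>C \<times> C. P p * exp ((s * (D p - real N * q)) * z))"
      by (intro Bochner_Integration.integrable_sum integrable_mult_right integrable_gauss1_exp)
    show "integrable gauss1 (\<lambda>z. exp (1 / (2 * \<epsilon>)) * exp ((\<kappa> * (1 + \<epsilon>)) * z\<^sup>2))"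
      using \<epsilon> by (intro integrable_mult_right integrable_gauss1_exp_square)
    fix z
    define t where "t = s * z"
    have "(\<Sum>p\<in>C \<times> C. P p * exp ((s * (D p - real N * q)) * z)) = exp (- (t * real N * q)) * (\<Sum>p\<in>C \<times> C. P p * exp (t * D p))"
      unfolding sum_distrib_left by (intro sum.cong refl) (simp add: t_def exp_add[symmetric] algebra_simps)
    also have "(\<Sum>p\<in>C \<times> C. P p * exp (t * D p)) = (cosh t + q * sinh t) ^ card V"
      using start_expectation[of t] unfolding EF D_def by simp
    also have "\<dots> \<le> exp (t * q + t\<^sup>2/2) ^ card V"
    proof (rule power_mono[OF Hoeffding_spin[OF q0 q1]])
      have "\<bar>sinh t\<bar> \<le> cosh t" by (simp add: abs_le_iff cosh_field_def sinh_field_def)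
      then have "\<bar>q * sinh t\<bar> \<le> 1 * cosh t" unfolding abs_mult using q0 q1 by (intro mult_mono) auto
      then show "0 \<le> cosh t + q * sinh t" by simp
    qed
    also have "\<dots> = exp (real (card V) * (t * q + t\<^sup>2/2))" by (simp add: exp_of_nat_mult)
    also have "exp (- (t * real N * q)) * exp (real (card V) * (t * q + t\<^sup>2/2)) \<le> exp (1 / (2 * \<epsilon>)) * exp ((\<kappa> * (1 + \<epsilon>)) * z\<^sup>2)"
    proof -
      define d where "d = real N - real (card V)"
      have d: "0 \<le> d" "d \<le> 1" using VN NV by (auto simp: d_def)
      have tt: "real N * t\<^sup>2 = 2 * \<kappa> * z\<^sup>2" using N1 by (simp add: t_def power_mult_distrib s2)
      have "- (t * real N * q) + real (card V) * (t * q + t\<^sup>2/2) = (real N - d) * t\<^sup>2/2 + (- t) * (d * q)"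
        by (simp add: d_def algebra_simps)
      also have "\<dots> \<le> real N * t\<^sup>2/2 + (\<epsilon> * t\<^sup>2/2 + 1 / (2 * \<epsilon>))"
      proof (rule add_mono)
        show "(real N - d) * t\<^sup>2 / 2 \<le> real N * t\<^sup>2/2" using d by (intro divide_right_mono mult_right_mono) auto
        have dq: "\<bar>d * q\<bar> \<le> 1 * 1" unfolding abs_mult using d q0 q1 by (intro mult_mono) auto
        have "(- t) * (d * q) \<le> \<bar>(- t) * (d * q)\<bar>" by (rule abs_ge_self)
        also have "\<dots> = \<bar>t\<bar> * \<bar>d * q\<bar>" by (simp only: abs_mult abs_minus_cancel)
        also have "\<dots> \<le> \<bar>t\<bar> * 1" using dq by (intro mult_left_mono) auto
        also have "\<bar>t\<bar> * 1 \<le> \<epsilon> * t\<^sup>2/2 + 1 / (2 * \<epsilon>)"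
        proof -
          have "0 \<le> (\<epsilon> * \<bar>t\<bar> - 1)\<^sup>2 / (2 * \<epsilon>)" using \<epsilon> by simp
          also have "\<dots> = \<epsilon> * t\<^sup>2/2 + 1 / (2 * \<epsilon>) - \<bar>t\<bar>" using \<epsilon> by (simp add: power2_eq_square field_simps)
          finally show ?thesis by simp
        qed
        finally show "(- t) * (d * q) \<le> \<epsilon> * t\<^sup>2/2 + 1 / (2 * \<epsilon>)" .
      qed
      also have "\<dots> \<le> real N * t\<^sup>2/2 + (\<epsilon> * (real N * t\<^sup>2)/2 + 1 / (2 * \<epsilon>))"
      proof -
        have "1 * t\<^sup>2 \<le> real N * t\<^sup>2" using N1 by (intro mult_right_mono) auto
        then show ?thesis using \<epsilon> by simp
      qed
      also have "\<dots> = 1 / (2 * \<epsilon>) + (\<kappa> * (1 + \<epsilon>)) * z\<^sup>2" unfolding tt by (simp add: algebra_simps)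
      finally show ?thesis by (simp add: exp_add[symmetric])
    qed
    finally show "(\<Sum>p\<in>C \<times> C. P p * exp ((s * (D p - real N * q)) * z)) \<le> exp (1 / (2 * \<epsilon>)) * exp ((\<kappa> * (1 + \<epsilon>)) * z\<^sup>2)"
      by simp
  qed
  also have "\<dots> = exp (1 / (2 * \<epsilon>)) / sqrt (1 - 2 * (\<kappa> * (1 + \<epsilon>)))"
    using \<epsilon> by (simp add: integral_gauss1_exp_square)
  finally show ?thesis .
qed

text \<open>At the end of the path the fields have amplitude zero and can be integrated out.\<close>
theorem overlap_exponential_moment:
  assumes \<epsilon>: "0 < \<epsilon>" "\<kappa> * (1 + \<epsilon>) < 1/2"
  shows "(\<integral>x. (\<Sum>\<sigma>\<in>C. \<Sum>\<tau>\<in>C. cav_weight N \<beta> h V x \<sigma> * cav_weight N \<beta> h V x \<tau>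
       * exp ((\<kappa> - 2 * \<beta>\<^sup>2) * (real N * (overlap N V \<sigma> \<tau> - q)\<^sup>2))) \<partial>gaussian (pairs V))
    \<le> exp (1 / (2 * \<epsilon>)) / sqrt (1 - 2 * (\<kappa> * (1 + \<epsilon>)))"
proof -
  interpret product_sigma_finite "\<lambda>_. gauss1" by (rule product_sigma_finite_gauss1)
  define H where "H = (\<lambda>x. \<Sum>\<sigma>\<in>C. \<Sum>\<tau>\<in>C. cav_weight N \<beta> h V x \<sigma> * cav_weight N \<beta> h V x \<tau>
       * exp ((\<kappa> - 2 * \<beta>\<^sup>2) * (real N * (overlap N V \<sigma> \<tau> - q)\<^sup>2)))"
  have disj: "pairs V \<inter> fields V = {}" using V0 by (auto simp: pairs_def fields_def)
  have energy_end: "en1 (pi/2) x \<sigma> = cav_energy N \<beta> h V x \<sigma>" for x \<sigma>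
  proof -
    have "(\<Sum>e\<in>fields V. cc (pi/2) e * x e * feat e \<sigma>) = 0"
      by (intro sum.neutral) (auto simp: cc_def fields_def cos_pi_half)
    moreover have "(\<Sum>e\<in>pairs V. cc (pi/2) e * x e * feat e \<sigma>) = \<beta> / sqrt (real N) * (\<Sum>(i, j)\<in>pairs V. x (i, j) * \<sigma> i * \<sigma> j)"
      unfolding sum_distrib_left using V0 by (intro sum.cong) (auto simp: cc_def pairs_def feat_def sin_pi_half)
    ultimately show ?thesis using pairs_finite[OF finV] fields_finite[OF finV] disj
      by (simp add: en1_def cav_energy_def E_def sum.union_disjoint)
  qed
  have avH: "av (pi/2) x (ff (pi/2)) = H x" for x
    unfolding av_split w1_def energy_end H_def cav_weight_def by (simp add: ff_def lam_def \<rho>_def sin_pi_half)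
  have Hm: "H (merge (pairs V) (fields V) (x, z)) = H x" for x z
  proof -
    have "cav_energy N \<beta> h V (merge (pairs V) (fields V) (x, z)) \<sigma> = cav_energy N \<beta> h V x \<sigma>" for \<sigma>
      unfolding cav_energy_def by (intro arg_cong2[where f="(+)"] arg_cong2[where f="(*)"] refl sum.cong) (auto simp: merge_def)
    then show ?thesis by (simp add: H_def cav_weight_def)
  qed
  have "integrable (gaussian E) H" unfolding avH[symmetric]
    by (intro integrable_bounded[where K="(1 + 4 * \<beta>\<^sup>2 * (real N * 4)) * exp (\<kappa> * (real N * 4))"] av_abs_le bf) measurable
  then have "(\<integral>x. H x \<partial>gaussian E) = (\<integral>x. (\<integral>z. H (merge (pairs V) (fields V) (x, z)) \<partial>gaussian (fields V)) \<partial>gaussian (pairs V))"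
    unfolding gaussian_def E_def
    by (intro product_integral_fold disj pairs_finite fields_finite finV)
  also have "\<dots> = (\<integral>x. H x \<partial>gaussian (pairs V))"
    unfolding Hm by (simp add: prob_space.prob_space[OF prob_space_gaussian])
  finally have "(\<integral>x. H x \<partial>gaussian (pairs V)) = (\<integral>x. av (pi/2) x (ff (pi/2)) \<partial>gaussian E)" by (simp add: avH)
  also have "\<dots> \<le> exp (1 / (2 * \<epsilon>)) / sqrt (1 - 2 * (\<kappa> * (1 + \<epsilon>)))"
    by (rule order_trans[OF path_monotone start_bound[OF \<epsilon>]])
  finally show ?thesis by (simp add: H_def)
qed

end

section \<open>Overlap moments and small parameters\<close>

lemma jensen_even_power:
  fixes y \<mu> :: "'s \<Rightarrow> real"
  assumes "finite S" "\<And>s. s \<in> S \<Longrightarrow> 0 \<le> \<mu> s" "(\<Sum>s\<in>S. \<mu> s) = 1"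
  shows "(\<Sum>s\<in>S. \<mu> s * y s) ^ (2 * k) \<le> (\<Sum>s\<in>S. \<mu> s * y s ^ (2 * k))"
proof -
  have "S \<noteq> {}" using assms(3) by auto
  then have "(\<Sum>s\<in>S. \<mu> s *\<^sub>R y s) ^ (2 * k) \<le> (\<Sum>s\<in>S. \<mu> s * y s ^ (2 * k))"
    using assms by (intro convex_on_sum[OF _ _ convex_power_even]) auto
  then show ?thesis by simp
qed

lemma jensen_exp_square:
  fixes y \<mu> :: "'s \<Rightarrow> real"
  assumes "finite S" "\<And>s. s \<in> S \<Longrightarrow> 0 \<le> \<mu> s" "(\<Sum>s\<in>S. \<mu> s) = 1" "0 \<le> a"
  shows "exp (a * (\<Sum>s\<in>S. \<mu> s * y s)\<^sup>2) \<le> (\<Sum>s\<in>S. \<mu> s * exp (a * (y s)\<^sup>2))"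
proof -
  have ne: "S \<noteq> {}" using assms(3) by auto
  have "a * (\<Sum>s\<in>S. \<mu> s * y s)\<^sup>2 \<le> a * (\<Sum>s\<in>S. \<mu> s * (y s)\<^sup>2)"
    using jensen_even_power[OF assms(1-3), of y 1] assms(4) by (intro mult_left_mono) auto
  also have "\<dots> = (\<Sum>s\<in>S. \<mu> s *\<^sub>R (a * (y s)\<^sup>2))" by (simp add: sum_distrib_left mult_ac)
  finally have "exp (a * (\<Sum>s\<in>S. \<mu> s * y s)\<^sup>2) \<le> exp (\<Sum>s\<in>S. \<mu> s *\<^sub>R (a * (y s)\<^sup>2))" by simp
  also have "\<dots> \<le> (\<Sum>s\<in>S. \<mu> s * exp (a * (y s)\<^sup>2))"
    using assms ne by (intro convex_on_sum[OF _ _ exp_convex]) auto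
  finally show ?thesis .
qed

text \<open>The convexity of \<open>1 / y\<close> on the positive reals, by its tangent at the mean.\<close>
lemma jensen_inverse:
  fixes y \<mu> :: "'s \<Rightarrow> real"
  assumes "finite S" "\<And>s. s \<in> S \<Longrightarrow> 0 \<le> \<mu> s" "(\<Sum>s\<in>S. \<mu> s) = 1" "\<And>s. s \<in> S \<Longrightarrow> 0 < y s"
  shows "0 < (\<Sum>s\<in>S. \<mu> s * y s)" "1 / (\<Sum>s\<in>S. \<mu> s * y s) \<le> (\<Sum>s\<in>S. \<mu> s * (1 / y s))"
proof -
  define c where "c = (\<Sum>s\<in>S. \<mu> s * y s)"
  have pos: "0 \<le> \<mu> s * y s" if "s \<in> S" for s using assms(2)[OF that] assms(4)[OF that] by simp
  have "c \<noteq> 0"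
  proof
    assume "c = 0"
    then have "\<mu> s * y s = 0" if "s \<in> S" for s
      using that pos assms(1) sum_nonneg_eq_0_iff[of S "\<lambda>s. \<mu> s * y s"] unfolding c_def by blast
    then have "\<mu> s = 0" if "s \<in> S" for s using that assms(4) by fastforce
    then show False using assms(3) by simp
  qed
  moreover have "0 \<le> c" unfolding c_def by (intro sum_nonneg pos)
  ultimately have c: "0 < c" by simp
  then show "0 < (\<Sum>s\<in>S. \<mu> s * y s)" by (simp add: c_def)
  have "1 / c = (\<Sum>s\<in>S. \<mu> s * ((2 * c - y s) / c\<^sup>2))"
  proof -
    have "(\<Sum>s\<in>S. \<mu> s * (2 * c - y s)) = 2 * c - c"
      by (simp add: right_diff_distrib sum_subtractf sum_distrib_right[symmetric] assms(3) c_def[symmetric])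
    moreover have "(\<Sum>s\<in>S. \<mu> s * ((2 * c - y s) / c\<^sup>2)) = (\<Sum>s\<in>S. \<mu> s * (2 * c - y s)) / c\<^sup>2"
      by (simp add: sum_divide_distrib)
    ultimately show ?thesis using c by (simp add: power2_eq_square)
  qed
  also have "\<dots> \<le> (\<Sum>s\<in>S. \<mu> s * (1 / y s))"
  proof (intro sum_mono mult_left_mono assms(2))
    fix s assume s: "s \<in> S"
    have "(2 * c - y s) * y s \<le> c\<^sup>2" using zero_le_power2[of "c - y s"] by (simp add: power2_eq_square algebra_simps)
    then show "(2 * c - y s) / c\<^sup>2 \<le> 1 / y s" using assms(4)[OF s] c by (simp add: field_simps)
  qed
  finally show "1 / (\<Sum>s\<in>S. \<mu> s * y s) \<le> (\<Sum>s\<in>S. \<mu> s * (1 / y s))" by (simp add: c_def)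
qed

lemma power_add_even: "(a + b) ^ (2 * k) \<le> 4 ^ k * (a ^ (2 * k) + b ^ (2 * k))" for a b :: real
proof -
  define M where "M = max \<bar>a\<bar> \<bar>b\<bar>"
  have "(a + b) ^ (2 * k) = \<bar>a + b\<bar> ^ (2 * k)" by (simp add: power_even_abs)
  also have "\<dots> \<le> (2 * M) ^ (2 * k)" by (intro power_mono) (auto simp: M_def)
  also have "\<dots> = 4 ^ k * M ^ (2 * k)" by (simp add: power_mult_distrib power_mult)
  also have "M ^ (2 * k) \<le> a ^ (2 * k) + b ^ (2 * k)"
    unfolding M_def by (cases "\<bar>a\<bar> \<le> \<bar>b\<bar>") (auto simp: max_def power_even_abs)
  finally show ?thesis by simp
qed

lemma power_add4_even: "(a + b + c + d) ^ (2 * k) \<le> 16 ^ k * (a ^ (2 * k) + b ^ (2 * k) + c ^ (2 * k) + d ^ (2 * k))" for a b c d :: real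
proof -
  have "(a + b + (c + d)) ^ (2 * k) \<le> 4 ^ k * ((a + b) ^ (2 * k) + (c + d) ^ (2 * k))" by (rule power_add_even)
  also have "\<dots> \<le> 4 ^ k * (4 ^ k * (a ^ (2 * k) + b ^ (2 * k)) + 4 ^ k * (c ^ (2 * k) + d ^ (2 * k)))"
    by (intro mult_left_mono add_mono power_add_even) auto
  also have "\<dots> = 16 ^ k * (a ^ (2 * k) + b ^ (2 * k) + c ^ (2 * k) + d ^ (2 * k))"
  proof -
    have p: "(16::real) ^ k = 4 ^ k * 4 ^ k" by (simp add: power_mult_distrib[symmetric])
    show ?thesis unfolding p by (simp only: distrib_left mult.assoc add.assoc)
  qed
  finally show ?thesis by (simp add: add.assoc)
qed

lemma power_div_fact_le_exp: "0 \<le> x \<Longrightarrow> x ^ k / fact k \<le> exp x" for x :: real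
proof -
  assume x: "0 \<le> x"
  have "(\<Sum>n\<in>{k}. x ^ n /\<^sub>R fact n) \<le> (\<Sum>n. x ^ n /\<^sub>R fact n)"
    using x by (intro sum_le_suminf summable_exp_generic) auto
  then show ?thesis by (simp add: exp_def divide_inverse mult.commute)
qed

context cavity begin

definition R :: "'s \<Rightarrow> 's \<Rightarrow> real" where "R s t = (\<Sum>i\<in>J. x s i * x t i)"

lemma dot_bary: "(\<Sum>i\<in>J. x s i * bary i) = (\<Sum>u\<in>S. \<mu> u * R s u)"
  unfolding bary_def R_def sum_distrib_left by (subst sum.swap) (simp add: mult_ac)

lemma bary_bary: "(\<Sum>i\<in>J. bary i * bary i) = (\<Sum>t\<in>S. \<mu> t * (\<Sum>u\<in>S. \<mu> u * R t u))"
proof -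
  have "(\<Sum>i\<in>J. bary i * bary i) = (\<Sum>t\<in>S. \<mu> t * (\<Sum>i\<in>J. x t i * bary i))"
    unfolding bary_def[of _] sum_distrib_left sum_distrib_right by (subst sum.swap) (simp add: mult_ac)
  then show ?thesis by (simp add: dot_bary)
qed

text \<open>All small parameters are combinations of the centred overlaps \<open>R s t - q\<close> and of their averages, so that Jensen's
inequality applies. The defect \<open>\<delta>\<close> of the self-overlap, later \<open>1 / N\<close>, comes from the missing site.\<close>
lemma small_parameters:
  assumes n: "n = 2 * k" and Rs: "\<And>s. s \<in> S \<Longrightarrow> R s s = 1 - \<delta>"
  defines "\<kappa> \<equiv> (\<Sum>s\<in>S. \<Sum>t\<in>S. \<mu> s * \<mu> t * (R s t - q) ^ (2 * k))"
  defines "\<tau> \<equiv> 16 ^ k * (4 * \<kappa> + \<delta> ^ (2 * k))"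
  shows "(\<Sum>s\<in>S. \<mu> s * \<bar>\<alpha> s\<bar> ^ n) \<le> \<tau>" "(\<Sum>s\<in>S. \<mu> s * \<bar>\<beta> s\<bar> ^ n) \<le> \<tau>"
    "(\<Sum>s\<in>S. \<mu> s * (\<Sum>t\<in>S. \<mu> t * \<bar>T s t\<bar> ^ n)) \<le> \<tau>"
proof -
  define D where "D = (\<lambda>s t. R s t - q)"
  define Ds where "Ds = (\<lambda>s. \<Sum>u\<in>S. \<mu> u * D s u)"
  define D0 where "D0 = (\<Sum>s\<in>S. \<mu> s * Ds s)"
  have Dsym: "D s t = D t s" for s t by (simp add: D_def R_def mult.commute)
  have Ds: "Ds s = (\<Sum>i\<in>J. x s i * bary i) - q" for s
    unfolding dot_bary Ds_def D_def by (simp add: right_diff_distrib sum_subtractf sum_distrib_right[symmetric] \<mu>1)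
  have D0: "D0 = (\<Sum>i\<in>J. bary i * bary i) - q"
    unfolding D0_def Ds dot_bary bary_bary by (simp add: right_diff_distrib sum_subtractf sum_distrib_right[symmetric] \<mu>1)
  have TD: "T s t = D s t + (- Ds s) + (- Ds t) + D0" for s t
    unfolding T_def dev_def Ds D0 D_def R_def
    by (simp add: algebra_simps sum_subtractf sum.distrib)
  have \<beta>D: "\<beta> s = Ds s + (- D0)" for s
    unfolding \<beta>_def dev_def Ds D0 by (simp add: left_diff_distrib sum_subtractf)
  have \<alpha>D: "\<alpha> s = (- \<delta>) + (- Ds s) + (- Ds s) + D0" if "s \<in> S" for s
    using Rs[OF that] unfolding \<alpha>_def TD D_def by simp
  have ev: "\<bar>y\<bar> ^ n = y ^ (2 * k)" for y :: real unfolding n by (simp add: power_even_abs)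
  have kap: "\<kappa> = (\<Sum>s\<in>S. \<mu> s * (\<Sum>t\<in>S. \<mu> t * D s t ^ (2 * k)))"
    unfolding \<kappa>_def D_def by (simp add: sum_distrib_left mult_ac)
  have kD: "(\<Sum>s\<in>S. \<mu> s * Ds s ^ (2 * k)) \<le> \<kappa>"
    unfolding kap Ds_def using \<mu>0 by (intro sum_mono mult_left_mono jensen_even_power finS \<mu>1) auto
  have k0: "D0 ^ (2 * k) \<le> \<kappa>"
    unfolding D0_def by (rule order_trans[OF jensen_even_power[OF finS \<mu>0 \<mu>1] kD])
  have kap0: "0 \<le> \<kappa>" unfolding kap using \<mu>0 by (intro sum_nonneg mult_nonneg_nonneg) auto
  have c: "(\<Sum>s\<in>S. \<mu> s * c) = c" for c by (simp add: sum_distrib_right[symmetric] \<mu>1)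
  have dpos: "0 \<le> \<delta> ^ (2 * k)" by simp
  show "(\<Sum>s\<in>S. \<mu> s * \<bar>\<alpha> s\<bar> ^ n) \<le> \<tau>"
  proof -
    have "(\<Sum>s\<in>S. \<mu> s * \<bar>\<alpha> s\<bar> ^ n) \<le> (\<Sum>s\<in>S. \<mu> s * (16 ^ k * (\<delta> ^ (2 * k) + Ds s ^ (2 * k) + Ds s ^ (2 * k) + D0 ^ (2 * k))))"
    proof (intro sum_mono mult_left_mono \<mu>0)
      fix s assume s: "s \<in> S"
      have me: "(- y) ^ (2 * k) = y ^ (2 * k)" for y :: real by simp
      show "\<bar>\<alpha> s\<bar> ^ n \<le> 16 ^ k * (\<delta> ^ (2 * k) + Ds s ^ (2 * k) + Ds s ^ (2 * k) + D0 ^ (2 * k))"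
        using power_add4_even[of "- \<delta>" "- Ds s" "- Ds s" D0 k] unfolding ev \<alpha>D[OF s] me .
    qed
    also have "\<dots> = 16 ^ k * (\<delta> ^ (2 * k) + 2 * (\<Sum>s\<in>S. \<mu> s * Ds s ^ (2 * k)) + D0 ^ (2 * k))"
      by (simp add: distrib_left sum.distrib mult.left_commute[of "\<mu> _" "16 ^ k"] mult.left_commute[of "\<mu> _" 2] sum_distrib_left[symmetric] c)
    also have "\<dots> \<le> \<tau>" unfolding \<tau>_def using kD k0 kap0 by (intro mult_left_mono) (linarith, simp)
    finally show ?thesis .
  qed
  show "(\<Sum>s\<in>S. \<mu> s * \<bar>\<beta> s\<bar> ^ n) \<le> \<tau>"
  proof -
    have "(\<Sum>s\<in>S. \<mu> s * \<bar>\<beta> s\<bar> ^ n) \<le> (\<Sum>s\<in>S. \<mu> s * (16 ^ k * (Ds s ^ (2 * k) + D0 ^ (2 * k))))"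
    proof (intro sum_mono mult_left_mono \<mu>0)
      fix s
      have "(Ds s + (- D0)) ^ (2 * k) \<le> 4 ^ k * (Ds s ^ (2 * k) + (- D0) ^ (2 * k))" by (rule power_add_even)
      also have "\<dots> \<le> 16 ^ k * (Ds s ^ (2 * k) + (- D0) ^ (2 * k))"
        by (intro mult_right_mono power_mono) auto
      finally show "\<bar>\<beta> s\<bar> ^ n \<le> 16 ^ k * (Ds s ^ (2 * k) + D0 ^ (2 * k))" by (simp add: ev \<beta>D)
    qed
    also have "\<dots> = 16 ^ k * ((\<Sum>s\<in>S. \<mu> s * Ds s ^ (2 * k)) + D0 ^ (2 * k))"
      by (simp add: distrib_left sum.distrib mult.left_commute[of "\<mu> _" "16 ^ k"] sum_distrib_left[symmetric] c)
    also have "\<dots> \<le> \<tau>" unfolding \<tau>_def using kD k0 kap0 dpos by (intro mult_left_mono) (linarith, simp)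
    finally show ?thesis .
  qed
  show "(\<Sum>s\<in>S. \<mu> s * (\<Sum>t\<in>S. \<mu> t * \<bar>T s t\<bar> ^ n)) \<le> \<tau>"
  proof -
    have "(\<Sum>s\<in>S. \<mu> s * (\<Sum>t\<in>S. \<mu> t * \<bar>T s t\<bar> ^ n))
      \<le> (\<Sum>s\<in>S. \<mu> s * (\<Sum>t\<in>S. \<mu> t * (16 ^ k * (D s t ^ (2 * k) + Ds s ^ (2 * k) + Ds t ^ (2 * k) + D0 ^ (2 * k)))))"
    proof (intro sum_mono mult_left_mono \<mu>0)
      fix s t
      show "\<bar>T s t\<bar> ^ n \<le> 16 ^ k * (D s t ^ (2 * k) + Ds s ^ (2 * k) + Ds t ^ (2 * k) + D0 ^ (2 * k))"
        using power_add4_even[of "D s t" "- Ds s" "- Ds t" D0 k] by (simp add: ev TD)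
    qed
    also have "\<dots> = 16 ^ k * (\<kappa> + (\<Sum>s\<in>S. \<mu> s * Ds s ^ (2 * k)) + (\<Sum>s\<in>S. \<mu> s * Ds s ^ (2 * k)) + D0 ^ (2 * k))"
      unfolding kap
      by (simp add: distrib_left sum.distrib mult.left_commute[of "\<mu> _" "16 ^ k"] sum_distrib_left[symmetric] sum_distrib_right[symmetric] \<mu>1)
    also have "\<dots> \<le> \<tau>" unfolding \<tau>_def using kD k0 kap0 dpos by (intro mult_left_mono) (linarith, simp)
    finally show ?thesis .
  qed
qed

end

text \<open>The bonds at the removed site \<open>i\<close>, and the site that such a bond joins to \<open>i\<close>.\<close>
definition star :: "nat \<Rightarrow> nat \<Rightarrow> (nat \<times> nat) set" where "star N i = {e \<in> bonds N. fst e = i \<or> snd e = i}"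
definition other :: "nat \<Rightarrow> nat \<times> nat \<Rightarrow> nat" where "other i e = fst e + snd e - i"
definition rest :: "nat \<Rightarrow> nat \<Rightarrow> nat set" where "rest N i = {1..N} - {i}"

text \<open>The local field at \<open>i\<close>, as a linear form in the couplings at \<open>i\<close>.\<close>
definition field_at :: "nat \<Rightarrow> nat \<Rightarrow> (nat \<times> nat \<Rightarrow> real) \<Rightarrow> (nat \<Rightarrow> real) \<Rightarrow> real" where
  "field_at N i G \<sigma> = (\<Sum>e\<in>star N i. G e * (\<sigma> (other i e) / sqrt (real N)))"

lemma bonds_finite: "finite (bonds N)"
  by (rule finite_subset[of _ "{1..N} \<times> {1..N}"]) (auto simp: bonds_def)

lemma bonds_split: "bonds N = pairs (rest N i) \<union> star N i" "pairs (rest N i) \<inter> star N i = {}"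
  by (auto simp: bonds_def pairs_def rest_def star_def)

lemma bij_other: assumes "1 \<le> i" "i \<le> N" shows "bij_betw (other i) (star N i) (rest N i)"
proof (rule bij_betw_byWitness[where f'="\<lambda>j. (min i j, max i j)"])
  show "\<forall>e\<in>star N i. (min i (other i e), max i (other i e)) = e"
    by (auto simp: star_def bonds_def other_def)
  show "\<forall>j\<in>rest N i. other i (min i j, max i j) = j" by (auto simp: rest_def other_def)
  show "other i ` star N i \<subseteq> rest N i" by (auto simp: star_def bonds_def other_def rest_def)
  show "(\<lambda>j. (min i j, max i j)) ` rest N i \<subseteq> star N i"
    using assms by (auto simp: star_def bonds_def rest_def)
qed

lemma sum_star: assumes "1 \<le> i" "i \<le> N" shows "(\<Sum>e\<in>star N i. f (other i e)) = (\<Sum>j\<in>rest N i. f j)"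
  by (rule sum.reindex_bij_betw[OF bij_other[OF assms]])

lemma star_overlap:
  assumes "1 \<le> i" "i \<le> N"
  shows "(\<Sum>e\<in>star N i. (\<sigma> (other i e) / sqrt (real N)) * (\<tau> (other i e) / sqrt (real N))) = overlap N (rest N i) \<sigma> \<tau>"
  unfolding overlap_def sum_star[OF assms, of "\<lambda>j. (\<sigma> j / sqrt (real N)) * (\<tau> j / sqrt (real N))"]
  by (simp add: sum_divide_distrib)

lemma card_rest: "1 \<le> i \<Longrightarrow> i \<le> N \<Longrightarrow> card (rest N i) = N - 1" by (simp add: rest_def)
lemma rest_finite: "finite (rest N i)" by (simp add: rest_def)
lemma rest_0: "0 \<notin> rest N i" by (simp add: rest_def)

lemma cav_weight_nonneg: "0 \<le> cav_weight N \<beta> h V y \<sigma>"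
  unfolding cav_weight_def by (intro divide_nonneg_nonneg sum_nonneg) auto

lemma cav_weight_sum: assumes "finite V" shows "(\<Sum>\<sigma>\<in>spins V. cav_weight N \<beta> h V y \<sigma>) = 1"
proof -
  have "0 < (\<Sum>\<tau>\<in>spins V. exp (cav_energy N \<beta> h V y \<tau>))"
    using spins_finite[OF assms] spins_nonempty by (intro sum_pos) auto
  then show ?thesis unfolding cav_weight_def sum_divide_distrib[symmetric] by simp
qed

lemma overlap_self: assumes "\<sigma> \<in> spins (rest N i)" "1 \<le> i" "i \<le> N"
  shows "overlap N (rest N i) \<sigma> \<sigma> = 1 - 1 / real N"
proof -
  have "(\<Sum>j\<in>rest N i. \<sigma> j * \<sigma> j) = (\<Sum>j\<in>rest N i. 1)"
    using spins_sq[OF assms(1)] by (intro sum.cong) auto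
  then show ?thesis using assms card_rest[OF assms(2,3)] by (simp add: overlap_def of_nat_diff diff_divide_distrib)
qed

text \<open>A power of \<open>N * (R - q)\<^sup>2\<close> is bounded by its exponential. The margin \<open>\<kappa> > 2 * \<beta>\<^sub>0\<^sup>2\<close> with
\<open>\<kappa> < 1/2\<close> exists because \<open>\<beta>\<^sub>0 < 1/2\<close>.\<close>
lemma overlap_moments:
  assumes \<beta>0: "0 < \<beta>\<^sub>0" "\<beta>\<^sub>0 < 1/2"
  shows "\<exists>K\<ge>0. \<forall>N i \<beta> h. 1 \<le> N \<longrightarrow> 1 \<le> i \<longrightarrow> i \<le> N \<longrightarrow> 0 < \<beta> \<longrightarrow> \<beta> \<le> \<beta>\<^sub>0 \<longrightarrow>
    (\<integral>\<^sup>+y. ennreal (\<Sum>\<sigma>\<in>spins (rest N i). \<Sum>\<tau>\<in>spins (rest N i). cav_weight N \<beta> h (rest N i) y \<sigma> * cav_weight N \<beta> h (rest N i) y \<tau>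
       * (overlap N (rest N i) \<sigma> \<tau> - sk_q \<beta> h) ^ (2 * k)) \<partial>gaussian (pairs (rest N i))) \<le> ennreal (K / real N ^ k)"
proof -
  \<comment> \<open>The midpoint of \<open>2 * \<beta>\<^sub>0\<^sup>2\<close> and \<open>1/2\<close>; then \<open>\<epsilon>\<close> halves the distance of \<open>\<kappa>\<close> to \<open>1/2\<close>.\<close>
  define \<kappa> where "\<kappa> = \<beta>\<^sub>0\<^sup>2 + 1/4"
  define \<epsilon> where "\<epsilon> = (1/2 - \<kappa>) / (2 * \<kappa>)"
  have b: "\<beta>\<^sub>0\<^sup>2 < 1/4"
    using mult_strict_mono[OF \<beta>0(2) \<beta>0(2)] \<beta>0 by (simp add: power2_eq_square)
  have \<kappa>: "0 < \<kappa>" "\<kappa> < 1/2" "2 * \<beta>\<^sub>0\<^sup>2 < \<kappa>" using b by (auto simp: \<kappa>_def add_nonneg_pos)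
  have \<epsilon>: "0 < \<epsilon>" "\<kappa> * (1 + \<epsilon>) < 1/2" using \<kappa> by (auto simp: \<epsilon>_def field_simps)
  define A where "A = exp (1 / (2 * \<epsilon>)) / sqrt (1 - 2 * (\<kappa> * (1 + \<epsilon>)))"
  define c where "c = \<kappa> - 2 * \<beta>\<^sub>0\<^sup>2"
  have c: "0 < c" using \<kappa> by (simp add: c_def)
  have A0: "0 \<le> A" using \<epsilon> by (simp add: A_def)
  show ?thesis
  proof (intro exI[of _ "fact k / c ^ k * A"] conjI allI impI)
    show "0 \<le> fact k / c ^ k * A" using c A0 by simp
    fix N i :: nat and \<beta> h :: real
    assume N: "1 \<le> N" "1 \<le> i" "i \<le> N" and \<beta>: "0 < \<beta>" "\<beta> \<le> \<beta>\<^sub>0"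
    define V where "V = rest N i"
    define q where "q = sk_q \<beta> h"
    note q = sk_q_properties[OF \<beta>(1) order_le_less_trans[OF \<beta>(2) \<beta>0(2)], of h, folded q_def]
    have bb: "\<beta>\<^sup>2 \<le> \<beta>\<^sub>0\<^sup>2" using \<beta> by (intro power_mono) auto
    have b2: "2 * \<beta>\<^sup>2 \<le> \<kappa>" using bb \<kappa>(3) by linarith
    interpret latala N V \<beta> q h \<kappa>
      by unfold_locales (use N \<beta> q b2 card_rest[OF N(2,3)] in \<open>auto simp: V_def rest_finite rest_0\<close>)
    define w where "w = cav_weight N \<beta> h V"
    have w0: "0 \<le> w y \<sigma>" for y \<sigma> unfolding w_def by (rule cav_weight_nonneg)
    have w1: "(\<Sum>\<sigma>\<in>spins V. w y \<sigma>) = 1" for y unfolding w_def by (rule cav_weight_sum[OF finV])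
    define H where "H = (\<lambda>y. \<Sum>\<sigma>\<in>spins V. \<Sum>\<tau>\<in>spins V. w y \<sigma> * w y \<tau> * exp ((\<kappa> - 2 * \<beta>\<^sup>2) * (real N * (overlap N V \<sigma> \<tau> - q)\<^sup>2)))"
    have minus_wt[measurable]: "(\<lambda>y. w y \<sigma>) \<in> borel_measurable (gaussian (pairs V))" for \<sigma>
    proof -
      have [measurable]: "(\<lambda>y. cav_energy N \<beta> h V y \<sigma>) \<in> borel_measurable (gaussian (pairs V))" for \<sigma>
        unfolding cav_energy_def case_prod_unfold by measurable
      show ?thesis unfolding w_def cav_weight_def by measurable
    qed
    have Hm[measurable]: "H \<in> borel_measurable (gaussian (pairs V))" unfolding H_def by measurable
    have pt: "(\<Sum>\<sigma>\<in>spins V. \<Sum>\<tau>\<in>spins V. w y \<sigma> * w y \<tau> * (overlap N V \<sigma> \<tau> - q) ^ (2 * k)) \<le> fact k / (c * real N) ^ k * H y" for y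
    proof -
      have "(overlap N V \<sigma> \<tau> - q) ^ (2 * k) \<le> fact k / (c * real N) ^ k * exp ((\<kappa> - 2 * \<beta>\<^sup>2) * (real N * (overlap N V \<sigma> \<tau> - q)\<^sup>2))" for \<sigma> \<tau>
      proof -
        define \<rho> where "\<rho> = (overlap N V \<sigma> \<tau> - q)\<^sup>2"
        have cN: "0 < c * real N" using c N by simp
        have "(c * real N * \<rho>) ^ k / fact k \<le> exp (c * real N * \<rho>)"
          using c by (intro power_div_fact_le_exp) (auto simp: \<rho>_def)
        also have "\<dots> \<le> exp ((\<kappa> - 2 * \<beta>\<^sup>2) * (real N * \<rho>))"
          using bb by (simp add: c_def \<rho>_def mult_right_mono mult.assoc)
        finally have "(c * real N) ^ k * \<rho> ^ k \<le> fact k * exp ((\<kappa> - 2 * \<beta>\<^sup>2) * (real N * \<rho>))"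
          by (simp add: power_mult_distrib divide_le_eq mult.commute)
        moreover have "(overlap N V \<sigma> \<tau> - q) ^ (2 * k) = \<rho> ^ k" by (simp add: \<rho>_def power_mult)
        moreover have "0 < (c * real N) ^ k" using cN by simp
        ultimately show ?thesis
          by (simp add: \<rho>_def[symmetric] pos_le_divide_eq mult.commute[of "\<rho> ^ k"] del: power_mult_distrib)
      qed
      then have "(\<Sum>\<sigma>\<in>spins V. \<Sum>\<tau>\<in>spins V. w y \<sigma> * w y \<tau> * (overlap N V \<sigma> \<tau> - q) ^ (2 * k))
        \<le> (\<Sum>\<sigma>\<in>spins V. \<Sum>\<tau>\<in>spins V. w y \<sigma> * w y \<tau> * (fact k / (c * real N) ^ k * exp ((\<kappa> - 2 * \<beta>\<^sup>2) * (real N * (overlap N V \<sigma> \<tau> - q)\<^sup>2))))"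
        by (intro sum_mono mult_left_mono mult_nonneg_nonneg w0)
      also have "\<dots> = fact k / (c * real N) ^ k * H y"
        unfolding H_def sum_distrib_left by (intro sum.cong refl) (simp only: mult_ac)
      finally show ?thesis .
    qed
    have iH: "integrable (gaussian (pairs V)) H"
    proof -
      interpret prob_space "gaussian (pairs V)" by (rule prob_space_gaussian)
      have "\<bar>H y\<bar> \<le> exp (\<kappa> * (real N * 4))" for y
      proof -
        have "\<bar>H y\<bar> \<le> (\<Sum>\<sigma>\<in>spins V. \<Sum>\<tau>\<in>spins V. w y \<sigma> * w y \<tau> * exp (\<kappa> * (real N * 4)))"
          unfolding H_def
        proof (intro order_trans[OF sum_abs] sum_mono)
          fix \<sigma> \<tau> assume st: "\<sigma> \<in> spins V" "\<tau> \<in> spins V"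
          have "(\<kappa> - 2 * \<beta>\<^sup>2) * (real N * (overlap N V \<sigma> \<tau> - q)\<^sup>2) \<le> \<kappa> * (real N * 4)"
            using \<rho>_le[OF st] bb \<kappa> unfolding \<rho>_def by (intro mult_mono) auto
          then show "\<bar>w y \<sigma> * w y \<tau> * exp ((\<kappa> - 2 * \<beta>\<^sup>2) * (real N * (overlap N V \<sigma> \<tau> - q)\<^sup>2))\<bar> \<le> w y \<sigma> * w y \<tau> * exp (\<kappa> * (real N * 4))"
            using w0 by (simp add: abs_mult mult_left_mono)
        qed
        also have "\<dots> = exp (\<kappa> * (real N * 4))"
          by (simp add: sum_distrib_left[symmetric] sum_distrib_right[symmetric] w1)
        finally show ?thesis .
      qed
      then show ?thesis by (intro integrable_const_bound[where B="exp (\<kappa> * (real N * 4))"]) auto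
    qed
    have H0: "0 \<le> H y" for y unfolding H_def using w0 by (intro sum_nonneg mult_nonneg_nonneg) auto
    have f0: "0 \<le> fact k / (c * real N) ^ k" using c by simp
    have "(\<integral>\<^sup>+y. ennreal (\<Sum>\<sigma>\<in>spins V. \<Sum>\<tau>\<in>spins V. w y \<sigma> * w y \<tau> * (overlap N V \<sigma> \<tau> - q) ^ (2 * k)) \<partial>gaussian (pairs V))
      \<le> (\<integral>\<^sup>+y. ennreal (fact k / (c * real N) ^ k) * ennreal (H y) \<partial>gaussian (pairs V))"
      using f0 H0 pt by (intro nn_integral_mono) (simp add: ennreal_mult[symmetric] ennreal_leI)
    also have "\<dots> = ennreal (fact k / (c * real N) ^ k) * ennreal (\<integral>y. H y \<partial>gaussian (pairs V))"
      using iH H0 by (simp add: nn_integral_cmult nn_integral_eq_integral)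
    also have "\<dots> \<le> ennreal (fact k / (c * real N) ^ k) * ennreal A"
      using overlap_exponential_moment[OF \<epsilon>] unfolding H_def w_def A_def by (intro mult_left_mono ennreal_leI) auto
    also have "\<dots> = ennreal (fact k / c ^ k * A / real N ^ k)"
      using f0 A0 c by (simp add: ennreal_mult[symmetric] power_mult_distrib)
    finally show "(\<integral>\<^sup>+y. ennreal (\<Sum>\<sigma>\<in>spins (rest N i). \<Sum>\<tau>\<in>spins (rest N i). cav_weight N \<beta> h (rest N i) y \<sigma> * cav_weight N \<beta> h (rest N i) y \<tau>
       * (overlap N (rest N i) \<sigma> \<tau> - sk_q \<beta> h) ^ (2 * k)) \<partial>gaussian (pairs (rest N i))) \<le> ennreal (fact k / c ^ k * A / real N ^ k)"
      unfolding w_def V_def q_def .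
  qed
qed

section \<open>The field of the reduced system at the removed site\<close>

text \<open>Gibbs average over the system without site \<open>i\<close>, of a function of its field at \<open>i\<close>.\<close>
definition cav_avg :: "nat \<Rightarrow> nat \<Rightarrow> real \<Rightarrow> real \<Rightarrow> (real \<Rightarrow> real) \<Rightarrow> (nat \<times> nat \<Rightarrow> real) \<Rightarrow> real" where
  "cav_avg N i \<beta> h F G = (\<Sum>\<sigma>\<in>spins (rest N i). cav_weight N \<beta> h (rest N i) G \<sigma> * F (field_at N i G \<sigma>))"

definition gauss_avg :: "real \<Rightarrow> (real \<Rightarrow> real) \<Rightarrow> real \<Rightarrow> real" where
  "gauss_avg q F y = (\<integral>z. F (y + sqrt (1 - q) * z) \<partial>gauss1)"

lemma cav_weight_cong:
  assumes "\<And>e. e \<in> pairs V \<Longrightarrow> G e = G' e" shows "cav_weight N \<beta> h V G \<sigma> = cav_weight N \<beta> h V G' \<sigma>"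
proof -
  have "cav_energy N \<beta> h V G \<tau> = cav_energy N \<beta> h V G' \<tau>" for \<tau>
    unfolding cav_energy_def case_prod_unfold using assms by (simp cong: sum.cong)
  then show ?thesis by (simp add: cav_weight_def)
qed

lemma field_at_cong: "(\<And>e. e \<in> star N i \<Longrightarrow> G e = G' e) \<Longrightarrow> field_at N i G \<sigma> = field_at N i G' \<sigma>"
  unfolding field_at_def by (simp cong: sum.cong)

lemma star_finite: "finite (star N i)"
  by (rule finite_subset[OF _ bonds_finite[of N]]) (auto simp: star_def)

lemma component_measurable: "e \<in> I \<Longrightarrow> (\<lambda>G. G e) \<in> borel_measurable (gaussian I)"
  by measurable

lemma cav_weight_measurable:
  assumes "pairs V \<subseteq> I" shows "(\<lambda>G. cav_weight N \<beta> h V G \<sigma>) \<in> borel_measurable (gaussian I)"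
proof -
  have [measurable]: "(\<lambda>G. cav_energy N \<beta> h V G \<sigma>) \<in> borel_measurable (gaussian I)" for \<sigma>
    unfolding cav_energy_def case_prod_unfold
  proof (intro borel_measurable_add borel_measurable_times borel_measurable_const borel_measurable_sum)
    fix e assume "e \<in> pairs V"
    then show "(\<lambda>G. G (fst e, snd e)) \<in> borel_measurable (gaussian I)"
      using assms by (intro component_measurable) auto
  qed
  show ?thesis unfolding cav_weight_def by measurable
qed

lemma field_at_measurable: assumes "star N i \<subseteq> I" shows "(\<lambda>G. field_at N i G \<sigma>) \<in> borel_measurable (gaussian I)"
  unfolding field_at_def
proof (intro borel_measurable_times borel_measurable_const borel_measurable_sum)
  fix e assume "e \<in> star N i"
  then show "(\<lambda>G. G e) \<in> borel_measurable (gaussian I)" using assms by (intro component_measurable) auto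
qed

lemma cav_avg_measurable:
  assumes [measurable]: "F \<in> borel_measurable borel"
  shows "cav_avg N i \<beta> h F \<in> borel_measurable (gaussian (bonds N))"
proof -
  have [measurable]: "(\<lambda>G. cav_weight N \<beta> h (rest N i) G \<sigma>) \<in> borel_measurable (gaussian (bonds N))"
    "(\<lambda>G. field_at N i G \<sigma>) \<in> borel_measurable (gaussian (bonds N))" for \<sigma>
    using bonds_split by (auto intro!: cav_weight_measurable field_at_measurable)
  show ?thesis unfolding cav_avg_def by measurable
qed

lemma gauss_avg_measurable:
  assumes [measurable]: "F \<in> borel_measurable borel"
  shows "gauss_avg q F \<in> borel_measurable borel"
proof -
  interpret sigma_finite_measure gauss1 by (rule prob_space_imp_sigma_finite[OF prob_space_gauss1])
  show ?thesis unfolding gauss_avg_def by measurable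
qed

text \<open>The couplings at \<open>i\<close> can be averaged with the reduced system fixed.\<close>
lemma nn_integral_bonds_split:
  assumes [measurable]: "f \<in> borel_measurable (gaussian (bonds N))"
  shows "(\<integral>\<^sup>+G. f G \<partial>gaussian (bonds N)) =
    (\<integral>\<^sup>+y. (\<integral>\<^sup>+g. f (merge (pairs (rest N i)) (star N i) (y, g)) \<partial>gaussian (star N i)) \<partial>gaussian (pairs (rest N i)))"
proof -
  interpret product_sigma_finite "\<lambda>_. gauss1" by (rule product_sigma_finite_gauss1)
  show ?thesis using assms unfolding gaussian_def bonds_split(1)[of N i]
    by (intro product_nn_integral_fold bonds_split(2) pairs_finite rest_finite star_finite)
qed

lemma merge_cav_weight: "cav_weight N \<beta> h (rest N i) (merge (pairs (rest N i)) (star N i) (y, g)) \<sigma> = cav_weight N \<beta> h (rest N i) y \<sigma>"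
  by (intro cav_weight_cong) (simp add: merge_def)

lemma merge_field_at: "field_at N i (merge (pairs (rest N i)) (star N i) (y, g)) \<sigma> = field_at N i g \<sigma>"
proof (intro field_at_cong)
  fix e assume "e \<in> star N i"
  moreover then have "e \<notin> pairs (rest N i)" using bonds_split(2)[of N i] by blast
  ultimately show "merge (pairs (rest N i)) (star N i) (y, g) e = g e" by (simp add: merge_def)
qed

lemma star_norm:
  assumes "1 \<le> N" "1 \<le> i" "i \<le> N" "\<sigma> \<in> spins (rest N i)"
  shows "(\<Sum>e\<in>star N i. (\<sigma> (other i e) / sqrt (real N))\<^sup>2) \<le> 1"
  using star_overlap[OF assms(2,3), of \<sigma> \<sigma>] overlap_self[OF assms(4,2,3)] assms(1)
  by (simp add: power2_eq_square)

text \<open>Conditionally on the reduced system the couplings at \<open>i\<close> form a cavity system, to which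
\<open>cavity_error_moment\<close> applies; its small parameters are controlled by \<open>overlap_moments\<close>. The constant depends
on \<open>W\<close> only through the bounds \<open>B\<close>, so that it is uniform over tilts.\<close>
theorem cavity_limit_moment:
  assumes \<beta>0: "0 < \<beta>\<^sub>0" "\<beta>\<^sub>0 < 1/2"
  shows "\<exists>K\<ge>0. \<forall>N i \<beta> h W. 1 \<le> N \<longrightarrow> 1 \<le> i \<longrightarrow> i \<le> N \<longrightarrow> 0 < \<beta> \<longrightarrow> \<beta> \<le> \<beta>\<^sub>0 \<longrightarrow>
    (\<forall>m y. (W m has_real_derivative W (Suc m) y) (at y)) \<longrightarrow>
    (\<forall>m y. \<bar>W m y\<bar> \<le> B m * exp (y\<^sup>2 / (320 * real (2 * k)))) \<longrightarrow>
    (\<integral>\<^sup>+G. ennreal ((cav_avg N i \<beta> h (W 0) G - gauss_avg (sk_q \<beta> h) (W 0) (cav_avg N i \<beta> h (\<lambda>y. y) G)) ^ (2 * k)) \<partial>gaussian (bonds N))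
      \<le> ennreal (K / real N ^ k)"
proof (cases "k = 0")
  case True
  then show ?thesis by (intro exI[of _ 1]) (simp add: prob_space.emeasure_space_1[OF prob_space_gaussian])
next
  case False
  from overlap_moments[OF \<beta>0, of k] obtain K1 where K1: "0 \<le> K1" and K1a: "\<forall>N i \<beta> h. 1 \<le> N \<longrightarrow> 1 \<le> i \<longrightarrow> i \<le> N \<longrightarrow> 0 < \<beta> \<longrightarrow> \<beta> \<le> \<beta>\<^sub>0 \<longrightarrow>
    (\<integral>\<^sup>+y. ennreal (\<Sum>\<sigma>\<in>spins (rest N i). \<Sum>\<tau>\<in>spins (rest N i). cav_weight N \<beta> h (rest N i) y \<sigma> * cav_weight N \<beta> h (rest N i) y \<tau>
       * (overlap N (rest N i) \<sigma> \<tau> - sk_q \<beta> h) ^ (2 * k)) \<partial>gaussian (pairs (rest N i))) \<le> ennreal (K1 / real N ^ k)"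
    by (elim exE conjE)
  define C where "C = raise_const (2 * k) B (2 * (2 * k)) [] (\<lambda>_. 0)"
  have C0: "0 \<le> C" unfolding C_def by (rule raise_const_nonneg)
  show ?thesis
  proof (intro exI[of _ "C * (16 ^ k * (4 * K1 + 1))"] conjI allI impI)
    show "0 \<le> C * (16 ^ k * (4 * K1 + 1))" using C0 K1 by simp
    fix N i :: nat and \<beta> h :: real and W :: "nat \<Rightarrow> real \<Rightarrow> real"
    assume N: "1 \<le> N" "1 \<le> i" "i \<le> N" and \<beta>: "0 < \<beta>" "\<beta> \<le> \<beta>\<^sub>0"
      and dW: "\<forall>m y. (W m has_real_derivative W (Suc m) y) (at y)"
      and bW: "\<forall>m y. \<bar>W m y\<bar> \<le> B m * exp (y\<^sup>2 / (320 * real (2 * k)))"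
    define V where "V = rest N i"
    define q where "q = sk_q \<beta> h"
    note q = sk_q_properties[OF \<beta>(1) order_le_less_trans[OF \<beta>(2) \<beta>0(2)], of h, folded q_def]
    define D where "D = (\<lambda>G. cav_avg N i \<beta> h (W 0) G - gauss_avg q (W 0) (cav_avg N i \<beta> h (\<lambda>y. y) G))"
    define \<kappa> where "\<kappa> = (\<lambda>y. \<Sum>\<sigma>\<in>spins V. \<Sum>\<tau>\<in>spins V. cav_weight N \<beta> h V y \<sigma> * cav_weight N \<beta> h V y \<tau> * (overlap N V \<sigma> \<tau> - q) ^ (2 * k))"
    have \<kappa>0: "0 \<le> \<kappa> y" for y unfolding \<kappa>_def using cav_weight_nonneg by (intro sum_nonneg mult_nonneg_nonneg) auto
    have Wm[measurable]: "W m \<in> borel_measurable borel" for m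
      using dW by (intro borel_measurable_continuous_onI DERIV_continuous_on) (auto intro: has_field_derivative_at_within)
    have Dm[measurable]: "D \<in> borel_measurable (gaussian (bonds N))"
    proof -
      have [measurable]: "cav_avg N i \<beta> h (W 0) \<in> borel_measurable (gaussian (bonds N))" "cav_avg N i \<beta> h (\<lambda>y. y) \<in> borel_measurable (gaussian (bonds N))"
        "gauss_avg q (W 0) \<in> borel_measurable borel"
        by (auto intro!: cav_avg_measurable gauss_avg_measurable)
      show ?thesis unfolding D_def by measurable
    qed
    have \<kappa>m[measurable]: "\<kappa> \<in> borel_measurable (gaussian (pairs V))"
    proof -
      have [measurable]: "(\<lambda>y. cav_weight N \<beta> h V y \<sigma>) \<in> borel_measurable (gaussian (pairs V))" for \<sigma>
        by (rule cav_weight_measurable) simp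
      show ?thesis unfolding \<kappa>_def by measurable
    qed
    have inner: "(\<integral>\<^sup>+g. ennreal (D (merge (pairs V) (star N i) (y, g)) ^ (2 * k)) \<partial>gaussian (star N i))
      \<le> ennreal (C * (16 ^ k * (4 * \<kappa> y + (1 / real N) ^ (2 * k))))" for y
    proof -
      interpret cavity "2 * k" "star N i" "spins V" "cav_weight N \<beta> h V y" "\<lambda>\<sigma> e. \<sigma> (other i e) / sqrt (real N)" q W B
      proof
        show "1 \<le> 2 * k" using False by simp
        show "finite (star N i)" by (rule star_finite)
        show "(0, a) \<notin> star N i" for a by (simp add: star_def bonds_def)
        show "finite (spins V)" by (simp add: V_def spins_finite rest_finite)
        show "0 \<le> cav_weight N \<beta> h V y s" for s by (rule cav_weight_nonneg)
        show "sum (cav_weight N \<beta> h V y) (spins V) = 1" by (rule cav_weight_sum) (simp add: V_def rest_finite)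
        show "(\<Sum>e\<in>star N i. (s (other i e) / sqrt (real N))\<^sup>2) \<le> 1" if "s \<in> spins V" for s
          using that N by (intro star_norm) (auto simp: V_def)
        show "0 \<le> q" "q \<le> 1" using q by auto
        show "(W m has_real_derivative W (Suc m) y) (at y)" for m y using dW by blast
        show "\<bar>W m y\<bar> \<le> B m * exp (y\<^sup>2 / (320 * real (2 * k)))" for m y using bW by blast
      qed
      have RO: "R s t = overlap N V s t" for s t unfolding R_def V_def by (rule star_overlap[OF N(2,3)])
      have Rs: "R s s = 1 - 1 / real N" if "s \<in> spins V" for s
        unfolding RO using that overlap_self[OF _ N(2,3)] by (simp add: V_def)
      have ce: "D (merge (pairs V) (star N i) (y, g)) = cavity_error g" for g
      proof -
        have bl: "(\<Sum>e\<in>star N i. g e * bary e) = (\<Sum>\<sigma>\<in>spins V. cav_weight N \<beta> h V y \<sigma> * field_at N i g \<sigma>)"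
          unfolding bary_def field_at_def sum_distrib_left by (subst sum.swap) (simp add: mult_ac)
        have "D (merge (pairs V) (star N i) (y, g)) = (\<Sum>\<sigma>\<in>spins V. cav_weight N \<beta> h V y \<sigma> * W 0 (field_at N i g \<sigma>))
          - (\<integral>z. W 0 ((\<Sum>\<sigma>\<in>spins V. cav_weight N \<beta> h V y \<sigma> * field_at N i g \<sigma>) + sqrt (1 - q) * z) \<partial>gauss1)"
          unfolding D_def cav_avg_def gauss_avg_def V_def merge_cav_weight merge_field_at ..
        also have "\<dots> = cavity_error g" unfolding cavity_error_def bl unfolding field_at_def ..
        finally show ?thesis .
      qed
      have "(\<integral>g. cavity_error g ^ (2 * k) \<partial>gaussian (star N i)) \<le> C * (16 ^ k * (4 * \<kappa> y + (1 / real N) ^ (2 * k)))"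
        using cavity_error_moment[OF small_parameters[OF refl Rs]] unfolding C_def \<kappa>_def RO .
      moreover have "(\<integral>\<^sup>+g. ennreal (cavity_error g ^ (2 * k)) \<partial>gaussian (star N i)) = ennreal (\<integral>g. cavity_error g ^ (2 * k) \<partial>gaussian (star N i))"
        using cavity_error_pow_integrable by (intro nn_integral_eq_integral) auto
      ultimately show ?thesis unfolding ce by (simp add: ennreal_leI)
    qed
    have f: "(\<lambda>G. ennreal (D G ^ (2 * k))) \<in> borel_measurable (gaussian (bonds N))" by measurable
    have "(\<integral>\<^sup>+G. ennreal (D G ^ (2 * k)) \<partial>gaussian (bonds N))
      \<le> (\<integral>\<^sup>+y. ennreal (C * (16 ^ k * (4 * \<kappa> y + (1 / real N) ^ (2 * k)))) \<partial>gaussian (pairs V))"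
      unfolding nn_integral_bonds_split[OF f, of i] V_def[symmetric] by (intro nn_integral_mono inner)
    also have "\<dots> = (\<integral>\<^sup>+y. ennreal (C * 16 ^ k * 4) * ennreal (\<kappa> y) + ennreal (C * 16 ^ k * (1 / real N) ^ (2 * k)) \<partial>gaussian (pairs V))"
      using C0 \<kappa>0 by (intro nn_integral_cong) (simp add: ennreal_mult[symmetric] ennreal_plus[symmetric] algebra_simps del: ennreal_plus)
    also have "\<dots> = ennreal (C * 16 ^ k * 4) * (\<integral>\<^sup>+y. ennreal (\<kappa> y) \<partial>gaussian (pairs V)) + ennreal (C * 16 ^ k * (1 / real N) ^ (2 * k))"
      by (simp add: nn_integral_add nn_integral_cmult prob_space.emeasure_space_1[OF prob_space_gaussian])
    also have "\<dots> \<le> ennreal (C * 16 ^ k * 4) * ennreal (K1 / real N ^ k) + ennreal (C * 16 ^ k * (1 / real N ^ k))"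
    proof (intro add_mono mult_left_mono ennreal_leI)
      show "(\<integral>\<^sup>+y. ennreal (\<kappa> y) \<partial>gaussian (pairs V)) \<le> ennreal (K1 / real N ^ k)"
        unfolding \<kappa>_def V_def q_def by (rule K1a[rule_format, OF N \<beta>])
      have "real N ^ k \<le> real N ^ (2 * k)" using N by (intro power_increasing) auto
      then show "(1 / real N) ^ (2 * k) \<le> 1 / real N ^ k"
        unfolding power_one_over using N by (intro divide_left_mono) auto
    qed (use C0 in auto)
    also have "\<dots> = ennreal (C * (16 ^ k * (4 * K1 + 1)) / real N ^ k)"
      using C0 K1 by (simp add: ennreal_mult[symmetric] ennreal_plus[symmetric] add_divide_distrib algebra_simps del: ennreal_plus)
    finally show "(\<integral>\<^sup>+G. ennreal ((cav_avg N i \<beta> h (W 0) G - gauss_avg (sk_q \<beta> h) (W 0) (cav_avg N i \<beta> h (\<lambda>y. y) G)) ^ (2 * k)) \<partial>gaussian (bonds N))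
      \<le> ennreal (C * (16 ^ k * (4 * K1 + 1)) / real N ^ k)"
      unfolding D_def q_def .
  qed
qed

section \<open>Moderate growth and orders of moments\<close>

text \<open>Moderate growth, uniformly over a family indexed by \<open>Q\<close>; the uniformity carries constants through \<open>\<beta>\<close>
and \<open>h\<close>.\<close>
definition growth :: "'p set \<Rightarrow> ('p \<Rightarrow> real \<Rightarrow> real) \<Rightarrow> bool" where
  "growth Q F \<longleftrightarrow> (\<forall>a>0. \<exists>C\<ge>0. \<forall>p\<in>Q. \<forall>y. \<bar>F p y\<bar> \<le> C * exp (a * y\<^sup>2))"

lemma growthI: "(\<And>a. 0 < a \<Longrightarrow> \<exists>C\<ge>0. \<forall>p\<in>Q. \<forall>y. \<bar>F p y\<bar> \<le> C * exp (a * y\<^sup>2)) \<Longrightarrow> growth Q F"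
  by (simp add: growth_def)

lemma growthE:
  assumes "growth Q F" "0 < a"
  obtains C where "0 \<le> C" "\<And>p y. p \<in> Q \<Longrightarrow> \<bar>F p y\<bar> \<le> C * exp (a * y\<^sup>2)"
  using assms unfolding growth_def by blast

lemma growth_add: assumes "growth Q F" "growth Q G" shows "growth Q (\<lambda>p y. F p y + G p y)"
proof (rule growthI)
  fix a :: real assume a: "0 < a"
  obtain C where C: "0 \<le> C" "\<And>p y. p \<in> Q \<Longrightarrow> \<bar>F p y\<bar> \<le> C * exp (a * y\<^sup>2)"
    by (rule growthE[OF assms(1) a]) blast
  obtain D where D: "0 \<le> D" "\<And>p y. p \<in> Q \<Longrightarrow> \<bar>G p y\<bar> \<le> D * exp (a * y\<^sup>2)"
    by (rule growthE[OF assms(2) a]) blast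
  have "\<bar>F p y + G p y\<bar> \<le> (C + D) * exp (a * y\<^sup>2)" if "p \<in> Q" for p y
    using C(2)[OF that, of y] D(2)[OF that, of y] by (simp add: distrib_right abs_le_iff)
  then show "\<exists>C\<ge>0. \<forall>p\<in>Q. \<forall>y. \<bar>F p y + G p y\<bar> \<le> C * exp (a * y\<^sup>2)"
    using C(1) D(1) by (intro exI[of _ "C + D"]) auto
qed

lemma growth_mult: assumes "growth Q F" "growth Q G" shows "growth Q (\<lambda>p y. F p y * G p y)"
proof (rule growthI)
  fix a :: real assume "0 < a"
  then have a: "0 < a/2" by simp
  obtain C where C: "0 \<le> C" "\<And>p y. p \<in> Q \<Longrightarrow> \<bar>F p y\<bar> \<le> C * exp (a/2 * y\<^sup>2)"
    by (rule growthE[OF assms(1) a]) blast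
  obtain D where D: "0 \<le> D" "\<And>p y. p \<in> Q \<Longrightarrow> \<bar>G p y\<bar> \<le> D * exp (a/2 * y\<^sup>2)"
    by (rule growthE[OF assms(2) a]) blast
  have "\<bar>F p y * G p y\<bar> \<le> (C * D) * exp (a * y\<^sup>2)" if "p \<in> Q" for p y
  proof -
    have "\<bar>F p y * G p y\<bar> \<le> (C * exp (a/2 * y\<^sup>2)) * (D * exp (a/2 * y\<^sup>2))"
      unfolding abs_mult using C D that by (intro mult_mono) auto
    also have "\<dots> = (C * D) * (exp (a/2 * y\<^sup>2) * exp (a/2 * y\<^sup>2))" by (simp only: mult_ac)
    also have "exp (a/2 * y\<^sup>2) * exp (a/2 * y\<^sup>2) = exp (a * y\<^sup>2)" by (simp add: exp_add[symmetric])
    finally show ?thesis .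
  qed
  then show "\<exists>C\<ge>0. \<forall>p\<in>Q. \<forall>y. \<bar>F p y * G p y\<bar> \<le> C * exp (a * y\<^sup>2)"
    using C(1) D(1) by (intro exI[of _ "C * D"]) auto
qed

lemma growth_bounded: assumes "\<And>p y. p \<in> Q \<Longrightarrow> \<bar>F p y\<bar> \<le> c" shows "growth Q F"
proof (rule growthI)
  fix a :: real assume a: "0 < a"
  have "\<bar>F p y\<bar> \<le> \<bar>c\<bar> * exp (a * y\<^sup>2)" if "p \<in> Q" for p y
  proof -
    have "\<bar>F p y\<bar> \<le> \<bar>c\<bar> * 1" using assms[OF that, of y] by simp
    also have "\<dots> \<le> \<bar>c\<bar> * exp (a * y\<^sup>2)" using a by (intro mult_left_mono) auto
    finally show ?thesis .
  qed
  then show "\<exists>C\<ge>0. \<forall>p\<in>Q. \<forall>y. \<bar>F p y\<bar> \<le> C * exp (a * y\<^sup>2)" by (intro exI[of _ "\<bar>c\<bar>"]) auto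
qed

lemma growth_mono: assumes "growth Q F" "\<And>p y. p \<in> Q \<Longrightarrow> \<bar>G p y\<bar> \<le> \<bar>F p y\<bar>" shows "growth Q G"
  using assms unfolding growth_def by (meson order_trans)

lemma growth_compose: assumes "growth Q F" "\<And>p. p \<in> Q' \<Longrightarrow> f p \<in> Q" shows "growth Q' (\<lambda>p. F (f p))"
  using assms unfolding growth_def by meson

lemma exp_abs_le: "0 < a \<Longrightarrow> exp \<bar>y\<bar> \<le> exp (1 / (4 * a)) * exp (a * y\<^sup>2)" for y a :: real
proof -
  assume a: "0 < a"
  have "0 \<le> (2 * a * \<bar>y\<bar> - 1)\<^sup>2 / (4 * a)" using a by simp
  also have "\<dots> = 1 / (4 * a) + a * y\<^sup>2 - \<bar>y\<bar>" using a by (simp add: power2_eq_square field_simps)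
  finally show ?thesis by (simp add: exp_add[symmetric])
qed

lemma growth_exp: "growth {c. \<bar>c\<bar> \<le> 1} (\<lambda>c y. exp (c * y))"
proof (rule growthI)
  fix a :: real assume a: "0 < a"
  have "\<bar>exp (c * y)\<bar> \<le> exp (1 / (4 * a)) * exp (a * y\<^sup>2)" if "\<bar>c\<bar> \<le> 1" for c y :: real
  proof -
    have "c * y \<le> \<bar>c\<bar> * \<bar>y\<bar>" by (metis abs_ge_self abs_mult)
    also have "\<dots> \<le> 1 * \<bar>y\<bar>" using that by (intro mult_right_mono) auto
    finally have "exp (c * y) \<le> exp \<bar>y\<bar>" by simp
    then show ?thesis using order_trans[OF _ exp_abs_le[OF a, of y]] by (simp only: abs_exp_cancel)
  qed
  then show "\<exists>C\<ge>0. \<forall>c\<in>{c. \<bar>c\<bar> \<le> 1}. \<forall>y. \<bar>exp (c * y)\<bar> \<le> C * exp (a * y\<^sup>2)"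
    by (intro exI[of _ "exp (1 / (4 * a))"]) auto
qed

lemma growth_id: "growth Q (\<lambda>_ y. y)"
proof -
  have "growth Q (\<lambda>p y. exp (1 * y) + exp (- 1 * y))"
    by (intro growth_add growth_compose[OF growth_exp]) auto
  then show ?thesis
  proof (rule growth_mono)
    fix y :: real
    have e: "y < exp y" "- y < exp (- y)" using exp_gt_self[of y] exp_gt_self[of "- y"] by auto
    have p: "0 < exp y" "0 < exp (- y)" by (rule exp_gt_zero)+
    have "\<bar>y\<bar> \<le> exp y + exp (- y)" unfolding abs_le_iff using e p by linarith
    then show "\<bar>y\<bar> \<le> \<bar>exp (1 * y) + exp (- 1 * y)\<bar>" by simp
  qed
qed

text \<open>Outside a compact set the limit bounds the function, inside it continuity does.\<close>
lemma moderate_growth_imp_growth: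
  fixes U :: "real \<Rightarrow> real"
  assumes "moderate_growth U"
  shows "growth Q (\<lambda>_. U)"
proof (rule growthI)
  fix a :: real assume a: "0 < a"
  have c: "continuous_on UNIV U" and l: "((\<lambda>x. U x * exp (- a * (norm x)\<^sup>2)) \<longlongrightarrow> 0) at_infinity"
    using assms a by (auto simp: moderate_growth_def)
  have "\<forall>\<^sub>F x in at_infinity. dist (U x * exp (- a * (norm x)\<^sup>2)) 0 < 1" using tendstoD[OF l] by simp
  then obtain b where b: "\<And>x. b \<le> norm x \<Longrightarrow> \<bar>U x * exp (- a * (norm x)\<^sup>2)\<bar> < 1"
    unfolding eventually_at_infinity by auto
  have "compact (U ` {-\<bar>b\<bar>..\<bar>b\<bar>})" using c by (intro compact_continuous_image continuous_on_subset[OF c]) auto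
  then obtain C where C: "\<And>x. x \<in> {-\<bar>b\<bar>..\<bar>b\<bar>} \<Longrightarrow> \<bar>U x\<bar> \<le> C"
    using compact_imp_bounded bounded_iff by (metis image_eqI real_norm_def)
  have "\<bar>U x\<bar> \<le> (1 + \<bar>C\<bar>) * exp (a * x\<^sup>2)" for x
  proof (cases "x \<in> {-\<bar>b\<bar>..\<bar>b\<bar>}")
    case True
    have "\<bar>U x\<bar> \<le> (1 + \<bar>C\<bar>) * 1" using C[OF True] by simp
    also have "\<dots> \<le> (1 + \<bar>C\<bar>) * exp (a * x\<^sup>2)" using a by (intro mult_left_mono) auto
    finally show ?thesis .
  next
    case False
    then have "b \<le> norm x" by auto
    from b[OF this] have "\<bar>U x\<bar> * exp (- (a * x\<^sup>2)) \<le> 1" by (simp add: abs_mult)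
    then have "\<bar>U x\<bar> \<le> 1 * exp (a * x\<^sup>2)" by (simp add: exp_minus field_simps)
    also have "\<dots> \<le> (1 + \<bar>C\<bar>) * exp (a * x\<^sup>2)" by (intro mult_right_mono) auto
    finally show ?thesis .
  qed
  then show "\<exists>C\<ge>0. \<forall>p\<in>Q. \<forall>y. \<bar>U y\<bar> \<le> C * exp (a * y\<^sup>2)" by (intro exI[of _ "1 + \<bar>C\<bar>"]) auto
qed

text \<open>The derivative of order \<open>m\<close> of \<open>U 0 y * exp (c * y)\<close> is \<open>tilt U c m 0 y * exp (c * y)\<close>; the last index counts
derivatives of \<open>U\<close>.\<close>
primrec tilt :: "(nat \<Rightarrow> real \<Rightarrow> real) \<Rightarrow> real \<Rightarrow> nat \<Rightarrow> nat \<Rightarrow> real \<Rightarrow> real" where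
  "tilt U c 0 = U"
| "tilt U c (Suc m) = (\<lambda>j y. tilt U c m (Suc j) y + c * tilt U c m j y)"

lemma tilt_deriv:
  assumes "\<And>j y. (U j has_real_derivative U (Suc j) y) (at y)"
  shows "(tilt U c m j has_real_derivative tilt U c m (Suc j) y) (at y)"
  by (induction m arbitrary: j) (auto intro!: derivative_eq_intros assms)

lemma tilt_exp_deriv:
  assumes "\<And>j y. (U j has_real_derivative U (Suc j) y) (at y)"
  shows "((\<lambda>y. tilt U c m 0 y * exp (c * y)) has_real_derivative tilt U c (Suc m) 0 y * exp (c * y)) (at y)"
  by (auto intro!: derivative_eq_intros tilt_deriv assms simp: algebra_simps)

lemma tilt_growth:
  assumes "\<And>j. growth {c::real. \<bar>c\<bar> \<le> 1} (\<lambda>_. U j)"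
  shows "growth {c. \<bar>c\<bar> \<le> 1} (\<lambda>c. tilt U c m j)"
proof (induction m arbitrary: j)
  case (Suc m)
  have "growth {c. \<bar>c\<bar> \<le> 1} (\<lambda>c y. c)" by (rule growth_bounded[of _ _ 1]) auto
  from growth_add[OF Suc[of "Suc j"] growth_mult[OF this Suc[of j]]] show ?case by simp
qed (simp add: assms)

lemma gauss_avg_bound:
  assumes q: "0 \<le> q" "q \<le> 1" and a: "0 < a" "a \<le> 1/8" and b: "\<And>y. \<bar>F y\<bar> \<le> C * exp (a * y\<^sup>2)"
    and [measurable]: "F \<in> borel_measurable borel"
  shows "integrable gauss1 (\<lambda>z. F (y + sqrt (1 - q) * z))" "\<bar>gauss_avg q F y\<bar> \<le> 2 * C * exp (2 * a * y\<^sup>2)"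
proof -
  have C0: "0 \<le> C" using order_trans[OF abs_ge_zero b[of 0]] by simp
  have pt: "\<bar>F (y + sqrt (1 - q) * z)\<bar> \<le> (C * exp (2 * a * y\<^sup>2)) * exp (1/4 * z\<^sup>2)" for z
  proof -
    have "(y + sqrt (1 - q) * z)\<^sup>2 \<le> 2 * y\<^sup>2 + 2 * (sqrt (1 - q) * z)\<^sup>2"
      using zero_le_power2[of "y - sqrt (1 - q) * z"] by (simp add: power2_eq_square algebra_simps)
    also have "\<dots> \<le> 2 * y\<^sup>2 + 2 * z\<^sup>2"
      using q by (simp add: power_mult_distrib mult_left_le_one_le)
    finally have "a * (y + sqrt (1 - q) * z)\<^sup>2 \<le> a * (2 * y\<^sup>2 + 2 * z\<^sup>2)" using a by (intro mult_left_mono) auto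
    also have "\<dots> = 2 * a * y\<^sup>2 + 2 * a * z\<^sup>2" by (simp add: algebra_simps)
    also have "\<dots> \<le> 2 * a * y\<^sup>2 + 1/4 * z\<^sup>2" using a by (intro add_left_mono mult_right_mono) auto
    finally have "C * exp (a * (y + sqrt (1 - q) * z)\<^sup>2) \<le> C * exp (2 * a * y\<^sup>2 + 1/4 * z\<^sup>2)"
      using C0 by (intro mult_left_mono) auto
    then show ?thesis using b[of "y + sqrt (1 - q) * z"] by (simp add: exp_add mult.assoc)
  qed
  have ie: "integrable gauss1 (\<lambda>z. (C * exp (2 * a * y\<^sup>2)) * exp (1/4 * z\<^sup>2))"
    by (intro integrable_mult_right integrable_gauss1_exp_square) simp
  show i: "integrable gauss1 (\<lambda>z. F (y + sqrt (1 - q) * z))"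
  proof (rule integrable_gauss1_bound)
    show "\<bar>F (y + sqrt (1 - q) * z)\<bar> \<le> (C * exp (2 * a * y\<^sup>2)) * exp (z\<^sup>2/4)" for z using pt[of z] by simp
  qed measurable
  have "\<bar>gauss_avg q F y\<bar> \<le> (\<integral>z. (C * exp (2 * a * y\<^sup>2)) * exp (1/4 * z\<^sup>2) \<partial>gauss1)"
    unfolding gauss_avg_def using i pt ie by (intro order_trans[OF integral_abs_bound integral_mono] integrable_abs) auto
  also have "\<dots> = (C * exp (2 * a * y\<^sup>2)) * (1 / sqrt (1 - 2 * (1/4)))"
    using integral_gauss1_exp_square[of "1/4"] by simp
  also have "\<dots> \<le> (C * exp (2 * a * y\<^sup>2)) * 2"
    using C0 by (intro mult_left_mono) (auto simp: real_sqrt_divide real_le_lsqrt)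
  finally show "\<bar>gauss_avg q F y\<bar> \<le> 2 * C * exp (2 * a * y\<^sup>2)" by simp
qed

lemma growth_gauss_avg:
  assumes g: "growth Q F" and q: "\<And>p. p \<in> Q \<Longrightarrow> 0 \<le> q p \<and> q p \<le> 1"
    and m: "\<And>p. p \<in> Q \<Longrightarrow> F p \<in> borel_measurable borel"
  shows "growth Q (\<lambda>p. gauss_avg (q p) (F p))"
proof (rule growthI)
  fix a :: real assume "0 < a"
  define b where "b = min (a/2) (1/8)"
  have b: "0 < b" "b \<le> 1/8" "2 * b \<le> a" using \<open>0 < a\<close> by (auto simp: b_def)
  obtain C where C: "0 \<le> C" "\<And>p y. p \<in> Q \<Longrightarrow> \<bar>F p y\<bar> \<le> C * exp (b * y\<^sup>2)"
    by (rule growthE[OF g b(1)]) blast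
  have "\<bar>gauss_avg (q p) (F p) y\<bar> \<le> 2 * C * exp (a * y\<^sup>2)" if p: "p \<in> Q" for p y
  proof -
    have "\<bar>gauss_avg (q p) (F p) y\<bar> \<le> 2 * C * exp (2 * b * y\<^sup>2)"
      using gauss_avg_bound(2)[OF _ _ b(1,2) C(2)[OF p] m[OF p]] q[OF p] by blast
    also have "\<dots> \<le> 2 * C * exp (a * y\<^sup>2)" using C(1) b by (intro mult_left_mono) (auto intro!: mult_right_mono)
    finally show ?thesis .
  qed
  then show "\<exists>C\<ge>0. \<forall>p\<in>Q. \<forall>y. \<bar>gauss_avg (q p) (F p) y\<bar> \<le> C * exp (a * y\<^sup>2)"
    using C(1) by (intro exI[of _ "2 * C"]) auto
qed

locale sk_range = fixes \<beta>\<^sub>0 :: real assumes \<beta>0: "0 < \<beta>\<^sub>0" "\<beta>\<^sub>0 < 1/2"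
begin

definition admissible :: "nat \<Rightarrow> nat \<Rightarrow> real \<Rightarrow> real \<Rightarrow> bool" where
  "admissible N i \<beta> h \<longleftrightarrow> 1 \<le> N \<and> 1 \<le> i \<and> i \<le> N \<and> 0 < \<beta> \<and> \<beta> \<le> \<beta>\<^sub>0"

text \<open>\<open>X\<close> is of the order \<open>N\<close> to the power \<open>- r / 2\<close> in all even moments, uniformly in the parameters.\<close>
definition moment_order :: "nat \<Rightarrow> (nat \<Rightarrow> nat \<Rightarrow> real \<Rightarrow> real \<Rightarrow> (nat \<times> nat \<Rightarrow> real) \<Rightarrow> real) \<Rightarrow> bool" where
  "moment_order r X \<longleftrightarrow> (\<forall>N i \<beta> h. admissible N i \<beta> h \<longrightarrow> X N i \<beta> h \<in> borel_measurable (gaussian (bonds N))) \<and>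
    (\<forall>k. \<exists>K\<ge>0. \<forall>N i \<beta> h. admissible N i \<beta> h \<longrightarrow>
      (\<integral>\<^sup>+G. ennreal (X N i \<beta> h G ^ (2 * k)) \<partial>gaussian (bonds N)) \<le> ennreal (K / real N ^ (r * k)))"

lemma moment_orderI:
  assumes "\<And>N i \<beta> h. admissible N i \<beta> h \<Longrightarrow> X N i \<beta> h \<in> borel_measurable (gaussian (bonds N))"
    "\<And>k. \<exists>K\<ge>0. \<forall>N i \<beta> h. admissible N i \<beta> h \<longrightarrow>
      (\<integral>\<^sup>+G. ennreal (X N i \<beta> h G ^ (2 * k)) \<partial>gaussian (bonds N)) \<le> ennreal (K / real N ^ (r * k))"
  shows "moment_order r X"
  using assms unfolding moment_order_def by blast

lemma moment_order_measurable: "moment_order r X \<Longrightarrow> admissible N i \<beta> h \<Longrightarrow> X N i \<beta> h \<in> borel_measurable (gaussian (bonds N))"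
  unfolding moment_order_def by blast

lemma moment_orderE:
  assumes "moment_order r X"
  obtains K where "0 \<le> K" "\<And>N i \<beta> h. admissible N i \<beta> h \<Longrightarrow>
      (\<integral>\<^sup>+G. ennreal (X N i \<beta> h G ^ (2 * k)) \<partial>gaussian (bonds N)) \<le> ennreal (K / real N ^ (r * k))"
  using assms unfolding moment_order_def by blast

lemma admissible_N: "admissible N i \<beta> h \<Longrightarrow> 0 < real N" by (simp add: admissible_def)

lemma moment_order_dominated:
  assumes m: "\<And>N i \<beta> h. admissible N i \<beta> h \<Longrightarrow> X N i \<beta> h \<in> borel_measurable (gaussian (bonds N))"
    and Y: "moment_order r Y" and le: "\<And>N i \<beta> h G. admissible N i \<beta> h \<Longrightarrow> \<bar>X N i \<beta> h G\<bar> \<le> \<bar>Y N i \<beta> h G\<bar>"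
  shows "moment_order r X"
proof (rule moment_orderI[OF m])
  fix k
  obtain K where K: "0 \<le> K" "\<And>N i \<beta> h. admissible N i \<beta> h \<Longrightarrow>
      (\<integral>\<^sup>+G. ennreal (Y N i \<beta> h G ^ (2 * k)) \<partial>gaussian (bonds N)) \<le> ennreal (K / real N ^ (r * k))"
    by (rule moment_orderE[OF Y]) blast
  have "(\<integral>\<^sup>+G. ennreal (X N i \<beta> h G ^ (2 * k)) \<partial>gaussian (bonds N)) \<le> ennreal (K / real N ^ (r * k))" if o: "admissible N i \<beta> h" for N i \<beta> h
  proof (rule order_trans[OF nn_integral_mono K(2)[OF o]])
    fix G
    have "\<bar>X N i \<beta> h G\<bar> ^ (2 * k) \<le> \<bar>Y N i \<beta> h G\<bar> ^ (2 * k)" using le[OF o] by (intro power_mono) auto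
    then show "ennreal (X N i \<beta> h G ^ (2 * k)) \<le> ennreal (Y N i \<beta> h G ^ (2 * k))" by (intro ennreal_leI) (simp add: power_even_abs)
  qed
  then show "\<exists>K\<ge>0. \<forall>N i \<beta> h. admissible N i \<beta> h \<longrightarrow>
      (\<integral>\<^sup>+G. ennreal (X N i \<beta> h G ^ (2 * k)) \<partial>gaussian (bonds N)) \<le> ennreal (K / real N ^ (r * k))"
    using K(1) by blast
qed

lemma moment_order_add:
  assumes X: "moment_order r X" and Y: "moment_order r Y"
  shows "moment_order r (\<lambda>N i \<beta> h G. X N i \<beta> h G + Y N i \<beta> h G)"
proof (rule moment_orderI)
  show "(\<lambda>G. X N i \<beta> h G + Y N i \<beta> h G) \<in> borel_measurable (gaussian (bonds N))" if "admissible N i \<beta> h" for N i \<beta> h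
    using moment_order_measurable[OF X that] moment_order_measurable[OF Y that] by measurable
  fix k
  obtain K where K: "0 \<le> K" "\<And>N i \<beta> h. admissible N i \<beta> h \<Longrightarrow>
      (\<integral>\<^sup>+G. ennreal (X N i \<beta> h G ^ (2 * k)) \<partial>gaussian (bonds N)) \<le> ennreal (K / real N ^ (r * k))"
    by (rule moment_orderE[OF X]) blast
  obtain L where L: "0 \<le> L" "\<And>N i \<beta> h. admissible N i \<beta> h \<Longrightarrow>
      (\<integral>\<^sup>+G. ennreal (Y N i \<beta> h G ^ (2 * k)) \<partial>gaussian (bonds N)) \<le> ennreal (L / real N ^ (r * k))"
    by (rule moment_orderE[OF Y]) blast
  have "(\<integral>\<^sup>+G. ennreal ((X N i \<beta> h G + Y N i \<beta> h G) ^ (2 * k)) \<partial>gaussian (bonds N)) \<le> ennreal (4 ^ k * (K + L) / real N ^ (r * k))"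
    if o: "admissible N i \<beta> h" for N i \<beta> h
  proof -
    note [measurable] = moment_order_measurable[OF X o] moment_order_measurable[OF Y o]
    have "(\<integral>\<^sup>+G. ennreal ((X N i \<beta> h G + Y N i \<beta> h G) ^ (2 * k)) \<partial>gaussian (bonds N))
      \<le> (\<integral>\<^sup>+G. ennreal (4 ^ k) * (ennreal (X N i \<beta> h G ^ (2 * k)) + ennreal (Y N i \<beta> h G ^ (2 * k))) \<partial>gaussian (bonds N))"
      using power_add_even by (intro nn_integral_mono) (simp add: ennreal_mult[symmetric] ennreal_plus[symmetric] ennreal_leI del: ennreal_plus)
    also have "\<dots> = ennreal (4 ^ k) * ((\<integral>\<^sup>+G. ennreal (X N i \<beta> h G ^ (2 * k)) \<partial>gaussian (bonds N)) + (\<integral>\<^sup>+G. ennreal (Y N i \<beta> h G ^ (2 * k)) \<partial>gaussian (bonds N)))"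
      by (simp add: nn_integral_cmult nn_integral_add)
    also have "\<dots> \<le> ennreal (4 ^ k) * (ennreal (K / real N ^ (r * k)) + ennreal (L / real N ^ (r * k)))"
      by (intro mult_left_mono add_mono K L o) auto
    also have "\<dots> = ennreal (4 ^ k * (K + L) / real N ^ (r * k))"
      using K(1) L(1) by (simp add: ennreal_mult[symmetric] ennreal_plus[symmetric] add_divide_distrib distrib_left del: ennreal_plus)
    finally show ?thesis .
  qed
  then show "\<exists>K\<ge>0. \<forall>N i \<beta> h. admissible N i \<beta> h \<longrightarrow>
      (\<integral>\<^sup>+G. ennreal ((X N i \<beta> h G + Y N i \<beta> h G) ^ (2 * k)) \<partial>gaussian (bonds N)) \<le> ennreal (K / real N ^ (r * k))"
    using K(1) L(1) by (intro exI[of _ "4 ^ k * (K + L)"]) auto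
qed

text \<open>Cauchy--Schwarz in the elementary form \<open>2 * x * y \<le> x\<^sup>2 + y\<^sup>2\<close>, with weights balanced in \<open>N\<close>.\<close>
lemma moment_order_mult:
  assumes X: "moment_order r X" and Y: "moment_order s Y"
  shows "moment_order (r + s) (\<lambda>N i \<beta> h G. X N i \<beta> h G * Y N i \<beta> h G)"
proof (rule moment_orderI)
  show "(\<lambda>G. X N i \<beta> h G * Y N i \<beta> h G) \<in> borel_measurable (gaussian (bonds N))" if "admissible N i \<beta> h" for N i \<beta> h
    using moment_order_measurable[OF X that] moment_order_measurable[OF Y that] by measurable
  fix k
  obtain K where K: "0 \<le> K" "\<And>N i \<beta> h. admissible N i \<beta> h \<Longrightarrow>
      (\<integral>\<^sup>+G. ennreal (X N i \<beta> h G ^ (2 * (2 * k))) \<partial>gaussian (bonds N)) \<le> ennreal (K / real N ^ (r * (2 * k)))"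
    by (rule moment_orderE[OF X]) blast
  obtain L where L: "0 \<le> L" "\<And>N i \<beta> h. admissible N i \<beta> h \<Longrightarrow>
      (\<integral>\<^sup>+G. ennreal (Y N i \<beta> h G ^ (2 * (2 * k))) \<partial>gaussian (bonds N)) \<le> ennreal (L / real N ^ (s * (2 * k)))"
    by (rule moment_orderE[OF Y]) blast
  have "(\<integral>\<^sup>+G. ennreal ((X N i \<beta> h G * Y N i \<beta> h G) ^ (2 * k)) \<partial>gaussian (bonds N)) \<le> ennreal ((K + L) / real N ^ ((r + s) * k))"
    if o: "admissible N i \<beta> h" for N i \<beta> h
  proof -
    note [measurable] = moment_order_measurable[OF X o] moment_order_measurable[OF Y o]
    define a where "a = real N ^ (r * k)" define b where "b = real N ^ (s * k)"
    have ab: "0 < a" "0 < b" using admissible_N[OF o] by (auto simp: a_def b_def)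
    have pt: "(x * y) ^ (2 * k) \<le> a / b * x ^ (2 * (2 * k)) + b / a * y ^ (2 * (2 * k))" for x y :: real
    proof -
      define u where "u = x ^ (2 * k)" define w where "w = y ^ (2 * k)"
      have uw: "0 \<le> u" "0 \<le> w" by (auto simp: u_def w_def)
      have "0 \<le> (a * u - b * w)\<^sup>2 + (a * u)\<^sup>2 + (b * w)\<^sup>2" by (intro add_nonneg_nonneg) auto
      then have "2 * (a * b * (u * w)) \<le> 2 * (a * a * (u * u) + b * b * (w * w))"
        by (simp add: power2_eq_square algebra_simps)
      then have "u * w \<le> a / b * (u * u) + b / a * (w * w)"
        using ab by (simp add: field_simps)
      moreover have "x ^ (2 * (2 * k)) = u * u" "y ^ (2 * (2 * k)) = w * w" "(x * y) ^ (2 * k) = u * w"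
        by (auto simp: u_def w_def power_add[symmetric] power_mult_distrib mult_2)
      ultimately show ?thesis by simp
    qed
    have "(\<integral>\<^sup>+G. ennreal ((X N i \<beta> h G * Y N i \<beta> h G) ^ (2 * k)) \<partial>gaussian (bonds N))
      \<le> (\<integral>\<^sup>+G. ennreal (a / b) * ennreal (X N i \<beta> h G ^ (2 * (2 * k))) + ennreal (b / a) * ennreal (Y N i \<beta> h G ^ (2 * (2 * k))) \<partial>gaussian (bonds N))"
    proof (rule nn_integral_mono)
      fix G
      have "ennreal ((X N i \<beta> h G * Y N i \<beta> h G) ^ (2 * k)) \<le> ennreal (a / b * X N i \<beta> h G ^ (2 * (2 * k)) + b / a * Y N i \<beta> h G ^ (2 * (2 * k)))"
        by (rule ennreal_leI[OF pt])
      also have "\<dots> = ennreal (a / b) * ennreal (X N i \<beta> h G ^ (2 * (2 * k))) + ennreal (b / a) * ennreal (Y N i \<beta> h G ^ (2 * (2 * k)))"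
      proof -
        have e: "ennreal (a / b * p + b / a * r) = ennreal (a / b) * ennreal p + ennreal (b / a) * ennreal r" if "0 \<le> p" "0 \<le> r" for p r
          using ab that by (simp add: ennreal_mult[symmetric])
        have "0 \<le> z ^ (2 * (2 * k))" for z :: real by (subst power_mult) simp
        then show ?thesis by (intro e)
      qed
      finally show "ennreal ((X N i \<beta> h G * Y N i \<beta> h G) ^ (2 * k)) \<le> ennreal (a / b) * ennreal (X N i \<beta> h G ^ (2 * (2 * k))) + ennreal (b / a) * ennreal (Y N i \<beta> h G ^ (2 * (2 * k)))" .
    qed
    also have "\<dots> = ennreal (a / b) * (\<integral>\<^sup>+G. ennreal (X N i \<beta> h G ^ (2 * (2 * k))) \<partial>gaussian (bonds N)) + ennreal (b / a) * (\<integral>\<^sup>+G. ennreal (Y N i \<beta> h G ^ (2 * (2 * k))) \<partial>gaussian (bonds N))"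
      by (simp add: nn_integral_cmult nn_integral_add)
    also have "\<dots> \<le> ennreal (a / b) * ennreal (K / real N ^ (r * (2 * k))) + ennreal (b / a) * ennreal (L / real N ^ (s * (2 * k)))"
      by (intro mult_left_mono add_mono K L o) auto
    also have "\<dots> = ennreal (a / b * (K / (a * a)) + b / a * (L / (b * b)))"
    proof -
      have "real N ^ (r * (2 * k)) = a * a" "real N ^ (s * (2 * k)) = b * b"
        by (auto simp: a_def b_def power_add[symmetric] mult_2 distrib_left)
      then show ?thesis using ab K(1) L(1) by (simp add: ennreal_mult[symmetric] ennreal_plus[symmetric] del: ennreal_plus)
    qed
    also have "a / b * (K / (a * a)) + b / a * (L / (b * b)) = (K + L) / (a * b)" using ab by (simp add: field_simps)
    also have "a * b = real N ^ ((r + s) * k)" by (simp add: a_def b_def power_add[symmetric] distrib_right)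
    finally show ?thesis .
  qed
  then show "\<exists>K\<ge>0. \<forall>N i \<beta> h. admissible N i \<beta> h \<longrightarrow>
      (\<integral>\<^sup>+G. ennreal ((X N i \<beta> h G * Y N i \<beta> h G) ^ (2 * k)) \<partial>gaussian (bonds N)) \<le> ennreal (K / real N ^ ((r + s) * k))"
    using K(1) L(1) by (intro exI[of _ "K + L"]) auto
qed

lemma moment_order_const:
  assumes "\<And>N i \<beta> h. admissible N i \<beta> h \<Longrightarrow> \<bar>c N i \<beta> h\<bar> \<le> C"
  shows "moment_order 0 (\<lambda>N i \<beta> h G. c N i \<beta> h)"
proof (rule moment_orderI)
  fix k
  have "(\<integral>\<^sup>+G. ennreal (c N i \<beta> h ^ (2 * k)) \<partial>gaussian (bonds N)) \<le> ennreal (C ^ (2 * k) / real N ^ (0 * k))" if "admissible N i \<beta> h" for N i \<beta> h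
  proof -
    have "\<bar>c N i \<beta> h\<bar> ^ (2 * k) \<le> C ^ (2 * k)" using assms[OF that] by (intro power_mono) auto
    then show ?thesis by (simp add: prob_space.emeasure_space_1[OF prob_space_gaussian] power_even_abs ennreal_leI)
  qed
  then show "\<exists>K\<ge>0. \<forall>N i \<beta> h. admissible N i \<beta> h \<longrightarrow>
      (\<integral>\<^sup>+G. ennreal (c N i \<beta> h ^ (2 * k)) \<partial>gaussian (bonds N)) \<le> ennreal (K / real N ^ (0 * k))"
    by (intro exI[of _ "C ^ (2 * k)"]) auto
qed auto

lemma moment_order_scale:
  assumes "\<And>N i \<beta> h. admissible N i \<beta> h \<Longrightarrow> \<bar>c N i \<beta> h\<bar> \<le> C" "moment_order r X"
  shows "moment_order r (\<lambda>N i \<beta> h G. c N i \<beta> h * X N i \<beta> h G)"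
  using moment_order_mult[OF moment_order_const[OF assms(1)] assms(2)] by simp

lemma moment_order_diff: "moment_order r X \<Longrightarrow> moment_order r Y \<Longrightarrow> moment_order r (\<lambda>N i \<beta> h G. X N i \<beta> h G - Y N i \<beta> h G)"
  using moment_order_add[OF _ moment_order_scale[of "\<lambda>_ _ _ _. -1" 1 r Y]] by (simp add: algebra_simps)

end

section \<open>Exponential tilts\<close>

lemma integral_gauss1_shift:
  fixes f :: "real \<Rightarrow> real"
  assumes [measurable]: "f \<in> borel_measurable borel"
  shows "(\<integral>x. exp (c * x) * f x \<partial>gauss1) = exp (c\<^sup>2/2) * (\<integral>x. f (x + c) \<partial>gauss1)"
proof -
  have e: "std_normal_density (c + x) * exp (c * (c + x)) = exp (c\<^sup>2/2) * std_normal_density x" for x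
    unfolding std_normal_density_def
    by (simp add: exp_add[symmetric] power2_eq_square field_simps)
  have "(\<integral>x. exp (c * x) * f x \<partial>gauss1) = (\<integral>x. std_normal_density x * exp (c * x) * f x \<partial>lborel)"
    by (subst integral_density) (auto simp: mult.assoc)
  also have "\<dots> = (\<integral>x. std_normal_density (c + x) * exp (c * (c + x)) * f (c + x) \<partial>lborel)"
    using lborel_integral_real_affine[of 1 "\<lambda>x. std_normal_density x * exp (c * x) * f x" c] by simp
  also have "\<dots> = (\<integral>x. exp (c\<^sup>2/2) * (std_normal_density x * f (x + c)) \<partial>lborel)"
    unfolding e by (simp add: mult.assoc add.commute)
  also have "\<dots> = exp (c\<^sup>2/2) * (\<integral>x. f (x + c) \<partial>gauss1)"
    by (subst integral_mult_right_zero, subst integral_density) auto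
  finally show ?thesis .
qed

text \<open>Multiplying a Gaussian density by an exponential shifts it by \<open>c\<close> times the variance. The shifts
\<open>\<beta> * (1 - q)\<close> and \<open>- \<beta> * (1 - q)\<close> in the theorem come from here.\<close>
lemma gauss_avg_tilt:
  assumes [measurable]: "U \<in> borel_measurable borel" and q: "q \<le> 1"
  shows "gauss_avg q (\<lambda>y. U y * exp (c * y)) y = exp (c * y + c\<^sup>2 * (1 - q) / 2) * gauss_avg q U (y + c * (1 - q))"
proof -
  define s where "s = sqrt (1 - q)"
  have s: "s * s = 1 - q" using q by (simp add: s_def)
  have "gauss_avg q (\<lambda>y. U y * exp (c * y)) y = (\<integral>z. exp (c * y) * (exp ((c * s) * z) * U (y + s * z)) \<partial>gauss1)"
    unfolding gauss_avg_def s_def[symmetric]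
    by (intro Bochner_Integration.integral_cong refl) (simp add: distrib_left exp_add mult_ac)
  also have "\<dots> = exp (c * y) * (\<integral>z. exp ((c * s) * z) * U (y + s * z) \<partial>gauss1)" by (rule integral_mult_right_zero)
  also have "\<dots> = exp (c * y) * (exp ((c * s)\<^sup>2/2) * (\<integral>z. U (y + s * (z + c * s)) \<partial>gauss1))"
    by (subst integral_gauss1_shift) auto
  also have "(\<integral>z. U (y + s * (z + c * s)) \<partial>gauss1) = gauss_avg q U (y + c * (1 - q))"
  proof -
    have e: "y + s * (z + c * s) = (y + c * (1 - q)) + s * z" for z unfolding s[symmetric] by (simp add: algebra_simps)
    show ?thesis unfolding gauss_avg_def s_def[symmetric] e ..
  qed
  also have "(c * s)\<^sup>2 = c\<^sup>2 * (1 - q)" using s by (simp add: power2_eq_square mult.assoc mult.left_commute)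
  finally show ?thesis by (simp add: exp_add)
qed

text \<open>Tilts by the effective field: \<open>exp_mix a b \<beta>\<close> with the weights below is proportional to
  \<open>cosh (\<beta> * y + h)\<close> or to \<open>sinh (\<beta> * y + h)\<close>.\<close>
definition exp_mix :: "real \<Rightarrow> real \<Rightarrow> real \<Rightarrow> real \<Rightarrow> real" where
  "exp_mix a b \<beta> y = a * exp (\<beta> * y) + b * exp (- \<beta> * y)"
definition plus_wt :: "real \<Rightarrow> real" where "plus_wt h = (1 + tanh h) / 2"
definition minus_wt :: "real \<Rightarrow> real" where "minus_wt h = (1 - tanh h) / 2"

lemma plus_wt_minus_wt: "0 \<le> plus_wt h" "0 \<le> minus_wt h" "plus_wt h \<le> 1" "minus_wt h \<le> 1" "plus_wt h + minus_wt h = 1"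
  using tanh_real_lt_1[of h] tanh_real_gt_neg1[of h] by (auto simp: plus_wt_def minus_wt_def field_simps)

lemma plus_wt_eq: "plus_wt h = exp h / (2 * cosh h)" "minus_wt h = exp (- h) / (2 * cosh h)"
proof -
  have "cosh h \<noteq> 0" using cosh_real_pos[of h] by linarith
  then show "plus_wt h = exp h / (2 * cosh h)" "minus_wt h = exp (- h) / (2 * cosh h)"
    by (simp_all add: plus_wt_def minus_wt_def tanh_def field_simps cosh_plus_sinh[symmetric] cosh_minus_sinh[symmetric])
qed

context sk_range begin

definition params :: "(real \<times> real) set" where "params = {(\<beta>, h). 0 < \<beta> \<and> \<beta> \<le> \<beta>\<^sub>0}"

lemma admissible_params: "admissible N i \<beta> h \<Longrightarrow> (\<beta>, h) \<in> params" by (simp add: admissible_def params_def)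

lemma q_range: assumes "(\<beta>, h) \<in> params" shows "0 \<le> sk_q \<beta> h" "sk_q \<beta> h < 1"
  using sk_q_properties[of \<beta> h] assms \<beta>0 by (auto simp: params_def)

text \<open>The mean of the local field in the reduced system; it takes the role of \<open>\<gamma>\<close> until both are compared.\<close>
definition mean_field :: "nat \<Rightarrow> nat \<Rightarrow> real \<Rightarrow> real \<Rightarrow> (nat \<times> nat \<Rightarrow> real) \<Rightarrow> real" where
  "mean_field N i \<beta> h G = cav_avg N i \<beta> h (\<lambda>y. y) G"

lemma mean_field_measurable[measurable]: "mean_field N i \<beta> h \<in> borel_measurable (gaussian (bonds N))"
  unfolding mean_field_def[abs_def] by (rule cav_avg_measurable) simp

lemma cav_avg_exp_le:
  assumes "admissible N i \<beta> h" "0 \<le> a" "a \<le> 1/4"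
  shows "(\<integral>\<^sup>+G. ennreal (cav_avg N i \<beta> h (\<lambda>y. exp (a * y\<^sup>2)) G) \<partial>gaussian (bonds N)) \<le> ennreal 2"
proof -
  have N: "1 \<le> N" "1 \<le> i" "i \<le> N" using assms by (auto simp: admissible_def)
  define V where "V = rest N i"
  define w where "w = cav_weight N \<beta> h V"
  have w0: "0 \<le> w y \<sigma>" for y \<sigma> unfolding w_def by (rule cav_weight_nonneg)
  have w1: "(\<Sum>\<sigma>\<in>spins V. w y \<sigma>) = 1" for y unfolding w_def V_def by (rule cav_weight_sum[OF rest_finite])
  have f: "(\<lambda>G. ennreal (cav_avg N i \<beta> h (\<lambda>y. exp (a * y\<^sup>2)) G)) \<in> borel_measurable (gaussian (bonds N))"
    using cav_avg_measurable[of "\<lambda>y. exp (a * y\<^sup>2)" N i \<beta> h] by measurable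
  have inner: "(\<integral>\<^sup>+g. ennreal (\<Sum>\<sigma>\<in>spins V. w y \<sigma> * exp (a * (field_at N i g \<sigma>)\<^sup>2)) \<partial>gaussian (star N i)) \<le> ennreal 2" for y
  proof -
    have [measurable]: "(\<lambda>g. field_at N i g \<sigma>) \<in> borel_measurable (gaussian (star N i))" for \<sigma> by (rule field_at_measurable) simp
    have "(\<integral>\<^sup>+g. ennreal (\<Sum>\<sigma>\<in>spins V. w y \<sigma> * exp (a * (field_at N i g \<sigma>)\<^sup>2)) \<partial>gaussian (star N i))
      = (\<integral>\<^sup>+g. (\<Sum>\<sigma>\<in>spins V. ennreal (w y \<sigma>) * ennreal (exp (a * (field_at N i g \<sigma>)\<^sup>2))) \<partial>gaussian (star N i))"
      using w0 by (simp add: sum_ennreal[symmetric] ennreal_mult)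
    also have "\<dots> = (\<Sum>\<sigma>\<in>spins V. ennreal (w y \<sigma>) * (\<integral>\<^sup>+g. ennreal (exp (a * (field_at N i g \<sigma>)\<^sup>2)) \<partial>gaussian (star N i)))"
      by (simp add: nn_integral_sum nn_integral_cmult)
    also have "\<dots> \<le> (\<Sum>\<sigma>\<in>spins V. ennreal (w y \<sigma>) * ennreal 2)"
    proof (intro sum_mono mult_left_mono)
      fix \<sigma> assume s: "\<sigma> \<in> spins V"
      have "a * (\<Sum>e\<in>star N i. (\<sigma> (other i e) / sqrt (real N))\<^sup>2) \<le> 1/4 * 1"
        using assms star_norm[OF N] s by (intro mult_mono sum_nonneg) (auto simp: V_def)
      then show "(\<integral>\<^sup>+g. ennreal (exp (a * (field_at N i g \<sigma>)\<^sup>2)) \<partial>gaussian (star N i)) \<le> ennreal 2"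
        unfolding field_at_def using assms by (intro nn_integral_gaussian_exp_linear_square star_finite) auto
    qed auto
    also have "\<dots> = ennreal 2 * ennreal (\<Sum>\<sigma>\<in>spins V. w y \<sigma>)"
      using w0 by (simp add: sum_distrib_left[symmetric] mult.commute)
    finally show ?thesis by (simp add: w1)
  qed
  have "(\<integral>\<^sup>+G. ennreal (cav_avg N i \<beta> h (\<lambda>y. exp (a * y\<^sup>2)) G) \<partial>gaussian (bonds N)) \<le> (\<integral>\<^sup>+y. ennreal 2 \<partial>gaussian (pairs V))"
    unfolding nn_integral_bonds_split[OF f, of i] V_def[symmetric]
  proof (rule nn_integral_mono)
    fix y
    show "(\<integral>\<^sup>+g. ennreal (cav_avg N i \<beta> h (\<lambda>y. exp (a * y\<^sup>2)) (merge (pairs V) (star N i) (y, g))) \<partial>gaussian (star N i)) \<le> ennreal 2"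
      using inner[of y] unfolding cav_avg_def w_def V_def merge_cav_weight merge_field_at .
  qed
  then show ?thesis by (simp add: prob_space.emeasure_space_1[OF prob_space_gaussian])
qed

text \<open>Exponential moments of the field are bounded in the reduced system, where it is a normalised linear form in
independent couplings. Everything dominated by them has moments of order zero.\<close>
lemma moment_order_of_exp_bound:
  assumes m: "\<And>N i \<beta> h. admissible N i \<beta> h \<Longrightarrow> X N i \<beta> h \<in> borel_measurable (gaussian (bonds N))"
    and b: "\<And>k. \<exists>C\<ge>0. \<forall>N i \<beta> h G. admissible N i \<beta> h \<longrightarrow> X N i \<beta> h G ^ (2 * k) \<le> C * cav_avg N i \<beta> h (\<lambda>y. exp (1/4 * y\<^sup>2)) G"
  shows "moment_order 0 X"
proof (rule moment_orderI[OF m])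
  fix k
  from b[of k] obtain C where C: "0 \<le> C" "\<forall>N i \<beta> h G. admissible N i \<beta> h \<longrightarrow> X N i \<beta> h G ^ (2 * k) \<le> C * cav_avg N i \<beta> h (\<lambda>y. exp (1/4 * y\<^sup>2)) G"
    by (elim exE conjE)
  have "(\<integral>\<^sup>+G. ennreal (X N i \<beta> h G ^ (2 * k)) \<partial>gaussian (bonds N)) \<le> ennreal (C * 2 / real N ^ (0 * k))" if o: "admissible N i \<beta> h" for N i \<beta> h
  proof -
    have [measurable]: "cav_avg N i \<beta> h (\<lambda>y. exp (1/4 * y\<^sup>2)) \<in> borel_measurable (gaussian (bonds N))"
      by (rule cav_avg_measurable) simp
    have "(\<integral>\<^sup>+G. ennreal (X N i \<beta> h G ^ (2 * k)) \<partial>gaussian (bonds N)) \<le> (\<integral>\<^sup>+G. ennreal C * ennreal (cav_avg N i \<beta> h (\<lambda>y. exp (1/4 * y\<^sup>2)) G) \<partial>gaussian (bonds N))"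
      using C o by (intro nn_integral_mono) (simp add: ennreal_mult'[symmetric] ennreal_leI)
    also have "\<dots> = ennreal C * (\<integral>\<^sup>+G. ennreal (cav_avg N i \<beta> h (\<lambda>y. exp (1/4 * y\<^sup>2)) G) \<partial>gaussian (bonds N))"
      by (rule nn_integral_cmult) measurable
    also have "\<dots> \<le> ennreal C * ennreal 2" by (intro mult_left_mono cav_avg_exp_le o) auto
    also have "\<dots> = ennreal (C * 2 / real N ^ (0 * k))" using C(1) by (simp add: ennreal_mult)
    finally show ?thesis .
  qed
  then show "\<exists>K\<ge>0. \<forall>N i \<beta> h. admissible N i \<beta> h \<longrightarrow>
      (\<integral>\<^sup>+G. ennreal (X N i \<beta> h G ^ (2 * k)) \<partial>gaussian (bonds N)) \<le> ennreal (K / real N ^ (0 * k))"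
    using C(1) by (intro exI[of _ "C * 2"]) auto
qed

lemma growth_power:
  assumes "growth Q F" shows "\<exists>C\<ge>0. \<forall>p\<in>Q. \<forall>y. F p y ^ (2 * k) \<le> C * exp (1/4 * y\<^sup>2)"
proof -
  obtain C where C: "0 \<le> C" "\<And>p y. p \<in> Q \<Longrightarrow> \<bar>F p y\<bar> \<le> C * exp (1 / (8 * (real k + 1)) * y\<^sup>2)"
    by (rule growthE[OF assms, of "1 / (8 * (real k + 1))"]) auto
  have "F p y ^ (2 * k) \<le> C ^ (2 * k) * exp (1/4 * y\<^sup>2)" if "p \<in> Q" for p y
  proof -
    have "F p y ^ (2 * k) = \<bar>F p y\<bar> ^ (2 * k)" by (simp add: power_even_abs)
    also have "\<dots> \<le> (C * exp (1 / (8 * (real k + 1)) * y\<^sup>2)) ^ (2 * k)" using C(2)[OF that] by (intro power_mono) auto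
    also have "\<dots> = C ^ (2 * k) * exp (real (2 * k) * (1 / (8 * (real k + 1)) * y\<^sup>2))"
      by (simp only: power_mult_distrib exp_of_nat_mult)
    also have "\<dots> \<le> C ^ (2 * k) * exp (1/4 * y\<^sup>2)"
    proof (intro mult_left_mono)
      have "real (2 * k) * (1 / (8 * (real k + 1))) \<le> 1/4" by (simp add: field_simps)
      then have "real (2 * k) * (1 / (8 * (real k + 1))) * y\<^sup>2 \<le> 1/4 * y\<^sup>2" by (rule mult_right_mono) auto
      then show "exp (real (2 * k) * (1 / (8 * (real k + 1)) * y\<^sup>2)) \<le> exp (1/4 * y\<^sup>2)" by (simp only: exp_le_cancel_iff mult.assoc)
    qed auto
    finally show ?thesis .
  qed
  then show ?thesis by (intro exI[of _ "C ^ (2 * k)"]) auto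
qed

lemma cav_avg_mono:
  assumes "\<And>y. F y \<le> H y" shows "cav_avg N i \<beta> h F G \<le> cav_avg N i \<beta> h H G"
  unfolding cav_avg_def using assms cav_weight_nonneg by (intro sum_mono mult_left_mono) auto

lemma cav_avg_cmult: "cav_avg N i \<beta> h (\<lambda>y. c * F y) G = c * cav_avg N i \<beta> h F G"
  unfolding cav_avg_def by (simp add: sum_distrib_left mult_ac)

lemma cav_avg_add: "cav_avg N i \<beta> h (\<lambda>y. F y + H y) G = cav_avg N i \<beta> h F G + cav_avg N i \<beta> h H G"
  unfolding cav_avg_def by (simp add: distrib_left sum.distrib)

lemma moment_order_cav_avg:
  assumes g: "growth params F" and m: "\<And>p. p \<in> params \<Longrightarrow> F p \<in> borel_measurable borel"
  shows "moment_order 0 (\<lambda>N i \<beta> h. cav_avg N i \<beta> h (F (\<beta>, h)))"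
proof (rule moment_order_of_exp_bound)
  show "cav_avg N i \<beta> h (F (\<beta>, h)) \<in> borel_measurable (gaussian (bonds N))" if "admissible N i \<beta> h" for N i \<beta> h
    by (intro cav_avg_measurable m[OF admissible_params[OF that]])
  fix k
  from growth_power[OF g, of k] obtain C where C: "0 \<le> C" "\<And>p y. p \<in> params \<Longrightarrow> F p y ^ (2 * k) \<le> C * exp (1/4 * y\<^sup>2)" by blast
  have "cav_avg N i \<beta> h (F (\<beta>, h)) G ^ (2 * k) \<le> C * cav_avg N i \<beta> h (\<lambda>y. exp (1/4 * y\<^sup>2)) G" if o: "admissible N i \<beta> h" for N i \<beta> h G
  proof -
    have "cav_avg N i \<beta> h (F (\<beta>, h)) G ^ (2 * k) \<le> cav_avg N i \<beta> h (\<lambda>y. F (\<beta>, h) y ^ (2 * k)) G"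
      unfolding cav_avg_def by (intro jensen_even_power spins_finite rest_finite cav_weight_nonneg cav_weight_sum)
    also have "\<dots> \<le> cav_avg N i \<beta> h (\<lambda>y. C * exp (1/4 * y\<^sup>2)) G" by (intro cav_avg_mono C(2)[OF admissible_params[OF o]])
    finally show ?thesis by (simp add: cav_avg_cmult)
  qed
  then show "\<exists>C\<ge>0. \<forall>N i \<beta> h G. admissible N i \<beta> h \<longrightarrow> cav_avg N i \<beta> h (F (\<beta>, h)) G ^ (2 * k) \<le> C * cav_avg N i \<beta> h (\<lambda>y. exp (1/4 * y\<^sup>2)) G"
    using C(1) by blast
qed

lemma mean_field_exp_le:
  assumes "0 \<le> a" shows "exp (a * (mean_field N i \<beta> h G)\<^sup>2) \<le> cav_avg N i \<beta> h (\<lambda>y. exp (a * y\<^sup>2)) G"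
  unfolding mean_field_def cav_avg_def using assms by (intro jensen_exp_square spins_finite rest_finite cav_weight_nonneg cav_weight_sum)

lemma moment_order_mean_field:
  assumes g: "growth params F" and m: "\<And>p. p \<in> params \<Longrightarrow> F p \<in> borel_measurable borel"
  shows "moment_order 0 (\<lambda>N i \<beta> h G. F (\<beta>, h) (mean_field N i \<beta> h G))"
proof (rule moment_order_of_exp_bound)
  show "(\<lambda>G. F (\<beta>, h) (mean_field N i \<beta> h G)) \<in> borel_measurable (gaussian (bonds N))" if "admissible N i \<beta> h" for N i \<beta> h
    using m[OF admissible_params[OF that]] by measurable
  fix k
  from growth_power[OF g, of k] obtain C where C: "0 \<le> C" "\<And>p y. p \<in> params \<Longrightarrow> F p y ^ (2 * k) \<le> C * exp (1/4 * y\<^sup>2)" by blast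
  have "F (\<beta>, h) (mean_field N i \<beta> h G) ^ (2 * k) \<le> C * cav_avg N i \<beta> h (\<lambda>y. exp (1/4 * y\<^sup>2)) G" if o: "admissible N i \<beta> h" for N i \<beta> h G
    using order_trans[OF C(2)[OF admissible_params[OF o]] mult_left_mono[OF mean_field_exp_le C(1)]] by simp
  then show "\<exists>C\<ge>0. \<forall>N i \<beta> h G. admissible N i \<beta> h \<longrightarrow> F (\<beta>, h) (mean_field N i \<beta> h G) ^ (2 * k) \<le> C * cav_avg N i \<beta> h (\<lambda>y. exp (1/4 * y\<^sup>2)) G"
    using C(1) by blast
qed

text \<open>A smooth function all of whose derivatives are of moderate growth, as the sequence of its derivatives.\<close>
definition smooth :: "(nat \<Rightarrow> real \<Rightarrow> real) \<Rightarrow> bool" where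
  "smooth U \<longleftrightarrow> (\<forall>j y. (U j has_real_derivative U (Suc j) y) (at y)) \<and> (\<forall>j. growth {c::real. \<bar>c\<bar> \<le> 1} (\<lambda>_. U j))"

lemma smooth_deriv: "smooth U \<Longrightarrow> (U j has_real_derivative U (Suc j) y) (at y)" by (simp add: smooth_def)

lemma smooth_growth: "smooth U \<Longrightarrow> growth Q (\<lambda>_. U j)"
proof -
  assume "smooth U"
  then have "growth {c::real. \<bar>c\<bar> \<le> 1} (\<lambda>_. U j)" by (simp add: smooth_def)
  from growth_compose[OF this, of Q "\<lambda>_. 0"] show ?thesis by simp
qed

lemma smooth_measurable: "smooth U \<Longrightarrow> U j \<in> borel_measurable borel"
  using smooth_deriv by (intro borel_measurable_continuous_onI DERIV_continuous_on) (auto intro: has_field_derivative_at_within)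

text \<open>The tilted function and its derivatives are bounded uniformly for \<open>\<bar>s * \<beta>\<bar> \<le> 1\<close>, as
\<open>cavity_limit_moment\<close> demands.\<close>
lemma moment_order_limit_tilt:
  assumes U: "smooth U" and s: "\<bar>s\<bar> \<le> 1"
  shows "moment_order 1 (\<lambda>N i \<beta> h G. cav_avg N i \<beta> h (\<lambda>y. U 0 y * exp (s * \<beta> * y)) G
     - gauss_avg (sk_q \<beta> h) (\<lambda>y. U 0 y * exp (s * \<beta> * y)) (mean_field N i \<beta> h G))"
proof (rule moment_orderI)
  have [measurable]: "U 0 \<in> borel_measurable borel" by (rule smooth_measurable[OF U])
  have [measurable]: "cav_avg N i \<beta> h (\<lambda>y. U 0 y * exp (s * \<beta> * y)) \<in> borel_measurable (gaussian (bonds N))"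
    "gauss_avg (sk_q \<beta> h) (\<lambda>y. U 0 y * exp (s * \<beta> * y)) \<in> borel_measurable borel" for N i \<beta> h
    by (intro cav_avg_measurable gauss_avg_measurable; measurable)+
  show "(\<lambda>G. cav_avg N i \<beta> h (\<lambda>y. U 0 y * exp (s * \<beta> * y)) G - gauss_avg (sk_q \<beta> h) (\<lambda>y. U 0 y * exp (s * \<beta> * y)) (mean_field N i \<beta> h G))
    \<in> borel_measurable (gaussian (bonds N))" if "admissible N i \<beta> h" for N i \<beta> h by measurable
  fix k
  define W where "W = (\<lambda>c m y. tilt U c m 0 y * exp (c * y))"
  have gW: "growth {c. \<bar>c\<bar> \<le> 1} (\<lambda>c. W c m)" for m
    unfolding W_def using U by (intro growth_mult tilt_growth growth_exp) (auto simp: smooth_def)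
  show "\<exists>K\<ge>0. \<forall>N i \<beta> h. admissible N i \<beta> h \<longrightarrow>
      (\<integral>\<^sup>+G. ennreal ((cav_avg N i \<beta> h (\<lambda>y. U 0 y * exp (s * \<beta> * y)) G - gauss_avg (sk_q \<beta> h) (\<lambda>y. U 0 y * exp (s * \<beta> * y)) (mean_field N i \<beta> h G)) ^ (2 * k)) \<partial>gaussian (bonds N))
      \<le> ennreal (K / real N ^ (1 * k))"
  proof (cases "k = 0")
    case True
    then show ?thesis by (intro exI[of _ 1]) (simp add: prob_space.emeasure_space_1[OF prob_space_gaussian])
  next
    case False
    have "\<exists>B. \<forall>c y. \<bar>c\<bar> \<le> 1 \<longrightarrow> \<bar>W c m y\<bar> \<le> B * exp (1 / (320 * real (2 * k)) * y\<^sup>2)" for m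
    proof -
      obtain C where "0 \<le> C" "\<And>c y. c \<in> {c. \<bar>c\<bar> \<le> 1} \<Longrightarrow> \<bar>W c m y\<bar> \<le> C * exp (1 / (320 * real (2 * k)) * y\<^sup>2)"
        by (rule growthE[OF gW[of m], of "1 / (320 * real (2 * k))"]) (use False in auto)
      then show ?thesis by blast
    qed
    then obtain B where B: "\<And>m c y. \<bar>c\<bar> \<le> 1 \<Longrightarrow> \<bar>W c m y\<bar> \<le> B m * exp (1 / (320 * real (2 * k)) * y\<^sup>2)" by metis
    from cavity_limit_moment[OF \<beta>0, of B k] obtain K where K: "0 \<le> K" "\<forall>N i \<beta> h W. 1 \<le> N \<longrightarrow> 1 \<le> i \<longrightarrow> i \<le> N \<longrightarrow> 0 < \<beta> \<longrightarrow> \<beta> \<le> \<beta>\<^sub>0 \<longrightarrow>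
      (\<forall>m y. (W m has_real_derivative W (Suc m) y) (at y)) \<longrightarrow>
      (\<forall>m y. \<bar>W m y\<bar> \<le> B m * exp (y\<^sup>2 / (320 * real (2 * k)))) \<longrightarrow>
      (\<integral>\<^sup>+G. ennreal ((cav_avg N i \<beta> h (W 0) G - gauss_avg (sk_q \<beta> h) (W 0) (cav_avg N i \<beta> h (\<lambda>y. y) G)) ^ (2 * k)) \<partial>gaussian (bonds N))
        \<le> ennreal (K / real N ^ k)" by (elim exE conjE)
    show ?thesis
    proof (intro exI[of _ K] conjI allI impI K(1))
      fix N i \<beta> h assume o: "admissible N i \<beta> h"
      then have o': "1 \<le> N" "1 \<le> i" "i \<le> N" "0 < \<beta>" "\<beta> \<le> \<beta>\<^sub>0" by (auto simp: admissible_def)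
      have c: "\<bar>s * \<beta>\<bar> \<le> 1"
      proof -
        have "\<bar>s\<bar> * \<bar>\<beta>\<bar> \<le> 1 * 1" using s o' \<beta>0 by (intro mult_mono) auto
        then show ?thesis by (simp add: abs_mult)
      qed
      have d: "(W c m has_real_derivative W c (Suc m) y) (at y)" for c m y
        unfolding W_def by (rule tilt_exp_deriv) (rule smooth_deriv[OF U])
      have b: "\<bar>W (s * \<beta>) m y\<bar> \<le> B m * exp (y\<^sup>2 / (320 * real (2 * k)))" for m y using B[OF c, of m y] by simp
      have W0: "W (s * \<beta>) 0 = (\<lambda>y. U 0 y * exp (s * \<beta> * y))" by (simp add: W_def)
      show "(\<integral>\<^sup>+G. ennreal ((cav_avg N i \<beta> h (\<lambda>y. U 0 y * exp (s * \<beta> * y)) G - gauss_avg (sk_q \<beta> h) (\<lambda>y. U 0 y * exp (s * \<beta> * y)) (mean_field N i \<beta> h G)) ^ (2 * k)) \<partial>gaussian (bonds N))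
        \<le> ennreal (K / real N ^ (1 * k))"
        using K(2)[rule_format, of N i \<beta> "W (s * \<beta>)" h, OF o' d b] unfolding W0 mean_field_def by simp
    qed
  qed
qed

end

section \<open>Ratios of tilted averages\<close>

lemma integrable_gauss_avg:
  assumes "growth Q F" "p \<in> Q" "0 \<le> q" "q \<le> 1" "F p \<in> borel_measurable borel"
  shows "integrable gauss1 (\<lambda>z. F p (y + sqrt (1 - q) * z))"
proof -
  obtain C where C: "0 \<le> C" "\<And>p y. p \<in> Q \<Longrightarrow> \<bar>F p y\<bar> \<le> C * exp (1/8 * y\<^sup>2)"
    by (rule growthE[OF assms(1), of "1/8"]) auto
  show ?thesis using gauss_avg_bound(1)[OF assms(3,4) _ _ C(2)[OF assms(2)] assms(5)] by simp
qed

text \<open>The weights add up to one, whatever \<open>h\<close> is; this makes the normalisation of the tilt uniform in \<open>h\<close>.\<close>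
lemma exp_mix_ge:
  assumes "0 \<le> \<beta>" "\<beta> \<le> 1" shows "exp (- \<bar>y\<bar>) \<le> exp_mix (plus_wt h) (minus_wt h) \<beta> y"
proof -
  have "\<bar>\<beta> * y\<bar> \<le> 1 * \<bar>y\<bar>" unfolding abs_mult using assms by (intro mult_right_mono) auto
  then have "exp (- \<bar>y\<bar>) \<le> exp (\<beta> * y)" "exp (- \<bar>y\<bar>) \<le> exp (- \<beta> * y)" by (auto simp: abs_le_iff)
  then have "plus_wt h * exp (- \<bar>y\<bar>) + minus_wt h * exp (- \<bar>y\<bar>) \<le> plus_wt h * exp (\<beta> * y) + minus_wt h * exp (- \<beta> * y)"
    using plus_wt_minus_wt[of h] by (intro add_mono mult_left_mono) auto
  then show ?thesis using plus_wt_minus_wt(5)[of h] by (simp add: exp_mix_def distrib_right[symmetric])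
qed

lemma exp_mix_measurable[measurable]: "exp_mix a b \<beta> \<in> borel_measurable borel" unfolding exp_mix_def[abs_def] by measurable

context sk_range begin

lemma admissible_\<beta>: "(\<beta>, h) \<in> params \<Longrightarrow> 0 \<le> \<beta> \<and> \<beta> \<le> 1" using \<beta>0 by (auto simp: params_def)

lemma growth_exp_mix:
  assumes "\<And>h. \<bar>a h\<bar> \<le> 1" "\<And>h. \<bar>b h\<bar> \<le> 1"
  shows "growth params (\<lambda>(\<beta>, h). exp_mix (a h) (b h) \<beta>)"
proof -
  have 1: "growth params (\<lambda>p y. (case p of (\<beta>, h) \<Rightarrow> a h) * exp (fst p * y))"
    by (intro growth_mult growth_compose[OF growth_exp] growth_bounded[of _ _ 1]) (use assms admissible_\<beta> in auto)
  have 2: "growth params (\<lambda>p y. (case p of (\<beta>, h) \<Rightarrow> b h) * exp (- fst p * y))"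
    by (intro growth_mult growth_compose[OF growth_exp] growth_bounded[of _ _ 1]) (use assms admissible_\<beta> in auto)
  show ?thesis by (rule growth_mono[OF growth_add[OF 1 2]]) (auto simp: exp_mix_def)
qed

lemma growth_inverse_exp_mix: "growth params (\<lambda>(\<beta>, h) y. 1 / exp_mix (plus_wt h) (minus_wt h) \<beta> y)"
proof -
  have g: "growth params (\<lambda>p y. exp (1 * y) + exp (- 1 * y))"
    by (intro growth_add growth_compose[OF growth_exp]) auto
  have le: "\<bar>1 / exp_mix (plus_wt h) (minus_wt h) \<beta> y\<bar> \<le> \<bar>exp (1 * y) + exp (- 1 * y)\<bar>" if "(\<beta>, h) \<in> params" for \<beta> h y
  proof -
    have c: "exp (- \<bar>y\<bar>) \<le> exp_mix (plus_wt h) (minus_wt h) \<beta> y" using admissible_\<beta>[OF that] by (intro exp_mix_ge) auto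
    have pos: "0 < exp_mix (plus_wt h) (minus_wt h) \<beta> y" by (rule less_le_trans[OF exp_gt_zero c])
    have "1 / exp_mix (plus_wt h) (minus_wt h) \<beta> y \<le> 1 / exp (- \<bar>y\<bar>)" using c by (intro divide_left_mono) (use pos in auto)
    also have "\<dots> = exp \<bar>y\<bar>" by (simp add: exp_minus inverse_eq_divide)
    also have "\<dots> \<le> exp y + exp (- y)" by (cases "0 \<le> y") auto
    finally show ?thesis using pos by simp
  qed
  show ?thesis by (rule growth_mono[OF g]) (use le in auto)
qed

lemma gauss_avg_exp_mix:
  assumes U: "smooth U" and p: "(\<beta>, h) \<in> params"
  shows "gauss_avg (sk_q \<beta> h) (\<lambda>y. U 0 y * exp_mix a b \<beta> y) y
    = a * gauss_avg (sk_q \<beta> h) (\<lambda>y. U 0 y * exp (\<beta> * y)) y + b * gauss_avg (sk_q \<beta> h) (\<lambda>y. U 0 y * exp (- \<beta> * y)) y"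
proof -
  have [measurable]: "U 0 \<in> borel_measurable borel" by (rule smooth_measurable[OF U])
  have q: "0 \<le> sk_q \<beta> h" "sk_q \<beta> h \<le> 1" using q_range[OF p] by auto
  have g: "growth {c. \<bar>c\<bar> \<le> 1} (\<lambda>c y. U 0 y * exp (c * y))"
    by (intro growth_mult growth_exp smooth_growth[OF U])
  have i: "integrable gauss1 (\<lambda>z. U 0 (y + sqrt (1 - sk_q \<beta> h) * z) * exp (c * (y + sqrt (1 - sk_q \<beta> h) * z)))" if "\<bar>c\<bar> \<le> 1" for c
    by (rule integrable_gauss_avg[OF g _ q]) (use that in auto)
  have "gauss_avg (sk_q \<beta> h) (\<lambda>y. U 0 y * exp_mix a b \<beta> y) y = (\<integral>z. a * (U 0 (y + sqrt (1 - sk_q \<beta> h) * z) * exp (\<beta> * (y + sqrt (1 - sk_q \<beta> h) * z)))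
     + b * (U 0 (y + sqrt (1 - sk_q \<beta> h) * z) * exp (- \<beta> * (y + sqrt (1 - sk_q \<beta> h) * z))) \<partial>gauss1)"
    unfolding gauss_avg_def exp_mix_def by (intro Bochner_Integration.integral_cong refl) (simp only: distrib_left mult_ac)
  also have "\<dots> = a * gauss_avg (sk_q \<beta> h) (\<lambda>y. U 0 y * exp (\<beta> * y)) y + b * gauss_avg (sk_q \<beta> h) (\<lambda>y. U 0 y * exp (- \<beta> * y)) y"
    unfolding gauss_avg_def using i[of \<beta>] i[of "- \<beta>"] admissible_\<beta>[OF p]
    by (subst Bochner_Integration.integral_add) (auto intro!: integrable_mult_right)
  finally show ?thesis .
qed

lemma gauss_avg_exp_mix_eq:
  assumes U: "smooth U" and p: "(\<beta>, h) \<in> params"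
  shows "gauss_avg (sk_q \<beta> h) (\<lambda>y. U 0 y * exp_mix a b \<beta> y) y
    = exp (\<beta>\<^sup>2 * (1 - sk_q \<beta> h) / 2) * (a * exp (\<beta> * y) * gauss_avg (sk_q \<beta> h) (U 0) (y + \<beta> * (1 - sk_q \<beta> h))
       + b * exp (- \<beta> * y) * gauss_avg (sk_q \<beta> h) (U 0) (y - \<beta> * (1 - sk_q \<beta> h)))"
proof -
  have m: "U 0 \<in> borel_measurable borel" by (rule smooth_measurable[OF U])
  have q: "sk_q \<beta> h \<le> 1" using q_range[OF p] by auto
  define E where "E = exp (\<beta>\<^sup>2 * (1 - sk_q \<beta> h) / 2)"
  have 1: "gauss_avg (sk_q \<beta> h) (\<lambda>y. U 0 y * exp (\<beta> * y)) y = E * (exp (\<beta> * y) * gauss_avg (sk_q \<beta> h) (U 0) (y + \<beta> * (1 - sk_q \<beta> h)))"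
    using gauss_avg_tilt[OF m q, of \<beta> y] unfolding exp_add E_def by (simp only: mult_ac)
  have 2: "gauss_avg (sk_q \<beta> h) (\<lambda>y. U 0 y * exp (- \<beta> * y)) y = E * (exp (- \<beta> * y) * gauss_avg (sk_q \<beta> h) (U 0) (y - \<beta> * (1 - sk_q \<beta> h)))"
    using gauss_avg_tilt[OF m q, of "- \<beta>" y] unfolding exp_add E_def
    by (simp only: power2_minus mult_minus_left diff_conv_add_uminus mult_ac)
  show ?thesis unfolding gauss_avg_exp_mix[OF U p] 1 2 E_def[symmetric] by (simp only: distrib_left mult_ac)
qed

lemma moment_order_limit_exp_mix:
  assumes U: "smooth U" and a: "\<And>h. \<bar>a h\<bar> \<le> 1" and b: "\<And>h. \<bar>b h\<bar> \<le> 1"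
  shows "moment_order 1 (\<lambda>N i \<beta> h G. cav_avg N i \<beta> h (\<lambda>y. U 0 y * exp_mix (a h) (b h) \<beta> y) G
     - gauss_avg (sk_q \<beta> h) (\<lambda>y. U 0 y * exp_mix (a h) (b h) \<beta> y) (mean_field N i \<beta> h G))"
proof -
  define X where "X = (\<lambda>s N i \<beta> h G. cav_avg N i \<beta> h (\<lambda>y. U 0 y * exp (s * \<beta> * y)) G
     - gauss_avg (sk_q \<beta> h) (\<lambda>y. U 0 y * exp (s * \<beta> * y)) (mean_field N i \<beta> h G))"
  have m: "moment_order 1 (\<lambda>N i \<beta> h G. a h * X 1 N i \<beta> h G + b h * X (- 1) N i \<beta> h G)"
    unfolding X_def by (intro moment_order_add moment_order_scale[where C=1] moment_order_limit_tilt U a b) auto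
  have e: "cav_avg N i \<beta> h (\<lambda>y. U 0 y * exp_mix (a h) (b h) \<beta> y) G - gauss_avg (sk_q \<beta> h) (\<lambda>y. U 0 y * exp_mix (a h) (b h) \<beta> y) (mean_field N i \<beta> h G)
    = a h * X 1 N i \<beta> h G + b h * X (- 1) N i \<beta> h G" if o: "admissible N i \<beta> h" for N i \<beta> h G
  proof -
    have "cav_avg N i \<beta> h (\<lambda>y. U 0 y * exp_mix (a h) (b h) \<beta> y) G
      = cav_avg N i \<beta> h (\<lambda>y. a h * (U 0 y * exp (\<beta> * y)) + b h * (U 0 y * exp (- \<beta> * y))) G"
      unfolding exp_mix_def by (intro arg_cong2[where f="cav_avg N i \<beta> h"] refl ext) (simp only: distrib_left mult_ac)
    also have "\<dots> = a h * cav_avg N i \<beta> h (\<lambda>y. U 0 y * exp (\<beta> * y)) G + b h * cav_avg N i \<beta> h (\<lambda>y. U 0 y * exp (- \<beta> * y)) G"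
      by (simp add: cav_avg_add cav_avg_cmult)
    finally show ?thesis unfolding gauss_avg_exp_mix[OF U admissible_params[OF o]] X_def by (simp add: algebra_simps)
  qed
  have [measurable]: "U 0 \<in> borel_measurable borel" by (rule smooth_measurable[OF U])
  have mm: "cav_avg N i \<beta> h (\<lambda>y. U 0 y * exp_mix (a h) (b h) \<beta> y) \<in> borel_measurable (gaussian (bonds N))"
    "gauss_avg (sk_q \<beta> h) (\<lambda>y. U 0 y * exp_mix (a h) (b h) \<beta> y) \<in> borel_measurable borel" for N i \<beta> h
    by (intro cav_avg_measurable gauss_avg_measurable; measurable)+
  show ?thesis
  proof (rule moment_order_dominated[OF _ m])
    show "(\<lambda>G. cav_avg N i \<beta> h (\<lambda>y. U 0 y * exp_mix (a h) (b h) \<beta> y) G - gauss_avg (sk_q \<beta> h) (\<lambda>y. U 0 y * exp_mix (a h) (b h) \<beta> y) (mean_field N i \<beta> h G))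
      \<in> borel_measurable (gaussian (bonds N))" for N i \<beta> h
      using mm(1)[of N i \<beta> h] measurable_compose[OF mean_field_measurable mm(2)[of \<beta> h]] by measurable
  qed (simp add: e)
qed

definition tilt_norm :: "nat \<Rightarrow> nat \<Rightarrow> real \<Rightarrow> real \<Rightarrow> (nat \<times> nat \<Rightarrow> real) \<Rightarrow> real" where
  "tilt_norm N i \<beta> h G = cav_avg N i \<beta> h (exp_mix (plus_wt h) (minus_wt h) \<beta>) G"

text \<open>With the weights \<open>plus_wt\<close> and \<open>minus_wt\<close> this is the Gibbs average of \<open>U 0\<close> at the local field of the
full system; the numerator may carry other weights, as for the average of the spin itself.\<close>
definition tilted_mean :: "(nat \<Rightarrow> real \<Rightarrow> real) \<Rightarrow> (real \<Rightarrow> real) \<Rightarrow> (real \<Rightarrow> real) \<Rightarrow> nat \<Rightarrow> nat \<Rightarrow> real \<Rightarrow> real \<Rightarrow> (nat \<times> nat \<Rightarrow> real) \<Rightarrow> real" where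
  "tilted_mean U a b N i \<beta> h G = cav_avg N i \<beta> h (\<lambda>y. U 0 y * exp_mix (a h) (b h) \<beta> y) G / tilt_norm N i \<beta> h G"

definition tilted_limit :: "(nat \<Rightarrow> real \<Rightarrow> real) \<Rightarrow> (real \<Rightarrow> real) \<Rightarrow> (real \<Rightarrow> real) \<Rightarrow> real \<Rightarrow> real \<Rightarrow> real \<Rightarrow> real" where
  "tilted_limit U a b \<beta> h y = gauss_avg (sk_q \<beta> h) (\<lambda>y. U 0 y * exp_mix (a h) (b h) \<beta> y) y / gauss_avg (sk_q \<beta> h) (exp_mix (plus_wt h) (minus_wt h) \<beta>) y"

text \<open>The constant function as a sequence of derivatives.\<close>
definition one :: "nat \<Rightarrow> real \<Rightarrow> real" where "one j y = (if j = 0 then 1 else 0)"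

lemma smooth_one: "smooth one"
  unfolding smooth_def by (auto simp: one_def[abs_def] intro!: growth_bounded[of _ _ 1])

lemma gauss_avg_one: "gauss_avg q (one 0) y = 1"
  using prob_space.prob_space[OF prob_space_gauss1] by (simp add: gauss_avg_def one_def)

lemma gauss_avg_tilt_norm:
  assumes "(\<beta>, h) \<in> params"
  shows "gauss_avg (sk_q \<beta> h) (exp_mix (plus_wt h) (minus_wt h) \<beta>) y = exp (\<beta>\<^sup>2 * (1 - sk_q \<beta> h) / 2) * exp_mix (plus_wt h) (minus_wt h) \<beta> y"
proof -
  have o1: "(\<lambda>y. one 0 y * exp_mix (plus_wt h) (minus_wt h) \<beta> y) = exp_mix (plus_wt h) (minus_wt h) \<beta>" by (auto simp: one_def)
  show ?thesis
    using gauss_avg_exp_mix_eq[OF smooth_one assms, of "plus_wt h" "minus_wt h" y] unfolding o1 gauss_avg_one by (simp add: exp_mix_def)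
qed

lemma exp_mix_pos: assumes "(\<beta>, h) \<in> params" shows "0 < exp_mix (plus_wt h) (minus_wt h) \<beta> y"
  using exp_mix_ge[of \<beta> y h] admissible_\<beta>[OF assms] by (intro less_le_trans[OF exp_gt_zero]) auto

lemma tilt_norm_pos: "admissible N i \<beta> h \<Longrightarrow> 0 < tilt_norm N i \<beta> h G"
  unfolding tilt_norm_def cav_avg_def using exp_mix_pos[OF admissible_params]
  by (intro jensen_inverse(1) spins_finite rest_finite cav_weight_nonneg cav_weight_sum) auto

lemma inverse_tilt_norm_le: "admissible N i \<beta> h \<Longrightarrow> 1 / tilt_norm N i \<beta> h G \<le> cav_avg N i \<beta> h (\<lambda>y. 1 / exp_mix (plus_wt h) (minus_wt h) \<beta> y) G"
  unfolding tilt_norm_def cav_avg_def using exp_mix_pos[OF admissible_params]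
  by (intro jensen_inverse(2) spins_finite rest_finite cav_weight_nonneg cav_weight_sum) auto

lemma tilt_norm_measurable[measurable]: "tilt_norm N i \<beta> h \<in> borel_measurable (gaussian (bonds N))"
  unfolding tilt_norm_def[abs_def] by (rule cav_avg_measurable) measurable

lemma moment_order_inverse_tilt_norm: "moment_order 0 (\<lambda>N i \<beta> h G. 1 / tilt_norm N i \<beta> h G)"
proof (rule moment_order_dominated)
  show "moment_order 0 (\<lambda>N i \<beta> h. cav_avg N i \<beta> h ((\<lambda>(\<beta>, h) y. 1 / exp_mix (plus_wt h) (minus_wt h) \<beta> y) (\<beta>, h)))"
    by (rule moment_order_cav_avg[OF growth_inverse_exp_mix]) (auto simp: case_prod_unfold)
  fix N i \<beta> h G assume o: "admissible N i \<beta> h"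
  show "\<bar>1 / tilt_norm N i \<beta> h G\<bar> \<le> \<bar>cav_avg N i \<beta> h ((\<lambda>(\<beta>, h) y. 1 / exp_mix (plus_wt h) (minus_wt h) \<beta> y) (\<beta>, h)) G\<bar>"
    using inverse_tilt_norm_le[OF o, of G] tilt_norm_pos[OF o, of G] by (simp add: case_prod_unfold)
qed measurable

lemma tilted_limit_measurable[measurable]: "smooth U \<Longrightarrow> tilted_limit U a b \<beta> h \<in> borel_measurable borel"
proof -
  assume "smooth U"
  then have [measurable]: "U 0 \<in> borel_measurable borel" by (rule smooth_measurable)
  have [measurable]: "gauss_avg (sk_q \<beta> h) (\<lambda>y. U 0 y * exp_mix (a h) (b h) \<beta> y) \<in> borel_measurable borel"
    "gauss_avg (sk_q \<beta> h) (exp_mix (plus_wt h) (minus_wt h) \<beta>) \<in> borel_measurable borel"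
    by (intro gauss_avg_measurable; measurable)+
  show ?thesis unfolding tilted_limit_def[abs_def] by measurable
qed

text \<open>The denominator is at least the tilt at the centre, whose inverse grows like \<open>exp \<bar>y\<bar>\<close>.\<close>
lemma growth_tilted_limit:
  assumes U: "smooth U" and a: "\<And>h. \<bar>a h\<bar> \<le> 1" and b: "\<And>h. \<bar>b h\<bar> \<le> 1"
  shows "growth params (\<lambda>(\<beta>, h). tilted_limit U a b \<beta> h)"
proof -
  have [measurable]: "U 0 \<in> borel_measurable borel" by (rule smooth_measurable[OF U])
  define F where "F = (\<lambda>p y. U 0 y * (case p of (\<beta>, h) \<Rightarrow> exp_mix (a h) (b h) \<beta>) y)"
  have gF: "growth params F" unfolding F_def by (intro growth_mult smooth_growth[OF U] growth_exp_mix a b)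
  have g1: "growth params (\<lambda>p. gauss_avg (case p of (\<beta>, h) \<Rightarrow> sk_q \<beta> h) (F p))"
  proof (rule growth_gauss_avg[OF gF])
    show "0 \<le> (case p of (\<beta>, h) \<Rightarrow> sk_q \<beta> h) \<and> (case p of (\<beta>, h) \<Rightarrow> sk_q \<beta> h) \<le> 1" if "p \<in> params" for p
      using q_range[of "fst p" "snd p"] that by (auto simp: case_prod_unfold less_imp_le)
    show "F p \<in> borel_measurable borel" for p unfolding F_def case_prod_unfold by measurable
  qed
  show ?thesis
  proof (rule growth_mono[OF growth_mult[OF g1 growth_inverse_exp_mix]])
    fix p :: "real \<times> real" and y assume "p \<in> params"
    then obtain \<beta> h where p: "p = (\<beta>, h)" "(\<beta>, h) \<in> params" by (cases p) auto
    have c: "0 < exp_mix (plus_wt h) (minus_wt h) \<beta> y" by (rule exp_mix_pos[OF p(2)])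
    have "0 \<le> \<beta>\<^sup>2 * (1 - sk_q \<beta> h) / 2" using q_range[OF p(2)] by simp
    then have "1 * exp_mix (plus_wt h) (minus_wt h) \<beta> y \<le> exp (\<beta>\<^sup>2 * (1 - sk_q \<beta> h) / 2) * exp_mix (plus_wt h) (minus_wt h) \<beta> y"
      using c by (intro mult_right_mono) auto
    then have "\<bar>tilted_limit U a b \<beta> h y\<bar> \<le> \<bar>gauss_avg (sk_q \<beta> h) (\<lambda>y. U 0 y * exp_mix (a h) (b h) \<beta> y) y\<bar> / exp_mix (plus_wt h) (minus_wt h) \<beta> y"
      unfolding tilted_limit_def gauss_avg_tilt_norm[OF p(2)] abs_divide using c by (intro divide_left_mono) auto
    then show "\<bar>(case p of (\<beta>, h) \<Rightarrow> tilted_limit U a b \<beta> h) y\<bar> \<le> \<bar>gauss_avg (case p of (\<beta>, h) \<Rightarrow> sk_q \<beta> h) (F p) y * (case p of (\<beta>, h) \<Rightarrow> \<lambda>y. 1 / exp_mix (plus_wt h) (minus_wt h) \<beta> y) y\<bar>"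
      using c by (simp add: p(1) F_def abs_mult)
  qed
qed

lemma tilted_mean_measurable:
  assumes U: "smooth U" shows "tilted_mean U a b N i \<beta> h \<in> borel_measurable (gaussian (bonds N))"
proof -
  have [measurable]: "U 0 \<in> borel_measurable borel" by (rule smooth_measurable[OF U])
  have [measurable]: "cav_avg N i \<beta> h (\<lambda>y. U 0 y * exp_mix (a h) (b h) \<beta> y) \<in> borel_measurable (gaussian (bonds N))"
    by (intro cav_avg_measurable) measurable
  show ?thesis unfolding tilted_mean_def[abs_def] by measurable
qed

text \<open>With numerators \<open>A\<close>, \<open>n\<close> and denominators \<open>D\<close>, \<open>d\<close>,
\<open>A / D - n / d = ((A - n) - (n / d) * (D - d)) / D\<close>. The two differences satisfy the claimed bound, while \<open>n / d\<close> and
\<open>1 / D\<close> are bounded in all moments, the latter by Jensen's inequality.\<close>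
theorem moment_order_ratio:
  assumes U: "smooth U" and a: "\<And>h. \<bar>a h\<bar> \<le> 1" and b: "\<And>h. \<bar>b h\<bar> \<le> 1"
  shows "moment_order 1 (\<lambda>N i \<beta> h G. tilted_mean U a b N i \<beta> h G - tilted_limit U a b \<beta> h (mean_field N i \<beta> h G))"
proof -
  define X where "X = (\<lambda>N i \<beta> h G. cav_avg N i \<beta> h (\<lambda>y. U 0 y * exp_mix (a h) (b h) \<beta> y) G
     - gauss_avg (sk_q \<beta> h) (\<lambda>y. U 0 y * exp_mix (a h) (b h) \<beta> y) (mean_field N i \<beta> h G))"
  define Y where "Y = (\<lambda>N i \<beta> h G. cav_avg N i \<beta> h (\<lambda>y. one 0 y * exp_mix (plus_wt h) (minus_wt h) \<beta> y) G
     - gauss_avg (sk_q \<beta> h) (\<lambda>y. one 0 y * exp_mix (plus_wt h) (minus_wt h) \<beta> y) (mean_field N i \<beta> h G))"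
  define L where "L = (\<lambda>N i \<beta> h G. (case (\<beta>, h) of (\<beta>, h) \<Rightarrow> tilted_limit U a b \<beta> h) (mean_field N i \<beta> h G))"
  have w: "\<bar>plus_wt h\<bar> \<le> 1" "\<bar>minus_wt h\<bar> \<le> 1" for h using plus_wt_minus_wt[of h] by auto
  have mX: "moment_order 1 X" unfolding X_def by (rule moment_order_limit_exp_mix[OF U a b])
  have mY: "moment_order 1 Y" unfolding Y_def by (rule moment_order_limit_exp_mix[OF smooth_one w])
  have mL: "moment_order 0 L" unfolding L_def by (rule moment_order_mean_field[OF growth_tilted_limit[OF U a b]]) (auto intro: tilted_limit_measurable[OF U])
  have m: "moment_order (1 + 0) (\<lambda>N i \<beta> h G. (X N i \<beta> h G - L N i \<beta> h G * Y N i \<beta> h G) * (1 / tilt_norm N i \<beta> h G))"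
    using moment_order_mult[OF mL mY] by (intro moment_order_mult moment_order_diff mX moment_order_inverse_tilt_norm) simp
  have e: "tilted_mean U a b N i \<beta> h G - tilted_limit U a b \<beta> h (mean_field N i \<beta> h G) = (X N i \<beta> h G - L N i \<beta> h G * Y N i \<beta> h G) * (1 / tilt_norm N i \<beta> h G)"
    if o: "admissible N i \<beta> h" for N i \<beta> h G
  proof -
    define D where "D = tilt_norm N i \<beta> h G"
    define A where "A = cav_avg N i \<beta> h (\<lambda>y. U 0 y * exp_mix (a h) (b h) \<beta> y) G"
    define d where "d = gauss_avg (sk_q \<beta> h) (exp_mix (plus_wt h) (minus_wt h) \<beta>) (mean_field N i \<beta> h G)"
    define n where "n = gauss_avg (sk_q \<beta> h) (\<lambda>y. U 0 y * exp_mix (a h) (b h) \<beta> y) (mean_field N i \<beta> h G)"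
    have D: "0 < D" unfolding D_def by (rule tilt_norm_pos[OF o])
    have d: "0 < d" unfolding d_def gauss_avg_tilt_norm[OF admissible_params[OF o]] using exp_mix_pos[OF admissible_params[OF o]] by simp
    have o1: "(\<lambda>y. one 0 y * exp_mix (plus_wt h) (minus_wt h) \<beta> y) = exp_mix (plus_wt h) (minus_wt h) \<beta>" by (auto simp: one_def)
    have Ye: "Y N i \<beta> h G = D - d" unfolding Y_def o1 D_def d_def tilt_norm_def ..
    have Xe: "X N i \<beta> h G = A - n" by (simp add: X_def A_def n_def)
    have Le: "L N i \<beta> h G = n / d" by (simp add: L_def tilted_limit_def n_def d_def)
    have Re: "tilted_mean U a b N i \<beta> h G = A / D" by (simp add: tilted_mean_def A_def D_def)
    have Me: "tilted_limit U a b \<beta> h (mean_field N i \<beta> h G) = n / d" by (simp add: tilted_limit_def n_def d_def)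
    show ?thesis unfolding Ye Xe Le Re Me D_def[symmetric] using D d by (simp add: field_simps)
  qed
  show ?thesis
  proof (rule moment_order_dominated[OF _ m[unfolded add_0_right]])
    show "(\<lambda>G. tilted_mean U a b N i \<beta> h G - tilted_limit U a b \<beta> h (mean_field N i \<beta> h G)) \<in> borel_measurable (gaussian (bonds N))" for N i \<beta> h
      using tilted_mean_measurable[OF U] tilted_limit_measurable[OF U] by measurable
  qed (simp add: e)
qed

end

section \<open>The mixture evaluated at the recovered mean\<close>

context sk_range begin

text \<open>The weight of the first component, \<open>exp (\<beta> * y + h) / (exp (\<beta> * y + h) + exp (- \<beta> * y - h))\<close>, with
numerator and denominator divided by \<open>2 * cosh h\<close>.\<close>
definition plus_prob :: "real \<Rightarrow> real \<Rightarrow> real \<Rightarrow> real" where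
  "plus_prob \<beta> h y = plus_wt h * exp (\<beta> * y) / exp_mix (plus_wt h) (minus_wt h) \<beta> y"

definition mixture_mean :: "(nat \<Rightarrow> real \<Rightarrow> real) \<Rightarrow> real \<Rightarrow> real \<Rightarrow> real \<Rightarrow> real" where
  "mixture_mean U \<beta> h y = plus_prob \<beta> h y * gauss_avg (sk_q \<beta> h) (U 0) (y + \<beta> * (1 - sk_q \<beta> h))
     + (1 - plus_prob \<beta> h y) * gauss_avg (sk_q \<beta> h) (U 0) (y - \<beta> * (1 - sk_q \<beta> h))"

lemma plus_prob_compl: "(\<beta>, h) \<in> params \<Longrightarrow> 1 - plus_prob \<beta> h y = minus_wt h * exp (- \<beta> * y) / exp_mix (plus_wt h) (minus_wt h) \<beta> y"
  using exp_mix_pos[of \<beta> h y] by (simp add: plus_prob_def field_simps) (simp add: exp_mix_def)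

lemma plus_prob_range: assumes "(\<beta>, h) \<in> params" shows "0 \<le> plus_prob \<beta> h y" "plus_prob \<beta> h y \<le> 1"
proof -
  show "0 \<le> plus_prob \<beta> h y" unfolding plus_prob_def using exp_mix_pos[OF assms, of y] plus_wt_minus_wt[of h] by simp
  have "0 \<le> 1 - plus_prob \<beta> h y" unfolding plus_prob_compl[OF assms] using exp_mix_pos[OF assms, of y] plus_wt_minus_wt[of h] by simp
  then show "plus_prob \<beta> h y \<le> 1" by simp
qed

lemma tilted_limit_general:
  assumes U: "smooth U" and p: "(\<beta>, h) \<in> params"
  shows "tilted_limit U a b \<beta> h y = (a h * exp (\<beta> * y) * gauss_avg (sk_q \<beta> h) (U 0) (y + \<beta> * (1 - sk_q \<beta> h))
       + b h * exp (- \<beta> * y) * gauss_avg (sk_q \<beta> h) (U 0) (y - \<beta> * (1 - sk_q \<beta> h))) / exp_mix (plus_wt h) (minus_wt h) \<beta> y"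
  unfolding tilted_limit_def gauss_avg_exp_mix_eq[OF U p] gauss_avg_tilt_norm[OF p] by simp

text \<open>The common factor \<open>exp (\<beta>\<^sup>2 * (1 - q) / 2)\<close> of the two shifts cancels in the ratio.\<close>
lemma tilted_limit_eq_mixture_mean:
  assumes U: "smooth U" and p: "(\<beta>, h) \<in> params"
  shows "tilted_limit U plus_wt minus_wt \<beta> h y = mixture_mean U \<beta> h y"
  unfolding tilted_limit_general[OF U p] mixture_mean_def plus_prob_compl[OF p] unfolding plus_prob_def by (simp add: add_divide_distrib)

lemma tilted_limit_spin:
  assumes p: "(\<beta>, h) \<in> params"
  shows "tilted_limit one plus_wt (\<lambda>h. - minus_wt h) \<beta> h y = plus_prob \<beta> h y - (1 - plus_prob \<beta> h y)"
  unfolding tilted_limit_general[OF smooth_one p] plus_prob_compl[OF p] unfolding plus_prob_def gauss_avg_one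
  by (simp add: diff_divide_distrib)

definition ident :: "nat \<Rightarrow> real \<Rightarrow> real" where
  "ident j y = (if j = 0 then y else if j = 1 then 1 else 0)"

lemma smooth_ident: "smooth ident"
proof -
  have "(ident j has_real_derivative ident (Suc j) y) (at y)" for j y
    by (cases "j = 0"; cases "j = 1") (auto simp: ident_def[abs_def])
  moreover have "growth {c::real. \<bar>c\<bar> \<le> 1} (\<lambda>_. ident j)" for j
  proof (cases "j = 0")
    case True
    then show ?thesis using growth_id by (simp add: ident_def[abs_def])
  next
    case False
    then show ?thesis by (intro growth_bounded[of _ _ 1]) (auto simp: ident_def)
  qed
  ultimately show ?thesis by (simp add: smooth_def)
qed

lemma gauss_avg_ident: "gauss_avg q (ident 0) y = y"
proof -
  have i: "integrable gauss1 (\<lambda>z. z)" using gauss1_integrable_abs by (simp add: integrable_abs_iff)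
  have "(\<integral>z. z * 1 \<partial>gauss1) = (\<integral>z. 0 \<partial>gauss1)"
    by (rule gauss1_integration_by_parts[where f="\<lambda>_. 1" and C=1]) auto
  then have z: "(\<integral>z. z \<partial>gauss1) = 0" by simp
  interpret prob_space gauss1 by (rule prob_space_gauss1)
  have "gauss_avg q (ident 0) y = (\<integral>z. y + sqrt (1 - q) * z \<partial>gauss1)" by (simp add: gauss_avg_def ident_def)
  also have "\<dots> = y" using i z prob_space by (subst Bochner_Integration.integral_add) auto
  finally show ?thesis .
qed

text \<open>The mean of the mixture. The correction in \<open>\<gamma>\<close> removes exactly the second summand.\<close>
lemma tilted_limit_ident:
  assumes p: "(\<beta>, h) \<in> params"
  shows "tilted_limit ident plus_wt minus_wt \<beta> h y = y + \<beta> * (1 - sk_q \<beta> h) * (plus_prob \<beta> h y - (1 - plus_prob \<beta> h y))"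
  unfolding tilted_limit_eq_mixture_mean[OF smooth_ident p] mixture_mean_def gauss_avg_ident by (simp add: algebra_simps)

lemma smooth_increment:
  assumes U: "smooth U" and C: "\<And>y. \<bar>U 1 y\<bar> \<le> C * exp (a * y\<^sup>2)" and a: "0 < a"
  shows "\<bar>U 0 x - U 0 y\<bar> \<le> C * \<bar>x - y\<bar> * (exp (a * x\<^sup>2) + exp (a * y\<^sup>2))"
proof -
  have C0: "0 \<le> C" using order_trans[OF abs_ge_zero C[of 0]] by simp
  define S where "S = {min x y..max x y}"
  have b: "\<bar>U 1 w\<bar> \<le> C * (exp (a * x\<^sup>2) + exp (a * y\<^sup>2))" if "w \<in> S" for w
  proof -
    have "\<bar>w\<bar> \<le> max \<bar>x\<bar> \<bar>y\<bar>" using that by (auto simp: S_def min_def max_def abs_le_iff split: if_splits)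
    then have "w\<^sup>2 \<le> x\<^sup>2 \<or> w\<^sup>2 \<le> y\<^sup>2" by (auto simp: abs_le_square_iff[symmetric] max_def split: if_splits)
    then have "exp (a * w\<^sup>2) \<le> exp (a * x\<^sup>2) \<or> exp (a * w\<^sup>2) \<le> exp (a * y\<^sup>2)" using a by auto
    moreover have "0 < exp (a * x\<^sup>2)" "0 < exp (a * y\<^sup>2)" by (rule exp_gt_zero)+
    ultimately have "exp (a * w\<^sup>2) \<le> exp (a * x\<^sup>2) + exp (a * y\<^sup>2)" by linarith
    then show ?thesis using order_trans[OF C mult_left_mono[OF _ C0]] by blast
  qed
  have "norm (U 0 x - U 0 y) \<le> (C * (exp (a * x\<^sup>2) + exp (a * y\<^sup>2))) * norm (x - y)"
  proof (rule field_differentiable_bound[where S=S and f'="U 1"])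
    show "(U 0 has_field_derivative U 1 z) (at z within S)" for z
      using smooth_deriv[OF U, of 0 z] by (auto intro: has_field_derivative_at_within)
    show "convex S" unfolding S_def by simp
    show "norm (U 1 z) \<le> C * (exp (a * x\<^sup>2) + exp (a * y\<^sup>2))" if "z \<in> S" for z using b[OF that] by simp
  qed (auto simp: S_def)
  then show ?thesis by (simp add: mult_ac)
qed

lemma gauss_avg_increment:
  assumes U: "smooth U" and q: "0 \<le> q" "q \<le> 1" and a: "0 < a" "a \<le> 1/8" and C: "\<And>y. \<bar>U 1 y\<bar> \<le> C * exp (a * y\<^sup>2)"
  shows "\<bar>gauss_avg q (U 0) x - gauss_avg q (U 0) y\<bar> \<le> 2 * C * \<bar>x - y\<bar> * (exp (2 * a * x\<^sup>2) + exp (2 * a * y\<^sup>2))"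
proof -
  have C0: "0 \<le> C" using order_trans[OF abs_ge_zero C[of 0]] by simp
  define E where "E = (\<lambda>y::real. exp (a * y\<^sup>2))"
  have Em: "E \<in> borel_measurable borel" unfolding E_def by measurable
  have Eb: "\<bar>E y\<bar> \<le> 1 * exp (a * y\<^sup>2)" for y by (simp add: E_def)
  note iE = gauss_avg_bound[OF q a Eb Em]
  have iU: "integrable gauss1 (\<lambda>z. U 0 (x + sqrt (1 - q) * z))" for x
    by (rule integrable_gauss_avg[where Q=UNIV and F="\<lambda>_. U 0", OF smooth_growth[OF U] _ q smooth_measurable[OF U]]) simp
  define s where "s = sqrt (1 - q)"
  have "\<bar>gauss_avg q (U 0) x - gauss_avg q (U 0) y\<bar> = \<bar>\<integral>z. U 0 (x + s * z) - U 0 (y + s * z) \<partial>gauss1\<bar>"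
    unfolding gauss_avg_def s_def using iU by simp
  also have "\<dots> \<le> (\<integral>z. (C * \<bar>x - y\<bar>) * (E (x + s * z) + E (y + s * z)) \<partial>gauss1)"
  proof (rule order_trans[OF integral_abs_bound integral_mono])
    show "integrable gauss1 (\<lambda>z. \<bar>U 0 (x + s * z) - U 0 (y + s * z)\<bar>)" unfolding s_def using iU by (intro integrable_abs) auto
    show "integrable gauss1 (\<lambda>z. (C * \<bar>x - y\<bar>) * (E (x + s * z) + E (y + s * z)))"
      unfolding s_def using iE(1) by (intro integrable_mult_right) auto
    show "\<bar>U 0 (x + s * z) - U 0 (y + s * z)\<bar> \<le> (C * \<bar>x - y\<bar>) * (E (x + s * z) + E (y + s * z))" for z
      using smooth_increment[OF U C a(1), of "x + s * z" "y + s * z"] by (simp add: E_def)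
  qed
  also have "\<dots> = (C * \<bar>x - y\<bar>) * (gauss_avg q E x + gauss_avg q E y)"
    unfolding gauss_avg_def s_def using iE(1) by simp
  also have "\<dots> \<le> (C * \<bar>x - y\<bar>) * (2 * exp (2 * a * x\<^sup>2) + 2 * exp (2 * a * y\<^sup>2))"
  proof -
    have "gauss_avg q E w \<le> 2 * exp (2 * a * w\<^sup>2)" for w using iE(2)[of w] by (simp add: abs_le_iff)
    then show ?thesis using C0 by (intro mult_left_mono add_mono) auto
  qed
  finally show ?thesis by (simp add: algebra_simps)
qed

lemma plus_prob_increment:
  assumes p: "(\<beta>, h) \<in> params" shows "\<bar>plus_prob \<beta> h x - plus_prob \<beta> h y\<bar> \<le> 2 * \<bar>x - y\<bar>"
proof -
  have d: "(plus_prob \<beta> h has_real_derivative 2 * \<beta> * (plus_prob \<beta> h z * (1 - plus_prob \<beta> h z))) (at z)" for z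
  proof -
    define D where "D = (\<lambda>y. exp_mix (plus_wt h) (minus_wt h) \<beta> y)"
    have D0: "D z \<noteq> 0" using exp_mix_pos[OF p, of z] by (simp add: D_def)
    have dD: "(D has_real_derivative \<beta> * (plus_wt h * exp (\<beta> * z)) - \<beta> * (minus_wt h * exp (- \<beta> * z))) (at z)"
      unfolding D_def exp_mix_def by (auto intro!: derivative_eq_intros)
    have dn: "((\<lambda>y. plus_wt h * exp (\<beta> * y)) has_real_derivative \<beta> * (plus_wt h * exp (\<beta> * z))) (at z)"
      by (auto intro!: derivative_eq_intros)
    have "((\<lambda>y. plus_wt h * exp (\<beta> * y) / D y) has_real_derivative
      (\<beta> * (plus_wt h * exp (\<beta> * z)) * D z - plus_wt h * exp (\<beta> * z) * (\<beta> * (plus_wt h * exp (\<beta> * z)) - \<beta> * (minus_wt h * exp (- \<beta> * z)))) / (D z * D z)) (at z)"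
      by (rule DERIV_divide[OF dn dD D0])
    moreover have "(\<beta> * A * (A + B) - A * (\<beta> * A - \<beta> * B)) / ((A + B) * (A + B)) = 2 * \<beta> * (A / (A + B) * (B / (A + B)))" if "A + B \<noteq> 0" for A B :: real
      using that by (simp add: field_simps)
    moreover have "D z = plus_wt h * exp (\<beta> * z) + minus_wt h * exp (- \<beta> * z)" by (simp add: D_def exp_mix_def)
    ultimately have "((\<lambda>y. plus_wt h * exp (\<beta> * y) / D y) has_real_derivative
      2 * \<beta> * (plus_wt h * exp (\<beta> * z) / D z * (minus_wt h * exp (- \<beta> * z) / D z))) (at z)" using D0 by simp
    then show ?thesis unfolding plus_prob_compl[OF p] unfolding plus_prob_def[abs_def] D_def .
  qed
  have "norm (plus_prob \<beta> h x - plus_prob \<beta> h y) \<le> 2 * norm (x - y)"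
  proof (rule field_differentiable_bound[where S=UNIV])
    show "(plus_prob \<beta> h has_field_derivative 2 * \<beta> * (plus_prob \<beta> h z * (1 - plus_prob \<beta> h z))) (at z within UNIV)" for z using d[of z] by simp
    show "norm (2 * \<beta> * (plus_prob \<beta> h z * (1 - plus_prob \<beta> h z))) \<le> 2" for z
    proof -
      have "plus_prob \<beta> h z * (1 - plus_prob \<beta> h z) \<le> 1 * 1" using plus_prob_range[OF p, of z] by (intro mult_mono) auto
      then have "\<beta> * (plus_prob \<beta> h z * (1 - plus_prob \<beta> h z)) \<le> 1 * 1" using plus_prob_range[OF p, of z] admissible_\<beta>[OF p] by (intro mult_mono) auto
      moreover have "0 \<le> \<beta> * (plus_prob \<beta> h z * (1 - plus_prob \<beta> h z))" using plus_prob_range[OF p, of z] admissible_\<beta>[OF p] by (intro mult_nonneg_nonneg) auto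
      ultimately show ?thesis by simp
    qed
  qed auto
  then show ?thesis by simp
qed

lemma exp_square_shift: "0 \<le> a \<Longrightarrow> \<bar>c\<bar> \<le> 1 \<Longrightarrow> exp (a * (x + c)\<^sup>2) \<le> exp (2 * a) * exp (2 * a * x\<^sup>2)" for a c x :: real
proof -
  assume a: "0 \<le> a" and c: "\<bar>c\<bar> \<le> 1"
  have "(x + c)\<^sup>2 \<le> 2 * x\<^sup>2 + 2 * c\<^sup>2" using zero_le_power2[of "x - c"] by (simp add: power2_eq_square algebra_simps)
  also have "c\<^sup>2 \<le> 1" using c by (simp add: abs_square_le_1)
  finally have "a * (x + c)\<^sup>2 \<le> a * (2 * x\<^sup>2 + 2)" using a by (intro mult_left_mono) auto
  then show ?thesis by (simp add: exp_add[symmetric] algebra_simps)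
qed

lemma shift_le_1: assumes p: "(\<beta>, h) \<in> params" shows "0 \<le> \<beta> * (1 - sk_q \<beta> h)" "\<beta> * (1 - sk_q \<beta> h) \<le> 1"
proof -
  show "0 \<le> \<beta> * (1 - sk_q \<beta> h)" using admissible_\<beta>[OF p] q_range[OF p] by simp
  have "\<beta> * (1 - sk_q \<beta> h) \<le> 1 * 1" using admissible_\<beta>[OF p] q_range[OF p] by (intro mult_mono) auto
  then show "\<beta> * (1 - sk_q \<beta> h) \<le> 1" by simp
qed

text \<open>A local Lipschitz bound: the components by the growth of \<open>U 1\<close>, the weight because its derivative is bounded.\<close>
lemma mixture_mean_increment:
  assumes U: "smooth U" and a: "0 < a" "a \<le> 1/2"
  shows "\<exists>C\<ge>0. \<forall>\<beta> h x y. (\<beta>, h) \<in> params \<longrightarrow> \<bar>mixture_mean U \<beta> h x - mixture_mean U \<beta> h y\<bar> \<le> C * \<bar>x - y\<bar> * (exp (a * x\<^sup>2) + exp (a * y\<^sup>2))"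
proof -
  define b where "b = a / 4"
  have b: "0 < b" "b \<le> 1/8" using a by (auto simp: b_def)
  obtain C0 where C0: "0 \<le> C0" "\<And>y. \<bar>U 0 y\<bar> \<le> C0 * exp (b * y\<^sup>2)"
    by (rule growthE[OF smooth_growth[OF U, of UNIV 0] b(1)]) auto
  obtain C1 where C1: "0 \<le> C1" "\<And>y. \<bar>U 1 y\<bar> \<le> C1 * exp (b * y\<^sup>2)"
    by (rule growthE[OF smooth_growth[OF U, of UNIV 1] b(1)]) auto
  define k where "k = exp (4 * b)"
  define C where "C = 8 * C0 * k + 4 * C1 * k"
  have k0: "0 < k" by (simp add: k_def)
  have "\<bar>mixture_mean U \<beta> h x - mixture_mean U \<beta> h y\<bar> \<le> C * \<bar>x - y\<bar> * (exp (a * x\<^sup>2) + exp (a * y\<^sup>2))" if p: "(\<beta>, h) \<in> params" for \<beta> h x y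
  proof -
    define q where "q = sk_q \<beta> h"
    define c where "c = \<beta> * (1 - q)"
    have q: "0 \<le> q" "q \<le> 1" using q_range[OF p] by (auto simp: q_def)
    have c: "\<bar>c\<bar> \<le> 1" "\<bar>- c\<bar> \<le> 1" using shift_le_1[OF p] by (auto simp: c_def q_def)
    define Eu where "Eu = gauss_avg q (U 0)"
    define w where "w = exp (a * x\<^sup>2) + exp (a * y\<^sup>2)"
    have sh: "exp (2 * b * (x + d)\<^sup>2) \<le> k * exp (a * x\<^sup>2)" if "\<bar>d\<bar> \<le> 1" for x d
      using exp_square_shift[of "2 * b" d x] that b by (simp add: k_def b_def)
    have E0: "\<bar>Eu (x + d)\<bar> \<le> 2 * C0 * k * exp (a * x\<^sup>2)" if "\<bar>d\<bar> \<le> 1" for x d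
    proof -
      have "\<bar>Eu (x + d)\<bar> \<le> 2 * C0 * exp (2 * b * (x + d)\<^sup>2)"
        unfolding Eu_def by (rule gauss_avg_bound(2)[OF q b C0(2) smooth_measurable[OF U]])
      also have "\<dots> \<le> 2 * C0 * (k * exp (a * x\<^sup>2))" using C0 sh[OF that] by (intro mult_left_mono) auto
      finally show ?thesis by simp
    qed
    have E1: "\<bar>Eu (x + d) - Eu (y + d)\<bar> \<le> 2 * C1 * k * (\<bar>x - y\<bar> * w)" if d: "\<bar>d\<bar> \<le> 1" for d
    proof -
      have "\<bar>Eu (x + d) - Eu (y + d)\<bar> \<le> 2 * C1 * \<bar>(x + d) - (y + d)\<bar> * (exp (2 * b * (x + d)\<^sup>2) + exp (2 * b * (y + d)\<^sup>2))"
        unfolding Eu_def by (rule gauss_avg_increment[OF U q b C1(2)])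
      also have "\<dots> \<le> 2 * C1 * \<bar>(x + d) - (y + d)\<bar> * (k * exp (a * x\<^sup>2) + k * exp (a * y\<^sup>2))"
        using C1 by (intro mult_left_mono add_mono sh d) auto
      finally show ?thesis by (simp add: w_def algebra_simps)
    qed
    define P where "P = plus_prob \<beta> h"
    have P: "0 \<le> P y" "P y \<le> 1" "\<bar>P x - P y\<bar> \<le> 2 * \<bar>x - y\<bar>" using plus_prob_range[OF p] plus_prob_increment[OF p] by (auto simp: P_def)
    have Mx: "mixture_mean U \<beta> h z = P z * Eu (z + c) + (1 - P z) * Eu (z + - c)" for z
      by (simp add: mixture_mean_def P_def Eu_def q_def c_def)
    have "mixture_mean U \<beta> h x - mixture_mean U \<beta> h y = (P x - P y) * Eu (x + c) + (- ((P x - P y) * Eu (x + - c)))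
      + P y * (Eu (x + c) - Eu (y + c)) + (1 - P y) * (Eu (x + - c) - Eu (y + - c))"
      unfolding Mx by (simp add: algebra_simps)
    also have "\<bar>\<dots>\<bar> \<le> \<bar>(P x - P y) * Eu (x + c)\<bar> + \<bar>(P x - P y) * Eu (x + - c)\<bar>
      + \<bar>P y * (Eu (x + c) - Eu (y + c))\<bar> + \<bar>(1 - P y) * (Eu (x + - c) - Eu (y + - c))\<bar>" by linarith
    also have "\<dots> \<le> (2 * \<bar>x - y\<bar>) * (2 * C0 * k * exp (a * x\<^sup>2)) + (2 * \<bar>x - y\<bar>) * (2 * C0 * k * exp (a * x\<^sup>2))
      + 1 * (2 * C1 * k * (\<bar>x - y\<bar> * w)) + 1 * (2 * C1 * k * (\<bar>x - y\<bar> * w))"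
      unfolding abs_mult by (intro add_mono mult_mono E0 E1 c P) (use P in auto)
    also have "\<dots> \<le> (2 * \<bar>x - y\<bar>) * (2 * C0 * k * w) + (2 * \<bar>x - y\<bar>) * (2 * C0 * k * w)
      + 1 * (2 * C1 * k * (\<bar>x - y\<bar> * w)) + 1 * (2 * C1 * k * (\<bar>x - y\<bar> * w))"
      using C0 k0 by (intro add_mono mult_left_mono order_refl) (auto simp: w_def)
    also have "\<dots> = C * \<bar>x - y\<bar> * w" by (simp add: C_def algebra_simps)
    finally show ?thesis by (simp add: w_def)
  qed
  then show ?thesis using C0 C1 k0 by (intro exI[of _ C]) (auto simp: C_def)
qed

text \<open>The quantity \<open>\<gamma>\<close> of the theorem in terms of the reduced system (see \<open>cavity_mean_eq_cavity_gamma\<close>).\<close>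
definition cavity_gamma :: "nat \<Rightarrow> nat \<Rightarrow> real \<Rightarrow> real \<Rightarrow> (nat \<times> nat \<Rightarrow> real) \<Rightarrow> real" where
  "cavity_gamma N i \<beta> h G = tilted_mean ident plus_wt minus_wt N i \<beta> h G - \<beta> * (1 - sk_q \<beta> h) * tilted_mean one plus_wt (\<lambda>h. - minus_wt h) N i \<beta> h G"

lemma cavity_gamma_measurable[measurable]: "cavity_gamma N i \<beta> h \<in> borel_measurable (gaussian (bonds N))"
  unfolding cavity_gamma_def[abs_def] using tilted_mean_measurable[OF smooth_ident] tilted_mean_measurable[OF smooth_one] by measurable

lemma w_abs: "\<bar>plus_wt h\<bar> \<le> 1" "\<bar>minus_wt h\<bar> \<le> 1" "\<bar>- minus_wt h\<bar> \<le> 1" using plus_wt_minus_wt[of h] by auto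

text \<open>Subtract the limits of \<open>\<langle>l\<rangle>\<close> and of \<open>\<beta> * (1 - q) * \<langle>\<sigma> i\<rangle>\<close>: the shifts
cancel and the mean of the field in the reduced system remains.\<close>
lemma moment_order_cavity_gamma: "moment_order 1 (\<lambda>N i \<beta> h G. cavity_gamma N i \<beta> h G - mean_field N i \<beta> h G)"
proof -
  define X where "X = (\<lambda>N i \<beta> h G. tilted_mean ident plus_wt minus_wt N i \<beta> h G - tilted_limit ident plus_wt minus_wt \<beta> h (mean_field N i \<beta> h G))"
  define Y where "Y = (\<lambda>N i \<beta> h G. tilted_mean one plus_wt (\<lambda>h. - minus_wt h) N i \<beta> h G - tilted_limit one plus_wt (\<lambda>h. - minus_wt h) \<beta> h (mean_field N i \<beta> h G))"
  have mX: "moment_order 1 X" unfolding X_def by (rule moment_order_ratio[OF smooth_ident w_abs(1,2)])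
  have mY: "moment_order 1 Y" unfolding Y_def by (rule moment_order_ratio[OF smooth_one w_abs(1,3)])
  have m: "moment_order 1 (\<lambda>N i \<beta> h G. X N i \<beta> h G - (\<beta> * (1 - sk_q \<beta> h)) * Y N i \<beta> h G)"
    using shift_le_1[OF admissible_params] by (intro moment_order_diff mX moment_order_scale[where C=1] mY) auto
  show ?thesis
  proof (rule moment_order_dominated[OF _ m])
    show "(\<lambda>G. cavity_gamma N i \<beta> h G - mean_field N i \<beta> h G) \<in> borel_measurable (gaussian (bonds N))" for N i \<beta> h by measurable
    fix N i \<beta> h G assume o: "admissible N i \<beta> h"
    have "cavity_gamma N i \<beta> h G - mean_field N i \<beta> h G = X N i \<beta> h G - (\<beta> * (1 - sk_q \<beta> h)) * Y N i \<beta> h G"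
      unfolding X_def Y_def cavity_gamma_def tilted_limit_ident[OF admissible_params[OF o]] tilted_limit_spin[OF admissible_params[OF o]] by (simp add: algebra_simps)
    then show "\<bar>cavity_gamma N i \<beta> h G - mean_field N i \<beta> h G\<bar> \<le> \<bar>X N i \<beta> h G - (\<beta> * (1 - sk_q \<beta> h)) * Y N i \<beta> h G\<bar>" by simp
  qed
qed

lemma cav_avg_square: "(cav_avg N i \<beta> h F G)\<^sup>2 \<le> cav_avg N i \<beta> h (\<lambda>y. (F y)\<^sup>2) G"
  unfolding cav_avg_def
  by (rule jensen_even_power[where k=1, OF spins_finite[OF rest_finite] cav_weight_nonneg cav_weight_sum[OF rest_finite], unfolded mult_1_right])

text \<open>The full Gibbs measure has density \<open>exp_mix / tilt_norm\<close> with respect to the reduced one. Jensen's inequality for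
it leaves a product of a numerator and \<open>1 / tilt_norm\<close>, separated by \<open>a * b \<le> a\<^sup>2 + b\<^sup>2\<close>.\<close>
lemma cavity_gamma_exp_le:
  "\<exists>C\<ge>0. \<forall>N i \<beta> h G. admissible N i \<beta> h \<longrightarrow> exp (1/32 * (cavity_gamma N i \<beta> h G)\<^sup>2) \<le> C * cav_avg N i \<beta> h (\<lambda>y. exp (1/4 * y\<^sup>2)) G"
proof -
  obtain C1 where C1: "0 \<le> C1" "\<And>p y. p \<in> params \<Longrightarrow> \<bar>(case p of (\<beta>, h) \<Rightarrow> exp_mix (plus_wt h) (minus_wt h) \<beta>) y\<bar> \<le> C1 * exp (1/16 * y\<^sup>2)"
    by (rule growthE[OF growth_exp_mix[of plus_wt minus_wt, OF w_abs(1,2)], of "1/16"]) auto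
  obtain C2 where C2: "0 \<le> C2" "\<And>p y. p \<in> params \<Longrightarrow> \<bar>(case p of (\<beta>, h) \<Rightarrow> \<lambda>y. 1 / exp_mix (plus_wt h) (minus_wt h) \<beta> y) y\<bar> \<le> C2 * exp (1/8 * y\<^sup>2)"
    by (rule growthE[OF growth_inverse_exp_mix, of "1/8"]) auto
  define C where "C = exp (1/16) * (C1\<^sup>2 + C2\<^sup>2)"
  have "exp (1/32 * (cavity_gamma N i \<beta> h G)\<^sup>2) \<le> C * cav_avg N i \<beta> h (\<lambda>y. exp (1/4 * y\<^sup>2)) G" if o: "admissible N i \<beta> h" for N i \<beta> h G
  proof -
    note p = admissible_params[OF o]
    define ct where "ct = exp_mix (plus_wt h) (minus_wt h) \<beta>"
    have ct: "0 < ct y" for y unfolding ct_def by (rule exp_mix_pos[OF p])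
    define D where "D = tilt_norm N i \<beta> h G"
    have D: "0 < D" unfolding D_def by (rule tilt_norm_pos[OF o])
    define L where "L = tilted_mean ident plus_wt minus_wt N i \<beta> h G"
    define s where "s = tilted_mean one plus_wt (\<lambda>h. - minus_wt h) N i \<beta> h G"
    have s: "\<bar>s\<bar> \<le> 1"
    proof -
      have "\<bar>cav_avg N i \<beta> h (\<lambda>y. one 0 y * exp_mix (plus_wt h) (- minus_wt h) \<beta> y) G\<bar> \<le> D"
      proof -
        have a: "\<bar>one 0 y * exp_mix (plus_wt h) (- minus_wt h) \<beta> y\<bar> \<le> exp_mix (plus_wt h) (minus_wt h) \<beta> y" for y
          using plus_wt_minus_wt[of h] mult_nonneg_nonneg[of "plus_wt h" "exp (\<beta> * y)"] mult_nonneg_nonneg[of "minus_wt h" "exp (- \<beta> * y)"]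
          by (simp add: one_def exp_mix_def abs_le_iff)
        show ?thesis unfolding D_def tilt_norm_def cav_avg_def
          using a cav_weight_nonneg
          by (intro order_trans[OF sum_abs] sum_mono) (simp add: abs_mult mult_left_mono)
      qed
      then show ?thesis using D by (simp add: s_def tilted_mean_def D_def[symmetric])
    qed
    have g2: "(cavity_gamma N i \<beta> h G)\<^sup>2 \<le> 2 * L\<^sup>2 + 2"
    proof -
      define e where "e = \<beta> * (1 - sk_q \<beta> h) * s"
      have "\<bar>\<beta> * (1 - sk_q \<beta> h)\<bar> * \<bar>s\<bar> \<le> 1 * 1" using shift_le_1[OF p] s by (intro mult_mono) auto
      then have "e\<^sup>2 \<le> 1" by (simp add: e_def abs_square_le_1 abs_mult)
      moreover have "(L - e)\<^sup>2 \<le> 2 * L\<^sup>2 + 2 * e\<^sup>2" using zero_le_power2[of "L + e"] by (simp add: power2_eq_square algebra_simps)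
      moreover have "cavity_gamma N i \<beta> h G = L - e" by (simp add: cavity_gamma_def L_def s_def e_def)
      ultimately show ?thesis by simp
    qed
    have "exp (1/32 * (cavity_gamma N i \<beta> h G)\<^sup>2) \<le> exp (1/32 * (2 * L\<^sup>2 + 2))" using g2 by simp
    also have "\<dots> = exp (1/16) * exp (1/16 * L\<^sup>2)" by (simp add: exp_add[symmetric])
    also have "exp (1/16 * L\<^sup>2) \<le> cav_avg N i \<beta> h (\<lambda>y. exp (1/16 * y\<^sup>2) * ct y) G / D"
    proof -
      \<comment> \<open>The marginal on the other spins of the full Gibbs measure.\<close>
      define \<mu> where "\<mu> = (\<lambda>\<sigma>. cav_weight N \<beta> h (rest N i) G \<sigma> * ct (field_at N i G \<sigma>) / D)"
      have \<mu>0: "0 \<le> \<mu> \<sigma>" for \<sigma> unfolding \<mu>_def using cav_weight_nonneg ct[of "field_at N i G \<sigma>"] D by (intro divide_nonneg_nonneg mult_nonneg_nonneg) auto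
      have \<mu>1: "(\<Sum>\<sigma>\<in>spins (rest N i). \<mu> \<sigma>) = 1"
        unfolding \<mu>_def sum_divide_distrib[symmetric] using D by (simp add: D_def tilt_norm_def cav_avg_def ct_def)
      have Le: "L = (\<Sum>\<sigma>\<in>spins (rest N i). \<mu> \<sigma> * field_at N i G \<sigma>)"
        unfolding L_def tilted_mean_def D_def[symmetric] cav_avg_def \<mu>_def by (simp add: ident_def ct_def sum_divide_distrib mult_ac)
      have "exp (1/16 * L\<^sup>2) \<le> (\<Sum>\<sigma>\<in>spins (rest N i). \<mu> \<sigma> * exp (1/16 * (field_at N i G \<sigma>)\<^sup>2))"
        unfolding Le by (intro jensen_exp_square spins_finite rest_finite \<mu>0 \<mu>1) auto
      also have "\<dots> = cav_avg N i \<beta> h (\<lambda>y. exp (1/16 * y\<^sup>2) * ct y) G / D"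
        unfolding cav_avg_def \<mu>_def by (simp add: sum_divide_distrib mult_ac)
      finally show ?thesis .
    qed
    also have "\<dots> \<le> C1\<^sup>2 * cav_avg N i \<beta> h (\<lambda>y. exp (1/4 * y\<^sup>2)) G + C2\<^sup>2 * cav_avg N i \<beta> h (\<lambda>y. exp (1/4 * y\<^sup>2)) G"
    proof -
      define A where "A = cav_avg N i \<beta> h (\<lambda>y. exp (1/16 * y\<^sup>2) * ct y) G"
      have "a * b \<le> a\<^sup>2 + b\<^sup>2" for a b :: real
        using sum_squares_bound[of a b] zero_le_power2[of a] zero_le_power2[of b] by (simp only: mult.assoc)
      then have "A * (1 / D) \<le> A\<^sup>2 + (1 / D)\<^sup>2" .
      moreover have "A\<^sup>2 \<le> C1\<^sup>2 * cav_avg N i \<beta> h (\<lambda>y. exp (1/4 * y\<^sup>2)) G"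
      proof -
        have "A\<^sup>2 \<le> cav_avg N i \<beta> h (\<lambda>y. (exp (1/16 * y\<^sup>2) * ct y)\<^sup>2) G"
          unfolding A_def by (rule cav_avg_square)
        also have "\<dots> \<le> cav_avg N i \<beta> h (\<lambda>y. C1\<^sup>2 * exp (1/4 * y\<^sup>2)) G"
        proof (rule cav_avg_mono)
          fix y
          have "exp (1/16 * y\<^sup>2) * ct y \<le> exp (1/16 * y\<^sup>2) * (C1 * exp (1/16 * y\<^sup>2))"
            using C1(2)[OF p, of y] by (intro mult_left_mono) (auto simp: ct_def)
          then have "(exp (1/16 * y\<^sup>2) * ct y)\<^sup>2 \<le> (exp (1/16 * y\<^sup>2) * (C1 * exp (1/16 * y\<^sup>2)))\<^sup>2"
            using ct[of y] by (intro power_mono) auto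
          also have "\<dots> = C1\<^sup>2 * exp (1/4 * y\<^sup>2)" by (simp add: power2_eq_square exp_add[symmetric])
          finally show "(exp (1/16 * y\<^sup>2) * ct y)\<^sup>2 \<le> C1\<^sup>2 * exp (1/4 * y\<^sup>2)" .
        qed
        finally show ?thesis by (simp add: cav_avg_cmult)
      qed
      moreover have "(1 / D)\<^sup>2 \<le> C2\<^sup>2 * cav_avg N i \<beta> h (\<lambda>y. exp (1/4 * y\<^sup>2)) G"
      proof -
        have "(1 / D)\<^sup>2 \<le> (cav_avg N i \<beta> h (\<lambda>y. 1 / ct y) G)\<^sup>2"
          using inverse_tilt_norm_le[OF o, of G] D by (intro power_mono) (auto simp: D_def ct_def)
        also have "\<dots> \<le> cav_avg N i \<beta> h (\<lambda>y. (1 / ct y)\<^sup>2) G"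
          by (rule cav_avg_square)
        also have "\<dots> \<le> cav_avg N i \<beta> h (\<lambda>y. C2\<^sup>2 * exp (1/4 * y\<^sup>2)) G"
        proof (rule cav_avg_mono)
          fix y
          have "(1 / ct y)\<^sup>2 \<le> (C2 * exp (1/8 * y\<^sup>2))\<^sup>2"
            using C2(2)[OF p, of y] ct[of y] by (intro power_mono) (auto simp: ct_def)
          also have "\<dots> = C2\<^sup>2 * exp (1/4 * y\<^sup>2)" by (simp add: power2_eq_square exp_add[symmetric])
          finally show "(1 / ct y)\<^sup>2 \<le> C2\<^sup>2 * exp (1/4 * y\<^sup>2)" .
        qed
        finally show ?thesis by (simp add: cav_avg_cmult)
      qed
      ultimately show ?thesis unfolding A_def[symmetric] by simp
    qed
    finally show ?thesis by (simp add: C_def algebra_simps)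
  qed
  then show ?thesis by (intro exI[of _ C]) (auto simp: C_def)
qed

text \<open>The ratio is close to the mixture at \<open>mean_field\<close>; replacing this by \<open>cavity_gamma\<close> costs their difference times a
quotient whose moments are bounded.\<close>
theorem moment_order_mixture:
  assumes U: "smooth U"
  shows "moment_order 1 (\<lambda>N i \<beta> h G. tilted_mean U plus_wt minus_wt N i \<beta> h G - mixture_mean U \<beta> h (cavity_gamma N i \<beta> h G))"
proof -
  have Mm[measurable]: "mixture_mean U \<beta> h \<in> borel_measurable borel" for \<beta> h
  proof -
    have [measurable]: "gauss_avg (sk_q \<beta> h) (U 0) \<in> borel_measurable borel" by (intro gauss_avg_measurable smooth_measurable[OF U])
    show ?thesis unfolding mixture_mean_def[abs_def] plus_prob_def by measurable
  qed
  \<comment> \<open>The difference quotient of the mixture, so that the change of the mixture is \<open>Y\<close> times the difference of the arguments.\<close>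
  define Y where "Y = (\<lambda>N i \<beta> h G. if cavity_gamma N i \<beta> h G = mean_field N i \<beta> h G then 0
    else (mixture_mean U \<beta> h (cavity_gamma N i \<beta> h G) - mixture_mean U \<beta> h (mean_field N i \<beta> h G)) / (cavity_gamma N i \<beta> h G - mean_field N i \<beta> h G))"
  obtain Cg where Cg: "0 \<le> Cg" "\<And>N i \<beta> h G. admissible N i \<beta> h \<Longrightarrow> exp (1/32 * (cavity_gamma N i \<beta> h G)\<^sup>2) \<le> Cg * cav_avg N i \<beta> h (\<lambda>y. exp (1/4 * y\<^sup>2)) G"
    using cavity_gamma_exp_le by blast
  have mY: "moment_order 0 Y"
  proof (rule moment_order_of_exp_bound)
    show "Y N i \<beta> h \<in> borel_measurable (gaussian (bonds N))" for N i \<beta> h unfolding Y_def by measurable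
    fix k
    \<comment> \<open>Small enough that the power \<open>2 * k\<close> of \<open>exp (a * x\<^sup>2)\<close> is at most \<open>exp (x\<^sup>2 / 32)\<close>.\<close>
    define a where "a = 1 / (64 * (real k + 1))"
    have a: "0 < a" "a \<le> 1/2" "real (2 * k) * a \<le> 1/32" by (auto simp: a_def field_simps)
    obtain C where C: "0 \<le> C" "\<And>\<beta> h x y. (\<beta>, h) \<in> params \<Longrightarrow> \<bar>mixture_mean U \<beta> h x - mixture_mean U \<beta> h y\<bar> \<le> C * \<bar>x - y\<bar> * (exp (a * x\<^sup>2) + exp (a * y\<^sup>2))"
      using mixture_mean_increment[OF U a(1,2)] by blast
    have "Y N i \<beta> h G ^ (2 * k) \<le> (C ^ (2 * k) * 4 ^ k * (Cg + 1)) * cav_avg N i \<beta> h (\<lambda>y. exp (1/4 * y\<^sup>2)) G" if o: "admissible N i \<beta> h" for N i \<beta> h G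
    proof -
      define x where "x = cavity_gamma N i \<beta> h G" define y where "y = mean_field N i \<beta> h G"
      define A where "A = cav_avg N i \<beta> h (\<lambda>y. exp (1/4 * y\<^sup>2)) G"
      have "\<bar>Y N i \<beta> h G\<bar> \<le> C * (exp (a * x\<^sup>2) + exp (a * y\<^sup>2))"
      proof (cases "x = y")
        case True
        then show ?thesis using C(1) by (simp add: Y_def x_def y_def)
      next
        case False
        then have "\<bar>Y N i \<beta> h G\<bar> = \<bar>mixture_mean U \<beta> h x - mixture_mean U \<beta> h y\<bar> / \<bar>x - y\<bar>" by (simp add: Y_def x_def y_def)
        also have "\<dots> \<le> (C * \<bar>x - y\<bar> * (exp (a * x\<^sup>2) + exp (a * y\<^sup>2))) / \<bar>x - y\<bar>"
          using C(2)[OF admissible_params[OF o]] by (intro divide_right_mono) auto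
        finally show ?thesis using False by simp
      qed
      then have "\<bar>Y N i \<beta> h G\<bar> ^ (2 * k) \<le> (C * (exp (a * x\<^sup>2) + exp (a * y\<^sup>2))) ^ (2 * k)" by (intro power_mono) auto
      also have "\<dots> \<le> C ^ (2 * k) * (4 ^ k * (exp (a * x\<^sup>2) ^ (2 * k) + exp (a * y\<^sup>2) ^ (2 * k)))"
        unfolding power_mult_distrib using C(1) by (intro mult_left_mono power_add_even) auto
      also have "\<dots> \<le> C ^ (2 * k) * (4 ^ k * (Cg * A + 1 * A))"
      proof (intro mult_left_mono add_mono)
        have pe: "exp (a * z\<^sup>2) ^ (2 * k) \<le> exp (1/32 * z\<^sup>2)" for z
        proof -
          have "real (2 * k) * a * z\<^sup>2 \<le> 1/32 * z\<^sup>2" using a(3) by (rule mult_right_mono) auto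
          then show ?thesis unfolding exp_of_nat_mult[symmetric] by (simp only: exp_le_cancel_iff mult.assoc)
        qed
        show "exp (a * x\<^sup>2) ^ (2 * k) \<le> Cg * A" using order_trans[OF pe Cg(2)[OF o]] by (simp add: x_def A_def)
        have "exp (1/32 * y\<^sup>2) \<le> exp (1/4 * y\<^sup>2)" by simp
        also have "exp (1/4 * y\<^sup>2) \<le> A" unfolding y_def A_def by (rule mean_field_exp_le) simp
        finally show "exp (a * y\<^sup>2) ^ (2 * k) \<le> 1 * A" using order_trans[OF pe[of y]] by simp
      qed (use C(1) in auto)
      finally show ?thesis by (simp add: A_def power_even_abs algebra_simps)
    qed
    then show "\<exists>C\<ge>0. \<forall>N i \<beta> h G. admissible N i \<beta> h \<longrightarrow> Y N i \<beta> h G ^ (2 * k) \<le> C * cav_avg N i \<beta> h (\<lambda>y. exp (1/4 * y\<^sup>2)) G"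
      using C(1) Cg(1) by (intro exI[of _ "C ^ (2 * k) * 4 ^ k * (Cg + 1)"]) auto
  qed
  have m: "moment_order 1 (\<lambda>N i \<beta> h G. (tilted_mean U plus_wt minus_wt N i \<beta> h G - tilted_limit U plus_wt minus_wt \<beta> h (mean_field N i \<beta> h G)) - Y N i \<beta> h G * (cavity_gamma N i \<beta> h G - mean_field N i \<beta> h G))"
    using moment_order_mult[OF mY moment_order_cavity_gamma] by (intro moment_order_diff moment_order_ratio U w_abs) simp
  show ?thesis
  proof (rule moment_order_dominated[OF _ m])
    show "(\<lambda>G. tilted_mean U plus_wt minus_wt N i \<beta> h G - mixture_mean U \<beta> h (cavity_gamma N i \<beta> h G)) \<in> borel_measurable (gaussian (bonds N))" for N i \<beta> h
      using tilted_mean_measurable[OF U] by measurable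
    fix N i \<beta> h G assume o: "admissible N i \<beta> h"
    have "Y N i \<beta> h G * (cavity_gamma N i \<beta> h G - mean_field N i \<beta> h G) = mixture_mean U \<beta> h (cavity_gamma N i \<beta> h G) - mixture_mean U \<beta> h (mean_field N i \<beta> h G)"
      by (simp add: Y_def)
    then show "\<bar>tilted_mean U plus_wt minus_wt N i \<beta> h G - mixture_mean U \<beta> h (cavity_gamma N i \<beta> h G)\<bar>
      \<le> \<bar>(tilted_mean U plus_wt minus_wt N i \<beta> h G - tilted_limit U plus_wt minus_wt \<beta> h (mean_field N i \<beta> h G)) - Y N i \<beta> h G * (cavity_gamma N i \<beta> h G - mean_field N i \<beta> h G)\<bar>"
      unfolding tilted_limit_eq_mixture_mean[OF U admissible_params[OF o]] by simp
  qed
qed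

end

section \<open>Back to the full spin system\<close>

text \<open>The symmetric matrix of couplings read off a Gaussian vector that is indexed by ordered bonds.\<close>
definition couplings :: "(nat \<times> nat \<Rightarrow> real) \<Rightarrow> nat \<Rightarrow> nat \<Rightarrow> real" where
  "couplings G i j = G (min i j, max i j)"

lemma configs_rest: assumes "1 \<le> i" "i \<le> N" shows "configs N = PiE (insert i (rest N i)) (\<lambda>_. {-1, 1})"
proof -
  have "insert i (rest N i) = {1..N}" using assms by (auto simp: rest_def)
  then show ?thesis by (simp add: configs_def)
qed

lemma local_field_update:
  assumes i: "1 \<le> i" "i \<le> N"
  shows "local_field N (couplings G) i (\<sigma>(i := s)) = field_at N i G \<sigma>"
proof -
  have "local_field N (couplings G) i (\<sigma>(i := s)) = 1 / sqrt (real N) * (\<Sum>j\<in>rest N i. G (min i j, max i j) * \<sigma> j)"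
    unfolding local_field_def couplings_def rest_def by (intro arg_cong2[where f="(*)"] refl sum.cong) auto
  also have "\<dots> = 1 / sqrt (real N) * (\<Sum>e\<in>star N i. G e * \<sigma> (other i e))"
    unfolding sum_star[OF i, symmetric]
    by (intro arg_cong2[where f="(*)"] refl sum.cong) (auto simp: star_def bonds_def other_def)
  also have "\<dots> = field_at N i G \<sigma>" unfolding field_at_def sum_distrib_left by (intro sum.cong) auto
  finally show ?thesis .
qed

lemma hamiltonian_update:
  assumes i: "1 \<le> i" "i \<le> N"
  shows "- hamiltonian N \<beta> h (couplings G) (\<sigma>(i := s)) = cav_energy N \<beta> h (rest N i) G \<sigma> + s * (\<beta> * field_at N i G \<sigma> + h)"
proof -
  define \<tau> where "\<tau> = \<sigma>(i := s)"
  define f where "f = (\<lambda>e. couplings G (fst e) (snd e) * \<tau> (fst e) * \<tau> (snd e))"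
  have "(\<Sum>e\<in>bonds N. f e) = (\<Sum>e\<in>pairs (rest N i). f e) + (\<Sum>e\<in>star N i. f e)"
    using bonds_split[of N i] bonds_finite[of N] by (metis finite_Un sum.union_disjoint)
  also have "(\<Sum>e\<in>pairs (rest N i). f e) = (\<Sum>(a, b)\<in>pairs (rest N i). G (a, b) * \<sigma> a * \<sigma> b)"
    by (intro sum.cong) (auto simp: f_def \<tau>_def couplings_def pairs_def rest_def)
  also have "(\<Sum>e\<in>star N i. f e) = (\<Sum>e\<in>star N i. s * (G e * \<sigma> (other i e)))"
    by (intro sum.cong) (auto simp: f_def \<tau>_def couplings_def star_def bonds_def other_def)
  also have "\<dots> = s * sqrt (real N) * field_at N i G \<sigma>"
    unfolding field_at_def sum_distrib_left using i by (intro sum.cong) auto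
  finally have b: "(\<Sum>(a, b)\<in>bonds N. couplings G a b * \<tau> a * \<tau> b)
      = (\<Sum>(a, b)\<in>pairs (rest N i). G (a, b) * \<sigma> a * \<sigma> b) + s * sqrt (real N) * field_at N i G \<sigma>"
    by (simp add: f_def case_prod_unfold)
  have ins: "{1..N} = insert i (rest N i)" using i by (auto simp: rest_def)
  have "(\<Sum>j\<in>{1..N}. \<tau> j) = \<tau> i + (\<Sum>j\<in>rest N i. \<tau> j)"
    unfolding ins by (rule sum.insert[OF rest_finite]) (simp add: rest_def)
  also have "(\<Sum>j\<in>rest N i. \<tau> j) = (\<Sum>j\<in>rest N i. \<sigma> j)" by (intro sum.cong) (auto simp: \<tau>_def rest_def)
  finally have m: "(\<Sum>j\<in>{1..N}. \<tau> j) = s + (\<Sum>j\<in>rest N i. \<sigma> j)" by (simp add: \<tau>_def)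
  have "sqrt (real N) \<noteq> 0" using i by simp
  then show ?thesis
    unfolding hamiltonian_def cav_energy_def \<tau>_def[symmetric] b m by (simp add: field_simps)
qed

text \<open>Sum over the spin at \<open>i\<close> first: the energy is that of the reduced system plus
\<open>s * (\<beta> * l + h)\<close>, and \<open>l\<close> is unchanged by an update at \<open>i\<close>.\<close>
lemma gibbs_average_cavity:
  assumes i: "1 \<le> i" "i \<le> N"
  shows "gibbs_average N \<beta> h (couplings G) (\<lambda>\<sigma>. \<phi> (\<sigma> i) (local_field N (couplings G) i \<sigma>))
    = cav_avg N i \<beta> h (\<lambda>y. \<phi> 1 y * exp (\<beta> * y + h) + \<phi> (- 1) y * exp (- (\<beta> * y + h))) G
      / cav_avg N i \<beta> h (\<lambda>y. exp (\<beta> * y + h) + exp (- (\<beta> * y + h))) G"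
proof -
  define J where "J = couplings G"
  define E where "E = cav_energy N \<beta> h (rest N i) G"
  define W where "W = (\<Sum>\<tau>\<in>spins (rest N i). exp (E \<tau>))"
  have W: "0 < W" unfolding W_def by (intro sum_pos spins_finite rest_finite spins_nonempty) auto
  have sum: "(\<Sum>\<sigma>\<in>configs N. \<psi> (\<sigma> i) (local_field N J i \<sigma>) * exp (- hamiltonian N \<beta> h J \<sigma>))
    = W * cav_avg N i \<beta> h (\<lambda>y. \<psi> 1 y * exp (\<beta> * y + h) + \<psi> (- 1) y * exp (- (\<beta> * y + h))) G" for \<psi> :: "real \<Rightarrow> real \<Rightarrow> real"
  proof -
    have ni: "i \<notin> rest N i" by (simp add: rest_def)
    have "(\<Sum>\<sigma>\<in>configs N. \<psi> (\<sigma> i) (local_field N J i \<sigma>) * exp (- hamiltonian N \<beta> h J \<sigma>))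
      = (\<Sum>s\<in>{-1, 1}. \<Sum>r\<in>spins (rest N i). \<psi> s (field_at N i G r) * (exp (E r) * exp (s * (\<beta> * field_at N i G r + h))))"
      unfolding configs_rest[OF i] sum_PiE_insert[OF ni] J_def hamiltonian_update[OF i] local_field_update[OF i] spins_def E_def exp_add
      by simp
    also have "\<dots> = (\<Sum>r\<in>spins (rest N i). exp (E r) * (\<psi> 1 (field_at N i G r) * exp (\<beta> * field_at N i G r + h) + \<psi> (- 1) (field_at N i G r) * exp (- (\<beta> * field_at N i G r + h))))"
      by (simp add: sum.distrib[symmetric] algebra_simps)
    also have "\<dots> = W * cav_avg N i \<beta> h (\<lambda>y. \<psi> 1 y * exp (\<beta> * y + h) + \<psi> (- 1) y * exp (- (\<beta> * y + h))) G"
      unfolding cav_avg_def cav_weight_def E_def[symmetric] W_def[symmetric] sum_distrib_left using W by (intro sum.cong) auto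
    finally show ?thesis .
  qed
  have Z: "partition_function N \<beta> h J = W * cav_avg N i \<beta> h (\<lambda>y. exp (\<beta> * y + h) + exp (- (\<beta> * y + h))) G"
    using sum[of "\<lambda>_ _. 1"] by (simp add: partition_function_def)
  have "gibbs_average N \<beta> h J (\<lambda>\<sigma>. \<phi> (\<sigma> i) (local_field N J i \<sigma>))
    = (\<Sum>\<sigma>\<in>configs N. \<phi> (\<sigma> i) (local_field N J i \<sigma>) * exp (- hamiltonian N \<beta> h J \<sigma>)) / partition_function N \<beta> h J"
    by (simp add: gibbs_average_def gibbs_weight_def sum_divide_distrib)
  then show ?thesis unfolding sum Z J_def[symmetric] using W by simp
qed

lemma exp_field_eq:
  "exp (\<beta> * y + h) = 2 * cosh h * (plus_wt h * exp (\<beta> * y))" "exp (- (\<beta> * y + h)) = 2 * cosh h * (minus_wt h * exp (- \<beta> * y))"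
proof -
  have "cosh h \<noteq> 0" using cosh_real_pos[of h] by linarith
  then show "exp (\<beta> * y + h) = 2 * cosh h * (plus_wt h * exp (\<beta> * y))" "exp (- (\<beta> * y + h)) = 2 * cosh h * (minus_wt h * exp (- \<beta> * y))"
    unfolding plus_wt_eq by (simp_all add: exp_add[symmetric] add.commute)
qed

context sk_range begin

lemma gibbs_average_tilted_mean:
  assumes o: "admissible N i \<beta> h"
  shows "gibbs_average N \<beta> h (couplings G) (\<lambda>\<sigma>. U 0 (local_field N (couplings G) i \<sigma>)) = tilted_mean U plus_wt minus_wt N i \<beta> h G"
    and "gibbs_average N \<beta> h (couplings G) (\<lambda>\<sigma>. \<sigma> i) = tilted_mean one plus_wt (\<lambda>h. - minus_wt h) N i \<beta> h G"
proof -
  have i: "1 \<le> i" "i \<le> N" using o by (auto simp: admissible_def)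
  have c: "cosh h \<noteq> 0" using cosh_real_pos[of h] by linarith
  have n: "cav_avg N i \<beta> h (\<lambda>y. a y * exp (\<beta> * y + h) + b y * exp (- (\<beta> * y + h))) G
    = 2 * cosh h * cav_avg N i \<beta> h (\<lambda>y. a y * (plus_wt h * exp (\<beta> * y)) + b y * (minus_wt h * exp (- \<beta> * y))) G" for a b
    unfolding exp_field_eq cav_avg_cmult[symmetric] by (intro arg_cong2[where f="cav_avg N i \<beta> h"] ext refl) (simp add: algebra_simps)
  have d: "cav_avg N i \<beta> h (\<lambda>y. exp (\<beta> * y + h) + exp (- (\<beta> * y + h))) G = 2 * cosh h * tilt_norm N i \<beta> h G"
    using n[of "\<lambda>_. 1" "\<lambda>_. 1"] by (simp add: tilt_norm_def exp_mix_def[abs_def])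
  show "gibbs_average N \<beta> h (couplings G) (\<lambda>\<sigma>. U 0 (local_field N (couplings G) i \<sigma>)) = tilted_mean U plus_wt minus_wt N i \<beta> h G"
    unfolding gibbs_average_cavity[OF i, where \<phi>="\<lambda>_. U 0"] n d tilted_mean_def using c by (simp add: exp_mix_def distrib_left)
  show "gibbs_average N \<beta> h (couplings G) (\<lambda>\<sigma>. \<sigma> i) = tilted_mean one plus_wt (\<lambda>h. - minus_wt h) N i \<beta> h G"
    unfolding gibbs_average_cavity[OF i, where \<phi>="\<lambda>s _. s"] n d tilted_mean_def using c by (simp add: exp_mix_def one_def)
qed

text \<open>By linearity the first term of \<open>\<gamma>\<close> is the Gibbs average of the local field.\<close>
lemma cavity_mean_eq_cavity_gamma:
  assumes o: "admissible N i \<beta> h"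
  shows "cavity_mean N \<beta> h (couplings G) i = cavity_gamma N i \<beta> h G"
proof -
  have "1 / sqrt (real N) * (\<Sum>j\<in>{1..N} - {i}. couplings G i j * gibbs_average N \<beta> h (couplings G) (\<lambda>\<sigma>. \<sigma> j))
    = gibbs_average N \<beta> h (couplings G) (\<lambda>\<sigma>. local_field N (couplings G) i \<sigma>)"
    unfolding gibbs_average_def local_field_def sum_distrib_left sum_distrib_right
    by (subst sum.swap) (simp add: mult_ac)
  then show ?thesis unfolding cavity_mean_def cavity_gamma_def
    using gibbs_average_tilted_mean(1)[OF o, where U=ident] gibbs_average_tilted_mean(2)[OF o] by (simp add: ident_def)
qed

lemma integral_normal_density:
  assumes U: "smooth U" and q: "0 \<le> q" "q < 1"
  shows "integrable lborel (\<lambda>x. normal_density \<mu> (sqrt (1 - q)) x * U 0 x)"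
    and "(\<integral>x. normal_density \<mu> (sqrt (1 - q)) x * U 0 x \<partial>lborel) = gauss_avg q (U 0) \<mu>"
proof -
  define s where "s = sqrt (1 - q)"
  have s: "0 < s" using q by (simp add: s_def)
  have [measurable]: "U 0 \<in> borel_measurable borel" by (rule smooth_measurable[OF U])
  have i: "integrable gauss1 (\<lambda>z. U 0 (\<mu> + s * z))" unfolding s_def using q
    by (intro integrable_gauss_avg[where Q=UNIV and F="\<lambda>_. U 0", OF smooth_growth[OF U] _ _ _ smooth_measurable[OF U]]) auto
  have e: "normal_density \<mu> s (\<mu> + s * z) = std_normal_density z / s" for z
    using s by (simp add: normal_density_def power_mult_distrib real_sqrt_mult field_simps)
  have j: "integrable lborel (\<lambda>z. std_normal_density z * U 0 (\<mu> + s * z))"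
    using i by (subst (asm) integrable_density) auto
  have "integrable lborel (\<lambda>z. normal_density \<mu> s (\<mu> + s * z) * U 0 (\<mu> + s * z))"
    unfolding e using j by (simp add: integrable_divide)
  then show "integrable lborel (\<lambda>x. normal_density \<mu> (sqrt (1 - q)) x * U 0 x)"
    unfolding s_def[symmetric]
    using lborel_integrable_real_affine_iff[of s "\<lambda>x. normal_density \<mu> s x * U 0 x" \<mu>] s by simp
  have "(\<integral>x. normal_density \<mu> s x * U 0 x \<partial>lborel) = s * (\<integral>z. normal_density \<mu> s (\<mu> + s * z) * U 0 (\<mu> + s * z) \<partial>lborel)"
    using lborel_integral_real_affine[of s "\<lambda>x. normal_density \<mu> s x * U 0 x" \<mu>] s by simp
  also have "\<dots> = (\<integral>z. std_normal_density z * U 0 (\<mu> + s * z) \<partial>lborel)" unfolding e using s by simp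
  also have "\<dots> = gauss_avg q (U 0) \<mu>"
    unfolding gauss_avg_def s_def[symmetric] by (subst integral_density) auto
  finally show "(\<integral>x. normal_density \<mu> (sqrt (1 - q)) x * U 0 x \<partial>lborel) = gauss_avg q (U 0) \<mu>" by (simp add: s_def)
qed

lemma mixture_weight_eq: "mixture_weight N \<beta> h J i = plus_prob \<beta> h (cavity_mean N \<beta> h J i)"
proof -
  define y where "y = cavity_mean N \<beta> h J i"
  have c: "cosh h \<noteq> 0" using cosh_real_pos[of h] by linarith
  have e: "- \<beta> * y - h = - (\<beta> * y + h)" by simp
  show ?thesis
    unfolding mixture_weight_def Let_def y_def[symmetric] e exp_field_eq plus_prob_def exp_mix_def distrib_left[symmetric]
    using c by simp
qed

lemma mixture_integral:
  assumes U: "smooth U" and p: "(\<beta>, h) \<in> params"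
  shows "(\<integral>x. U 0 x \<partial>mixture_measure N \<beta> h J i) = mixture_mean U \<beta> h (cavity_mean N \<beta> h J i)"
proof -
  define y where "y = cavity_mean N \<beta> h J i"
  define w where "w = plus_prob \<beta> h y"
  define q where "q = sk_q \<beta> h"
  have q: "0 \<le> q" "q < 1" using q_range[OF p] by (auto simp: q_def)
  have w: "0 \<le> w" "w \<le> 1" using plus_prob_range[OF p] by (auto simp: w_def)
  define f where "f = normal_density (y + \<beta> * (1 - q)) (sqrt (1 - q))"
  define g where "g = normal_density (y - \<beta> * (1 - q)) (sqrt (1 - q))"
  have nn: "0 \<le> f x" "0 \<le> g x" for x by (auto simp: f_def g_def)
  have [measurable]: "U 0 \<in> borel_measurable borel" "f \<in> borel_measurable borel" "g \<in> borel_measurable borel"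
    using smooth_measurable[OF U] by (auto simp: f_def g_def)
  have "(\<integral>x. U 0 x \<partial>mixture_measure N \<beta> h J i) = (\<integral>x. U 0 x \<partial>density lborel (\<lambda>x. ennreal (w * f x + (1 - w) * g x)))"
    unfolding mixture_measure_def Let_def mixture_weight_eq y_def[symmetric] w_def[symmetric] q_def[symmetric] f_def[symmetric] g_def[symmetric] ..
  also have "\<dots> = (\<integral>x. (w * f x + (1 - w) * g x) *\<^sub>R U 0 x \<partial>lborel)"
    using w nn by (intro integral_density) auto
  also have "\<dots> = (\<integral>x. w * (f x * U 0 x) + (1 - w) * (g x * U 0 x) \<partial>lborel)"
    by (intro Bochner_Integration.integral_cong refl) (simp add: algebra_simps)
  also have "\<dots> = w * gauss_avg q (U 0) (y + \<beta> * (1 - q)) + (1 - w) * gauss_avg q (U 0) (y - \<beta> * (1 - q))"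
    using integral_normal_density[OF U q] by (simp add: f_def g_def)
  finally show ?thesis by (simp add: mixture_mean_def y_def w_def q_def)
qed

lemma smooth_iterated_deriv:
  assumes "infinitely_differentiable U" "\<And>n. moderate_growth ((deriv ^^ n) U)"
  shows "smooth (\<lambda>n. (deriv ^^ n) U)"
  unfolding smooth_def
proof safe
  fix n y show "((deriv ^^ n) U has_real_derivative (deriv ^^ Suc n) U y) (at y)"
    using assms(1) unfolding infinitely_differentiable_def real_differentiable_def
    by (metis DERIV_imp_deriv comp_apply funpow.simps(2))
  show "growth {c::real. \<bar>c\<bar> \<le> 1} (\<lambda>_. (deriv ^^ n) U)" by (rule moderate_growth_imp_growth[OF assms(2)])
qed

lemma mixture_error_eq:
  assumes "smooth U" "admissible N i \<beta> h"
  shows "mixture_error N \<beta> h (couplings G) i (U 0) = tilted_mean U plus_wt minus_wt N i \<beta> h G - mixture_mean U \<beta> h (cavity_gamma N i \<beta> h G)"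
  unfolding mixture_error_def mixture_integral[OF assms(1) admissible_params[OF assms(2)]] gibbs_average_tilted_mean(1)[OF assms(2)]
    cavity_mean_eq_cavity_gamma[OF assms(2)] ..

end

lemma mixture_error_cong:
  assumes J: "\<And>a b. a \<in> {1..N} \<Longrightarrow> b \<in> {1..N} \<Longrightarrow> a \<noteq> b \<Longrightarrow> J a b = J' a b" and i: "1 \<le> i" "i \<le> N"
  shows "mixture_error N \<beta> h J i U = mixture_error N \<beta> h J' i U"
proof -
  have "hamiltonian N \<beta> h J = hamiltonian N \<beta> h J'"
    unfolding hamiltonian_def[abs_def] using J
    by (intro ext arg_cong[where f=uminus] arg_cong2[where f="(+)"] arg_cong2[where f="(*)"] refl sum.cong) (auto simp: bonds_def)
  then have g: "gibbs_average N \<beta> h J = gibbs_average N \<beta> h J'"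
    unfolding gibbs_average_def[abs_def] gibbs_weight_def partition_function_def by simp
  have l: "local_field N J i = local_field N J' i"
    unfolding local_field_def[abs_def] using J i by (intro ext arg_cong2[where f="(*)"] refl sum.cong) auto
  have c: "cavity_mean N \<beta> h J i = cavity_mean N \<beta> h J' i"
    unfolding cavity_mean_def g using J i
    by (intro arg_cong2[where f="(-)"] arg_cong2[where f="(*)"] refl sum.cong) auto
  show ?thesis unfolding mixture_error_def mixture_measure_def mixture_weight_def Let_def g l c ..
qed

text \<open>Independence makes the joint distribution of the couplings the product of their distributions. For \<open>N = 1\<close> there is
no bond and both sides are the point mass.\<close>
lemma sk_disorder_distr:
  assumes D: "sk_disorder M N g"
  defines "X \<equiv> \<lambda>\<omega>. \<lambda>e\<in>bonds N. g (fst e) (snd e) \<omega>"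
  shows "X \<in> M \<rightarrow>\<^sub>M Pi\<^sub>M (bonds N) (\<lambda>_. borel)" "distr M (Pi\<^sub>M (bonds N) (\<lambda>_. borel)) X = gaussian (bonds N)"
proof -
  interpret prob_space M using D by (simp add: sk_disorder_def)
  have ind: "indep_vars (\<lambda>_. borel) (\<lambda>e. g (fst e) (snd e)) (bonds N)"
    using D by (simp add: sk_disorder_def case_prod_unfold)
  have dist: "distributed M lborel (g (fst e) (snd e)) std_normal_density" if "e \<in> bonds N" for e
    using D that by (auto simp: sk_disorder_def)
  have rv: "random_variable borel (g (fst e) (snd e))" if "e \<in> bonds N" for e
    using distributed_measurable[OF dist[OF that]] by simp
  show X: "X \<in> M \<rightarrow>\<^sub>M Pi\<^sub>M (bonds N) (\<lambda>_. borel)" unfolding X_def using rv by (intro measurable_restrict) auto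
  show "distr M (Pi\<^sub>M (bonds N) (\<lambda>_. borel)) X = gaussian (bonds N)"
  proof (cases "bonds N = {}")
    case True
    have P: "prob_space (distr M (Pi\<^sub>M (bonds N) (\<lambda>_. borel)) X)" by (rule prob_space_distr[OF X])
    show ?thesis
    proof (rule measure_eqI)
      show "sets (distr M (Pi\<^sub>M (bonds N) (\<lambda>_. borel)) X) = sets (gaussian (bonds N))" by (simp add: sets_gaussian)
      fix A assume A: "A \<in> sets (distr M (Pi\<^sub>M (bonds N) (\<lambda>_. borel)) X)"
      have s: "space (gaussian (bonds N)) = {\<lambda>_. undefined}" by (simp add: gaussian_def True space_PiM_empty)
      have "A = {} \<or> A = {\<lambda>_. undefined}" using A by (auto simp: True sets_PiM_empty)
      then show "emeasure (distr M (Pi\<^sub>M (bonds N) (\<lambda>_. borel)) X) A = emeasure (gaussian (bonds N)) A"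
        using prob_space.emeasure_space_1[OF P] prob_space.emeasure_space_1[OF prob_space_gaussian[of "bonds N"]]
        by (auto simp: s) (simp add: True space_PiM_empty)
    qed
  next
    case False
    have "distr M (Pi\<^sub>M (bonds N) (\<lambda>_. borel)) X = Pi\<^sub>M (bonds N) (\<lambda>e. distr M borel (g (fst e) (snd e)))"
      using ind rv unfolding X_def by (subst (asm) indep_vars_iff_distr_eq_PiM'[OF False]) auto
    also have "\<dots> = gaussian (bonds N)" unfolding gaussian_def
    proof (intro PiM_cong refl)
      fix e assume e: "e \<in> bonds N"
      have "distr M borel (g (fst e) (snd e)) = distr M lborel (g (fst e) (snd e))" by (rule distr_cong) auto
      then show "distr M borel (g (fst e) (snd e)) = gauss1" using distributed_distr_eq_density[OF dist[OF e]] by simp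
    qed
    finally show ?thesis .
  qed
qed

theorem theorem3:
  fixes \<beta>\<^sub>0 :: real and k :: nat and U :: "real \<Rightarrow> real"
  assumes "0 < \<beta>\<^sub>0" and "\<beta>\<^sub>0 < 1 / 2"
    and "infinitely_differentiable U"
    and "\<And>n. moderate_growth ((deriv ^^ n) U)"
  shows "\<exists>K::real. \<forall>(M :: 'a measure) (g :: nat \<Rightarrow> nat \<Rightarrow> 'a \<Rightarrow> real) (N::nat) (i::nat) (\<beta>::real) (h::real).
    1 \<le> N \<longrightarrow> sk_disorder M N g \<longrightarrow> 1 \<le> i \<longrightarrow> i \<le> N \<longrightarrow> 0 < \<beta> \<longrightarrow> \<beta> \<le> \<beta>\<^sub>0 \<longrightarrow>
      integrable M (\<lambda>\<omega>. (mixture_error N \<beta> h (\<lambda>i j. g i j \<omega>) i U) ^ (2 * k)) \<and>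
      (\<integral>\<omega>. (mixture_error N \<beta> h (\<lambda>i j. g i j \<omega>) i U) ^ (2 * k) \<partial>M) \<le> K / real N ^ k"
proof -
  interpret sk_range \<beta>\<^sub>0 by unfold_locales (use assms in auto)
  define V where "V = (\<lambda>n. (deriv ^^ n) U)"
  have V: "smooth V" unfolding V_def by (rule smooth_iterated_deriv[OF assms(3,4)])
  have V0: "V 0 = U" by (simp add: V_def)
  define R where "R = (\<lambda>N i \<beta> h G. tilted_mean V plus_wt minus_wt N i \<beta> h G - mixture_mean V \<beta> h (cavity_gamma N i \<beta> h G))"
  have mR: "moment_order 1 R" unfolding R_def by (rule moment_order_mixture[OF V])
  obtain K where K: "0 \<le> K" "\<And>N i \<beta> h. admissible N i \<beta> h \<Longrightarrow>
      (\<integral>\<^sup>+G. ennreal (R N i \<beta> h G ^ (2 * k)) \<partial>gaussian (bonds N)) \<le> ennreal (K / real N ^ k)"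
    using mR unfolding moment_order_def by (metis mult_1)
  show ?thesis
  proof (intro exI[of _ K] allI impI)
    fix M :: "'a measure" and g :: "nat \<Rightarrow> nat \<Rightarrow> 'a \<Rightarrow> real" and N i :: nat and \<beta> h :: real
    assume a: "1 \<le> N" "sk_disorder M N g" "1 \<le> i" "i \<le> N" "0 < \<beta>" "\<beta> \<le> \<beta>\<^sub>0"
    have o: "admissible N i \<beta> h" using a by (simp add: admissible_def)
    define X where "X = (\<lambda>\<omega>. \<lambda>e\<in>bonds N. g (fst e) (snd e) \<omega>)"
    note X = sk_disorder_distr[OF a(2), folded X_def]
    define F where "F = (\<lambda>G. R N i \<beta> h G ^ (2 * k))"
    have F0: "0 \<le> F G" for G by (simp add: F_def)
    have Rm: "R N i \<beta> h \<in> borel_measurable (gaussian (bonds N))" using mR o by (simp add: moment_order_def)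
    then have "R N i \<beta> h \<in> borel_measurable (Pi\<^sub>M (bonds N) (\<lambda>_. borel))"
      using measurable_cong_sets[OF sets_gaussian refl] by blast
    then have Fm[measurable]: "F \<in> borel_measurable (Pi\<^sub>M (bonds N) (\<lambda>_. borel))" unfolding F_def by measurable
    have XM[measurable]: "X \<in> M \<rightarrow>\<^sub>M Pi\<^sub>M (bonds N) (\<lambda>_. borel)" by (rule X(1))
    have e: "(mixture_error N \<beta> h (\<lambda>i j. g i j \<omega>) i U) ^ (2 * k) = F (X \<omega>)" if w: "\<omega> \<in> space M" for \<omega>
    proof -
      have "g a b \<omega> = couplings (X \<omega>) a b" if "a \<in> {1..N}" "b \<in> {1..N}" "a \<noteq> b" for a b
      proof (cases "a < b")
        case True
        then show ?thesis using that by (auto simp: couplings_def X_def bonds_def)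
      next
        case False
        then have "g a b \<omega> = g b a \<omega>" using a(2) that w by (auto simp: sk_disorder_def)
        then show ?thesis using False that by (auto simp: couplings_def X_def bonds_def)
      qed
      then have "mixture_error N \<beta> h (\<lambda>i j. g i j \<omega>) i U = mixture_error N \<beta> h (couplings (X \<omega>)) i U"
        by (intro mixture_error_cong a(3,4)) auto
      then show ?thesis using mixture_error_eq[OF V o, of "X \<omega>"] by (simp add: F_def R_def V0)
    qed
    have nn: "(\<integral>\<^sup>+\<omega>. ennreal (F (X \<omega>)) \<partial>M) \<le> ennreal (K / real N ^ k)"
    proof -
      have "(\<integral>\<^sup>+\<omega>. ennreal (F (X \<omega>)) \<partial>M) = (\<integral>\<^sup>+G. ennreal (F G) \<partial>gaussian (bonds N))"
        unfolding X(2)[symmetric] by (subst nn_integral_distr) auto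
      then show ?thesis using K(2)[OF o] by (simp add: F_def)
    qed
    have int: "integrable M (\<lambda>\<omega>. F (X \<omega>))"
    proof (rule integrableI_bounded)
      show "(\<lambda>\<omega>. F (X \<omega>)) \<in> borel_measurable M" by measurable
      show "(\<integral>\<^sup>+\<omega>. ennreal (norm (F (X \<omega>))) \<partial>M) < \<infinity>" using le_less_trans[OF nn ennreal_less_top] F0 by simp
    qed
    have "(\<integral>\<omega>. F (X \<omega>) \<partial>M) \<le> K / real N ^ k"
      using nn K(1) F0 unfolding nn_integral_eq_integral[OF int AE_I2[OF F0]] by (simp add: ennreal_le_iff)
    moreover have "integrable M (\<lambda>\<omega>. (mixture_error N \<beta> h (\<lambda>i j. g i j \<omega>) i U) ^ (2 * k)) \<longleftrightarrow> integrable M (\<lambda>\<omega>. F (X \<omega>))"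
      by (intro Bochner_Integration.integrable_cong refl e)
    moreover have "(\<integral>\<omega>. (mixture_error N \<beta> h (\<lambda>i j. g i j \<omega>) i U) ^ (2 * k) \<partial>M) = (\<integral>\<omega>. F (X \<omega>) \<partial>M)"
      by (intro Bochner_Integration.integral_cong refl e)
    ultimately show "integrable M (\<lambda>\<omega>. (mixture_error N \<beta> h (\<lambda>i j. g i j \<omega>) i U) ^ (2 * k)) \<and>
      (\<integral>\<omega>. (mixture_error N \<beta> h (\<lambda>i j. g i j \<omega>) i U) ^ (2 * k) \<partial>M) \<le> K / real N ^ k" using int by simp
  qed
qed

end
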